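(* Let $u$ be the solution of $-\varepsilon^2\triangle u+f(x,y;u)=0$ in $\Omega=(0,1)^2$, $u=0$ on $\partial\Omega$, and let $u_h\in S_h$ satisfy $\varepsilon^2\langle\nabla u_h,\nabla v_h\rangle+\langle f_h,v_h\rangle_h=0$ for all $v_h\in S_h$, on a partially structured anisotropic mesh $\mathcal T$ as described in the context. Let $\Omega_i:=(x_{i-1},x_{i+1})\times(0,1)$. Suppose that either no quadrature is used in $\Omega_i$ (i.e. $\langle f_h,v_h\rangle_h=\langle f_h,v_h\rangle$ for all $v_h\in S_h$ with support in $\Omega_i$), or $\langle\cdot,\cdot\rangle_h$ is the quadrature described in the context with either all triangles of $\mathcal T$ in $\Omega_i$ belonging to $\mathcal T^*$, or no triangle of $\mathcal T$ in $\Omega_i$ belonging to $\mathcal T^*$. Then $$\sum_{S\in\mathcal S\cap\{x=x_i\}}\min\{\varepsilon|S|,|\omega_S|\}\,(\varepsilon J_S)^2\lesssim|||u_h-u|||^2_{\varepsilon;\Omega_i}+\|\lambda_T\,\mathrm{osc}(f_h;T)\|^2_{\Omega_i},$$ where $\lambda_T:=\min\{1,H_T\varepsilon^{-1}\}$.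
   Context: Conventions. $a\lesssim b$ means $a\le Cb$ with a constant $C$ that may depend on $f$ and the constants in the mesh assumptions, but not on $\varepsilon$ nor on the diameters and aspect ratios of the mesh elements; $a\simeq b$ means $a\lesssim b$ and $a\gtrsim b$; $a\ll b$ means $a<c_0b$ with a fixed small constant $c_0$. When such relations are used as conditions, the constants are fixed once and for all. $\|\cdot\|_{\mathcal D}=\|\cdot\|_{L_2(\mathcal D)}$; $\mathrm{osc}(v;\mathcal D)=\sup_{\mathcal D}v-\inf_{\mathcal D}v$; $\|\lambda_T\,\mathrm{osc}(f_h;T)\|_{\Omega_i}$ is the $L_2(\Omega_i)$ norm of the piecewise-constant function equal to $\lambda_T\,\mathrm{osc}(f_h;T)$ on each $T\subset\Omega_i$. $|||v|||_{\varepsilon;\mathcal D}:=\{\varepsilon^2\|\nabla v\|^2_{\mathcal D}+C_f\|v\|^2_{\mathcal D}\}^{1/2}$. Problem. $\Omega=(0,1)^2$, $0<\varepsilon\le1$; $f$ is continuous on $\Omega\times\mathbb R$, $f(\cdot;s)\in L_\infty(\Omega)$ for all $s$, $f(x,y;u)-f(x,y;v)\ge C_f[u-v]$ for $u\ge v$, $C_f\ge0$, $C_f+\varepsilon^2\ge1$, and additionally $|f(x,y;u)-f(x,y;v)|\lesssim|u-v|$. Mesh. $\mathcal T,\mathcal N,\mathcal S$: triangles, nodes and edges of a triangulation of $\Omega$. $H_T$: maximum edge length of $T$; $h_T:=2H_T^{-1}|T|$. $\omega_z$: patch of elements around a node $z$; $H_z:=\mathrm{diam}(\omega_z)$, $h_z:=\max_{T\subset\omega_z}h_T$,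 $\mathring h_z:=\min_{T\subset\omega_z}h_T$. Standing assumptions: all triangle angles are bounded by a fixed $\lambda_0<\pi$; the number of triangles containing any node is uniformly bounded; for any $z$ and any $T\subset\omega_z$, either ($h_T\simeq\mathring h_z$ and $H_T\simeq H_z$) or $h_T\simeq H_T$. Partially structured anisotropic mesh: $\{x_i\}_{i=0}^n$ is an arbitrary mesh in the $x$ direction on $(0,1)$; each $T\in\mathcal T$, for some $i$, has its shortest edge on the line $x=x_i$ and a vertex on the line $x=x_{i+1}$ or $x=x_{i-1}$; every node $z$ is anisotropic ($\mathcal N=\mathcal N_{\rm ani}$), i.e. $h_z\ll H_z$ and $h_T\simeq h_z$, $H_T\simeq H_z$ for all $T\subset\omega_z$; and the maximum triangle angle at every node $z$ is at most $\frac\pi2+\lambda_1\frac{h_z}{H_z}$ for a fixed constant $\lambda_1>0$. In the theorem $1\le i\le n-1$. For $S=\partial T\cap\partial T'\in\mathcal S$, $\omega_S:=T\cup T'$ and $J_S:=[\partial_{\boldsymbol\nu}u_h]_S:=\nabla u_h\cdot\boldsymbol\nu|_T+\nabla u_h\cdot\boldsymbol\nu|_{T'}$ with the respective outward unit normals; $\mathcal S\cap\{x=x_i\}$ is the set of edges lying on the line $x=x_i$. Discretization. $S_h\subset H^1_0(\Omega)\cap C(\bar\Omega)$: piecewise-linear finite element space on $\mathcal T$; $f_h:=f(\cdot;u_h)$; $\langle\cdot,\cdot\rangle$: $L_2(\Omega)$ inner product. Quadrature: for $T$ with vertices $z_1,z_2,z_3$, where $z_3=:z^*$ is opposite the shortest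 edge, $Q_T(w):=\frac13|T|(w(z_1)+w(z_2)+w(z_3))$ if $T\in\mathcal T\setminus\mathcal T^*$ and $Q_T(w):=\frac12|T|(w(z_1)+w(z_2))$ if $T\in\mathcal T^*$, where $\mathcal T^*:=\{T:h_T\ll H_T\text{ and }h_T\lesssim\varepsilon\}\setminus\mathcal T_0$ with a chosen $\mathcal T_0\subset\{T:z^*\in\mathcal N_{\rm iso}\text{ and }z_1,z_2\notin\mathcal N_{\rm ani}\setminus\partial\Omega\}$, $\mathcal N_{\rm iso}:=\{z:h_z\simeq H_z\}$. $\bar f_h:=\frac13[f_h(z_1)+f_h(z_2)+f_h(z_3)]$ on each $T$; $\langle f_h,v_h\rangle_h:=\sum_{T\in\mathcal T\setminus\mathcal T^*}Q_T(f_hv_h)+\sum_{T\in\mathcal T^*}Q_T(\bar f_hv_h)$. *)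

theory Defs
  imports "HOL-Analysis.Analysis"
begin

type_synonym point = "real \<times> real"

definition Omega :: "point set"
  where "Omega = {0<..<1} \<times> {0<..<1}"

section \<open>Function spaces and norms\<close>

definition L2 :: "point set \<Rightarrow> (point \<Rightarrow> 'b::{banach, second_countable_topology}) set"
  where "L2 D = {v. set_borel_measurable lborel D v \<and>
                    set_integrable lborel D (\<lambda>p. (norm (v p))\<^sup>2)}"

definition L2_norm :: "point set \<Rightarrow> (point \<Rightarrow> 'b::{banach, second_countable_topology}) \<Rightarrow> real"
  where "L2_norm D v = sqrt (LINT p:D|lborel. (norm (v p))\<^sup>2)"

definition L2_inner :: "point set \<Rightarrow> (point \<Rightarrow> 'b::real_inner) \<Rightarrow> (point \<Rightarrow> 'b) \<Rightarrow> real"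
  where "L2_inner D v w = (LINT p:D|lborel. v p \<bullet> w p)"

definition grad :: "(point \<Rightarrow> real) \<Rightarrow> point \<Rightarrow> point"
  where "grad \<phi> p = (THE g. GDERIV \<phi> p :> g)"

text \<open>The space \<open>C\<^sub>0\<^sup>1(D)\<close>.  As in Gilbarg and Trudinger, weak first derivatives are defined by
  testing with it, and \<open>H\<^sup>1\<^sub>0(D)\<close> is its closure in \<open>H\<^sup>1(D)\<close>.\<close>

definition test_function :: "point set \<Rightarrow> (point \<Rightarrow> real) \<Rightarrow> bool"
  where "test_function D \<phi> \<longleftrightarrow>
    (\<exists>\<phi>'. (\<forall>p. GDERIV \<phi> p :> \<phi>' p) \<and> continuous_on UNIV \<phi>') \<and>
    (\<exists>K. compact K \<and> K \<subseteq> D \<and> (\<forall>p. p \<notin> K \<longrightarrow> \<phi> p = 0))"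

definition has_weak_gradient :: "point set \<Rightarrow> (point \<Rightarrow> real) \<Rightarrow> (point \<Rightarrow> point) \<Rightarrow> bool"
  where "has_weak_gradient D v g \<longleftrightarrow>
    (\<forall>\<phi>. test_function D \<phi> \<longrightarrow>
      (LINT p:D|lborel. v p *\<^sub>R grad \<phi> p) = - (LINT p:D|lborel. \<phi> p *\<^sub>R g p))"

definition H1 :: "point set \<Rightarrow> (point \<Rightarrow> real) set"
  where "H1 D = {v \<in> L2 D. \<exists>g \<in> L2 D. has_weak_gradient D v g}"

text \<open>A representative of the weak gradient; it is determined up to null sets.\<close>

definition weak_grad :: "point set \<Rightarrow> (point \<Rightarrow> real) \<Rightarrow> point \<Rightarrow> point"
  where "weak_grad D v = (SOME g. g \<in> L2 D \<and> has_weak_gradient D v g)"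

definition H1_0 :: "point set \<Rightarrow> (point \<Rightarrow> real) set"
  where "H1_0 D = {v \<in> H1 D. \<exists>\<phi> :: nat \<Rightarrow> point \<Rightarrow> real.
    (\<forall>k. test_function D (\<phi> k)) \<and>
    (\<lambda>k. L2_norm D (\<lambda>p. \<phi> k p - v p)) \<longlonglongrightarrow> 0 \<and>
    (\<lambda>k. L2_norm D (\<lambda>p. grad (\<phi> k) p - weak_grad D v p)) \<longlonglongrightarrow> 0}"

definition energy_norm :: "real \<Rightarrow> real \<Rightarrow> point set \<Rightarrow> (point \<Rightarrow> real) \<Rightarrow> real"
  where "energy_norm \<epsilon> C\<^sub>f D v =
    sqrt (\<epsilon>\<^sup>2 * (L2_norm D (weak_grad D v))\<^sup>2 + C\<^sub>f * (L2_norm D v)\<^sup>2)"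

definition osc :: "(point \<Rightarrow> real) \<Rightarrow> point set \<Rightarrow> real"
  where "osc v D = Sup (v ` D) - Inf (v ` D)"

section \<open>The continuous problem\<close>

text \<open>The quadrature samples \<open>f(\<cdot>;u\<^sub>h)\<close> at boundary nodes, and triangles are closed sets,
  so \<open>f\<close> needs values on the boundary as well.  There only boundedness is required.  Inside
  \<open>Omega\<close>, where \<open>f\<close> is continuous, boundedness is the same as \<open>f(\<cdot>;s) \<in> L\<^sub>\<infinity>\<close>.\<close>

definition admissible_reaction :: "(point \<Rightarrow> real \<Rightarrow> real) \<Rightarrow> real \<Rightarrow> bool"
  where "admissible_reaction f C\<^sub>f \<longleftrightarrow>
    continuous_on (Omega \<times> UNIV) (\<lambda>(p, s). f p s) \<and>
    (\<forall>s. bounded ((\<lambda>p. f p s) ` closure Omega)) \<and>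
    C\<^sub>f \<ge> 0 \<and>
    (\<forall>p \<in> Omega. \<forall>s t. s \<ge> t \<longrightarrow> f p s - f p t \<ge> C\<^sub>f * (s - t)) \<and>
    (\<exists>L. \<forall>p \<in> Omega. \<forall>s t. \<bar>f p s - f p t\<bar> \<le> L * \<bar>s - t\<bar>)"

definition weak_solution :: "real \<Rightarrow> (point \<Rightarrow> real \<Rightarrow> real) \<Rightarrow> (point \<Rightarrow> real) \<Rightarrow> bool"
  where "weak_solution \<epsilon> f u \<longleftrightarrow> u \<in> H1_0 Omega \<and>
    (\<forall>v \<in> H1_0 Omega.
      \<epsilon>\<^sup>2 * L2_inner Omega (weak_grad Omega u) (weak_grad Omega v)
        + L2_inner Omega (\<lambda>p. f p (u p)) v = 0)"

section \<open>Triangulations\<close>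

definition triangulates_Omega :: "point set set \<Rightarrow> bool"
  where "triangulates_Omega \<T> \<longleftrightarrow>
    triangulation \<T> \<and> (\<forall>T \<in> \<T>. 2 simplex T) \<and> \<Union>\<T> = closure Omega"

definition vertices :: "point set \<Rightarrow> point set"
  where "vertices T = {z. z extreme_point_of T}"

definition nodes :: "point set set \<Rightarrow> point set"
  where "nodes \<T> = (\<Union>T \<in> \<T>. vertices T)"

definition edges :: "point set set \<Rightarrow> point set set"
  where "edges \<T> = {S. \<exists>T \<in> \<T>. S edge_of T}"

abbreviation area :: "point set \<Rightarrow> real"
  where "area D \<equiv> measure lborel D"

text \<open>The length of an edge is its diameter.\<close>

definition H_tri :: "point set \<Rightarrow> real"
  where "H_tri T = Max (diameter ` {S. S edge_of T})"

definition h_tri :: "point set \<Rightarrow> real"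
  where "h_tri T = 2 * area T / H_tri T"

definition elements_at :: "point set set \<Rightarrow> point \<Rightarrow> point set set"
  where "elements_at \<T> z = {T \<in> \<T>. z \<in> T}"

definition H_node :: "point set set \<Rightarrow> point \<Rightarrow> real"
  where "H_node \<T> z = diameter (\<Union>(elements_at \<T> z))"

definition h_node :: "point set set \<Rightarrow> point \<Rightarrow> real"
  where "h_node \<T> z = Max (h_tri ` elements_at \<T> z)"

definition h_node_min :: "point set set \<Rightarrow> point \<Rightarrow> real"
  where "h_node_min \<T> z = Min (h_tri ` elements_at \<T> z)"

text \<open>The angle at \<open>b\<close> between the segments to \<open>a\<close> and \<open>c\<close>.\<close>

definition angle :: "point \<Rightarrow> point \<Rightarrow> point \<Rightarrow> real"
  where "angle a b c = arccos (((a - b) \<bullet> (c - b)) / (norm (a - b) * norm (c - b)))"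

text \<open>\<open>a \<simeq> b\<close> with constant \<open>\<kappa>\<close>.\<close>

definition comparable :: "real \<Rightarrow> real \<Rightarrow> real \<Rightarrow> bool"
  where "comparable \<kappa> a b \<longleftrightarrow> a \<le> \<kappa> * b \<and> b \<le> \<kappa> * a"

definition shortest_edge :: "point set \<Rightarrow> point set \<Rightarrow> bool"
  where "shortest_edge T S \<longleftrightarrow>
    S edge_of T \<and> (\<forall>S'. S' edge_of T \<longrightarrow> diameter S \<le> diameter S')"

text \<open>The vertex \<open>z\<^sup>*\<close>.  It is unambiguous on the triangles where it matters: for small \<open>c\<^sub>0\<close>,
  the maximum angle condition and \<open>h\<^sub>T < c\<^sub>0 H\<^sub>T\<close> make the shortest edge unique.\<close>

definition apex :: "point set \<Rightarrow> point"
  where "apex T = (SOME z. z \<in> vertices T \<and> (\<exists>S. shortest_edge T S \<and> z \<notin> S))"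

definition aniso_nodes :: "real \<Rightarrow> real \<Rightarrow> point set set \<Rightarrow> point set"
  where "aniso_nodes \<kappa> c\<^sub>0 \<T> = {z \<in> nodes \<T>. h_node \<T> z < c\<^sub>0 * H_node \<T> z \<and>
    (\<forall>T \<in> elements_at \<T> z. comparable \<kappa> (h_tri T) (h_node \<T> z) \<and>
                              comparable \<kappa> (H_tri T) (H_node \<T> z))}"

definition iso_nodes :: "real \<Rightarrow> point set set \<Rightarrow> point set"
  where "iso_nodes \<kappa> \<T> = {z \<in> nodes \<T>. comparable \<kappa> (h_node \<T> z) (H_node \<T> z)}"

definition standing_mesh_assumptions :: "real \<Rightarrow> nat \<Rightarrow> real \<Rightarrow> point set set \<Rightarrow> bool"
  where "standing_mesh_assumptions lam\<^sub>0 M \<kappa> \<T> \<longleftrightarrow>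
    triangulates_Omega \<T> \<and>
    (\<forall>T \<in> \<T>. \<forall>a b c. vertices T = {a, b, c} \<longrightarrow> angle a b c \<le> lam\<^sub>0) \<and>
    (\<forall>z \<in> nodes \<T>. card (elements_at \<T> z) \<le> M) \<and>
    (\<forall>z \<in> nodes \<T>. \<forall>T \<in> elements_at \<T> z.
      (comparable \<kappa> (h_tri T) (h_node_min \<T> z) \<and> comparable \<kappa> (H_tri T) (H_node \<T> z)) \<or>
      comparable \<kappa> (h_tri T) (H_tri T))"

definition vline :: "real \<Rightarrow> point set"
  where "vline a = {p. fst p = a}"

definition partially_structured_mesh ::
    "real \<Rightarrow> nat \<Rightarrow> real \<Rightarrow> real \<Rightarrow> real \<Rightarrow> nat \<Rightarrow> (nat \<Rightarrow> real) \<Rightarrow> point set set \<Rightarrow> bool"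
  where "partially_structured_mesh lam\<^sub>0 M \<kappa> c\<^sub>0 lam\<^sub>1 n x \<T> \<longleftrightarrow>
    standing_mesh_assumptions lam\<^sub>0 M \<kappa> \<T> \<and>
    x 0 = 0 \<and> x n = 1 \<and> strict_mono_on {0..n} x \<and>
    (\<forall>T \<in> \<T>. \<exists>i \<le> n. (\<exists>S. shortest_edge T S \<and> S \<subseteq> vline (x i)) \<and>
      (\<exists>j \<le> n. (j = i + 1 \<or> i = j + 1) \<and> vertices T \<inter> vline (x j) \<noteq> {})) \<and>
    aniso_nodes \<kappa> c\<^sub>0 \<T> = nodes \<T> \<and>
    (\<forall>T \<in> \<T>. \<forall>a z b. vertices T = {a, z, b} \<longrightarrow>
      angle a z b \<le> pi / 2 + lam\<^sub>1 * (h_node \<T> z / H_node \<T> z))"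

text \<open>\<open>\<Omega>\<^sub>i\<close>, for \<open>1 \<le> i \<le> n - 1\<close>.\<close>

definition strip :: "(nat \<Rightarrow> real) \<Rightarrow> nat \<Rightarrow> point set"
  where "strip x i = {x (i - 1)<..<x (i + 1)} \<times> {0<..<1}"

definition elements_in_strip :: "point set set \<Rightarrow> (nat \<Rightarrow> real) \<Rightarrow> nat \<Rightarrow> point set set"
  where "elements_in_strip \<T> x i = {T \<in> \<T>. T \<subseteq> closure (strip x i)}"

section \<open>Finite element space and normal derivative jumps\<close>

definition FE_space :: "point set set \<Rightarrow> (point \<Rightarrow> real) set"
  where "FE_space \<T> = {v. continuous_on (closure Omega) v \<and>
    (\<forall>p \<in> frontier Omega. v p = 0) \<and>
    (\<forall>T \<in> \<T>. \<exists>g c. \<forall>p \<in> T. v p = g \<bullet> p + c)}"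

definition element_grad :: "point set \<Rightarrow> (point \<Rightarrow> real) \<Rightarrow> point"
  where "element_grad T v = (THE g. \<forall>p \<in> interior T. GDERIV v p :> g)"

definition outward_normal :: "point set \<Rightarrow> point set \<Rightarrow> point"
  where "outward_normal T S = (THE \<nu>. norm \<nu> = 1 \<and>
    (\<forall>p \<in> S. \<forall>q \<in> S. \<nu> \<bullet> (p - q) = 0) \<and> (\<forall>p \<in> T. \<forall>q \<in> S. \<nu> \<bullet> (p - q) \<le> 0))"

definition elements_on :: "point set set \<Rightarrow> point set \<Rightarrow> point set set"
  where "elements_on \<T> S = {T \<in> \<T>. S edge_of T}"

text \<open>For an edge inside \<open>Omega\<close> the sum and the union have two members, \<open>T\<close> and \<open>T'\<close>.\<close>

definition normal_jump :: "point set set \<Rightarrow> (point \<Rightarrow> real) \<Rightarrow> point set \<Rightarrow> real"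
  where "normal_jump \<T> v S = (\<Sum>T \<in> elements_on \<T> S. element_grad T v \<bullet> outward_normal T S)"

definition edge_patch :: "point set set \<Rightarrow> point set \<Rightarrow> point set"
  where "edge_patch \<T> S = \<Union>(elements_on \<T> S)"

section \<open>Quadrature\<close>

definition T_star ::
    "real \<Rightarrow> real \<Rightarrow> real \<Rightarrow> point set set \<Rightarrow> point set set \<Rightarrow> point set set"
  where "T_star c\<^sub>0 C\<^sub>1 \<epsilon> \<T> \<T>\<^sub>0 =
    {T \<in> \<T>. h_tri T < c\<^sub>0 * H_tri T \<and> h_tri T \<le> C\<^sub>1 * \<epsilon>} - \<T>\<^sub>0"

definition admissible_T0 :: "real \<Rightarrow> real \<Rightarrow> point set set \<Rightarrow> point set set \<Rightarrow> bool"
  where "admissible_T0 \<kappa> c\<^sub>0 \<T> \<T>\<^sub>0 \<longleftrightarrow>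
    \<T>\<^sub>0 \<subseteq> {T \<in> \<T>. apex T \<in> iso_nodes \<kappa> \<T> \<and>
      (\<forall>z \<in> vertices T - {apex T}. z \<notin> aniso_nodes \<kappa> c\<^sub>0 \<T> - frontier Omega)}"

definition Q_full :: "point set \<Rightarrow> (point \<Rightarrow> real) \<Rightarrow> real"
  where "Q_full T w = area T / 3 * (\<Sum>z \<in> vertices T. w z)"

definition Q_star :: "point set \<Rightarrow> (point \<Rightarrow> real) \<Rightarrow> real"
  where "Q_star T w = area T / 2 * (\<Sum>z \<in> vertices T - {apex T}. w z)"

definition nodal_mean :: "point set \<Rightarrow> (point \<Rightarrow> real) \<Rightarrow> real"
  where "nodal_mean T w = (\<Sum>z \<in> vertices T. w z) / 3"

definition quadrature_form ::
    "point set set \<Rightarrow> point set set \<Rightarrow> (point \<Rightarrow> real) \<Rightarrow> (point \<Rightarrow> real) \<Rightarrow> real"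
  where "quadrature_form \<T> \<T>s w v =
    (\<Sum>T \<in> \<T> - \<T>s. Q_full T (\<lambda>p. w p * v p)) +
    (\<Sum>T \<in> \<T>s. Q_star T (\<lambda>p. nodal_mean T w * v p))"

text \<open>\<open>ip_h\<close> stands for \<open>\<langle>\<cdot>,\<cdot>\<rangle>\<^sub>h\<close>, which may or may not involve quadrature.\<close>

definition discrete_solution ::
    "real \<Rightarrow> (point \<Rightarrow> real \<Rightarrow> real) \<Rightarrow> point set set \<Rightarrow>
      ((point \<Rightarrow> real) \<Rightarrow> (point \<Rightarrow> real) \<Rightarrow> real) \<Rightarrow> (point \<Rightarrow> real) \<Rightarrow> bool"
  where "discrete_solution \<epsilon> f \<T> ip_h u\<^sub>h \<longleftrightarrow> u\<^sub>h \<in> FE_space \<T> \<and>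
    (\<forall>v \<in> FE_space \<T>.
      \<epsilon>\<^sup>2 * L2_inner Omega (weak_grad Omega u\<^sub>h) (weak_grad Omega v)
        + ip_h (\<lambda>p. f p (u\<^sub>h p)) v = 0)"

definition no_quadrature_in ::
    "point set \<Rightarrow> point set set \<Rightarrow>
      ((point \<Rightarrow> real) \<Rightarrow> (point \<Rightarrow> real) \<Rightarrow> real) \<Rightarrow> (point \<Rightarrow> real) \<Rightarrow> bool"
  where "no_quadrature_in D \<T> ip_h w \<longleftrightarrow>
    (\<forall>v \<in> FE_space \<T>. (\<forall>p \<in> Omega - D. v p = 0) \<longrightarrow> ip_h w v = L2_inner Omega w v)"

definition quadrature_in_strip ::
    "real \<Rightarrow> real \<Rightarrow> real \<Rightarrow> real \<Rightarrow> point set set \<Rightarrow> (nat \<Rightarrow> real) \<Rightarrow> nat \<Rightarrow>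
      ((point \<Rightarrow> real) \<Rightarrow> (point \<Rightarrow> real) \<Rightarrow> real) \<Rightarrow> (point \<Rightarrow> real) \<Rightarrow> bool"
  where "quadrature_in_strip \<kappa> c\<^sub>0 C\<^sub>1 \<epsilon> \<T> x i ip_h w \<longleftrightarrow>
    (\<exists>\<T>\<^sub>0. admissible_T0 \<kappa> c\<^sub>0 \<T> \<T>\<^sub>0 \<and>
      (\<forall>v \<in> FE_space \<T>. ip_h w v = quadrature_form \<T> (T_star c\<^sub>0 C\<^sub>1 \<epsilon> \<T> \<T>\<^sub>0) w v) \<and>
      (elements_in_strip \<T> x i \<subseteq> T_star c\<^sub>0 C\<^sub>1 \<epsilon> \<T> \<T>\<^sub>0 \<or>
       elements_in_strip \<T> x i \<inter> T_star c\<^sub>0 C\<^sub>1 \<epsilon> \<T> \<T>\<^sub>0 = {}))"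

section \<open>The oscillation term\<close>

definition lambda_tri :: "real \<Rightarrow> point set \<Rightarrow> real"
  where "lambda_tri \<epsilon> T = min 1 (H_tri T / \<epsilon>)"

text \<open>The piecewise constant function equal to \<open>\<lambda>\<^sub>T osc(w;T)\<close> in \<open>T\<close>
  (set to \<open>0\<close> on the null set of element boundaries).\<close>

definition osc_function :: "real \<Rightarrow> point set set \<Rightarrow> (point \<Rightarrow> real) \<Rightarrow> point \<Rightarrow> real"
  where "osc_function \<epsilon> \<T> w p =
    (\<Sum>T \<in> \<T>. lambda_tri \<epsilon> T * osc w T * indicator (interior T) p)"

end

(* Subtracting the weak formulations shows that the residual of u_h, tested with a C^1 function
   supported in the strip, is controlled by the energy error on the strip; where C_f is small this
   uses a one-sided Poincare inequality, as u_h - u vanishes at y = 0.  The discrete equation is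
   bypassed: test functions are made orthogonal to the (elementwise almost constant) reaction term.

   First the jumps across the long edges inside the strip are bounded by bubbles that are odd across
   the edge, so that their integral vanishes on each of the two adjacent elements.  Then the jumps on
   x = x_i are picked up by q((x - x_i)/w) * alpha(y), where alpha interpolates the jumps and the odd
   profile q again has mean zero on either side of the line.  The y-derivative of this function meets
   the variation of the gradient along the line, which consists of the long-edge jumps already bounded.
   By the maximum angle condition the elements between two neighbouring lines form a stack of
   triangles with long edges of bounded slope, which is all the geometry that the estimate needs. *)

theory Submission
  imports Defs
begin

section \<open>Test functions\<close>

text \<open>The obstacle is anisotropy. The short edges S on the line may be far shorter than both
  \<epsilon> and the mesh width W, while the wanted weight is comparable with |S| min(\<epsilon>,
  W). A bubble on a single short edge, with a y-derivative of size 1/|S|, would give a much smaller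
  weight. The jumps are therefore tested together by one function of width about min(\<epsilon>, W),
  whose y-derivative involves only differences of neighbouring jumps. Such a difference is a sum of
  terms slope times \<beta>, where \<beta> is the jump of the vertical derivative across a long edge
  ending at the common node: continuity of the discrete solution along that edge couples the jumps
  of both gradient components. The slope is at most a constant times |S| / W, which cancels the
  factor 1/|S| of differentiation. Zero boundary values replace the missing neighbours at both ends
  of the line. Freezing the gradient and the reaction at the values of one element is possible only
  within horizontal distance W / K, where every element met shares a node with the edge. Products
  are split by Young's inequality with explicit weights, so that half of the jumps is left.\<close>

lemma GDERIV_unique:
  assumes "GDERIV \<phi> p :> g" "GDERIV \<phi> p :> g'"
  shows "g = g'"
proof -
  have "(\<lambda>h. h \<bullet> g) = (\<lambda>h. h \<bullet> g')"
    using assms has_derivative_unique unfolding gderiv_def by blast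
  then have "h \<bullet> (g - g') = 0" for h
    by (metis inner_diff_right right_minus_eq)
  then show ?thesis
    by (metis inner_eq_zero_iff right_minus_eq)
qed

lemma grad_eq: "GDERIV \<phi> p :> g \<Longrightarrow> grad \<phi> p = g"
  unfolding grad_def by (blast intro: the_equality GDERIV_unique)

lemma test_functionI:
  assumes "\<And>p. GDERIV \<phi> p :> \<phi>' p" "continuous_on UNIV \<phi>'"
    and "compact K" "K \<subseteq> D" "\<And>p. p \<notin> K \<Longrightarrow> \<phi> p = 0"
  shows "test_function D \<phi>"
  unfolding test_function_def using assms by blast

section \<open>One-dimensional profiles: smooth step, bump with mean zero on each half,
  cut-off\<close>

definition sqpos :: "real \<Rightarrow> real"
  where "sqpos t = (max 0 t)\<^sup>2"

lemma sqpos_nonneg [simp]: "sqpos t \<ge> 0"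
  by (simp add: sqpos_def)

lemma has_real_derivative_sqpos: "(sqpos has_real_derivative 2 * max 0 t) (at t)"
proof -
  consider "t < 0" | "t > 0" | "t = 0" by linarith
  then show ?thesis
  proof cases
    case 1
    have "((\<lambda>t. 0) has_real_derivative 0) (at t)" by simp
    then have "(sqpos has_real_derivative 0) (at t)"
      by (rule has_field_derivative_transform_within_open[where S="{..<0}"])
        (use 1 in \<open>auto simp: sqpos_def max_def\<close>)
    with 1 show ?thesis by (simp add: max_def)
  next
    case 2
    have "((\<lambda>t. t\<^sup>2) has_real_derivative 2 * t) (at t)"
      by (auto intro!: derivative_eq_intros)
    then have "(sqpos has_real_derivative 2 * t) (at t)"
      by (rule has_field_derivative_transform_within_open[where S="{0<..}"])
        (use 2 in \<open>auto simp: sqpos_def max_def\<close>)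
    with 2 show ?thesis by (simp add: max_def)
  next
    case 3
    \<comment> \<open>At the kink the difference quotient is h or 0, hence at most |h|.\<close>
    have "((\<lambda>h. (sqpos (0 + h) - sqpos 0) / h) \<longlongrightarrow> 0) (at 0)"
    proof (rule Lim_null_comparison[of _ "\<lambda>h. \<bar>h\<bar>"])
      show "\<forall>\<^sub>F h in at (0::real). norm ((sqpos (0 + h) - sqpos 0) / h) \<le> \<bar>h\<bar>"
        by (rule always_eventually) (auto simp: sqpos_def max_def power2_eq_square)
      show "((\<lambda>h. \<bar>h\<bar>) \<longlongrightarrow> 0) (at (0::real))"
        by (auto intro!: tendsto_eq_intros)
    qed
    then show ?thesis
      using 3 by (simp add: DERIV_def)
  qed
qed

lemmas has_real_derivative_sqpos' [derivative_intros] =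
  DERIV_chain2[OF has_real_derivative_sqpos]

lemma continuous_on_sqpos [continuous_intros]:
  "continuous_on S f \<Longrightarrow> continuous_on S (\<lambda>x. sqpos (f x))"
  unfolding sqpos_def by (intro continuous_intros)

text \<open>Its derivative is a hat function of height 4 and area 1 on [1/4, 3/4]. The margins of
  length 1/4, on which the step is constant, later keep supports compact inside open sets.\<close>

definition sstep :: "real \<Rightarrow> real"
  where "sstep t = 8 * (sqpos (t - 1/4) - 2 * sqpos (t - 1/2) + sqpos (t - 3/4))"

definition sstep' :: "real \<Rightarrow> real"
  where "sstep' t = 16 * (max 0 (t - 1/4) - 2 * max 0 (t - 1/2) + max 0 (t - 3/4))"

lemma has_real_derivative_sstep: "(sstep has_real_derivative sstep' t) (at t)"
  unfolding sstep_def sstep'_def by (auto intro!: derivative_eq_intros)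

lemma continuous_on_sstep' [continuous_intros]:
  "continuous_on S f \<Longrightarrow> continuous_on S (\<lambda>x. sstep' (f x))"
  unfolding sstep'_def by (intro continuous_intros)

lemma continuous_on_sstep [continuous_intros]:
  "continuous_on S f \<Longrightarrow> continuous_on S (\<lambda>x. sstep (f x))"
  unfolding sstep_def by (intro continuous_intros)

lemma sstep_0: "t \<le> 1/4 \<Longrightarrow> sstep t = 0"
  by (simp add: sstep_def sqpos_def)

lemma sstep_1: "t \<ge> 3/4 \<Longrightarrow> sstep t = 1"
  by (simp add: sstep_def sqpos_def power2_eq_square algebra_simps)

lemma sstep'_bounds: "0 \<le> sstep' t" "sstep' t \<le> 4"
  by (auto simp: sstep'_def max_def)

lemma sstep'_0: "t \<le> 0 \<or> t \<ge> 1 \<Longrightarrow> sstep' t = 0"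
  by (auto simp: sstep'_def max_def)

lemma sstep_mono: "s \<le> t \<Longrightarrow> sstep s \<le> sstep t"
  by (rule DERIV_nonneg_imp_nondecreasing) (use has_real_derivative_sstep sstep'_bounds in blast)+

lemma sstep_bounds: "0 \<le> sstep t" "sstep t \<le> 1"
proof -
  show "0 \<le> sstep t" using sstep_mono[of "min t 0" t] sstep_0[of "min t 0"] by auto
  show "sstep t \<le> 1" using sstep_mono[of t "max t 1"] sstep_1[of "max t 1"] by auto
qed

text \<open>Odd, with vanishing values at \<open>0\<close> and \<open>\<plusminus>1\<close>, so its derivative has mean zero on both
  \<open>[-1,0]\<close> and \<open>[0,1]\<close>.\<close>

definition qint :: "real \<Rightarrow> real"
  where "qint t = t * (1 - t\<^sup>2) * sqpos (1 - t\<^sup>2)"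

text \<open>The derivative of \<open>qint\<close>; the factor 1 - 7 t^2 comes from differentiating t
  (1 - t^2)^3. It is even with value 1 at 0, so its own derivative has integral 1 over [-1,0] and -1
  over [0,1] and detects a jump at 0, whereas its zero mean over each half ignores elementwise
  constants.\<close>

definition qbump :: "real \<Rightarrow> real"
  where "qbump t = sqpos (1 - t\<^sup>2) * (1 - 7 * t\<^sup>2)"

definition qbump' :: "real \<Rightarrow> real"
  where "qbump' t = - 4 * t * max 0 (1 - t\<^sup>2) * (1 - 7 * t\<^sup>2) - 14 * t * sqpos (1 - t\<^sup>2)"

text \<open>Cut-off in the direction along a long edge. It has to be nonnegative with a definite
  mass, in contrast to the profile across the edge.\<close>

definition pbump :: "real \<Rightarrow> real"
  where "pbump t = sqpos (1 - t\<^sup>2)"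

definition pbump' :: "real \<Rightarrow> real"
  where "pbump' t = - 4 * t * max 0 (1 - t\<^sup>2)"

lemma max_mult_self: "a * max 0 a = (max 0 a)\<^sup>2" for a :: real
  by (simp add: max_def power2_eq_square)

lemma has_real_derivative_qint: "(qint has_real_derivative qbump t) (at t)"
proof -
  let ?m = "max 0 (1 - t\<^sup>2)"
  have "(qint has_real_derivative
    t * (1 - t\<^sup>2) * (2 * ?m * (- 2 * t)) + ((1 - t\<^sup>2) + t * (- 2 * t)) * sqpos (1 - t\<^sup>2)) (at t)"
    unfolding qint_def by (auto intro!: derivative_eq_intros)
  also have "t * (1 - t\<^sup>2) * (2 * ?m * (- 2 * t)) = - 4 * t\<^sup>2 * ((1 - t\<^sup>2) * ?m)"
    by (simp add: power2_eq_square algebra_simps)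
  also have "\<dots> = - 4 * t\<^sup>2 * sqpos (1 - t\<^sup>2)"
    unfolding max_mult_self sqpos_def ..
  finally show ?thesis
    by (simp add: qbump_def algebra_simps power2_eq_square)
qed

lemma has_real_derivative_qbump: "(qbump has_real_derivative qbump' t) (at t)"
  unfolding qbump_def qbump'_def by (auto intro!: derivative_eq_intros)

lemma has_real_derivative_pbump: "(pbump has_real_derivative pbump' t) (at t)"
  unfolding pbump_def pbump'_def by (auto intro!: derivative_eq_intros)

lemma continuous_on_qbump' [continuous_intros]:
  "continuous_on S f \<Longrightarrow> continuous_on S (\<lambda>x. qbump' (f x))"
  unfolding qbump'_def by (intro continuous_intros)

lemma continuous_on_qbump [continuous_intros]:
  "continuous_on S f \<Longrightarrow> continuous_on S (\<lambda>x. qbump (f x))"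
  unfolding qbump_def by (intro continuous_intros)

lemma continuous_on_pbump' [continuous_intros]:
  "continuous_on S f \<Longrightarrow> continuous_on S (\<lambda>x. pbump' (f x))"
  unfolding pbump'_def by (intro continuous_intros)

lemma continuous_on_pbump [continuous_intros]:
  "continuous_on S f \<Longrightarrow> continuous_on S (\<lambda>x. pbump (f x))"
  unfolding pbump_def by (intro continuous_intros)

lemma bump_outside:
  assumes "\<bar>t\<bar> \<ge> 1"
  shows "qint t = 0" "qbump t = 0" "qbump' t = 0" "pbump t = 0" "pbump' t = 0"
proof -
  have "1 - t\<^sup>2 \<le> 0" using assms by (metis abs_le_square_iff abs_one diff_le_0_iff_le power_one)
  then show "qint t = 0" "qbump t = 0" "qbump' t = 0" "pbump t = 0" "pbump' t = 0"
    by (auto simp: qint_def qbump_def qbump'_def pbump_def pbump'_def sqpos_def)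
qed

lemma bump_values: "qint 0 = 0" "qint 1 = 0" "qint (-1) = 0" "qbump 0 = 1" "qbump 1 = 0" "qbump (-1) = 0"
  by (auto simp: qint_def qbump_def sqpos_def)

lemma bump_bounds: "\<bar>qbump t\<bar> \<le> 6" "\<bar>qbump' t\<bar> \<le> 60" "0 \<le> pbump t" "pbump t \<le> 1" "\<bar>pbump' t\<bar> \<le> 4"
proof -
  have "\<bar>qbump t\<bar> \<le> 6 \<and> \<bar>qbump' t\<bar> \<le> 60 \<and> 0 \<le> pbump t \<and> pbump t \<le> 1 \<and> \<bar>pbump' t\<bar> \<le> 4"
  proof (cases "\<bar>t\<bar> \<ge> 1")
    case True
    then show ?thesis by (simp add: bump_outside)
  next
    case False
    then have t: "\<bar>t\<bar> \<le> 1" "t\<^sup>2 \<le> 1" by (auto simp: abs_square_le_1)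
    have m: "0 \<le> max 0 (1 - t\<^sup>2)" "max 0 (1 - t\<^sup>2) \<le> 1" using t by auto
    have s: "0 \<le> sqpos (1 - t\<^sup>2)" "sqpos (1 - t\<^sup>2) \<le> 1"
      using m by (auto simp: sqpos_def power_le_one)
    have c: "\<bar>1 - 7 * t\<^sup>2\<bar> \<le> 6" using zero_le_power2[of t] t unfolding abs_le_iff by linarith
    have "\<bar>qbump t\<bar> \<le> 1 * 6"
      unfolding qbump_def abs_mult by (rule mult_mono) (use s c in auto)
    moreover have 1: "\<bar>t * max 0 (1 - t\<^sup>2)\<bar> \<le> 1 * 1"
      unfolding abs_mult by (rule mult_mono) (use m t in auto)
    moreover have "\<bar>t * max 0 (1 - t\<^sup>2) * (1 - 7 * t\<^sup>2)\<bar> \<le> 1 * 6"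
      by (subst abs_mult, rule mult_mono) (use 1 c in auto)
    moreover have "\<bar>t * sqpos (1 - t\<^sup>2)\<bar> \<le> 1 * 1"
      unfolding abs_mult by (rule mult_mono) (use s t in auto)
    ultimately show ?thesis using s
      unfolding qbump'_def pbump_def pbump'_def by (auto simp: mult.assoc)
  qed
  then show "\<bar>qbump t\<bar> \<le> 6" "\<bar>qbump' t\<bar> \<le> 60" "0 \<le> pbump t" "pbump t \<le> 1" "\<bar>pbump' t\<bar> \<le> 4"
    by auto
qed

text \<open>One computation for all test functions: \<open>P\<close> cuts off horizontally, while
  \<open>Q\<close> acts on y alone for the box cut-offs and for the function on the line, and on the
  vertical distance from a sloping edge for the bubbles.\<close>

lemma GDERIV_product_affine:
  assumes P: "\<And>t. (P has_real_derivative P' t) (at t)"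
    and Q: "\<And>t. (Q has_real_derivative Q' t) (at t)"
  shows "GDERIV (\<lambda>p. P (a * fst p + b) * Q (c * fst p + d * snd p + e)) p :>
    (a * P' (a * fst p + b) * Q (c * fst p + d * snd p + e)
       + c * P (a * fst p + b) * Q' (c * fst p + d * snd p + e),
     d * P (a * fst p + b) * Q' (c * fst p + d * snd p + e))"
proof -
  have P1: "((\<lambda>p. P (a * fst p + b)) has_derivative (\<lambda>h. P' (a * fst p + b) * (a * fst h))) (at p)"
    by (rule has_derivative_compose[of "\<lambda>p. a * fst p + b" "\<lambda>h. a * fst h" p UNIV P, simplified])
      (use P in \<open>auto intro!: derivative_eq_intros simp: has_field_derivative_def\<close>)
  have Q1: "((\<lambda>p. Q (c * fst p + d * snd p + e)) has_derivative
      (\<lambda>h. Q' (c * fst p + d * snd p + e) * (c * fst h + d * snd h))) (at p)"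
    by (rule has_derivative_compose[of "\<lambda>p. c * fst p + d * snd p + e" "\<lambda>h. c * fst h + d * snd h" p UNIV Q, simplified])
      (use Q in \<open>auto intro!: derivative_eq_intros simp: has_field_derivative_def\<close>)
  show ?thesis
    unfolding gderiv_def
    by (rule has_derivative_eq_rhs[OF has_derivative_mult[OF P1 Q1]])
      (auto simp: fun_eq_iff inner_prod_def algebra_simps)
qed

lemma continuous_product_affine:
  assumes "continuous_on UNIV P" "continuous_on UNIV P'" "continuous_on UNIV Q" "continuous_on UNIV Q'"
  shows "continuous_on UNIV (\<lambda>p::real\<times>real.
    (a * P' (a * fst p + b) * Q (c * fst p + d * snd p + e)
       + c * P (a * fst p + b) * Q' (c * fst p + d * snd p + e),
     d * P (a * fst p + b) * Q' (c * fst p + d * snd p + e)) :: real \<times> real)"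
  by (intro continuous_intros continuous_on_compose2[OF assms(1)] continuous_on_compose2[OF assms(2)]
      continuous_on_compose2[OF assms(3)] continuous_on_compose2[OF assms(4)]) auto

section \<open>Functions with broken gradients\<close>

lemma box_times: "box (a, c) (b, d) = {a<..<b} \<times> {c<..<d}" for a b c d :: real
  by (auto simp: box_def Basis_prod_def)

lemma rectangle_sets [measurable, simp]:
  "{a<..<b} \<times> {c<..<d} \<in> sets borel" for a b c d :: real
  unfolding box_times[symmetric] by simp

section \<open>Fubini and integrability on rectangles and bounded sets\<close>

lemma set_integral_rectangle_fst:
  fixes F :: "real \<times> real \<Rightarrow> 'b::{banach, second_countable_topology}"
  assumes "set_integrable lborel (A \<times> B) F"
  shows "(LINT p:A \<times> B|lborel. F p) = (LINT x:A|lborel. LINT y:B|lborel. F (x, y))"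
    "set_integrable lborel A (\<lambda>x. LINT y:B|lborel. F (x, y))"
    "AE x in lborel. x \<in> A \<longrightarrow> set_integrable lborel B (\<lambda>y. F (x, y))"
proof -
  have int: "integrable (lborel \<Otimes>\<^sub>M lborel) (\<lambda>p. indicator (A \<times> B) p *\<^sub>R F p)"
    using assms by (simp add: set_integrable_def lborel_prod)
  have ind: "indicator (A \<times> B) (x, y) *\<^sub>R F (x, y) = indicator A x *\<^sub>R indicator B y *\<^sub>R F (x, y)" for x y
    by (auto simp: indicator_def)
  show "(LINT p:A \<times> B|lborel. F p) = (LINT x:A|lborel. LINT y:B|lborel. F (x, y))"
    using lborel_pair.integral_fst'[OF int]
    unfolding set_lebesgue_integral_def ind lborel_prod integral_scaleR_right by simp
  show "set_integrable lborel A (\<lambda>x. LINT y:B|lborel. F (x, y))"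
    using lborel_pair.integrable_fst'[OF int]
    unfolding set_lebesgue_integral_def set_integrable_def ind lborel_prod integral_scaleR_right by simp
  show "AE x in lborel. x \<in> A \<longrightarrow> set_integrable lborel B (\<lambda>y. F (x, y))"
    using lborel_pair.AE_integrable_fst'[OF int]
    unfolding set_integrable_def ind by eventually_elim (auto simp: indicator_def)
qed

lemma set_integral_rectangle_snd:
  fixes F :: "real \<times> real \<Rightarrow> 'b::{banach, second_countable_topology}"
  assumes "set_integrable lborel (A \<times> B) F"
  shows "(LINT p:A \<times> B|lborel. F p) = (LINT y:B|lborel. LINT x:A|lborel. F (x, y))"
    "set_integrable lborel B (\<lambda>y. LINT x:A|lborel. F (x, y))"
    "AE y in lborel. y \<in> B \<longrightarrow> set_integrable lborel A (\<lambda>x. F (x, y))"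
proof -
  have "integrable (lborel \<Otimes>\<^sub>M lborel) (\<lambda>p. indicator (A \<times> B) p *\<^sub>R F p)"
    using assms by (simp add: set_integrable_def lborel_prod)
  moreover have eq: "(\<lambda>p. indicator (A \<times> B) p *\<^sub>R F p) = (\<lambda>(x, y). indicator B y *\<^sub>R indicator A x *\<^sub>R F (x, y))"
    by (auto simp: indicator_def)
  ultimately have int: "integrable (lborel \<Otimes>\<^sub>M lborel) (\<lambda>(x, y). indicator B y *\<^sub>R indicator A x *\<^sub>R F (x, y))"
    by simp
  show "(LINT p:A \<times> B|lborel. F p) = (LINT y:B|lborel. LINT x:A|lborel. F (x, y))"
    using lborel_pair.integral_snd[OF int]
    unfolding set_lebesgue_integral_def eq lborel_prod integral_scaleR_right by simp
  show "set_integrable lborel B (\<lambda>y. LINT x:A|lborel. F (x, y))"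
    using lborel_pair.integrable_snd[OF int]
    unfolding set_lebesgue_integral_def set_integrable_def lborel_prod integral_scaleR_right by simp
  show "AE y in lborel. y \<in> B \<longrightarrow> set_integrable lborel A (\<lambda>x. F (x, y))"
    using lborel_pair.AE_integrable_snd[OF int]
    unfolding set_integrable_def by eventually_elim (auto simp: indicator_def)
qed

lemma set_integrable_bounded:
  fixes F :: "'a::euclidean_space \<Rightarrow> 'b::{banach, second_countable_topology}"
  assumes "set_borel_measurable lborel A F" "A \<in> sets borel" "bounded A" "\<And>p. p \<in> A \<Longrightarrow> norm (F p) \<le> B"
  shows "set_integrable lborel A F"
proof -
  have fin: "emeasure lborel A < \<infinity>"
    using emeasure_bounded_finite[OF \<open>bounded A\<close>] by simp
  have "integrable lborel (\<lambda>p. indicator A p *\<^sub>R (indicator A p *\<^sub>R F p))"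
    by (rule integrableI_bounded_set_indicator[where B=B])
      (use assms fin in \<open>auto simp: set_borel_measurable_def indicator_def\<close>)
  moreover have "(\<lambda>p. indicator A p *\<^sub>R (indicator A p *\<^sub>R F p)) = (\<lambda>p. indicator A p *\<^sub>R F p)"
    by (auto simp: indicator_def)
  ultimately show ?thesis
    by (simp only: set_integrable_def)
qed

lemma set_borel_measurable_continuous:
  fixes F :: "'a::euclidean_space \<Rightarrow> 'b::{real_normed_vector, second_countable_topology}"
  assumes "A \<in> sets borel" "continuous_on A F"
  shows "set_borel_measurable lborel A F"
  using borel_measurable_continuous_on_indicator[OF assms] by (simp add: set_borel_measurable_def)

text \<open>The bound t \<le> 1 + t^2 and the finite measure of \<open>D\<close> turn square
  integrability into integrability.\<close>

lemma L2_D: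
  assumes "v \<in> L2 D" "D \<in> sets borel" "bounded D"
  shows "set_integrable lborel D v"
proof -
  have v: "set_borel_measurable lborel D v" "set_integrable lborel D (\<lambda>p. (norm (v p))\<^sup>2)"
    using assms by (auto simp: L2_def)
  have one: "set_integrable lborel D (\<lambda>p. 1::real)"
    by (rule set_integrable_bounded[where B=1]) (use assms in \<open>auto simp: set_borel_measurable_def\<close>)
  have "set_integrable lborel D (\<lambda>p. 1 + (norm (v p))\<^sup>2)"
    using set_integral_add(1)[OF one v(2)] .
  then show ?thesis
  proof (rule set_integrable_bound[OF _ v(1)])
    show "AE p in lborel. p \<in> D \<longrightarrow> norm (v p) \<le> norm (1 + (norm (v p))\<^sup>2)"
    proof (rule AE_I2, rule impI)
      fix p
      have "0 \<le> (norm (v p) - 1/2)\<^sup>2" by simp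
      then have "norm (v p) \<le> 1 + (norm (v p))\<^sup>2" by (simp add: power2_eq_square algebra_simps)
      then show "norm (v p) \<le> norm (1 + (norm (v p))\<^sup>2)" by simp
    qed
  qed
qed

section \<open>Vanishing against test functions and uniqueness of weak gradients\<close>

lemma box_cutoff:
  fixes a b c d :: real
  assumes ab: "a < b" and cd: "c < d"
  obtains \<phi> :: "nat \<Rightarrow> point \<Rightarrow> real" where
    "\<And>n D. {a<..<b} \<times> {c<..<d} \<subseteq> D \<Longrightarrow> test_function D (\<phi> n)"
    "\<And>n p. \<bar>\<phi> n p\<bar> \<le> 1"
    "\<And>p. (\<lambda>n. \<phi> n p) \<longlonglongrightarrow> indicator ({a<..<b} \<times> {c<..<d}) p"
    "\<And>n. continuous_on UNIV (\<phi> n)"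
proof -
  \<comment> \<open>An ascending and a descending step at the two ends, each in a layer of width
    1/(n+1). A nonzero value needs both arguments above 1/4, so the support stays away from the end
    points.\<close>
  define P where "P a b n x = sstep (real (Suc n) * (x - a)) * sstep (real (Suc n) * (b - x))" for a b n x
  define P' where "P' a b n x = real (Suc n) * sstep' (real (Suc n) * (x - a)) * sstep (real (Suc n) * (b - x))
    - real (Suc n) * sstep (real (Suc n) * (x - a)) * sstep' (real (Suc n) * (b - x))" for a b n x
  define \<phi> where "\<phi> n p = P a b n (fst p) * P c d n (snd p)" for n :: nat and p :: point
  have dP: "(P a b n has_real_derivative P' a b n x) (at x)" for a b n x
    unfolding P_def P'_def
    by (auto intro!: derivative_eq_intros DERIV_chain2[OF has_real_derivative_sstep] simp: algebra_simps)
  have contP: "continuous_on UNIV (P a b n)" "continuous_on UNIV (P' a b n)" for a b n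
    unfolding P_def P'_def by (intro continuous_intros)+
  have P0: "P a b n x = 0" if "x \<notin> {a + 1 / (4 * real (Suc n)) .. b - 1 / (4 * real (Suc n))}" for a b n x
  proof -
    have "real (Suc n) * (x - a) \<le> 1/4 \<or> real (Suc n) * (b - x) \<le> 1/4"
      using that by (auto simp: field_simps simp del: of_nat_Suc)
    then show ?thesis unfolding P_def using sstep_0 by auto
  qed
  have Pb: "0 \<le> P a b n x" "P a b n x \<le> 1" for a b n x
    unfolding P_def using sstep_bounds by (auto simp: mult_le_one)
  have P1: "(\<lambda>n. P a b n x) \<longlonglongrightarrow> indicator {a<..<b} x" for a b x
  proof (cases "x \<in> {a<..<b}")
    case True
    \<comment> \<open>Beyond these thresholds both arguments exceed 3/4, where \<open>sstep\<close>
      equals 1, so the sequence is eventually constant.\<close>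
    obtain N where N: "real N > 3 / (4 * (x - a))" using reals_Archimedean2 by blast
    obtain M where M: "real M > 3 / (4 * (b - x))" using reals_Archimedean2 by blast
    have "P a b n x = 1" if "n \<ge> max M N" for n
    proof -
      have "real (Suc n) > 3 / (4 * (x - a))" "real (Suc n) > 3 / (4 * (b - x))"
        using that N M by auto
      then have "real (Suc n) * (x - a) \<ge> 3/4" "real (Suc n) * (b - x) \<ge> 3/4"
        using True by (auto simp: field_simps simp del: of_nat_Suc)
      then show ?thesis by (simp add: P_def sstep_1)
    qed
    then have "\<forall>\<^sub>F n in sequentially. P a b n x = indicator {a<..<b} x"
      using True unfolding eventually_sequentially by (intro exI[of _ "max M N"]) simp
    then show ?thesis by (rule tendsto_eventually)
  next
    case False
    have "P a b n x = indicator {a<..<b} x" for n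
    proof -
      have "real (Suc n) * (x - a) \<le> 1/4 \<or> real (Suc n) * (b - x) \<le> 1/4"
        using False by (metis diff_ge_0_iff_ge diff_le_0_iff_le greaterThanLessThan_iff
            mult_nonneg_nonpos not_less of_nat_0_le_iff order_trans zero_le_divide_1_iff zero_le_numeral)
      then show ?thesis using False unfolding P_def using sstep_0 by auto
    qed
    then show ?thesis by simp
  qed
  show ?thesis
  proof
    fix n D assume D: "{a<..<b} \<times> {c<..<d} \<subseteq> D"
    define r where "r = 1 / (4 * real (Suc n))"
    have r: "r > 0" by (simp add: r_def)
    have "GDERIV (\<phi> n) p :> (P' a b n (fst p) * P c d n (snd p), P a b n (fst p) * P' c d n (snd p))" for p
      using GDERIV_product_affine[OF dP dP, of a b n 1 0 c d n 0 1 0 p]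
      unfolding \<phi>_def by simp
    moreover have "continuous_on UNIV (\<lambda>p::point. (P' a b n (fst p) * P c d n (snd p), P a b n (fst p) * P' c d n (snd p)))"
      using continuous_product_affine[OF contP contP, of 1 a b n 0 c d n 0 1 0] by simp
    moreover have "compact ({a + r .. b - r} \<times> {c + r .. d - r})"
      by (intro compact_Times compact_Icc)
    moreover have "{a + r .. b - r} \<times> {c + r .. d - r} \<subseteq> D"
      using D r by (intro subset_trans[OF _ D] Sigma_mono) auto
    moreover have "\<phi> n p = 0" if "p \<notin> {a + r .. b - r} \<times> {c + r .. d - r}" for p
      using that P0 unfolding \<phi>_def r_def by (cases p) auto
    ultimately show "test_function D (\<phi> n)"
      by (rule test_functionI)
  next
    fix n p
    show "\<bar>\<phi> n p\<bar> \<le> 1"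
      unfolding \<phi>_def using Pb by (auto simp: abs_mult mult_le_one)
  next
    fix p
    have "(\<lambda>n. \<phi> n p) \<longlonglongrightarrow> indicator {a<..<b} (fst p) * indicator {c<..<d} (snd p)"
      unfolding \<phi>_def by (intro tendsto_mult P1)
    then show "(\<lambda>n. \<phi> n p) \<longlonglongrightarrow> indicator ({a<..<b} \<times> {c<..<d}) p"
      by (cases p) (simp add: indicator_times)
  next
    fix n
    show "continuous_on UNIV (\<phi> n)"
      unfolding \<phi>_def
      by (intro continuous_intros continuous_on_compose2[OF contP(1)]) auto
  qed
qed

text \<open>Dominated convergence along the cut-offs gives vanishing integrals over all open boxes.
  Boxes form an intersection-stable generator of the Borel sets, so a Dynkin argument extends this
  to every Borel set, and a function with all such integrals zero vanishes almost
  everywhere.\<close>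

lemma AE_zero_of_test_functions:
  fixes g :: "point \<Rightarrow> 'b::{banach, second_countable_topology}" and a b c d :: real
  defines "D \<equiv> {a<..<b} \<times> {c<..<d}"
  assumes int: "set_integrable lborel D g"
    and zero: "\<And>\<phi>. test_function D \<phi> \<Longrightarrow> (LINT p:D|lborel. \<phi> p *\<^sub>R g p) = 0"
  shows "AE p in lborel. p \<in> D \<longrightarrow> g p = 0"
proof -
  define f where "f = (\<lambda>p. indicator D p *\<^sub>R g p)"
  have f: "integrable lborel f" using int by (simp add: f_def set_integrable_def)
  then have fm [measurable]: "f \<in> borel_measurable borel" by auto
  have box: "(LINT p:box u v|lborel. f p) = 0" for u v
  proof -
    obtain u1 u2 v1 v2 where uv: "u = (u1, u2)" "v = (v1, v2)" by (cases u, cases v) auto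
    define a' where "a' = max a u1"
    define b' where "b' = min b v1"
    define c' where "c' = max c u2"
    define d' where "d' = min d v2"
    have I: "box u v \<inter> D = {a'<..<b'} \<times> {c'<..<d'}"
      unfolding uv box_times D_def a'_def b'_def c'_def d'_def by auto
    have eq: "(LINT p:box u v|lborel. f p) = (LINT p|lborel. indicator ({a'<..<b'} \<times> {c'<..<d'}) p *\<^sub>R f p)"
      unfolding set_lebesgue_integral_def
      by (intro Bochner_Integration.integral_cong) (auto simp: f_def indicator_def I[symmetric])
    show ?thesis
    proof (cases "a' < b' \<and> c' < d'")
      case False
      then have "{a'<..<b'} \<times> {c'<..<d'} = {}" by auto
      then show ?thesis unfolding eq by (simp only:) simp
    next
      case True
      then obtain \<phi> where \<phi>: "\<And>n D. {a'<..<b'} \<times> {c'<..<d'} \<subseteq> D \<Longrightarrow> test_function D (\<phi> n)"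
        "\<And>n p. \<bar>\<phi> n p\<bar> \<le> 1"
        "\<And>p. (\<lambda>n. \<phi> n p) \<longlonglongrightarrow> indicator ({a'<..<b'} \<times> {c'<..<d'}) p"
        "\<And>n. continuous_on UNIV (\<phi> n)"
        using box_cutoff[of a' b' c' d'] by blast
      have "(\<lambda>n. LINT p|lborel. \<phi> n p *\<^sub>R f p) \<longlonglongrightarrow> (LINT p|lborel. indicator ({a'<..<b'} \<times> {c'<..<d'}) p *\<^sub>R f p)"
      proof (rule integral_dominated_convergence[where w="\<lambda>p. norm (f p)"])
        show "(\<lambda>p. indicator ({a'<..<b'} \<times> {c'<..<d'}) p *\<^sub>R f p) \<in> borel_measurable lborel"
          by measurable
        show "(\<lambda>p. \<phi> n p *\<^sub>R f p) \<in> borel_measurable lborel" for n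
          using borel_measurable_continuous_onI[OF \<phi>(4)] by measurable
        show "integrable lborel (\<lambda>p. norm (f p))" using f by simp
        show "AE p in lborel. (\<lambda>n. \<phi> n p *\<^sub>R f p) \<longlonglongrightarrow> indicator ({a'<..<b'} \<times> {c'<..<d'}) p *\<^sub>R f p"
          by (intro AE_I2 tendsto_intros \<phi>)
        show "AE p in lborel. norm (\<phi> n p *\<^sub>R f p) \<le> norm (f p)" for n
          using \<phi>(2) by (intro AE_I2) (simp add: mult_left_le_one_le)
      qed
      moreover have "(LINT p|lborel. \<phi> n p *\<^sub>R f p) = 0" for n
      proof -
        have "test_function D (\<phi> n)" by (rule \<phi>) (use I in blast)
        from zero[OF this] show ?thesis
          by (simp add: set_lebesgue_integral_def f_def mult.commute)
      qed
      ultimately show ?thesis unfolding eq by (simp add: LIMSEQ_const_iff)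
    qed
  qed
  have all: "(LINT p:A|lborel. f p) = 0" if "A \<in> sets lborel" for A
  proof -
    \<comment> \<open>The complement step of the induction needs the integral over the whole plane;
      since \<open>f\<close> is zero outside \<open>D\<close>, it is an integral over one
      box.\<close>
    have UN: "(LINT p|lborel. f p) = 0"
    proof -
      have "(LINT p|lborel. f p) = (LINT p:box (a,c) (b,d)|lborel. f p)"
        unfolding set_lebesgue_integral_def box_times
        by (intro Bochner_Integration.integral_cong) (auto simp: f_def D_def indicator_def)
      then show ?thesis using box by simp
    qed
    have sm: "set_integrable lborel A f" if "A \<in> sets borel" for A
      using f that unfolding set_integrable_def by (intro integrable_mult_indicator) auto
    have Int: "Int_stable (range (\<lambda>(a, b). box a b :: point set))"
      by (auto simp: Int_stable_def box_Int_box)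
    have sig: "sigma_sets UNIV (range (\<lambda>(a, b). box a b :: point set)) = sets borel"
      by (simp add: borel_eq_box)
    have A: "A \<in> sigma_sets UNIV (range (\<lambda>(a, b). box a b))"
      using that by (simp add: borel_eq_box)
    have sub: "range (\<lambda>(a, b). box a b) \<subseteq> Pow (UNIV :: point set)" by simp
    from Int sub A show ?thesis
    proof (induction rule: sigma_sets_induct_disjoint)
      case (basic A)
      then show ?case using box by auto
    next
      case empty
      show ?case by (simp add: set_lebesgue_integral_def)
    next
      case (compl A)
      then have A: "A \<in> sets borel" using sig by simp
      have "(LINT p:UNIV|lborel. f p) = (LINT p:UNIV - A|lborel. f p) + (LINT p:A|lborel. f p)"
        using set_integral_Un[of "UNIV - A" A lborel f] A sm by (simp add: Un_commute Diff_disjoint Int_commute)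
      then show ?case using compl UN by (simp add: set_lebesgue_integral_def)
    next
      case (union A)
      then have A: "A i \<in> sets borel" for i using sig by auto
      have "(LINT p:(\<Union>i. A i)|lborel. f p) = (\<Sum>i. LINT p:A i|lborel. f p)"
        by (rule lebesgue_integral_countable_add)
          (use A union sm in \<open>auto simp: disjoint_family_on_def\<close>)
      then show ?case using union by simp
    qed
  qed
  have "AE p in lborel. f p = 0"
    by (rule sigma_finite_measure.density_zero[OF lborel.sigma_finite_measure_axioms f all])
  then show ?thesis
    by eventually_elim (auto simp: f_def)
qed

lemma sq_le_of_abs_le: "\<bar>x\<bar> \<le> C \<Longrightarrow> x\<^sup>2 \<le> C\<^sup>2" for x C :: real
  by (metis abs_ge_zero power2_abs power_mono)

lemma bounded_rectangle [simp]: "bounded ({a<..<b} \<times> {c<..<d})" for a b c d :: real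
  by (intro bounded_Times) auto

text \<open>\<open>weak_grad\<close> is an arbitrary choice among weak gradients, so every identity
  for it is obtained by comparison with an explicit one through this lemma.\<close>

lemma weak_gradient_unique:
  fixes a b c d :: real
  defines "D \<equiv> {a<..<b} \<times> {c<..<d}"
  assumes "g \<in> L2 D" "has_weak_gradient D v g" "g' \<in> L2 D" "has_weak_gradient D v g'"
  shows "AE p in lborel. p \<in> D \<longrightarrow> g p = g' p"
proof -
  have D: "D \<in> sets borel" "bounded D" by (auto simp: D_def)
  have int: "set_integrable lborel D g" "set_integrable lborel D g'"
    using assms L2_D D by blast+
  have "AE p in lborel. p \<in> D \<longrightarrow> g p - g' p = 0"
    unfolding D_def
  proof (rule AE_zero_of_test_functions, fold D_def)
    show "set_integrable lborel D (\<lambda>p. g p - g' p)"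
      using int by (rule set_integral_diff)
    fix \<phi> assume \<phi>: "test_function D \<phi>"
    then obtain \<phi>' K where \<phi>': "\<And>p. GDERIV \<phi> p :> \<phi>' p" and K: "compact K" "\<And>p. p \<notin> K \<Longrightarrow> \<phi> p = 0"
      unfolding test_function_def by blast
    have cont: "continuous_on UNIV \<phi>"
      using \<phi>' unfolding gderiv_def
      by (meson continuous_at_imp_continuous_on has_derivative_continuous)
    have m: "set_borel_measurable lborel D (\<lambda>p. \<phi> p *\<^sub>R g p)" if "set_integrable lborel D g" for g :: "point \<Rightarrow> point"
    proof -
      have "(\<lambda>p. indicator D p *\<^sub>R g p) \<in> borel_measurable lborel"
        using that unfolding set_integrable_def by auto
      then have "(\<lambda>p. \<phi> p *\<^sub>R (indicator D p *\<^sub>R g p)) \<in> borel_measurable lborel"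
        using borel_measurable_continuous_onI[OF cont] by measurable
      then show ?thesis by (simp add: set_borel_measurable_def mult.commute)
    qed
    have "bounded (\<phi> ` K)"
      by (intro compact_imp_bounded compact_continuous_image continuous_on_subset[OF cont] K) auto
    then obtain B where B: "\<And>p. p \<in> K \<Longrightarrow> \<bar>\<phi> p\<bar> \<le> B" unfolding bounded_iff by auto
    have B': "\<bar>\<phi> p\<bar> \<le> max B 0" for p
      using B[of p] K(2)[of p] by (cases "p \<in> K") (auto intro: order_trans)
    have i: "set_integrable lborel D (\<lambda>p. \<phi> p *\<^sub>R g p)" if "set_integrable lborel D g" for g :: "point \<Rightarrow> point"
    proof (rule set_integrable_bound[OF set_integrable_scaleR_right[of "max B 0", OF that] m[OF that]])
      show "AE p in lborel. p \<in> D \<longrightarrow> norm (\<phi> p *\<^sub>R g p) \<le> norm (max B 0 *\<^sub>R g p)"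
        using B' by (intro AE_I2) (auto intro!: mult_right_mono)
    qed
    have "(LINT p:D|lborel. \<phi> p *\<^sub>R (g p - g' p)) = (LINT p:D|lborel. \<phi> p *\<^sub>R g p) - (LINT p:D|lborel. \<phi> p *\<^sub>R g' p)"
      unfolding scaleR_diff_right using i int by (intro set_integral_diff) auto
    also have "\<dots> = 0"
      using assms(3)[unfolded has_weak_gradient_def, rule_format, OF \<phi>]
        assms(5)[unfolded has_weak_gradient_def, rule_format, OF \<phi>] by simp
    finally show "(LINT p:D|lborel. \<phi> p *\<^sub>R (g p - g' p)) = 0" .
  qed
  then show ?thesis by simp
qed

lemma weak_grad_in_H1:
  assumes "v \<in> H1 D"
  shows "weak_grad D v \<in> L2 D" "has_weak_gradient D v (weak_grad D v)"
proof -
  have "\<exists>g. g \<in> L2 D \<and> has_weak_gradient D v g"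
    using assms by (auto simp: H1_def)
  from someI_ex[OF this] show "weak_grad D v \<in> L2 D" "has_weak_gradient D v (weak_grad D v)"
    unfolding weak_grad_def by auto
qed

text \<open>The complement of the compact \<open>K\<close> is open and the function is locally zero
  there, hence so is its gradient. Compactness supplies one bound \<open>B\<close> for both.\<close>

lemma test_functionE:
  assumes "test_function D \<phi>"
  obtains \<phi>' K B where "\<And>p. GDERIV \<phi> p :> \<phi>' p" "grad \<phi> = \<phi>'" "continuous_on UNIV \<phi>" "continuous_on UNIV \<phi>'"
    "compact K" "K \<subseteq> D" "\<And>p. p \<notin> K \<Longrightarrow> \<phi> p = 0" "\<And>p. p \<notin> K \<Longrightarrow> \<phi>' p = 0"
    "\<And>p. \<bar>\<phi> p\<bar> \<le> B" "\<And>p. norm (\<phi>' p) \<le> B" "B \<ge> 0"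
proof -
  obtain \<phi>' K where \<phi>': "\<And>p. GDERIV \<phi> p :> \<phi>' p" and cont': "continuous_on UNIV \<phi>'"
    and K: "compact K" "K \<subseteq> D" "\<And>p. p \<notin> K \<Longrightarrow> \<phi> p = 0"
    using assms unfolding test_function_def by blast
  have cont: "continuous_on UNIV \<phi>"
    using \<phi>' unfolding gderiv_def
    by (meson continuous_at_imp_continuous_on has_derivative_continuous)
  have 0: "\<phi>' p = 0" if "p \<notin> K" for p
  proof -
    have "(\<phi> has_derivative (\<lambda>h. 0)) (at p)"
      by (rule has_derivative_transform_within_open[OF has_derivative_const[of 0], of "- K"])
        (use K that compact_imp_closed in \<open>auto simp: open_closed\<close>)
    then have "GDERIV \<phi> p :> 0" by (simp add: gderiv_def)
    then show ?thesis using \<phi>' GDERIV_unique by blast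
  qed
  have "bounded (\<phi> ` K)" "bounded (\<phi>' ` K)"
    by (intro compact_imp_bounded compact_continuous_image continuous_on_subset[OF cont]
        continuous_on_subset[OF cont'] K subset_UNIV)+
  then obtain B1 B2 where B: "\<And>p. p \<in> K \<Longrightarrow> \<bar>\<phi> p\<bar> \<le> B1" "\<And>p. p \<in> K \<Longrightarrow> norm (\<phi>' p) \<le> B2"
    unfolding bounded_iff by auto
  define B where "B = max 0 (max B1 B2)"
  show ?thesis
  proof
    show "grad \<phi> = \<phi>'" using \<phi>' grad_eq by blast
    show "\<bar>\<phi> p\<bar> \<le> B" for p
      using B(1)[of p] K(3)[of p] by (cases "p \<in> K") (auto simp: B_def)
    show "norm (\<phi>' p) \<le> B" for p
      using B(2)[of p] 0[of p] by (cases "p \<in> K") (auto simp: B_def)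
    show "B \<ge> 0" by (simp add: B_def)
  qed (use \<phi>' cont cont' K 0 in auto)
qed

section \<open>Integration by parts along axis-parallel slices\<close>

lemma LINT_derivative:
  fixes f F :: "real \<Rightarrow> real"
  assumes "set_integrable lborel {c<..<d} F" "c \<le> d" "finite S"
    and "\<And>y. y \<in> {c<..<d} - S \<Longrightarrow> (f has_real_derivative F y) (at y)"
    and "continuous_on {c..d} f"
  shows "(LINT y:{c<..<d}|lborel. F y) = f d - f c"
proof -
  \<comment> \<open>The finite exceptional set will consist of the points where a slice crosses mesh
    edges. The theorem speaks about the gauge integral; the integrability assumption transfers its
    value to the Lebesgue integral.\<close>
  have "(F has_integral (f d - f c)) {c..d}"
    using assms
    by (intro fundamental_theorem_of_calculus_interior_strong[where S=S])
      (auto simp: has_real_derivative_iff_has_vector_derivative)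
  then have "integral {c<..<d} F = f d - f c"
    by (metis has_integral_Icc_iff_Ioo integral_unique)
  then show ?thesis
    using set_borel_integral_eq_integral(2)[OF assms(1)] by simp
qed

lemma GDERIV_slices:
  assumes "GDERIV v (x, y) :> g"
  shows "((\<lambda>y. v (x, y)) has_real_derivative snd g) (at y)"
    "((\<lambda>x. v (x, y)) has_real_derivative fst g) (at x)"
proof -
  have v: "(v has_derivative (\<lambda>h. h \<bullet> g)) (at (x, y))"
    using assms by (simp add: gderiv_def)
  have "((\<lambda>t. (x, t)) has_derivative (\<lambda>h. (0, h))) (at y)"
    by (auto intro!: derivative_eq_intros)
  from has_derivative_compose[OF this v]
  show "((\<lambda>y. v (x, y)) has_real_derivative snd g) (at y)"
    by (simp add: has_field_derivative_def inner_prod_def mult_commute_abs)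
  have "((\<lambda>t. (t, y)) has_derivative (\<lambda>h. (h, 0))) (at x)"
    by (auto intro!: derivative_eq_intros)
  from has_derivative_compose[OF this v]
  show "((\<lambda>x. v (x, y)) has_real_derivative fst g) (at x)"
    by (simp add: has_field_derivative_def inner_prod_def mult_commute_abs)
qed

lemma set_LINT_fst_snd:
  fixes F :: "point \<Rightarrow> point"
  assumes "set_integrable lborel D F"
  shows "fst (LINT p:D|lborel. F p) = (LINT p:D|lborel. fst (F p))"
    "snd (LINT p:D|lborel. F p) = (LINT p:D|lborel. snd (F p))"
    "set_integrable lborel D (\<lambda>p. fst (F p))" "set_integrable lborel D (\<lambda>p. snd (F p))"
  using integral_bounded_linear[OF bounded_linear_fst assms[unfolded set_integrable_def]]
    integral_bounded_linear[OF bounded_linear_snd assms[unfolded set_integrable_def]]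
    integrable_bounded_linear[OF bounded_linear_fst assms[unfolded set_integrable_def]]
    integrable_bounded_linear[OF bounded_linear_snd assms[unfolded set_integrable_def]]
  by (auto simp: set_lebesgue_integral_def set_integrable_def)

text \<open>Models a continuous piecewise linear function on a rectangle, with \<open>U\<close> the
  union of the open elements. The two slice assumptions say that all but finitely many vertical and
  horizontal lines meet the remaining points finitely often, which is what integration by parts on
  slices requires.\<close>

locale broken_gradient =
  fixes a b c d :: real and D :: "point set" and v :: "point \<Rightarrow> real" and G :: "point \<Rightarrow> point"
    and U :: "point set" and B :: real
  assumes D_def: "D = {a<..<b} \<times> {c<..<d}"
    and ab: "a < b" and cd: "c < d"
    and cont: "continuous_on ({a..b} \<times> {c..d}) v"
    and deriv: "\<And>p. p \<in> U \<Longrightarrow> GDERIV v p :> G p"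
    and meas: "G \<in> borel_measurable borel"
    and bound: "\<And>p. norm (G p) \<le> B"
    and slices_x: "\<exists>X. finite X \<and> (\<forall>x \<in> {a<..<b} - X. finite {y \<in> {c<..<d}. (x, y) \<notin> U})"
    and slices_y: "\<exists>Y. finite Y \<and> (\<forall>y \<in> {c<..<d} - Y. finite {x \<in> {a<..<b}. (x, y) \<notin> U})"
begin

lemma D_sets [simp]: "D \<in> sets borel" "bounded D"
  by (auto simp: D_def)

lemma D_subset: "D \<subseteq> {a..b} \<times> {c..d}"
  by (auto simp: D_def)

lemma v_bounded: obtains C where "\<And>p. p \<in> {a..b} \<times> {c..d} \<Longrightarrow> \<bar>v p\<bar> \<le> C"
proof -
  have "bounded (v ` ({a..b} \<times> {c..d}))"
    by (intro compact_imp_bounded compact_continuous_image cont compact_Times compact_Icc)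
  then show ?thesis using that unfolding bounded_iff by auto
qed

lemma v_measurable: "set_borel_measurable lborel D v"
  by (intro set_borel_measurable_continuous continuous_on_subset[OF cont] D_subset) simp

lemma G_measurable: "set_borel_measurable lborel A G" if "A \<in> sets borel"
  using meas that by (auto simp: set_borel_measurable_def)

lemma v_L2: "v \<in> L2 D"
proof -
  obtain C where C: "\<And>p. p \<in> {a..b} \<times> {c..d} \<Longrightarrow> \<bar>v p\<bar> \<le> C" using v_bounded by blast
  have "continuous_on D (\<lambda>p. (norm (v p))\<^sup>2)"
    by (intro continuous_intros continuous_on_subset[OF cont] D_subset)
  then have "set_integrable lborel D (\<lambda>p. (norm (v p))\<^sup>2)"
    using C D_subset
    by (intro set_integrable_bounded[where B="C\<^sup>2"] set_borel_measurable_continuous)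
      (auto intro!: sq_le_of_abs_le)
  with v_measurable show ?thesis by (simp add: L2_def)
qed

lemma G_L2: "G \<in> L2 D"
proof -
  have "set_borel_measurable lborel D (\<lambda>p. (norm (G p))\<^sup>2)"
  proof -
    note [measurable] = meas D_sets(1)
    show ?thesis unfolding set_borel_measurable_def by measurable
  qed
  then have "set_integrable lborel D (\<lambda>p. (norm (G p))\<^sup>2)"
    using bound
    by (intro set_integrable_bounded[where B="B\<^sup>2"]) (auto intro!: power_mono)
  with G_measurable show ?thesis by (simp add: L2_def)
qed

text \<open>The quantifier over \<open>y\<close> stands inside the null set, because the Poincare
  inequality uses the identity at all heights of the same slice. The horizontal counterpart is
  needed for the full slice only.\<close>

lemma vertical_FTC:
  fixes w :: "point \<Rightarrow> real" and w' :: "point \<Rightarrow> real"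
  assumes "continuous_on ({a..b} \<times> {c..d}) w"
    and "\<And>x y. (x, y) \<in> U \<inter> D \<Longrightarrow> ((\<lambda>y. w (x, y)) has_real_derivative w' (x, y)) (at y)"
    and "set_integrable lborel D w'"
  shows "AE x in lborel. x \<in> {a<..<b} \<longrightarrow> (\<forall>y \<in> {c<..d}.
    set_integrable lborel {c<..<y} (\<lambda>y. w' (x, y)) \<and>
    (LINT y:{c<..<y}|lborel. w' (x, y)) = w (x, y) - w (x, c))"
proof -
  obtain X where X: "finite X" "\<And>x. x \<in> {a<..<b} - X \<Longrightarrow> finite {y \<in> {c<..<d}. (x, y) \<notin> U}"
    using slices_x by blast
  have "AE x in lborel. x \<in> {a<..<b} \<longrightarrow> set_integrable lborel {c<..<d} (\<lambda>y. w' (x, y))"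
    using assms(3) unfolding D_def by (rule set_integral_rectangle_fst)
  moreover have "AE x in lborel. x \<notin> X"
    by (intro AE_not_in finite_imp_null_set_lborel X)
  ultimately show ?thesis
  proof eventually_elim
    case (elim x)
    show ?case
    proof (intro impI ballI)
      fix y assume x: "x \<in> {a<..<b}" and y: "y \<in> {c<..d}"
      have i: "set_integrable lborel {c<..<y} (\<lambda>y. w' (x, y))"
        by (rule set_integrable_subset[where A="{c<..<d}"]) (use elim x y in auto)
      moreover have "(LINT y:{c<..<y}|lborel. w' (x, y)) = w (x, y) - w (x, c)"
      proof (rule LINT_derivative[OF i])
        show "finite {y \<in> {c<..<d}. (x, y) \<notin> U}" using X x elim by auto
        show "((\<lambda>y. w (x, y)) has_real_derivative w' (x, y')) (at y')"
          if "y' \<in> {c<..<y} - {y \<in> {c<..<d}. (x, y) \<notin> U}" for y'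
          by (rule assms(2)) (use that x y in \<open>auto simp: D_def\<close>)
        show "continuous_on {c..y} (\<lambda>y. w (x, y))"
          by (rule continuous_on_compose2[OF assms(1)])
            (use x y in \<open>auto intro!: continuous_intros\<close>)
      qed (use y in auto)
      ultimately show "set_integrable lborel {c<..<y} (\<lambda>y. w' (x, y)) \<and>
        (LINT y:{c<..<y}|lborel. w' (x, y)) = w (x, y) - w (x, c)" by simp
    qed
  qed
qed

lemma horizontal_FTC:
  fixes w :: "point \<Rightarrow> real" and w' :: "point \<Rightarrow> real"
  assumes "continuous_on ({a..b} \<times> {c..d}) w"
    and "\<And>x y. (x, y) \<in> U \<inter> D \<Longrightarrow> ((\<lambda>x. w (x, y)) has_real_derivative w' (x, y)) (at x)"
    and "set_integrable lborel D w'"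
  shows "AE y in lborel. y \<in> {c<..<d} \<longrightarrow> (LINT x:{a<..<b}|lborel. w' (x, y)) = w (b, y) - w (a, y)"
proof -
  obtain Y where Y: "finite Y" "\<And>y. y \<in> {c<..<d} - Y \<Longrightarrow> finite {x \<in> {a<..<b}. (x, y) \<notin> U}"
    using slices_y by blast
  have "AE y in lborel. y \<in> {c<..<d} \<longrightarrow> set_integrable lborel {a<..<b} (\<lambda>x. w' (x, y))"
    using assms(3) unfolding D_def by (rule set_integral_rectangle_snd)
  moreover have "AE y in lborel. y \<notin> Y"
    by (intro AE_not_in finite_imp_null_set_lborel Y)
  ultimately show ?thesis
  proof eventually_elim
    case (elim y)
    show ?case
    proof
      assume y: "y \<in> {c<..<d}"
      show "(LINT x:{a<..<b}|lborel. w' (x, y)) = w (b, y) - w (a, y)"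
      proof (rule LINT_derivative)
        show "set_integrable lborel {a<..<b} (\<lambda>x. w' (x, y))" using elim y by simp
        show "finite {x \<in> {a<..<b}. (x, y) \<notin> U}" using Y y elim by auto
        show "((\<lambda>x. w (x, y)) has_real_derivative w' (x, y)) (at x)"
          if "x \<in> {a<..<b} - {x \<in> {a<..<b}. (x, y) \<notin> U}" for x
          by (rule assms(2)) (use that y in \<open>auto simp: D_def\<close>)
        show "continuous_on {a..b} (\<lambda>x. w (x, y))"
          by (rule continuous_on_compose2[OF assms(1)])
            (use y in \<open>auto intro!: continuous_intros\<close>)
      qed (use ab in auto)
    qed
  qed
qed

lemma set_LINT_AE_zero:
  fixes F :: "real \<Rightarrow> real"
  assumes "AE x in lborel. x \<in> A \<longrightarrow> F x = 0"
  shows "(LINT x:A|lborel. F x) = 0"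
  unfolding set_lebesgue_integral_def
  by (rule integral_eq_zero_AE) (use assms in \<open>auto simp: indicator_def\<close>)

text \<open>By the product rule the sum \<open>F\<close> of the two integrands is the broken
  gradient of \<open>v * \<phi>\<close>, which is continuous and zero off \<open>D\<close>. Its
  second component therefore integrates to zero over almost every vertical slice and its first over
  almost every horizontal one.\<close>

lemma weak_gradient: "has_weak_gradient D v G"
  unfolding has_weak_gradient_def
proof (intro allI impI)
  fix \<phi> assume "test_function D \<phi>"
  then obtain \<phi>' K C where \<phi>': "\<And>p. GDERIV \<phi> p :> \<phi>' p" "grad \<phi> = \<phi>'"
    and c\<phi>: "continuous_on UNIV \<phi>" "continuous_on UNIV \<phi>'"
    and K: "compact K" "K \<subseteq> D" "\<And>p. p \<notin> K \<Longrightarrow> \<phi> p = 0"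
    and C: "\<And>p. \<bar>\<phi> p\<bar> \<le> C" "\<And>p. norm (\<phi>' p) \<le> C" "C \<ge> 0"
    by (rule test_functionE) blast
  obtain V where V: "\<And>p. p \<in> {a..b} \<times> {c..d} \<Longrightarrow> \<bar>v p\<bar> \<le> V" using v_bounded by blast
  have i1: "set_integrable lborel D (\<lambda>p. v p *\<^sub>R \<phi>' p)"
  proof (rule set_integrable_bounded[where B="V * C"])
    show "set_borel_measurable lborel D (\<lambda>p. v p *\<^sub>R \<phi>' p)"
      by (intro set_borel_measurable_continuous continuous_intros continuous_on_subset[OF cont]
          continuous_on_subset[OF c\<phi>(2)] D_subset) auto
    show "norm (v p *\<^sub>R \<phi>' p) \<le> V * C" if "p \<in> D" for p
      unfolding norm_scaleR by (rule mult_mono) (use V[of p] C that D_subset in auto)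
  qed auto
  have i2: "set_integrable lborel D (\<lambda>p. \<phi> p *\<^sub>R G p)"
  proof (rule set_integrable_bounded[where B="C * B"])
    show "set_borel_measurable lborel D (\<lambda>p. \<phi> p *\<^sub>R G p)"
    proof -
      note [measurable] = meas D_sets(1) borel_measurable_continuous_onI[OF c\<phi>(1)]
      show ?thesis unfolding set_borel_measurable_def by measurable
    qed
    show "norm (\<phi> p *\<^sub>R G p) \<le> C * B" if "p \<in> D" for p
      unfolding norm_scaleR by (rule mult_mono) (use C bound in auto)
  qed auto
  define F where "F p = v p *\<^sub>R \<phi>' p + \<phi> p *\<^sub>R G p" for p
  have iF: "set_integrable lborel D F"
    unfolding F_def using i1 i2 by (rule set_integral_add)
  have cw: "continuous_on ({a..b} \<times> {c..d}) (\<lambda>p. v p * \<phi> p)"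
    by (intro continuous_intros cont continuous_on_subset[OF c\<phi>(1)]) auto
  have zero: "v p * \<phi> p = 0" if "p \<notin> D" for p
    using K(2) K(3)[of p] that by (metis mult_zero_right subsetD)
  have G: "GDERIV (\<lambda>p. v p * \<phi> p) p :> F p" if "p \<in> U" for p
    unfolding F_def using GDERIV_mult[OF deriv[OF that] \<phi>'(1)] .
  have "(LINT p:D|lborel. snd (F p)) = (LINT x:{a<..<b}|lborel. LINT y:{c<..<d}|lborel. snd (F (x, y)))"
    using set_LINT_fst_snd(4)[OF iF] unfolding D_def by (rule set_integral_rectangle_fst)
  also have "\<dots> = 0"
  proof (rule set_LINT_AE_zero)
    have "AE x in lborel. x \<in> {a<..<b} \<longrightarrow> (\<forall>y \<in> {c<..d}.
      set_integrable lborel {c<..<y} (\<lambda>y. snd (F (x, y))) \<and>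
      (LINT y:{c<..<y}|lborel. snd (F (x, y))) = v (x, y) * \<phi> (x, y) - v (x, c) * \<phi> (x, c))"
      by (rule vertical_FTC[OF cw GDERIV_slices(1)[OF G] set_LINT_fst_snd(4)[OF iF]]) simp
    then show "AE x in lborel. x \<in> {a<..<b} \<longrightarrow> (LINT y:{c<..<d}|lborel. snd (F (x, y))) = 0"
    proof eventually_elim
      case (elim x)
      then show ?case using zero[of "(x, d)"] zero[of "(x, c)"] cd by (auto simp: D_def)
    qed
  qed
  finally have s: "snd (LINT p:D|lborel. F p) = 0"
    using set_LINT_fst_snd(2)[OF iF] by simp
  have "(LINT p:D|lborel. fst (F p)) = (LINT y:{c<..<d}|lborel. LINT x:{a<..<b}|lborel. fst (F (x, y)))"
    using set_LINT_fst_snd(3)[OF iF] unfolding D_def by (rule set_integral_rectangle_snd)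
  also have "\<dots> = 0"
  proof (rule set_LINT_AE_zero)
    have "AE y in lborel. y \<in> {c<..<d} \<longrightarrow>
      (LINT x:{a<..<b}|lborel. fst (F (x, y))) = v (b, y) * \<phi> (b, y) - v (a, y) * \<phi> (a, y)"
      by (rule horizontal_FTC[OF cw GDERIV_slices(2)[OF G] set_LINT_fst_snd(3)[OF iF]]) simp
    then show "AE y in lborel. y \<in> {c<..<d} \<longrightarrow> (LINT x:{a<..<b}|lborel. fst (F (x, y))) = 0"
    proof eventually_elim
      case (elim y)
      then show ?case using zero[of "(b, y)"] zero[of "(a, y)"] by (auto simp: D_def)
    qed
  qed
  finally have "fst (LINT p:D|lborel. F p) = 0"
    using set_LINT_fst_snd(1)[OF iF] by simp
  with s have "(LINT p:D|lborel. F p) = 0"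
    by (simp add: prod_eq_iff)
  then have "(LINT p:D|lborel. v p *\<^sub>R \<phi>' p) + (LINT p:D|lborel. \<phi> p *\<^sub>R G p) = 0"
    unfolding F_def using set_integral_add(2)[OF i1 i2] by simp
  then show "(LINT p:D|lborel. v p *\<^sub>R grad \<phi> p) = - (LINT p:D|lborel. \<phi> p *\<^sub>R G p)"
    unfolding \<phi>'(2) by (simp add: eq_neg_iff_add_eq_0)
qed

end

section \<open>Integrability of products and comparison of square integrals\<close>

lemma set_borel_measurable_borel:
  fixes F :: "'a::euclidean_space \<Rightarrow> 'b::{real_normed_vector, second_countable_topology}"
  shows "F \<in> borel_measurable borel \<Longrightarrow> A \<in> sets borel \<Longrightarrow> set_borel_measurable lborel A F"
  unfolding set_borel_measurable_def by (auto intro: borel_measurable_scaleR borel_measurable_indicator)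

lemma set_integrable_times_bounded:
  fixes g :: "point \<Rightarrow> 'b::{banach, second_countable_topology}" and m :: "point \<Rightarrow> real"
  assumes g: "set_integrable lborel D g" and m: "m \<in> borel_measurable borel" and B: "\<And>p. \<bar>m p\<bar> \<le> B"
  shows "set_integrable lborel D (\<lambda>p. m p *\<^sub>R g p)"
proof (rule set_integrable_bound[OF set_integrable_scaleR_right[of B, OF g]])
  have "(\<lambda>p. indicator D p *\<^sub>R g p) \<in> borel_measurable lborel"
    using g unfolding set_integrable_def by auto
  then have "(\<lambda>p. m p *\<^sub>R (indicator D p *\<^sub>R g p)) \<in> borel_measurable lborel"
    using m by measurable
  then show "set_borel_measurable lborel D (\<lambda>p. m p *\<^sub>R g p)"
    by (simp add: set_borel_measurable_def mult.commute)
  show "AE p in lborel. p \<in> D \<longrightarrow> norm (m p *\<^sub>R g p) \<le> norm (B *\<^sub>R g p)"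
    by (intro AE_I2 impI) (auto intro!: mult_right_mono order_trans[OF B abs_ge_self])
qed

lemma set_integrable_inner_bounded:
  fixes g m :: "point \<Rightarrow> point"
  assumes g: "set_integrable lborel D g" and m: "m \<in> borel_measurable borel" and B: "\<And>p. norm (m p) \<le> B"
  shows "set_integrable lborel D (\<lambda>p. g p \<bullet> m p)"
proof (rule set_integrable_bound[OF set_integrable_scaleR_right[of B, OF g]])
  have "(\<lambda>p. indicator D p *\<^sub>R g p) \<in> borel_measurable lborel"
    using g unfolding set_integrable_def by auto
  then have "(\<lambda>p. (indicator D p *\<^sub>R g p) \<bullet> m p) \<in> borel_measurable lborel"
    using m by measurable
  then show "set_borel_measurable lborel D (\<lambda>p. g p \<bullet> m p)"
    by (simp add: set_borel_measurable_def)
  have "norm (g p \<bullet> m p) \<le> norm (B *\<^sub>R g p)" for p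
  proof -
    have "norm (g p \<bullet> m p) \<le> norm (g p) * norm (m p)" by (simp add: Cauchy_Schwarz_ineq2)
    also have "\<dots> \<le> norm (g p) * \<bar>B\<bar>" using B[of p] by (intro mult_left_mono) auto
    finally show ?thesis by (simp add: mult.commute)
  qed
  then show "AE p in lborel. p \<in> D \<longrightarrow> norm (g p \<bullet> m p) \<le> norm (B *\<^sub>R g p)" by auto
qed

lemma set_LINT_mono_set:
  fixes F :: "point \<Rightarrow> 'b::{banach, second_countable_topology}"
  assumes "D \<subseteq> E" "\<And>p. p \<in> E \<Longrightarrow> p \<notin> D \<Longrightarrow> F p = 0"
  shows "(LINT p:E|lborel. F p) = (LINT p:D|lborel. F p)"
  unfolding set_lebesgue_integral_def
  by (intro Bochner_Integration.integral_cong) (use assms in \<open>auto simp: indicator_def\<close>)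

lemma power2_norm_diff_le: "(norm (x - y))\<^sup>2 \<le> 2 * (norm x)\<^sup>2 + 2 * (norm y)\<^sup>2"
  for x y :: "'a::real_normed_vector"
proof -
  have "(norm (x - y))\<^sup>2 \<le> (norm x + norm y)\<^sup>2" by (intro power_mono norm_triangle_ineq4) auto
  moreover have "0 \<le> (norm x - norm y)\<^sup>2" by simp
  ultimately show ?thesis unfolding power2_eq_square by (simp add: algebra_simps)
qed

lemma L2_diff:
  assumes "v \<in> L2 D" "w \<in> L2 D"
  shows "(\<lambda>p. v p - w p) \<in> L2 D"
proof -
  have m: "set_borel_measurable lborel D (\<lambda>p. v p - w p)"
    using assms unfolding L2_def set_borel_measurable_def by (auto simp: algebra_simps)
  then have m2: "set_borel_measurable lborel D (\<lambda>p. (norm (v p - w p))\<^sup>2)"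
  proof -
    have "(\<lambda>p. (norm (indicator D p *\<^sub>R (v p - w p)))\<^sup>2) \<in> borel_measurable lborel"
      using m unfolding set_borel_measurable_def by measurable
    moreover have "(\<lambda>p. (norm (indicator D p *\<^sub>R (v p - w p)))\<^sup>2) = (\<lambda>p. indicator D p *\<^sub>R (norm (v p - w p))\<^sup>2)"
      by (auto simp: indicator_def)
    ultimately show ?thesis by (simp only: set_borel_measurable_def)
  qed
  have "set_integrable lborel D (\<lambda>p. 2 * (norm (v p))\<^sup>2 + 2 * (norm (w p))\<^sup>2)"
    using assms unfolding L2_def by (intro set_integral_add set_integrable_mult_right) auto
  then have "set_integrable lborel D (\<lambda>p. (norm (v p - w p))\<^sup>2)"
  proof (rule set_integrable_bound[OF _ m2])
    show "AE p in lborel. p \<in> D \<longrightarrow> norm ((norm (v p - w p))\<^sup>2) \<le> norm (2 * (norm (v p))\<^sup>2 + 2 * (norm (w p))\<^sup>2)"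
      using power2_norm_diff_le by (intro AE_I2) (auto intro: order_trans)
  qed
  with m show ?thesis by (simp add: L2_def)
qed

lemma L2_subset:
  assumes "v \<in> L2 E" "D \<subseteq> E" "D \<in> sets borel"
  shows "v \<in> L2 D"
proof -
  have "set_borel_measurable lborel D v"
  proof -
    have "(\<lambda>p. indicator D p *\<^sub>R (indicator E p *\<^sub>R v p)) \<in> borel_measurable lborel"
    proof -
      note [measurable] = assms(3)
      have [measurable]: "(\<lambda>p. indicator E p *\<^sub>R v p) \<in> borel_measurable borel"
        using assms(1) unfolding L2_def set_borel_measurable_def by simp
      show ?thesis by measurable
    qed
    moreover have "(\<lambda>p. indicator D p *\<^sub>R (indicator E p *\<^sub>R v p)) = (\<lambda>p. indicator D p *\<^sub>R v p)"
      using assms(2) by (auto simp: indicator_def fun_eq_iff)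
    ultimately show ?thesis by (simp only: set_borel_measurable_def)
  qed
  moreover have "set_integrable lborel D (\<lambda>p. (norm (v p))\<^sup>2)"
    using assms by (auto simp: L2_def intro: set_integrable_subset)
  ultimately show ?thesis by (simp add: L2_def)
qed

lemma L2_integral_triangle:
  assumes "v \<in> L2 D" "w \<in> L2 D"
  shows "(LINT p:D|lborel. (norm (v p - w p))\<^sup>2)
    \<le> 2 * (LINT p:D|lborel. (norm (v p))\<^sup>2) + 2 * (LINT p:D|lborel. (norm (w p))\<^sup>2)"
proof -
  have i: "set_integrable lborel D (\<lambda>p. (norm (v p))\<^sup>2)" "set_integrable lborel D (\<lambda>p. (norm (w p))\<^sup>2)"
    using assms by (auto simp: L2_def)
  have "(LINT p:D|lborel. (norm (v p - w p))\<^sup>2)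
    \<le> (LINT p:D|lborel. 2 * (norm (v p))\<^sup>2 + 2 * (norm (w p))\<^sup>2)"
    using L2_diff[OF assms] i power2_norm_diff_le
    by (intro set_integral_mono set_integral_add set_integrable_mult_right) (auto simp: L2_def)
  also have "\<dots> = 2 * (LINT p:D|lborel. (norm (v p))\<^sup>2) + 2 * (LINT p:D|lborel. (norm (w p))\<^sup>2)"
    using i by (subst set_integral_add) (auto intro: set_integrable_mult_right)
  finally show ?thesis .
qed

lemma set_LINT_nonneg:
  fixes F :: "'a::euclidean_space \<Rightarrow> real"
  shows "(\<And>p. p \<in> D \<Longrightarrow> 0 \<le> F p) \<Longrightarrow> 0 \<le> (LINT p:D|lborel. F p)"
  unfolding set_lebesgue_integral_def by (rule Bochner_Integration.integral_nonneg) (auto simp: indicator_def)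

lemma set_LINT_mono_subset:
  fixes F :: "'a::euclidean_space \<Rightarrow> real"
  assumes "set_integrable lborel E F" "D \<subseteq> E" "D \<in> sets borel" "\<And>p. p \<in> E \<Longrightarrow> 0 \<le> F p"
  shows "(LINT p:D|lborel. F p) \<le> (LINT p:E|lborel. F p)"
  using assms set_integrable_subset[OF assms(1), of D]
  unfolding set_lebesgue_integral_def set_integrable_def
  by (intro integral_mono) (auto simp: indicator_def)

text \<open>Cauchy-Schwarz from the nonnegativity of the variance about the mean
  \<open>m\<close>.\<close>

lemma LINT_square_le:
  fixes f :: "real \<Rightarrow> real"
  assumes "set_integrable lborel {c<..<y} f" "set_integrable lborel {c<..<y} (\<lambda>t. (f t)\<^sup>2)" "c < y"
  shows "(LINT t:{c<..<y}|lborel. f t)\<^sup>2 \<le> (y - c) * (LINT t:{c<..<y}|lborel. (f t)\<^sup>2)"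
proof -
  define m where "m = (LINT t:{c<..<y}|lborel. f t) / (y - c)"
  have one: "set_integrable lborel {c<..<y} (\<lambda>t. m\<^sup>2)"
    by (rule set_integrable_bounded[where B="m\<^sup>2"]) (auto simp: set_borel_measurable_def)
  have len: "(LINT t:{c<..<y}|lborel. m\<^sup>2) = m\<^sup>2 * (y - c)"
    using assms(3) by (simp add: set_lebesgue_integral_def)
  have "0 \<le> (LINT t:{c<..<y}|lborel. (f t - m)\<^sup>2)"
    by (rule set_LINT_nonneg) auto
  also have "\<dots> = (LINT t:{c<..<y}|lborel. ((f t)\<^sup>2 - 2 * m * f t) + m\<^sup>2)"
    by (rule set_lebesgue_integral_cong) (auto simp: power2_eq_square algebra_simps)
  also have "\<dots> = (LINT t:{c<..<y}|lborel. (f t)\<^sup>2) - 2 * m * (LINT t:{c<..<y}|lborel. f t) + m\<^sup>2 * (y - c)"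
    using assms one by (subst set_integral_add) (auto simp: len mult.assoc intro!: set_integral_diff set_integrable_mult_right)
  also have "\<dots> = (LINT t:{c<..<y}|lborel. (f t)\<^sup>2) - (LINT t:{c<..<y}|lborel. f t)\<^sup>2 / (y - c)"
    using assms(3) by (simp add: m_def power2_eq_square)
  finally show ?thesis using assms(3) by (simp add: field_simps)
qed

section \<open>One-sided Poincare inequality\<close>

context broken_gradient
begin

text \<open>Integration upwards from the bottom side, where both functions vanish, followed by
  Cauchy-Schwarz; a height of at most 1 keeps the constant 1. A test function stands in for the
  exact solution, which is known to vanish on the boundary only through its approximations by such
  functions.\<close>

lemma Poincare:
  assumes "d - c \<le> 1" and \<phi>: "test_function E \<phi>"
    and zero: "\<And>x. x \<in> {a<..<b} \<Longrightarrow> v (x, c) = 0" "\<And>x. x \<in> {a<..<b} \<Longrightarrow> \<phi> (x, c) = 0"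
  shows "(LINT p:D|lborel. (norm (v p - \<phi> p))\<^sup>2) \<le> (LINT p:D|lborel. (norm (G p - grad \<phi> p))\<^sup>2)"
proof -
  obtain \<phi>' K C where \<phi>': "\<And>p. GDERIV \<phi> p :> \<phi>' p" "grad \<phi> = \<phi>'"
    and c\<phi>: "continuous_on UNIV \<phi>" "continuous_on UNIV \<phi>'"
    and C: "\<And>p. \<bar>\<phi> p\<bar> \<le> C" "\<And>p. norm (\<phi>' p) \<le> C" "C \<ge> 0"
    by (rule test_functionE[OF \<phi>]) blast
  define H where "H p = G p - \<phi>' p" for p
  define s where "s p = snd (H p)" for p
  have Hm [measurable]: "H \<in> borel_measurable borel"
    unfolding H_def using meas borel_measurable_continuous_onI[OF c\<phi>(2)] by measurable
  have HB: "norm (H p) \<le> B + C" for p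
    unfolding H_def using norm_triangle_ineq4[of "G p" "\<phi>' p"] bound[of p] C(2)[of p] by linarith
  have sH: "\<bar>s p\<bar> \<le> norm (H p)" for p
    unfolding s_def using norm_snd_le[of "snd (H p)" "fst (H p)"] by simp
  have sB: "\<bar>s p\<bar> \<le> B + C" for p using sH HB order_trans by blast
  have sm [measurable]: "s \<in> borel_measurable borel"
  proof -
    have "s = (\<lambda>p. H p \<bullet> (0, 1))" by (auto simp: s_def inner_prod_def)
    then show ?thesis by simp
  qed
  have iH2: "set_integrable lborel D (\<lambda>p. (norm (H p))\<^sup>2)"
    by (rule set_integrable_bounded[where B="(B + C)\<^sup>2"])
      (use HB in \<open>auto intro!: set_borel_measurable_borel power_mono\<close>)
  have is2: "set_integrable lborel D (\<lambda>p. (s p)\<^sup>2)"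
    by (rule set_integrable_bounded[where B="(B + C)\<^sup>2"])
      (use sB in \<open>auto intro!: set_borel_measurable_borel sq_le_of_abs_le\<close>)
  have is1: "set_integrable lborel D s"
    by (rule set_integrable_bounded[where B="B + C"])
      (use sB in \<open>auto intro!: set_borel_measurable_borel\<close>)
  define w where "w p = v p - \<phi> p" for p
  have cw: "continuous_on ({a..b} \<times> {c..d}) w"
    unfolding w_def by (intro continuous_intros cont continuous_on_subset[OF c\<phi>(1)]) auto
  have iw2: "set_integrable lborel D (\<lambda>p. (w p)\<^sup>2)"
  proof -
    have "bounded (w ` ({a..b} \<times> {c..d}))"
      by (intro compact_imp_bounded compact_continuous_image cw compact_Times compact_Icc)
    then obtain W where W: "\<And>p. p \<in> {a..b} \<times> {c..d} \<Longrightarrow> \<bar>w p\<bar> \<le> W"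
      unfolding bounded_iff by auto
    show ?thesis
      by (rule set_integrable_bounded[where B="W\<^sup>2"])
        (use W D_subset in \<open>auto intro!: sq_le_of_abs_le set_borel_measurable_continuous continuous_intros
            continuous_on_subset[OF cw D_subset]\<close>)
  qed
  have GD: "GDERIV w p :> H p" if "p \<in> U" for p
    unfolding w_def H_def using GDERIV_diff[OF deriv[OF that] \<phi>'(1)] .
  have "AE x in lborel. x \<in> {a<..<b} \<longrightarrow> (\<forall>y \<in> {c<..d}.
    set_integrable lborel {c<..<y} (\<lambda>y. s (x, y)) \<and>
    (LINT y:{c<..<y}|lborel. s (x, y)) = w (x, y) - w (x, c))"
    by (rule vertical_FTC[OF cw GDERIV_slices(1)[OF GD, folded s_def] is1]) simp
  moreover have "AE x in lborel. x \<in> {a<..<b} \<longrightarrow> set_integrable lborel {c<..<d} (\<lambda>y. (s (x, y))\<^sup>2)"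
    using is2 unfolding D_def by (rule set_integral_rectangle_fst)
  moreover have "AE x in lborel. x \<in> {a<..<b} \<longrightarrow> set_integrable lborel {c<..<d} (\<lambda>y. (w (x, y))\<^sup>2)"
    using iw2 unfolding D_def by (rule set_integral_rectangle_fst)
  ultimately have main: "AE x in lborel. x \<in> {a<..<b} \<longrightarrow>
    (LINT y:{c<..<d}|lborel. (w (x, y))\<^sup>2) \<le> (LINT y:{c<..<d}|lborel. (s (x, y))\<^sup>2)"
  proof eventually_elim
    case (elim x)
    show ?case
    proof
      assume x: "x \<in> {a<..<b}"
      define F where "F = (LINT y:{c<..<d}|lborel. (s (x, y))\<^sup>2)"
      have F0: "F \<ge> 0" unfolding F_def by (rule set_LINT_nonneg) auto
      have iss: "set_integrable lborel {c<..<d} (\<lambda>y. (s (x, y))\<^sup>2)" using elim x by auto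
      have pw: "(w (x, y))\<^sup>2 \<le> F" if y: "y \<in> {c<..<d}" for y
      proof -
        have wy: "(LINT y:{c<..<y}|lborel. s (x, y)) = w (x, y)"
          "set_integrable lborel {c<..<y} (\<lambda>y. s (x, y))"
          using elim x y zero by (auto simp: w_def)
        have is': "set_integrable lborel {c<..<y} (\<lambda>y. (s (x, y))\<^sup>2)"
          by (rule set_integrable_subset[OF iss]) (use y in auto)
        have "(w (x, y))\<^sup>2 \<le> (y - c) * (LINT y:{c<..<y}|lborel. (s (x, y))\<^sup>2)"
          using LINT_square_le[OF wy(2) is'] y unfolding wy(1) by auto
        also have "\<dots> \<le> 1 * F"
        proof (rule mult_mono)
          show "(LINT y:{c<..<y}|lborel. (s (x, y))\<^sup>2) \<le> F"
            unfolding F_def by (rule set_LINT_mono_subset[OF iss]) (use y in auto)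
          show "0 \<le> (LINT y:{c<..<y}|lborel. (s (x, y))\<^sup>2)" by (rule set_LINT_nonneg) auto
        qed (use y assms(1) in auto)
        finally show ?thesis by simp
      qed
      have "(LINT y:{c<..<d}|lborel. (w (x, y))\<^sup>2) \<le> (LINT y:{c<..<d}|lborel. F)"
        using elim x pw
        by (intro set_integral_mono) (auto intro!: set_integrable_bounded[where B=F] simp: set_borel_measurable_def F0)
      also have "\<dots> = F * (d - c)" using cd by (simp add: set_lebesgue_integral_def)
      also have "\<dots> \<le> F * 1" by (intro mult_left_mono assms(1) F0)
      finally show "(LINT y:{c<..<d}|lborel. (w (x, y))\<^sup>2) \<le> (LINT y:{c<..<d}|lborel. (s (x, y))\<^sup>2)"
        by (simp add: F_def)
    qed
  qed
  have "(LINT p:D|lborel. (w p)\<^sup>2) = (LINT x:{a<..<b}|lborel. LINT y:{c<..<d}|lborel. (w (x, y))\<^sup>2)"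
    using iw2 unfolding D_def by (rule set_integral_rectangle_fst)
  also have "\<dots> \<le> (LINT x:{a<..<b}|lborel. LINT y:{c<..<d}|lborel. (s (x, y))\<^sup>2)"
    by (rule set_integral_mono_AE)
      (use main iw2 is2 in \<open>auto simp: D_def intro: set_integral_rectangle_fst(2)\<close>)
  also have "\<dots> = (LINT p:D|lborel. (s p)\<^sup>2)"
    using is2 unfolding D_def by (rule set_integral_rectangle_fst(1)[symmetric])
  also have "\<dots> \<le> (LINT p:D|lborel. (norm (H p))\<^sup>2)"
    by (rule set_integral_mono[OF is2 iH2]) (metis abs_ge_zero power2_abs power_mono sH)
  finally show ?thesis by (simp add: w_def H_def \<phi>'(2))
qed

end

section \<open>The residual and the energy error\<close>

lemma set_LINT_cong_AE:
  fixes F :: "'a::euclidean_space \<Rightarrow> 'b::{banach, second_countable_topology}"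
  assumes "AE p in lborel. p \<in> D \<longrightarrow> F p = H p" "set_borel_measurable lborel D F" "set_borel_measurable lborel D H"
  shows "(LINT p:D|lborel. F p) = (LINT p:D|lborel. H p)"
  unfolding set_lebesgue_integral_def
proof (rule integral_cong_AE)
  show "AE p in lborel. indicator D p *\<^sub>R F p = indicator D p *\<^sub>R H p"
    using assms(1) by eventually_elim (auto simp: indicator_def)
qed (use assms in \<open>auto simp: set_borel_measurable_def\<close>)

lemma Omega_sets [simp]: "Omega \<in> sets borel" "bounded Omega" "open Omega"
  by (auto simp: Omega_def open_Times)

lemma test_function_mono: "test_function D \<phi> \<Longrightarrow> D \<subseteq> E \<Longrightarrow> test_function E \<phi>"
  unfolding test_function_def by (meson subset_trans)

text \<open>The case of \<open>broken_gradient\<close> without exceptional points: the classical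
  gradient serves as the weak one.\<close>

lemma test_function_Omega_H1:
  assumes "test_function Omega \<phi>"
  shows "\<phi> \<in> L2 Omega" "grad \<phi> \<in> L2 Omega" "has_weak_gradient Omega \<phi> (grad \<phi>)"
proof -
  obtain \<phi>' K B where \<phi>': "\<And>p. GDERIV \<phi> p :> \<phi>' p" "grad \<phi> = \<phi>'"
    and c: "continuous_on UNIV \<phi>" "continuous_on UNIV \<phi>'" and B: "\<And>p. norm (\<phi>' p) \<le> B"
    using test_functionE[OF assms] by metis
  interpret broken_gradient 0 1 0 1 Omega \<phi> \<phi>' UNIV B
    using \<phi>' c B by unfold_locales
      (auto simp: Omega_def intro: continuous_on_subset borel_measurable_continuous_onI)
  show "\<phi> \<in> L2 Omega" "grad \<phi> \<in> L2 Omega" "has_weak_gradient Omega \<phi> (grad \<phi>)"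
    using v_L2 G_L2 weak_gradient \<phi>'(2) by auto
qed

lemma weak_grad_test_function:
  assumes "test_function Omega \<phi>"
  shows "AE p in lborel. p \<in> Omega \<longrightarrow> weak_grad Omega \<phi> p = grad \<phi> p"
    and "\<phi> \<in> H1_0 Omega"
proof -
  note H1 = test_function_Omega_H1[OF assms]
  then have *: "\<phi> \<in> H1 Omega" by (auto simp: H1_def)
  show AE: "AE p in lborel. p \<in> Omega \<longrightarrow> weak_grad Omega \<phi> p = grad \<phi> p"
    using weak_gradient_unique[of "weak_grad Omega \<phi>" 0 1 0 1 \<phi> "grad \<phi>"]
      weak_grad_in_H1[OF *] H1 by (simp add: Omega_def)
  have "(LINT p:Omega|lborel. (norm (grad \<phi> p - weak_grad Omega \<phi> p))\<^sup>2) = 0"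
    unfolding set_lebesgue_integral_def
    by (rule integral_eq_zero_AE) (use AE in \<open>eventually_elim, auto simp: indicator_def\<close>)
  then have "L2_norm Omega (\<lambda>p. grad \<phi> p - weak_grad Omega \<phi> p) = 0"
    by (simp add: L2_norm_def)
  moreover have "L2_norm Omega (\<lambda>p. \<phi> p - \<phi> p) = 0"
    by (simp add: L2_norm_def set_lebesgue_integral_def)
  ultimately show "\<phi> \<in> H1_0 Omega"
    unfolding H1_0_def using * assms by (intro CollectI conjI exI[of _ "\<lambda>_. \<phi>"]) auto
qed

lemma L2_norm_sq: "(L2_norm D v)\<^sup>2 = (LINT p:D|lborel. (norm (v p))\<^sup>2)"
  unfolding L2_norm_def by (simp add: set_LINT_nonneg)

text \<open>Outside \<open>D\<close> both the test function and its gradient vanish, so the two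
  inner products localise; the arbitrary representative \<open>weak_grad Omega \<phi>\<close> is
  exchanged for the classical gradient.\<close>

lemma weak_solution_test:
  assumes "weak_solution \<epsilon> f u" "test_function D \<phi>" "D \<subseteq> Omega"
  shows "\<epsilon>\<^sup>2 * (LINT p:D|lborel. weak_grad Omega u p \<bullet> grad \<phi> p) + (LINT p:D|lborel. f p (u p) * \<phi> p) = 0"
proof -
  have \<phi>: "test_function Omega \<phi>" using assms test_function_mono by blast
  obtain \<phi>' K where g: "grad \<phi> = \<phi>'" and K: "K \<subseteq> D" "\<And>p. p \<notin> K \<Longrightarrow> \<phi> p = 0" "\<And>p. p \<notin> K \<Longrightarrow> \<phi>' p = 0"
    and c: "continuous_on UNIV \<phi>'" and B: "\<exists>B. \<forall>p. norm (\<phi>' p) \<le> B"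
    using test_functionE[OF assms(2)] by metis
  have u: "u \<in> H1 Omega" using assms(1) by (auto simp: weak_solution_def H1_0_def)
  have iu: "set_integrable lborel Omega (weak_grad Omega u)"
    using weak_grad_in_H1(1)[OF u] by (intro L2_D) auto
  have w\<phi>: "\<phi> \<in> H1 Omega" using weak_grad_test_function(2)[OF \<phi>] by (auto simp: H1_0_def)
  note AE = weak_grad_test_function(1)[OF \<phi>]
  have "L2_inner Omega (weak_grad Omega u) (weak_grad Omega \<phi>)
    = (LINT p:Omega|lborel. weak_grad Omega u p \<bullet> grad \<phi> p)"
    unfolding L2_inner_def
  proof (rule set_LINT_cong_AE)
    show "AE p in lborel. p \<in> Omega \<longrightarrow> weak_grad Omega u p \<bullet> weak_grad Omega \<phi> p = weak_grad Omega u p \<bullet> grad \<phi> p"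
      using AE by eventually_elim auto
    have m1: "(\<lambda>p. indicator Omega p *\<^sub>R weak_grad Omega u p) \<in> borel_measurable lborel"
      "(\<lambda>p. indicator Omega p *\<^sub>R weak_grad Omega \<phi> p) \<in> borel_measurable lborel"
      using weak_grad_in_H1(1)[OF u] weak_grad_in_H1(1)[OF w\<phi>] by (auto simp: L2_def set_borel_measurable_def)
    have "(\<lambda>p. (indicator Omega p *\<^sub>R weak_grad Omega u p) \<bullet> (indicator Omega p *\<^sub>R weak_grad Omega \<phi> p)) \<in> borel_measurable lborel"
      using m1 by measurable
    moreover have "(\<lambda>p. (indicator Omega p *\<^sub>R weak_grad Omega u p) \<bullet> (indicator Omega p *\<^sub>R weak_grad Omega \<phi> p))
       = (\<lambda>p. indicator Omega p *\<^sub>R (weak_grad Omega u p \<bullet> weak_grad Omega \<phi> p))"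
      by (auto simp: indicator_def)
    ultimately show "set_borel_measurable lborel Omega (\<lambda>p. weak_grad Omega u p \<bullet> weak_grad Omega \<phi> p)"
      by (simp only: set_borel_measurable_def)
    obtain B where B: "\<And>p. norm (\<phi>' p) \<le> B" using B by blast
    have "set_integrable lborel Omega (\<lambda>p. weak_grad Omega u p \<bullet> grad \<phi> p)"
      unfolding g by (rule set_integrable_inner_bounded[OF iu borel_measurable_continuous_onI[OF c] B])
    then show "set_borel_measurable lborel Omega (\<lambda>p. weak_grad Omega u p \<bullet> grad \<phi> p)"
      by (auto simp: set_borel_measurable_def set_integrable_def)
  qed
  also have "\<dots> = (LINT p:D|lborel. weak_grad Omega u p \<bullet> grad \<phi> p)"
  proof (rule set_LINT_mono_set[OF assms(3)])
    fix p assume "p \<notin> D"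
    then show "weak_grad Omega u p \<bullet> grad \<phi> p = 0" using K g by (metis inner_zero_right subsetD)
  qed
  finally have 1: "L2_inner Omega (weak_grad Omega u) (weak_grad Omega \<phi>)
    = (LINT p:D|lborel. weak_grad Omega u p \<bullet> grad \<phi> p)" .
  have 2: "L2_inner Omega (\<lambda>p. f p (u p)) \<phi> = (LINT p:D|lborel. f p (u p) * \<phi> p)"
    unfolding L2_inner_def inner_real_def
  proof (rule set_LINT_mono_set[OF assms(3)])
    fix p assume "p \<notin> D"
    then show "f p (u p) * \<phi> p = 0" using K by (metis mult_zero_right subsetD)
  qed
  have "\<epsilon>\<^sup>2 * L2_inner Omega (weak_grad Omega u) (weak_grad Omega \<phi>) + L2_inner Omega (\<lambda>p. f p (u p)) \<phi> = 0"
    using assms(1) weak_grad_test_function(2)[OF \<phi>] unfolding weak_solution_def by blast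
  then show ?thesis unfolding 1 2 .
qed

lemma reaction_bounded:
  assumes adm: "admissible_reaction f C\<^sub>f" and L: "\<And>p s t. p \<in> Omega \<Longrightarrow> \<bar>f p s - f p t\<bar> \<le> L * \<bar>s - t\<bar>"
  obtains F where "\<And>p. p \<in> closure Omega \<Longrightarrow> \<bar>f p 0\<bar> \<le> F" "F \<ge> 0"
    "\<And>p s. p \<in> Omega \<Longrightarrow> \<bar>f p s\<bar> \<le> F + L * \<bar>s\<bar>"
proof -
  have "bounded ((\<lambda>p. f p 0) ` closure Omega)" using adm by (auto simp: admissible_reaction_def)
  then obtain F where F: "\<And>p. p \<in> closure Omega \<Longrightarrow> \<bar>f p 0\<bar> \<le> F" unfolding bounded_iff by auto
  show ?thesis
  proof
    show "\<bar>f p 0\<bar> \<le> max F 0" if "p \<in> closure Omega" for p using F[OF that] by auto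
    show "\<bar>f p s\<bar> \<le> max F 0 + L * \<bar>s\<bar>" if "p \<in> Omega" for p s
      using L[OF that, of s 0] F[of p] that closure_subset[of Omega] by auto
  qed simp
qed

lemma reaction_integrable:
  assumes adm: "admissible_reaction f C\<^sub>f" and L: "\<And>p s t. p \<in> Omega \<Longrightarrow> \<bar>f p s - f p t\<bar> \<le> L * \<bar>s - t\<bar>"
    and "D \<subseteq> Omega" "D \<in> sets borel" and v: "v \<in> L2 D" and "L \<ge> 0"
  shows "set_integrable lborel D (\<lambda>p. f p (v p))"
proof -
  obtain F where F: "F \<ge> 0" "\<And>p s. p \<in> Omega \<Longrightarrow> \<bar>f p s\<bar> \<le> F + L * \<bar>s\<bar>"
    using reaction_bounded[OF adm L] by metis
  have bD: "bounded D" by (rule bounded_subset[OF Omega_sets(2) assms(3)])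
  have vi: "set_integrable lborel D v" using L2_D[OF v assms(4) bD] .
  define vt where "vt p = indicator D p *\<^sub>R v p" for p
  have vt [measurable]: "vt \<in> borel_measurable borel"
    using v unfolding L2_def set_borel_measurable_def vt_def by auto
  note [measurable] = assms(4)
  \<comment> \<open>Continuity of the reaction is known on \<open>Omega \<times> UNIV\<close> only.
    This set is open, so the extension by zero is Borel and can be composed with the measurable
    \<open>vt\<close>.\<close>
  define h where "h = (\<lambda>z. indicator (Omega \<times> UNIV) z *\<^sub>R (case z of (p, s) \<Rightarrow> f p s))"
  have [measurable]: "h \<in> borel_measurable borel"
    unfolding h_def
    by (rule borel_measurable_continuous_on_indicator)
      (use adm in \<open>auto simp: admissible_reaction_def intro!: borel_open open_Times\<close>)
  have "(\<lambda>p. indicator D p *\<^sub>R h (p, vt p)) \<in> borel_measurable borel"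
    by measurable
  moreover have "(\<lambda>p. indicator D p *\<^sub>R h (p, vt p)) = (\<lambda>p. indicator D p *\<^sub>R f p (v p))"
    using assms(3) by (auto simp: indicator_def h_def vt_def fun_eq_iff)
  ultimately have m: "set_borel_measurable lborel D (\<lambda>p. f p (v p))"
    by (simp only: set_borel_measurable_def measurable_lborel2)
  have "set_integrable lborel D (\<lambda>p. F)"
    by (rule set_integrable_bounded[where B=F]) (use F assms(4) bD in \<open>auto simp: set_borel_measurable_def\<close>)
  then have "set_integrable lborel D (\<lambda>p. F + L * \<bar>v p\<bar>)"
    using vi by (intro set_integral_add set_integrable_mult_right set_integrable_abs)
  then show ?thesis
  proof (rule set_integrable_bound[OF _ m])
    show "AE p in lborel. p \<in> D \<longrightarrow> norm (f p (v p)) \<le> norm (F + L * \<bar>v p\<bar>)"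
    proof (intro AE_I2 impI)
      fix p assume "p \<in> D"
      then have "\<bar>f p (v p)\<bar> \<le> F + L * \<bar>v p\<bar>" using F(2) assms(3) by blast
      then show "norm (f p (v p)) \<le> norm (F + L * \<bar>v p\<bar>)" by simp
    qed
  qed
qed

section \<open>Residual of a broken-gradient function in terms of the energy error\<close>

context broken_gradient
begin

text \<open>Subtracting the weak formulation leaves the gradient error paired with
  \<open>grad \<phi>\<close> and a reaction difference, which the Lipschitz bound controls by
  \<open>L\<close> times the error. The error enters through pointwise densities \<open>P\<close>
  and \<open>Q\<close> rather than norms, so that bounds on disjoint supports can be added up
  later.\<close>

theorem error_residual:
  assumes wsol: "weak_solution \<epsilon> f u" and adm: "admissible_reaction f C\<^sub>f"
    and L: "\<And>p s t. p \<in> Omega \<Longrightarrow> \<bar>f p s - f p t\<bar> \<le> L * \<bar>s - t\<bar>" and L0: "L \<ge> 0"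
    and eps: "0 < \<epsilon>" "C\<^sub>f + \<epsilon>\<^sup>2 \<ge> 1"
    and D01: "0 \<le> a" "b \<le> 1" "c = 0" "d = 1"
    and v0: "\<And>x. x \<in> {a<..<b} \<Longrightarrow> v (x, 0) = 0"
  obtains P Q :: "point \<Rightarrow> real" where
    "set_integrable lborel D P" "set_integrable lborel D Q"
    "set_integrable lborel D (\<lambda>p. (P p)\<^sup>2)" "set_integrable lborel D (\<lambda>p. (Q p)\<^sup>2)"
    "\<And>p. P p \<ge> 0" "\<And>p. Q p \<ge> 0"
    "(LINT p:D|lborel. (P p)\<^sup>2) \<le> (energy_norm \<epsilon> C\<^sub>f D (\<lambda>p. v p - u p))\<^sup>2"
    "(LINT p:D|lborel. (Q p)\<^sup>2) \<le> 4 * L\<^sup>2 * (energy_norm \<epsilon> C\<^sub>f D (\<lambda>p. v p - u p))\<^sup>2"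
    "\<And>\<phi>. test_function D \<phi> \<Longrightarrow>
      \<bar>\<epsilon>\<^sup>2 * (LINT p:D|lborel. G p \<bullet> grad \<phi> p) + (LINT p:D|lborel. f p (v p) * \<phi> p)\<bar>
        \<le> (LINT p:D|lborel. \<epsilon> * P p * norm (grad \<phi> p) + Q p * \<bar>\<phi> p\<bar>)"
proof -
  define gu where "gu = weak_grad Omega u"
  define w where "w p = v p - u p" for p
  define g0 where "g0 p = G p - gu p" for p
  define g where "g = weak_grad D w"
  have DO: "D \<subseteq> Omega" using D01 by (auto simp: D_def Omega_def)
  have u: "u \<in> H1_0 Omega" "u \<in> H1 Omega" "u \<in> L2 Omega"
    using wsol by (auto simp: weak_solution_def H1_0_def H1_def)
  have gu: "gu \<in> L2 Omega" "has_weak_gradient Omega u gu"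
    using weak_grad_in_H1[OF u(2)] by (auto simp: gu_def)
  have uD: "u \<in> L2 D" "gu \<in> L2 D" using u gu DO by (auto intro: L2_subset)
  have wL2: "w \<in> L2 D" unfolding w_def using v_L2 uD by (intro L2_diff)
  have g0L2: "g0 \<in> L2 D" unfolding g0_def using G_L2 uD by (intro L2_diff)
  have int: "set_integrable lborel D v" "set_integrable lborel D G" "set_integrable lborel D u"
    "set_integrable lborel D gu" "set_integrable lborel D w" "set_integrable lborel D g0"
    using v_L2 G_L2 uD wL2 g0L2 by (auto intro: L2_D)
  \<comment> \<open>The energy norm refers to an arbitrary weak gradient of the difference on
    \<open>D\<close>; this identifies it almost everywhere with the explicit difference of the
    gradients.\<close>
  have wg: "has_weak_gradient D w g0"
    unfolding has_weak_gradient_def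
  proof (intro allI impI)
    fix \<phi> assume \<phi>: "test_function D \<phi>"
    obtain \<phi>' K B where g: "grad \<phi> = \<phi>'" and K: "K \<subseteq> D" "\<And>p. p \<notin> K \<Longrightarrow> \<phi> p = 0" "\<And>p. p \<notin> K \<Longrightarrow> \<phi>' p = 0"
      and c: "continuous_on UNIV \<phi>" "continuous_on UNIV \<phi>'"
      and B: "\<And>p. \<bar>\<phi> p\<bar> \<le> B" "\<And>p. norm (\<phi>' p) \<le> B"
      using test_functionE[OF \<phi>] by metis
    have "(LINT p:Omega|lborel. u p *\<^sub>R grad \<phi> p) = - (LINT p:Omega|lborel. \<phi> p *\<^sub>R gu p)"
      using gu(2) test_function_mono[OF \<phi> DO] by (auto simp: has_weak_gradient_def)
    moreover have "(LINT p:Omega|lborel. u p *\<^sub>R grad \<phi> p) = (LINT p:D|lborel. u p *\<^sub>R grad \<phi> p)"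
      by (rule set_LINT_mono_set[OF DO]) (metis K(1,3) g scaleR_zero_right subsetD)
    moreover have "(LINT p:Omega|lborel. \<phi> p *\<^sub>R gu p) = (LINT p:D|lborel. \<phi> p *\<^sub>R gu p)"
      by (rule set_LINT_mono_set[OF DO]) (metis K(1,2) scaleR_zero_left subsetD)
    ultimately have U: "(LINT p:D|lborel. u p *\<^sub>R grad \<phi> p) = - (LINT p:D|lborel. \<phi> p *\<^sub>R gu p)" by simp
    have V: "(LINT p:D|lborel. v p *\<^sub>R grad \<phi> p) = - (LINT p:D|lborel. \<phi> p *\<^sub>R G p)"
      using weak_gradient \<phi> by (auto simp: has_weak_gradient_def)
    have i\<phi>: "set_integrable lborel D (\<lambda>p. \<phi> p *\<^sub>R G p)" "set_integrable lborel D (\<lambda>p. \<phi> p *\<^sub>R gu p)"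
      using int by (auto intro!: set_integrable_times_bounded borel_measurable_continuous_onI c B)
    have iv: "set_integrable lborel D (\<lambda>p. z p *\<^sub>R \<phi>' p)" if "set_integrable lborel D z" for z
    proof (rule set_integrable_bound[OF set_integrable_mult_right[of B, OF that]])
      have "(\<lambda>p. indicator D p *\<^sub>R z p) \<in> borel_measurable lborel"
        using that unfolding set_integrable_def by auto
      then have "(\<lambda>p. (indicator D p *\<^sub>R z p) *\<^sub>R \<phi>' p) \<in> borel_measurable lborel"
        using borel_measurable_continuous_onI[OF c(2)] by measurable
      then show "set_borel_measurable lborel D (\<lambda>p. z p *\<^sub>R \<phi>' p)"
        by (simp add: set_borel_measurable_def)
      show "AE p in lborel. p \<in> D \<longrightarrow> norm (z p *\<^sub>R \<phi>' p) \<le> norm (B * z p)"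
        unfolding norm_scaleR norm_mult real_norm_def mult.commute[of B]
        by (intro AE_I2 impI) (auto intro!: mult_left_mono order_trans[OF B(2) abs_ge_self] simp: abs_mult)
    qed
    have "(LINT p:D|lborel. w p *\<^sub>R grad \<phi> p) = (LINT p:D|lborel. v p *\<^sub>R grad \<phi> p) - (LINT p:D|lborel. u p *\<^sub>R grad \<phi> p)"
      unfolding w_def scaleR_diff_left g using iv int by (intro set_integral_diff) auto
    also have "\<dots> = - ((LINT p:D|lborel. \<phi> p *\<^sub>R G p) - (LINT p:D|lborel. \<phi> p *\<^sub>R gu p))"
      unfolding U V by simp
    also have "\<dots> = - (LINT p:D|lborel. \<phi> p *\<^sub>R g0 p)"
      unfolding g0_def scaleR_diff_right using i\<phi> by (subst set_integral_diff) auto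
    finally show "(LINT p:D|lborel. w p *\<^sub>R grad \<phi> p) = - (LINT p:D|lborel. \<phi> p *\<^sub>R g0 p)" .
  qed
  have wH1: "w \<in> H1 D" using wL2 g0L2 wg by (auto simp: H1_def)
  have gL2: "g \<in> L2 D" using weak_grad_in_H1(1)[OF wH1] by (simp add: g_def)
  have AE: "AE p in lborel. p \<in> D \<longrightarrow> g p = g0 p"
    using weak_gradient_unique[of g a b c d w g0] weak_grad_in_H1[OF wH1] g0L2 wg
    by (simp add: D_def g_def)
  have g_eq: "(LINT p:D|lborel. (norm (g p))\<^sup>2) = (LINT p:D|lborel. (norm (g0 p))\<^sup>2)"
    by (rule set_LINT_cong_AE)
      (use AE gL2 g0L2 in \<open>auto simp: L2_def set_integrable_def set_borel_measurable_def\<close>)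
  define N where "N = (LINT p:D|lborel. (norm (g0 p))\<^sup>2)"
  define W where "W = (LINT p:D|lborel. (norm (w p))\<^sup>2)"
  have N0: "N \<ge> 0" "W \<ge> 0" unfolding N_def W_def by (rule set_LINT_nonneg, simp)+
  have Cf: "C\<^sub>f \<ge> 0" using adm by (auto simp: admissible_reaction_def)
  define E where "E = energy_norm \<epsilon> C\<^sub>f D (\<lambda>p. v p - u p)"
  have E: "E\<^sup>2 = \<epsilon>\<^sup>2 * N + C\<^sub>f * W"
    unfolding E_def energy_norm_def L2_norm_sq w_def[symmetric] g_def[symmetric] g_eq
    unfolding N_def[symmetric] W_def[symmetric] using N0 Cf by simp
  \<comment> \<open>The inequality is applied to \<open>v\<close> minus an approximating test
    function. Splitting off the approximation error by two triangle inequalities gives 2 * 2 = 4,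
    and the remainder \<open>\<delta>\<close> tends to zero.\<close>
  have WN: "W \<le> 4 * N"
  proof -
    obtain \<phi> where \<phi>: "\<And>k. test_function Omega (\<phi> k)"
      and lim: "(\<lambda>k. L2_norm Omega (\<lambda>p. \<phi> k p - u p)) \<longlonglongrightarrow> 0"
       "(\<lambda>k. L2_norm Omega (\<lambda>p. grad (\<phi> k) p - weak_grad Omega u p)) \<longlonglongrightarrow> 0"
      using u(1) unfolding H1_0_def by blast
    define \<delta> where "\<delta> k = 2 * (L2_norm Omega (\<lambda>p. \<phi> k p - u p))\<^sup>2
      + 4 * (L2_norm Omega (\<lambda>p. grad (\<phi> k) p - weak_grad Omega u p))\<^sup>2" for k
    have "\<delta> \<longlonglongrightarrow> 2 * 0\<^sup>2 + 4 * 0\<^sup>2"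
      unfolding \<delta>_def by (intro tendsto_intros lim)
    moreover have "W \<le> 4 * N + \<delta> k" for k
    proof -
      note H = test_function_Omega_H1[OF \<phi>]
      have HD: "\<phi> k \<in> L2 D" "grad (\<phi> k) \<in> L2 D" by (rule L2_subset[OF _ DO D_sets(1)], rule H)+
      have z: "\<phi> k (x, c) = 0" for x
      proof -
        obtain K where "K \<subseteq> Omega" "\<And>p. p \<notin> K \<Longrightarrow> \<phi> k p = 0"
          using \<phi>[of k] unfolding test_function_def by blast
        moreover have "(x, c) \<notin> Omega" using D01 by (auto simp: Omega_def)
        ultimately show ?thesis by blast
      qed
      have P: "(LINT p:D|lborel. (norm (v p - \<phi> k p))\<^sup>2) \<le> (LINT p:D|lborel. (norm (G p - grad (\<phi> k) p))\<^sup>2)"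
        by (rule Poincare[OF _ \<phi>]) (use D01 v0 z in auto)
      have 1: "W = (LINT p:D|lborel. (norm ((v p - \<phi> k p) - (u p - \<phi> k p)))\<^sup>2)"
        unfolding W_def w_def by simp
      have 2: "W \<le> 2 * (LINT p:D|lborel. (norm (v p - \<phi> k p))\<^sup>2) + 2 * (LINT p:D|lborel. (norm (u p - \<phi> k p))\<^sup>2)"
        unfolding 1 by (rule L2_integral_triangle) (use v_L2 uD HD in \<open>auto intro: L2_diff\<close>)
      have 3: "(LINT p:D|lborel. (norm (G p - grad (\<phi> k) p))\<^sup>2)
        = (LINT p:D|lborel. (norm (g0 p - (grad (\<phi> k) p - gu p)))\<^sup>2)"
        unfolding g0_def by simp
      have 4: "(LINT p:D|lborel. (norm (G p - grad (\<phi> k) p))\<^sup>2)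
        \<le> 2 * N + 2 * (LINT p:D|lborel. (norm (grad (\<phi> k) p - gu p))\<^sup>2)"
        unfolding 3 N_def by (rule L2_integral_triangle) (use g0L2 uD HD in \<open>auto intro: L2_diff\<close>)
      have "(\<lambda>p. u p - \<phi> k p) \<in> L2 Omega" using u H by (auto intro: L2_diff)
      then have 5: "(LINT p:D|lborel. (norm (u p - \<phi> k p))\<^sup>2) \<le> (LINT p:Omega|lborel. (norm (u p - \<phi> k p))\<^sup>2)"
        by (intro set_LINT_mono_subset DO) (auto simp: L2_def)
      have "(\<lambda>p. grad (\<phi> k) p - gu p) \<in> L2 Omega" using gu H by (auto intro: L2_diff)
      then have 6: "(LINT p:D|lborel. (norm (grad (\<phi> k) p - gu p))\<^sup>2) \<le> (LINT p:Omega|lborel. (norm (grad (\<phi> k) p - gu p))\<^sup>2)"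
        by (intro set_LINT_mono_subset DO) (auto simp: L2_def)
      have "\<delta> k = 2 * (LINT p:Omega|lborel. (norm (u p - \<phi> k p))\<^sup>2) + 4 * (LINT p:Omega|lborel. (norm (grad (\<phi> k) p - gu p))\<^sup>2)"
        unfolding \<delta>_def L2_norm_sq gu_def[symmetric] by (simp add: norm_minus_commute power2_commute)
      then show ?thesis using 2 4 5 6 P by linarith
    qed
    ultimately have "W \<le> 4 * N + (2 * 0\<^sup>2 + 4 * 0\<^sup>2)"
      by (intro LIMSEQ_le[of "\<lambda>_. W" W "\<lambda>k. 4 * N + \<delta> k"] tendsto_intros) auto
    then show ?thesis by simp
  qed
  \<comment> \<open>By \<open>C\<^sub>f + \<epsilon>\<^sup>2 \<ge> 1\<close> the L2 error splits
    into a part that is already in the energy norm and a part with factor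
    \<open>\<epsilon>\<^sup>2\<close>, to which the Poincare bound applies.\<close>
  have WE: "W \<le> 4 * E\<^sup>2"
  proof -
    have "W \<le> (C\<^sub>f + \<epsilon>\<^sup>2) * W" using mult_right_mono[OF eps(2) N0(2)] by simp
    also have "\<dots> \<le> C\<^sub>f * W + \<epsilon>\<^sup>2 * (4 * N)"
      using mult_left_mono[OF WN, of "\<epsilon>\<^sup>2"] by (simp add: algebra_simps)
    also have "\<dots> \<le> 4 * E\<^sup>2" unfolding E using N0 Cf by simp
    finally show ?thesis .
  qed
  define P where "P p = \<epsilon> * norm (g0 p)" for p
  define Q where "Q p = L * \<bar>w p\<bar>" for p
  have iP: "set_integrable lborel D P" unfolding P_def
    using set_integrable_norm[OF int(6)] by (intro set_integrable_mult_right)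
  have iQ: "set_integrable lborel D Q" unfolding Q_def
    using int(5) by (intro set_integrable_mult_right set_integrable_abs)
  have iP2: "set_integrable lborel D (\<lambda>p. (P p)\<^sup>2)" "(LINT p:D|lborel. (P p)\<^sup>2) = \<epsilon>\<^sup>2 * N"
    using g0L2 by (auto simp: P_def power_mult_distrib L2_def N_def)
  have iQ2: "set_integrable lborel D (\<lambda>p. (Q p)\<^sup>2)" "(LINT p:D|lborel. (Q p)\<^sup>2) = L\<^sup>2 * W"
    using wL2 by (auto simp: Q_def power_mult_distrib L2_def W_def)
  show ?thesis
  proof
    show "set_integrable lborel D P" "set_integrable lborel D Q"
      "set_integrable lborel D (\<lambda>p. (P p)\<^sup>2)" "set_integrable lborel D (\<lambda>p. (Q p)\<^sup>2)"
      using iP iQ iP2 iQ2 by auto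
    show "P p \<ge> 0" "Q p \<ge> 0" for p using eps L0 by (auto simp: P_def Q_def)
    show "(LINT p:D|lborel. (P p)\<^sup>2) \<le> (energy_norm \<epsilon> C\<^sub>f D (\<lambda>p. v p - u p))\<^sup>2"
      unfolding E_def[symmetric] iP2 E using N0 Cf by simp
    show "(LINT p:D|lborel. (Q p)\<^sup>2) \<le> 4 * L\<^sup>2 * (energy_norm \<epsilon> C\<^sub>f D (\<lambda>p. v p - u p))\<^sup>2"
      unfolding E_def[symmetric] iQ2 using mult_left_mono[OF WE, of "L\<^sup>2"] by simp
    fix \<phi> assume \<phi>: "test_function D \<phi>"
    obtain \<phi>' B where g: "grad \<phi> = \<phi>'"
      and c: "continuous_on UNIV \<phi>" "continuous_on UNIV \<phi>'"
      and B: "\<And>p. \<bar>\<phi> p\<bar> \<le> B" "\<And>p. norm (\<phi>' p) \<le> B"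
      using test_functionE[OF \<phi>] by metis
    have ig: "set_integrable lborel D (\<lambda>p. G p \<bullet> \<phi>' p)" "set_integrable lborel D (\<lambda>p. gu p \<bullet> \<phi>' p)"
      "set_integrable lborel D (\<lambda>p. g0 p \<bullet> \<phi>' p)"
      using int by (auto intro!: set_integrable_inner_bounded borel_measurable_continuous_onI c B)
    have if1: "set_integrable lborel D (\<lambda>p. f p (v p))" "set_integrable lborel D (\<lambda>p. f p (u p))"
      using reaction_integrable[OF adm L DO D_sets(1) _ L0] v_L2 uD by auto
    have if2: "set_integrable lborel D (\<lambda>p. f p (v p) * \<phi> p)" "set_integrable lborel D (\<lambda>p. f p (u p) * \<phi> p)"
      using set_integrable_times_bounded[OF if1(1) borel_measurable_continuous_onI[OF c(1)] B(1)]
        set_integrable_times_bounded[OF if1(2) borel_measurable_continuous_onI[OF c(1)] B(1)]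
      by (auto simp: mult.commute)
    have if3: "set_integrable lborel D (\<lambda>p. f p (v p) * \<phi> p - f p (u p) * \<phi> p)"
      using if2 by (rule set_integral_diff)
    have iR: "set_integrable lborel D (\<lambda>p. \<epsilon> * P p * norm (grad \<phi> p) + Q p * \<bar>\<phi> p\<bar>)"
    proof -
      have "set_integrable lborel D (\<lambda>p. norm (\<phi>' p) *\<^sub>R P p)"
        by (rule set_integrable_times_bounded[OF iP, of _ B])
          (use B borel_measurable_continuous_onI[OF c(2)] in auto)
      then have 1: "set_integrable lborel D (\<lambda>p. \<epsilon> * P p * norm (grad \<phi> p))"
        unfolding g using set_integrable_mult_right[of \<epsilon>] by (simp add: mult_ac)
      have "set_integrable lborel D (\<lambda>p. \<bar>\<phi> p\<bar> *\<^sub>R Q p)"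
        by (rule set_integrable_times_bounded[OF iQ, of _ B])
          (use B borel_measurable_continuous_onI[OF c(1)] in auto)
      then have 2: "set_integrable lborel D (\<lambda>p. Q p * \<bar>\<phi> p\<bar>)"
        by (simp add: mult_ac)
      show ?thesis using 1 2 by (rule set_integral_add)
    qed
    have "\<epsilon>\<^sup>2 * (LINT p:D|lborel. G p \<bullet> \<phi>' p) + (LINT p:D|lborel. f p (v p) * \<phi> p)
      = \<epsilon>\<^sup>2 * ((LINT p:D|lborel. G p \<bullet> \<phi>' p) - (LINT p:D|lborel. gu p \<bullet> \<phi>' p))
        + ((LINT p:D|lborel. f p (v p) * \<phi> p) - (LINT p:D|lborel. f p (u p) * \<phi> p))"
      using weak_solution_test[OF wsol \<phi> DO] unfolding g gu_def[symmetric] by (simp add: algebra_simps)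
    also have "\<dots> = \<epsilon>\<^sup>2 * (LINT p:D|lborel. g0 p \<bullet> \<phi>' p) + (LINT p:D|lborel. f p (v p) * \<phi> p - f p (u p) * \<phi> p)"
      unfolding g0_def inner_diff_left using ig if2 by (simp add: set_integral_diff)
    also have "\<dots> = (LINT p:D|lborel. \<epsilon>\<^sup>2 * (g0 p \<bullet> \<phi>' p) + (f p (v p) * \<phi> p - f p (u p) * \<phi> p))"
      using ig if3 by (subst set_integral_add) auto
    finally have eq: "\<epsilon>\<^sup>2 * (LINT p:D|lborel. G p \<bullet> \<phi>' p) + (LINT p:D|lborel. f p (v p) * \<phi> p)
      = (LINT p:D|lborel. \<epsilon>\<^sup>2 * (g0 p \<bullet> \<phi>' p) + (f p (v p) * \<phi> p - f p (u p) * \<phi> p))" .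
    have iS: "set_integrable lborel D (\<lambda>p. \<epsilon>\<^sup>2 * (g0 p \<bullet> \<phi>' p) + (f p (v p) * \<phi> p - f p (u p) * \<phi> p))"
      using ig if3 by (intro set_integral_add set_integrable_mult_right)
    have "\<bar>LINT p:D|lborel. \<epsilon>\<^sup>2 * (g0 p \<bullet> \<phi>' p) + (f p (v p) * \<phi> p - f p (u p) * \<phi> p)\<bar>
      \<le> (LINT p:D|lborel. \<bar>\<epsilon>\<^sup>2 * (g0 p \<bullet> \<phi>' p) + (f p (v p) * \<phi> p - f p (u p) * \<phi> p)\<bar>)"
      using set_integral_norm_bound[OF iS] by simp
    also have "\<dots> \<le> (LINT p:D|lborel. \<epsilon> * P p * norm (grad \<phi> p) + Q p * \<bar>\<phi> p\<bar>)"
    proof (rule set_integral_mono[OF set_integrable_abs[OF iS] iR])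
      fix p assume p: "p \<in> D"
      have "\<bar>\<epsilon>\<^sup>2 * (g0 p \<bullet> \<phi>' p)\<bar> \<le> \<epsilon>\<^sup>2 * (norm (g0 p) * norm (\<phi>' p))"
        unfolding abs_mult by (simp add: mult_left_mono Cauchy_Schwarz_ineq2)
      moreover have "\<bar>f p (v p) * \<phi> p - f p (u p) * \<phi> p\<bar> \<le> L * \<bar>w p\<bar> * \<bar>\<phi> p\<bar>"
        using L[of p "v p" "u p"] p DO unfolding left_diff_distrib[symmetric] abs_mult w_def
        by (intro mult_right_mono) auto
      ultimately show "\<bar>\<epsilon>\<^sup>2 * (g0 p \<bullet> \<phi>' p) + (f p (v p) * \<phi> p - f p (u p) * \<phi> p)\<bar>
        \<le> \<epsilon> * P p * norm (grad \<phi> p) + Q p * \<bar>\<phi> p\<bar>"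
        unfolding P_def Q_def g by (simp add: power2_eq_square mult.assoc)
    qed
    finally show "\<bar>\<epsilon>\<^sup>2 * (LINT p:D|lborel. G p \<bullet> grad \<phi> p) + (LINT p:D|lborel. f p (v p) * \<phi> p)\<bar>
        \<le> (LINT p:D|lborel. \<epsilon> * P p * norm (grad \<phi> p) + Q p * \<bar>\<phi> p\<bar>)"
      unfolding g eq .
  qed
qed

end

section \<open>Stacks of triangles\<close>

lemma measure_between:
  fixes g h :: "real \<Rightarrow> real"
  assumes "continuous_on {\<alpha>..\<beta>} g" "continuous_on {\<alpha>..\<beta>} h" "\<And>x. x \<in> {\<alpha>..\<beta>} \<Longrightarrow> g x \<le> h x"
  defines "Z \<equiv> {p. fst p \<in> {\<alpha>..\<beta>} \<and> g (fst p) \<le> snd p \<and> snd p \<le> h (fst p)}"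
  shows "compact Z" "measure lborel Z = integral {\<alpha>..\<beta>} (\<lambda>x. h x - g x)"
proof -
  define T where "T = (\<lambda>p::real\<times>real. (fst p, g (fst p) + snd p * (h (fst p) - g (fst p))))"
  \<comment> \<open>Parametrisation by a rectangle yields compactness, although \<open>g\<close> and
    \<open>h\<close> are continuous on the interval only.\<close>
  have Zeq: "Z = T ` ({\<alpha>..\<beta>} \<times> {0..1})"
  proof (intro set_eqI iffI)
    fix p assume p: "p \<in> Z"
    define s where "s = (if h (fst p) = g (fst p) then 0 else (snd p - g (fst p)) / (h (fst p) - g (fst p)))"
    have "s \<in> {0..1}" using p assms(3)[of "fst p"] by (auto simp: s_def Z_def field_simps)
    moreover have "T (fst p, s) = p" using p by (auto simp: T_def s_def Z_def prod_eq_iff)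
    ultimately show "p \<in> T ` ({\<alpha>..\<beta>} \<times> {0..1})" using p
      by (intro image_eqI[of _ _ "(fst p, s)"]) (auto simp: Z_def)
  next
    fix p assume "p \<in> T ` ({\<alpha>..\<beta>} \<times> {0..1})"
    then obtain x s where x: "x \<in> {\<alpha>..\<beta>}" and s: "s \<in> {0..1}" and p: "p = (x, g x + s * (h x - g x))"
      by (auto simp: T_def)
    have "0 \<le> s * (h x - g x)" using s assms(3)[OF x] by auto
    moreover have "s * (h x - g x) \<le> 1 * (h x - g x)" using s assms(3)[OF x] by (intro mult_right_mono) auto
    ultimately show "p \<in> Z" using x by (auto simp: Z_def p)
  qed
  show "compact Z" unfolding Zeq T_def
    by (intro compact_continuous_image compact_Times compact_Icc continuous_intros
        continuous_on_compose2[OF assms(1)] continuous_on_compose2[OF assms(2)]) auto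
  then have Zs: "Z \<in> sets (lborel \<Otimes>\<^sub>M lborel)" unfolding lborel_prod by (auto intro: borel_closed compact_imp_closed)
  have "emeasure lborel Z = (\<integral>\<^sup>+x. emeasure lborel (Pair x -` Z) \<partial>lborel)"
    using lborel.emeasure_pair_measure_alt[OF Zs] by (simp add: lborel_prod)
  also have "\<dots> = (\<integral>\<^sup>+x. ennreal (indicator {\<alpha>..\<beta>} x * (h x - g x)) \<partial>lborel)"
  proof (rule nn_integral_cong)
    fix x
    have "Pair x -` Z = (if x \<in> {\<alpha>..\<beta>} then {g x..h x} else {})" by (auto simp: Z_def)
    then show "emeasure lborel (Pair x -` Z) = ennreal (indicator {\<alpha>..\<beta>} x * (h x - g x))"
      using assms(3)[of x] by (auto simp: indicator_def)
  qed
  also have "\<dots> = ennreal (\<integral>x. indicator {\<alpha>..\<beta>} x * (h x - g x) \<partial>lborel)"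
  proof (rule nn_integral_eq_integral)
    show "integrable lborel (\<lambda>x. indicator {\<alpha>..\<beta>} x * (h x - g x))"
      using borel_integrable_compact[of "{\<alpha>..\<beta>}" "\<lambda>x. h x - g x"] assms
      by (auto intro: continuous_intros)
    show "AE x in lborel. 0 \<le> indicator {\<alpha>..\<beta>} x * (h x - g x)"
      using assms(3) by (auto simp: indicator_def)
  qed
  finally have e: "emeasure lborel Z = ennreal (\<integral>x. indicator {\<alpha>..\<beta>} x * (h x - g x) \<partial>lborel)" .
  have i: "set_integrable lborel {\<alpha>..\<beta>} (\<lambda>x. h x - g x)"
    unfolding set_integrable_def by (intro borel_integrable_compact compact_Icc continuous_intros assms)
  have "0 \<le> (\<integral>x. indicator {\<alpha>..\<beta>} x * (h x - g x) \<partial>lborel)"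
    by (rule Bochner_Integration.integral_nonneg) (use assms(3) in \<open>auto simp: indicator_def\<close>)
  then have "measure lborel Z = (\<integral>x. indicator {\<alpha>..\<beta>} x * (h x - g x) \<partial>lborel)"
    by (simp add: measure_def e)
  also have "\<dots> = integral {\<alpha>..\<beta>} (\<lambda>x. h x - g x)"
    using set_borel_integral_eq_integral(2)[OF i] by (simp add: set_lebesgue_integral_def)
  finally show "measure lborel Z = integral {\<alpha>..\<beta>} (\<lambda>x. h x - g x)" .
qed

text \<open>One column of elements between the near line x = \<open>x0\<close> and the far line x =
  \<open>x0\<close> + \<open>d\<close>, with negative \<open>d\<close> for a column on the left.
  \<open>N k\<close> and \<open>F k\<close> are the heights of the k-th long edge on the two lines,
  and element \<open>k\<close> lies between the edges \<open>k\<close> and \<open>Suc k\<close>. The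
  step condition says that each element has its short edge on exactly one of the lines.\<close>

locale half_strip =
  fixes x0 d :: real and m :: nat and N F :: "nat \<Rightarrow> real"
  assumes d: "d \<noteq> 0"
    and ends: "N 0 = 0" "F 0 = 0" "N m = 1" "F m = 1"
    and step: "\<And>k. k < m \<Longrightarrow> (N k < N (Suc k) \<and> F k = F (Suc k)) \<or> (N k = N (Suc k) \<and> F k < F (Suc k))"
begin

definition W :: real where "W = \<bar>d\<bar>"
definition \<tau> :: "real \<Rightarrow> real" where "\<tau> x = (x - x0) / d"
definition ell :: "nat \<Rightarrow> real \<Rightarrow> real" where "ell k x = N k + (F k - N k) * \<tau> x"
text \<open>Only one summand is nonzero: this is the length of the short edge of element
  \<open>k\<close>, whichever line carries it.\<close>

definition sz :: "nat \<Rightarrow> real" where "sz k = (N (Suc k) - N k) + (F (Suc k) - F k)"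
definition slope :: "nat \<Rightarrow> real" where "slope k = (F k - N k) / d"
definition tri :: "nat \<Rightarrow> point set"
  where "tri k = {p. 0 \<le> \<tau> (fst p) \<and> \<tau> (fst p) \<le> 1 \<and> ell k (fst p) \<le> snd p \<and> snd p \<le> ell (Suc k) (fst p)}"

lemma W_pos: "W > 0" using d by (simp add: W_def)

lemma NF_step: "k < m \<Longrightarrow> N k \<le> N (Suc k)" "k < m \<Longrightarrow> F k \<le> F (Suc k)"
  using step[of k] by auto

lemma sz_pos: "k < m \<Longrightarrow> sz k > 0"
  using step[of k] by (auto simp: sz_def)

lemma NF_mono: "i \<le> j \<Longrightarrow> j \<le> m \<Longrightarrow> N i \<le> N j" "i \<le> j \<Longrightarrow> j \<le> m \<Longrightarrow> F i \<le> F j"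
proof (induction j rule: dec_induct)
  case (step n)
  { case 1 then show ?case using step NF_step(1)[of n] by auto next
    case 2 then show ?case using step NF_step(2)[of n] by auto }
qed auto

lemma NF_range: "k \<le> m \<Longrightarrow> 0 \<le> N k \<and> N k \<le> 1 \<and> 0 \<le> F k \<and> F k \<le> 1"
  using NF_mono[of 0 k] NF_mono[of k m] ends by auto

lemma ell_convex: "ell k x = (1 - \<tau> x) * N k + \<tau> x * F k"
  by (simp add: ell_def algebra_simps)

lemma ell_slope: "ell k x = N k + slope k * (x - x0)"
  by (simp add: ell_def slope_def \<tau>_def)

lemma ell_mono:
  assumes "0 \<le> \<tau> x" "\<tau> x \<le> 1" "i \<le> j" "j \<le> m"
  shows "ell i x \<le> ell j x"
  unfolding ell_convex using assms NF_mono[of i j] by (intro add_mono mult_left_mono) auto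

lemma ell_ends: "ell 0 x = 0" "ell m x = 1"
  using ends by (simp_all add: ell_convex)

text \<open>In the middle half of the column both weights of the convex combination are at least
  1/4, so it does not matter on which line the short edge lies.\<close>

lemma ell_gap:
  assumes "1/4 \<le> \<tau> x" "\<tau> x \<le> 3/4" "k < m"
  shows "ell (Suc k) x - ell k x \<ge> sz k / 4"
proof -
  have "1/4 * (N (Suc k) - N k) \<le> (1 - \<tau> x) * (N (Suc k) - N k)"
    by (rule mult_right_mono) (use assms NF_step in auto)
  moreover have "1/4 * (F (Suc k) - F k) \<le> \<tau> x * (F (Suc k) - F k)"
    by (rule mult_right_mono) (use assms NF_step in auto)
  ultimately show ?thesis unfolding ell_convex sz_def
    by (simp add: algebra_simps add_divide_distrib diff_divide_distrib)
qed

lemma tri_cover: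
  assumes "0 \<le> \<tau> x" "\<tau> x \<le> 1" "0 \<le> y" "y \<le> 1"
  obtains k where "k < m" "(x, y) \<in> tri k"
proof -
  define k where "k = (LEAST k. y \<le> ell (Suc k) x)"
  have m0: "m > 0" using ends by (cases m) auto
  then have ex: "y \<le> ell (Suc (m - 1)) x" using assms ell_ends by simp
  then have k: "y \<le> ell (Suc k) x" "k \<le> m - 1" unfolding k_def by (auto intro: LeastI Least_le)
  have "ell k x \<le> y"
  proof (cases k)
    case 0 then show ?thesis using ell_ends assms by simp
  next
    case (Suc j)
    then have "\<not> y \<le> ell (Suc j) x" using not_less_Least[of j "\<lambda>k. y \<le> ell (Suc k) x"] unfolding k_def by auto
    then show ?thesis using Suc by simp
  qed
  then show ?thesis using that[of k] k m0 assms by (auto simp: tri_def)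
qed

end

section \<open>The residual functional and its localised bound\<close>

lemma Young_weighted:
  fixes a b \<eta> :: real
  assumes "\<eta> > 0"
  shows "a * b \<le> \<eta> * a\<^sup>2 / 2 + b\<^sup>2 / (2 * \<eta>)"
proof -
  have "0 \<le> (\<eta> * a - b)\<^sup>2 / (2 * \<eta>)" using assms by simp
  also have "\<dots> = \<eta> * a\<^sup>2 / 2 + b\<^sup>2 / (2 * \<eta>) - a * b"
    using assms by (simp add: power2_eq_square field_simps)
  finally show ?thesis by simp
qed

text \<open>What is retained of the differential equation: \<open>G\<close> is the gradient of the
  discrete solution, \<open>h\<close> its reaction term, and \<open>P\<close>, \<open>Q\<close> are
  the densities of the error.\<close>

locale residual_bound =
  fixes l r :: real and D :: "point set" and P Q :: "point \<Rightarrow> real" and G :: "point \<Rightarrow> point"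
    and h :: "point \<Rightarrow> real" and \<epsilon> BG :: real
  assumes D_def: "D = {l<..<r} \<times> {0<..<1}" and lr: "l < r" and eps: "\<epsilon> > 0"
    and iP: "set_integrable lborel D P" and iQ: "set_integrable lborel D Q"
    and iP2: "set_integrable lborel D (\<lambda>p. (P p)\<^sup>2)" and iQ2: "set_integrable lborel D (\<lambda>p. (Q p)\<^sup>2)"
    and P0: "\<And>p. P p \<ge> 0" and Q0: "\<And>p. Q p \<ge> 0"
    and G_meas: "G \<in> borel_measurable borel" and G_bound: "\<And>p. norm (G p) \<le> BG"
    and ih: "set_integrable lborel D h"
    and residual: "\<And>\<phi>. test_function D \<phi> \<Longrightarrow>
      \<bar>\<epsilon>\<^sup>2 * (LINT p:D|lborel. G p \<bullet> grad \<phi> p) + (LINT p:D|lborel. h p * \<phi> p)\<bar>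
        \<le> (LINT p:D|lborel. \<epsilon> * P p * norm (grad \<phi> p) + Q p * \<bar>\<phi> p\<bar>)"
begin

lemma D_sets [simp]: "D \<in> sets borel" "bounded D"
  by (auto simp: D_def)

lemma iG: "set_integrable lborel D G"
  by (rule set_integrable_bounded[OF set_borel_measurable_borel]) (use G_meas G_bound in auto)

definition R2 :: "point \<Rightarrow> real" where "R2 p = (P p)\<^sup>2 + (Q p)\<^sup>2"

lemma iR2: "set_integrable lborel D R2"
  unfolding R2_def using iP2 iQ2 by (rule set_integral_add)

text \<open>The amplitude \<open>A\<close> is kept outside the test function. Each of the two
  products spends half of the term with \<open>\<eta>\<close>, which is later absorbed by the
  squared jump; the rest is the error on the support \<open>Z\<close> alone.\<close>

lemma residual_Young:
  assumes \<phi>: "test_function D \<phi>" and Z: "Z \<in> sets borel" "Z \<subseteq> D"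
    and off: "\<And>p. p \<in> D - Z \<Longrightarrow> \<phi> p = 0 \<and> grad \<phi> p = 0"
    and A: "A \<ge> 0" and K: "K1 > 0" "K2 > 0" and \<eta>: "\<eta> > 0"
    and b1: "\<And>p. p \<in> Z \<Longrightarrow> norm (grad \<phi> p) \<le> K1" and b2: "\<And>p. p \<in> Z \<Longrightarrow> \<bar>\<phi> p\<bar> \<le> K2"
  shows "A * (LINT p:D|lborel. \<epsilon> * P p * norm (grad \<phi> p) + Q p * \<bar>\<phi> p\<bar>)
    \<le> \<eta> * \<epsilon>\<^sup>2 * A\<^sup>2 * measure lborel Z
      + (K1\<^sup>2 / (2 * \<eta>) + K2\<^sup>2 / (2 * \<eta> * \<epsilon>\<^sup>2)) * (LINT p:Z|lborel. R2 p)"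
proof -
  define c0 where "c0 = \<eta> * \<epsilon>\<^sup>2 * A\<^sup>2"
  define c1 where "c1 = K1\<^sup>2 / (2 * \<eta>) + K2\<^sup>2 / (2 * \<eta> * \<epsilon>\<^sup>2)"
  have c1: "K1\<^sup>2 / (2 * \<eta>) \<le> c1" "K2\<^sup>2 / (2 * \<eta> * \<epsilon>\<^sup>2) \<le> c1" "0 \<le> c1"
    using \<eta> eps unfolding c1_def by auto
  have iRZ: "set_integrable lborel Z R2"
    by (rule set_integrable_subset[OF iR2]) (use Z in auto)
  have bZ: "bounded Z" using Z by (rule_tac bounded_subset[OF D_sets(2)])
  have i0: "set_integrable lborel Z (\<lambda>p. c0)"
    by (rule set_integrable_bounded[where B="\<bar>c0\<bar>"]) (use Z bZ in \<open>auto simp: set_borel_measurable_def\<close>)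
  obtain \<phi>' K B where g: "grad \<phi> = \<phi>'" and c: "continuous_on UNIV \<phi>" "continuous_on UNIV \<phi>'"
    and B: "\<And>p. \<bar>\<phi> p\<bar> \<le> B" "\<And>p. norm (\<phi>' p) \<le> B"
    using test_functionE[OF \<phi>] by metis
  have iL: "set_integrable lborel D (\<lambda>p. \<epsilon> * P p * norm (grad \<phi> p) + Q p * \<bar>\<phi> p\<bar>)"
  proof -
    have "set_integrable lborel D (\<lambda>p. norm (\<phi>' p) *\<^sub>R P p)"
      by (rule set_integrable_times_bounded[OF iP, of _ B])
        (use B borel_measurable_continuous_onI[OF c(2)] in auto)
    then have 1: "set_integrable lborel D (\<lambda>p. \<epsilon> * P p * norm (grad \<phi> p))"
      unfolding g using set_integrable_mult_right[of \<epsilon>] by (simp add: mult_ac)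
    have "set_integrable lborel D (\<lambda>p. \<bar>\<phi> p\<bar> *\<^sub>R Q p)"
      by (rule set_integrable_times_bounded[OF iQ, of _ B])
        (use B borel_measurable_continuous_onI[OF c(1)] in auto)
    then have 2: "set_integrable lborel D (\<lambda>p. Q p * \<bar>\<phi> p\<bar>)"
      by (simp add: mult_ac)
    show ?thesis using 1 2 by (rule set_integral_add)
  qed
  have "(LINT p:D|lborel. \<epsilon> * P p * norm (grad \<phi> p) + Q p * \<bar>\<phi> p\<bar>)
    = (LINT p:Z|lborel. \<epsilon> * P p * norm (grad \<phi> p) + Q p * \<bar>\<phi> p\<bar>)"
    by (rule set_LINT_mono_set[OF Z(2)]) (use off in auto)
  then have "A * (LINT p:D|lborel. \<epsilon> * P p * norm (grad \<phi> p) + Q p * \<bar>\<phi> p\<bar>)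
    = (LINT p:Z|lborel. A * (\<epsilon> * P p * norm (grad \<phi> p) + Q p * \<bar>\<phi> p\<bar>))" by simp
  also have "\<dots> \<le> (LINT p:Z|lborel. c0 + c1 * R2 p)"
  proof (rule set_integral_mono)
    show "set_integrable lborel Z (\<lambda>p. A * (\<epsilon> * P p * norm (grad \<phi> p) + Q p * \<bar>\<phi> p\<bar>))"
      using set_integrable_subset[OF iL _ Z(2)] Z by (intro set_integrable_mult_right) auto
    show "set_integrable lborel Z (\<lambda>p. c0 + c1 * R2 p)"
      using i0 iRZ by (intro set_integral_add set_integrable_mult_right)
    fix p assume p: "p \<in> Z"
    have "\<epsilon> * A * (P p * norm (grad \<phi> p)) \<le> \<epsilon> * A * (P p * K1)"
      using A eps P0 b1[OF p] by (intro mult_left_mono) auto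
    also have "\<dots> = (\<epsilon> * A) * (K1 * P p)" by simp
    also have "\<dots> \<le> \<eta> * (\<epsilon> * A)\<^sup>2 / 2 + (K1 * P p)\<^sup>2 / (2 * \<eta>)" by (rule Young_weighted[OF \<eta>])
    also have "\<dots> = c0 / 2 + K1\<^sup>2 / (2 * \<eta>) * (P p)\<^sup>2" by (simp add: c0_def power_mult_distrib)
    also have "\<dots> \<le> c0 / 2 + c1 * (P p)\<^sup>2" using c1 by (intro add_left_mono mult_right_mono) auto
    finally have 1: "\<epsilon> * A * (P p * norm (grad \<phi> p)) \<le> c0 / 2 + c1 * (P p)\<^sup>2" .
    have "A * (Q p * \<bar>\<phi> p\<bar>) \<le> A * (Q p * K2)"
      using A Q0 b2[OF p] by (intro mult_left_mono) auto
    also have "\<dots> = (\<epsilon> * A) * (K2 * Q p / \<epsilon>)" using eps by simp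
    also have "\<dots> \<le> \<eta> * (\<epsilon> * A)\<^sup>2 / 2 + (K2 * Q p / \<epsilon>)\<^sup>2 / (2 * \<eta>)" by (rule Young_weighted[OF \<eta>])
    also have "\<dots> = c0 / 2 + K2\<^sup>2 / (2 * \<eta> * \<epsilon>\<^sup>2) * (Q p)\<^sup>2"
      by (simp add: c0_def power_mult_distrib power_divide mult_ac)
    also have "\<dots> \<le> c0 / 2 + c1 * (Q p)\<^sup>2" using c1 by (intro add_left_mono mult_right_mono) auto
    finally have 2: "A * (Q p * \<bar>\<phi> p\<bar>) \<le> c0 / 2 + c1 * (Q p)\<^sup>2" .
    show "A * (\<epsilon> * P p * norm (grad \<phi> p) + Q p * \<bar>\<phi> p\<bar>) \<le> c0 + c1 * R2 p"
      using 1 2 unfolding R2_def by (simp add: algebra_simps)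
  qed
  also have "\<dots> = c0 * measure lborel Z + c1 * (LINT p:Z|lborel. R2 p)"
    using i0 iRZ by (subst set_integral_add) (auto simp: set_lebesgue_integral_def)
  finally show ?thesis unfolding c0_def c1_def .
qed

lemma h_test_integrable:
  assumes \<phi>: "test_function D \<phi>"
  shows "set_integrable lborel D (\<lambda>p. h p * \<phi> p)" "set_integrable lborel D (\<lambda>p. G p \<bullet> grad \<phi> p)"
proof -
  obtain \<phi>' B where g: "grad \<phi> = \<phi>'" and c: "continuous_on UNIV \<phi>" "continuous_on UNIV \<phi>'"
    and B: "\<And>p. \<bar>\<phi> p\<bar> \<le> B" "\<And>p. norm (\<phi>' p) \<le> B"
    using test_functionE[OF \<phi>] by metis
  show "set_integrable lborel D (\<lambda>p. h p * \<phi> p)"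
    using set_integrable_times_bounded[OF ih borel_measurable_continuous_onI[OF c(1)] B(1)]
    by (simp add: mult.commute)
  show "set_integrable lborel D (\<lambda>p. G p \<bullet> grad \<phi> p)"
    unfolding g by (rule set_integrable_inner_bounded[OF iG borel_measurable_continuous_onI[OF c(2)] B(2)])
qed

end

section \<open>Bubbles on long edges\<close>

text \<open>On element \<open>k\<close> the gradient is (\<open>a k\<close>, \<open>b k\<close>),
  \<open>c k\<close> is a reference value of the reaction, \<open>oc k\<close> its oscillation and
  \<open>os k\<close> the weighted oscillation. The assumption on jumps is continuity along a long
  edge, \<open>a_ends\<close> reflects the zero boundary values, \<open>slope_le\<close> the angle
  condition; \<open>sz_comp\<close> and \<open>c_comp\<close> compare elements with a common node on
  the near line, and \<open>count\<close> limits the long edges at such a node.\<close>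

locale mesh_side = half_strip x0 d m N F + residual_bound l r D P Q G h \<epsilon> BG
  for x0 d m N F l r D P Q G h \<epsilon> BG +
  fixes a b c oc os :: "nat \<Rightarrow> real" and K :: real and Mx :: nat
  assumes inside: "\<And>x y. 0 < \<tau> x \<Longrightarrow> \<tau> x < 1 \<Longrightarrow> 0 < y \<Longrightarrow> y < 1 \<Longrightarrow> (x, y) \<in> D"
    and G_tri: "\<And>k x y. k < m \<Longrightarrow> 0 < \<tau> x \<Longrightarrow> \<tau> x < 1 \<Longrightarrow> ell k x < y \<Longrightarrow> y < ell (Suc k) x \<Longrightarrow> G (x, y) = (a k, b k)"
    and h_tri: "\<And>k p. k < m \<Longrightarrow> p \<in> tri k \<Longrightarrow> p \<in> D \<Longrightarrow> \<bar>h p - c k\<bar> \<le> oc k"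
    and jump: "\<And>k. Suc k < m \<Longrightarrow> a (Suc k) - a k = - slope (Suc k) * (b (Suc k) - b k)"
    and a_ends: "a 0 = 0" "a (m - 1) = 0"
    and K: "K \<ge> 1"
    and slope_le: "\<And>k. Suc k < m \<Longrightarrow> \<bar>F (Suc k) - N (Suc k)\<bar> \<le> K * sz k \<and> \<bar>F (Suc k) - N (Suc k)\<bar> \<le> K * sz (Suc k)"
    and sz_le: "\<And>k. k < m \<Longrightarrow> sz k \<le> 2 * W"
    and sz_comp: "\<And>j k y. j < m \<Longrightarrow> k < m \<Longrightarrow> y = N j \<or> y = N (Suc j) \<Longrightarrow> y = N k \<or> y = N (Suc k) \<Longrightarrow> sz j \<le> K * sz k"
    and c_comp: "\<And>j k y. j < m \<Longrightarrow> k < m \<Longrightarrow> y = N j \<or> y = N (Suc j) \<Longrightarrow> y = N k \<or> y = N (Suc k) \<Longrightarrow> \<bar>c j - c k\<bar> \<le> oc j + oc k"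
    and osc0: "\<And>k. k < m \<Longrightarrow> oc k \<ge> 0"
    and osc_scaled: "\<And>k t. k < m \<Longrightarrow> 0 \<le> t \<Longrightarrow> t \<le> \<epsilon> \<Longrightarrow> t \<le> W \<Longrightarrow> t / \<epsilon> * oc k \<le> os k"
    and count: "\<And>y. card {k. Suc k < m \<and> N (Suc k) = y} \<le> Mx"
begin

definition \<beta> :: "nat \<Rightarrow> real" where "\<beta> k = b (Suc k) - b k"
text \<open>Half-height of the bubble. The cap \<epsilon> balances reaction against diffusion. Two
  bubbles of a tenth of the short edge each fit into an element, whose thickness in the middle half
  is at least a quarter of that edge.\<close>

definition \<delta> :: "nat \<Rightarrow> real" where "\<delta> k = min \<epsilon> (min (sz k) (sz (Suc k)) / 10)"

text \<open>The edge \<open>Suc k\<close> separates the triangles \<open>k\<close> and \<open>Suc k\<close>; this is the support of its bubble.\<close>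

definition Zs :: "nat \<Rightarrow> point set"
  where "Zs k = {p. fst p \<in> {x0 + d/2 - W/4 .. x0 + d/2 + W/4} \<and>
    ell (Suc k) (fst p) - \<delta> k \<le> snd p \<and> snd p \<le> ell (Suc k) (fst p) + \<delta> k}"

lemma \<delta>:
  assumes "Suc k < m"
  shows "\<delta> k > 0" "\<delta> k \<le> \<epsilon>" "\<delta> k \<le> sz k / 10" "\<delta> k \<le> sz (Suc k) / 10" "\<delta> k \<le> W / 5"
proof -
  show "\<delta> k > 0" using assms sz_pos[of k] sz_pos[of "Suc k"] eps by (auto simp: \<delta>_def)
  show "\<delta> k \<le> \<epsilon>" "\<delta> k \<le> sz k / 10" "\<delta> k \<le> sz (Suc k) / 10" by (auto simp: \<delta>_def min_def)
  then show "\<delta> k \<le> W / 5" using sz_le[of k] assms by auto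
qed

lemma mid_range:
  assumes "\<bar>x - (x0 + d/2)\<bar> \<le> W/4"
  shows "1/4 \<le> \<tau> x" "\<tau> x \<le> 3/4"
proof -
  have "\<tau> x - 1/2 = (x - (x0 + d/2)) / d" using d by (simp add: \<tau>_def field_simps)
  then have "\<bar>\<tau> x - 1/2\<bar> = \<bar>x - (x0 + d/2)\<bar> / W" using d by (simp add: W_def abs_divide)
  also have "\<dots> \<le> 1/4" using assms W_pos by (simp add: field_simps)
  finally have "\<bar>\<tau> x - 1/2\<bar> \<le> 1/4" .
  then show "1/4 \<le> \<tau> x" "\<tau> x \<le> 3/4" unfolding abs_le_iff by linarith+
qed

lemma mid_gaps:
  assumes "Suc k < m" "\<bar>x - (x0 + d/2)\<bar> \<le> W/4"
  shows "ell (Suc k) x - \<delta> k > ell k x" "ell (Suc k) x + \<delta> k < ell (Suc (Suc k)) x"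
    "ell (Suc k) x - \<delta> k \<ge> ell k x + sz k / 10" "ell (Suc k) x + \<delta> k \<le> ell (Suc k) x + sz (Suc k) / 10"
    "ell (Suc k) x - \<delta> k > 0" "ell (Suc k) x + \<delta> k < 1"
proof -
  note t = mid_range[OF assms(2)]
  have g: "ell (Suc k) x - ell k x \<ge> sz k / 4" "ell (Suc (Suc k)) x - ell (Suc k) x \<ge> sz (Suc k) / 4"
    using ell_gap[OF t] assms by auto
  have e: "0 \<le> ell k x" "ell (Suc (Suc k)) x \<le> 1"
    using ell_mono[of x 0 k] ell_mono[of x "Suc (Suc k)" m] t assms ell_ends by auto
  show "ell (Suc k) x - \<delta> k > ell k x" "ell (Suc k) x + \<delta> k < ell (Suc (Suc k)) x"
    "ell (Suc k) x - \<delta> k \<ge> ell k x + sz k / 10" "ell (Suc k) x + \<delta> k \<le> ell (Suc k) x + sz (Suc k) / 10"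
    "ell (Suc k) x - \<delta> k > 0" "ell (Suc k) x + \<delta> k < 1"
    using g e \<delta>[OF assms(1)] sz_pos[of k] sz_pos[of "Suc k"] assms(1) by linarith+
qed

lemma continuous_ell: "continuous_on S (ell k)"
  unfolding ell_slope by (intro continuous_intros)

lemma Zs_iff: "p \<in> Zs k \<longleftrightarrow> \<bar>fst p - (x0 + d/2)\<bar> \<le> W/4 \<and> \<bar>snd p - ell (Suc k) (fst p)\<bar> \<le> \<delta> k"
  unfolding Zs_def mem_Collect_eq atLeastAtMost_iff abs_le_iff
  by (intro iffI conjI; linarith)

lemma Zs_props:
  assumes "Suc k < m"
  shows "compact (Zs k)" "Zs k \<subseteq> D" "measure lborel (Zs k) = W * \<delta> k"
proof -
  have "compact (Zs k) \<and> measure lborel (Zs k) = integral {x0 + d/2 - W/4 .. x0 + d/2 + W/4} (\<lambda>x. (ell (Suc k) x + \<delta> k) - (ell (Suc k) x - \<delta> k))"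
    unfolding Zs_def using \<delta>[OF assms]
    by (intro conjI measure_between continuous_intros continuous_ell) auto
  then show "compact (Zs k)" "measure lborel (Zs k) = W * \<delta> k" using W_pos by auto
  show "Zs k \<subseteq> D"
  proof
    fix p assume p: "p \<in> Zs k"
    then have x: "\<bar>fst p - (x0 + d/2)\<bar> \<le> W/4" by (auto simp only: Zs_iff)
    have "(fst p, snd p) \<in> D"
      by (rule inside) (use mid_range[OF x] mid_gaps[OF assms x] p in \<open>auto simp: Zs_def\<close>)
    then show "p \<in> D" by simp
  qed
qed

lemma Zs_disjoint:
  assumes "i < j" "Suc j < m"
  shows "Zs i \<inter> Zs j = {}"
proof (rule ccontr)
  assume "Zs i \<inter> Zs j \<noteq> {}"
  then obtain p where p: "p \<in> Zs i" "p \<in> Zs j" by auto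
  then have x: "\<bar>fst p - (x0 + d/2)\<bar> \<le> W/4" by (auto simp only: Zs_iff)
  have m: "Suc i < m" using assms by simp
  have 1: "snd p < ell (Suc (Suc i)) (fst p)" using mid_gaps(2)[OF m x] p by (auto simp: Zs_def)
  have g: "ell j (fst p) < snd p" using mid_gaps(1)[OF assms(2) x] p by (auto simp: Zs_def)
  have e1: "ell (Suc i) (fst p) \<le> ell j (fst p)" using ell_mono[of "fst p" "Suc i" j] mid_range[OF x] assms by auto
  show False
  proof (cases "j = Suc i")
    \<comment> \<open>The supports of adjacent edges share the element \<open>Suc i\<close>. Each
      takes at most a tenth of its short edge, less than the available quarter.\<close>
    case True
    have "snd p \<le> ell (Suc i) (fst p) + sz (Suc i) / 10"
      using mid_gaps(4)[OF m x] p by (auto simp: Zs_def)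
    moreover have "snd p \<ge> ell (Suc i) (fst p) + sz (Suc i) / 10"
      using mid_gaps(3)[OF assms(2) x] p True by (auto simp: Zs_def)
    moreover have "snd p < ell (Suc i) (fst p) + sz (Suc i) / 10 \<or> snd p > ell (Suc i) (fst p) + sz (Suc i) / 10"
    proof -
      have "ell (Suc (Suc i)) (fst p) - ell (Suc i) (fst p) \<ge> sz (Suc i) / 4"
        using ell_gap[of "fst p" "Suc i"] mid_range[OF x] assms True by auto
      moreover have "\<delta> j \<le> sz (Suc i) / 10" using \<delta>(3)[OF assms(2)] True by simp
      moreover have "ell (Suc j) (fst p) - \<delta> j \<le> snd p" using p by (simp add: Zs_def)
      ultimately show ?thesis using sz_pos[of "Suc i"] m True by auto
    qed
    ultimately show False by linarith
  next
    case False
    then have "ell (Suc (Suc i)) (fst p) \<le> ell j (fst p)"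
      using ell_mono[of "fst p" "Suc (Suc i)" j] mid_range[OF x] assms by auto
    then show False using 1 g by linarith
  qed
qed

text \<open>The affine arguments are expanded to fit \<open>GDERIV_product_affine\<close>. They are
  the horizontal distance from the middle of the column divided by W/4 and the vertical distance
  from the edge divided by \<open>\<delta> k\<close>.\<close>

definition bub :: "nat \<Rightarrow> point \<Rightarrow> real"
  where "bub k p = pbump (4 / W * fst p + (- 4 / W * (x0 + d/2)))
    * qbump (- slope (Suc k) / \<delta> k * fst p + 1 / \<delta> k * snd p + (slope (Suc k) * x0 - N (Suc k)) / \<delta> k)"

lemma bub_args:
  assumes "Suc k < m"
  shows "4 / W * x + (- 4 / W * (x0 + d/2)) = (x - (x0 + d/2)) / (W/4)"
    "- slope (Suc k) / \<delta> k * x + 1 / \<delta> k * y + (slope (Suc k) * x0 - N (Suc k)) / \<delta> k = (y - ell (Suc k) x) / \<delta> k"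
  using W_pos \<delta>[OF assms] by (simp_all add: ell_slope field_simps)

lemma bub_grad:
  assumes k: "Suc k < m"
  shows "grad (bub k) (x, y) =
    (4 / W * pbump' ((x - (x0 + d/2)) / (W/4)) * qbump ((y - ell (Suc k) x) / \<delta> k)
       - slope (Suc k) / \<delta> k * pbump ((x - (x0 + d/2)) / (W/4)) * qbump' ((y - ell (Suc k) x) / \<delta> k),
     1 / \<delta> k * pbump ((x - (x0 + d/2)) / (W/4)) * qbump' ((y - ell (Suc k) x) / \<delta> k))"
    and "bub k (x, y) = pbump ((x - (x0 + d/2)) / (W/4)) * qbump ((y - ell (Suc k) x) / \<delta> k)"
    and "test_function D (bub k)"
    and "\<And>p. p \<in> D - Zs k \<Longrightarrow> bub k p = 0 \<and> grad (bub k) p = 0"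
proof -
  let ?P = "\<lambda>x. pbump (4 / W * x + (- 4 / W * (x0 + d/2)))"
  note GD = GDERIV_product_affine[OF has_real_derivative_pbump has_real_derivative_qbump,
      of "4 / W" "- 4 / W * (x0 + d/2)" "- slope (Suc k) / \<delta> k" "1 / \<delta> k" "(slope (Suc k) * x0 - N (Suc k)) / \<delta> k"]
  define \<phi>' where "\<phi>' p = (4 / W * pbump' (4 / W * fst p + (- 4 / W * (x0 + d/2)))
      * qbump (- slope (Suc k) / \<delta> k * fst p + 1 / \<delta> k * snd p + (slope (Suc k) * x0 - N (Suc k)) / \<delta> k)
    + - slope (Suc k) / \<delta> k * pbump (4 / W * fst p + (- 4 / W * (x0 + d/2)))
      * qbump' (- slope (Suc k) / \<delta> k * fst p + 1 / \<delta> k * snd p + (slope (Suc k) * x0 - N (Suc k)) / \<delta> k),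
    1 / \<delta> k * pbump (4 / W * fst p + (- 4 / W * (x0 + d/2)))
      * qbump' (- slope (Suc k) / \<delta> k * fst p + 1 / \<delta> k * snd p + (slope (Suc k) * x0 - N (Suc k)) / \<delta> k))" for p :: point
  have G: "GDERIV (bub k) p :> \<phi>' p" for p
    unfolding bub_def[abs_def] \<phi>'_def by (rule GD)
  have cont: "continuous_on UNIV \<phi>'"
    unfolding \<phi>'_def by (rule continuous_product_affine) (intro continuous_intros)+
  have gr: "grad (bub k) p = \<phi>' p" for p using G grad_eq by blast
  show 1: "grad (bub k) (x, y) =
    (4 / W * pbump' ((x - (x0 + d/2)) / (W/4)) * qbump ((y - ell (Suc k) x) / \<delta> k)
       - slope (Suc k) / \<delta> k * pbump ((x - (x0 + d/2)) / (W/4)) * qbump' ((y - ell (Suc k) x) / \<delta> k),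
     1 / \<delta> k * pbump ((x - (x0 + d/2)) / (W/4)) * qbump' ((y - ell (Suc k) x) / \<delta> k))" for x y
    unfolding gr \<phi>'_def fst_conv snd_conv bub_args[OF k] by simp
  show 2: "bub k (x, y) = pbump ((x - (x0 + d/2)) / (W/4)) * qbump ((y - ell (Suc k) x) / \<delta> k)" for x y
    unfolding bub_def fst_conv snd_conv bub_args[OF k] by simp
  have off: "bub k p = 0 \<and> grad (bub k) p = 0" if "p \<notin> Zs k" for p
  proof -
    obtain x y where p: "p = (x, y)" by (cases p)
    have "\<not> \<bar>x - (x0 + d/2)\<bar> \<le> W/4 \<or> \<not> \<bar>y - ell (Suc k) x\<bar> \<le> \<delta> k"
      using that unfolding p Zs_iff by auto
    moreover have "\<bar>z / e\<bar> \<ge> 1" if "e > 0" "\<not> \<bar>z\<bar> \<le> e" for z e :: real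
      using that by (simp add: abs_divide)
    ultimately have "\<bar>(x - (x0 + d/2)) / (W/4)\<bar> \<ge> 1 \<or> \<bar>(y - ell (Suc k) x) / \<delta> k\<bar> \<ge> 1"
      using W_pos \<delta>(1)[OF k] by (metis divide_pos_pos zero_less_numeral)
    then show ?thesis unfolding p 1 2 by (auto simp: bump_outside zero_prod_def)
  qed
  then show "\<And>p. p \<in> D - Zs k \<Longrightarrow> bub k p = 0 \<and> grad (bub k) p = 0" by auto
  show "test_function D (bub k)"
    by (rule test_functionI[OF G cont Zs_props(1,2)[OF k]]) (use off in auto)
qed

text \<open>Covers the contributions 20, 120 K and 60 of the three terms of the gradient, using K
  \<ge> 1.\<close>

definition K1 :: real where "K1 = 200 * K"

lemma slope_bound:
  assumes "Suc k < m"
  shows "\<bar>slope (Suc k)\<bar> \<le> K * sz k / W" "\<bar>slope (Suc k)\<bar> \<le> K * sz (Suc k) / W" "\<bar>slope (Suc k)\<bar> \<le> 2 * K"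
proof -
  have e: "\<bar>slope (Suc k)\<bar> = \<bar>F (Suc k) - N (Suc k)\<bar> / W" by (simp add: slope_def W_def)
  show 1: "\<bar>slope (Suc k)\<bar> \<le> K * sz k / W" "\<bar>slope (Suc k)\<bar> \<le> K * sz (Suc k) / W"
    unfolding e using slope_le[OF assms] W_pos by (auto intro!: divide_right_mono)
  have "K * sz k \<le> K * (2 * W)" using sz_le[of k] assms K by (intro mult_left_mono) auto
  then have "K * sz k / W \<le> 2 * K" using W_pos by (simp add: field_simps)
  then show "\<bar>slope (Suc k)\<bar> \<le> 2 * K" using 1 by linarith
qed

lemma bub_bounds:
  assumes k: "Suc k < m"
  shows "norm (grad (bub k) p) \<le> K1 / \<delta> k" "\<bar>bub k p\<bar> \<le> 6"
proof -
  obtain x y where p: "p = (x, y)" by (cases p)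
  define s where "s = (x - (x0 + d/2)) / (W/4)"
  define t where "t = (y - ell (Suc k) x) / \<delta> k"
  note D = \<delta>[OF k]
  have b: "bub k p = pbump s * qbump t"
    "grad (bub k) p = (4 / W * pbump' s * qbump t - slope (Suc k) / \<delta> k * pbump s * qbump' t, 1 / \<delta> k * pbump s * qbump' t)"
    unfolding p bub_grad(1,2)[OF k] s_def t_def by simp_all
  have "\<bar>pbump s * qbump t\<bar> \<le> 1 * 6"
    unfolding abs_mult using bump_bounds[of s] bump_bounds[of t] by (intro mult_mono) auto
  then show "\<bar>bub k p\<bar> \<le> 6" using b by simp
  have pq: "\<bar>pbump s * qbump' t\<bar> \<le> 1 * 60"
    unfolding abs_mult using bump_bounds[of s] bump_bounds[of t] by (intro mult_mono) auto
  have pq': "\<bar>pbump' s * qbump t\<bar> \<le> 4 * 6"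
    unfolding abs_mult using bump_bounds[of s] bump_bounds[of t] by (intro mult_mono) auto
  have "4 / W \<le> 4 / (5 * \<delta> k)" using D W_pos by (intro divide_left_mono) auto
  then have "4 / W * \<bar>pbump' s * qbump t\<bar> \<le> 4 / (5 * \<delta> k) * 24"
    using pq' D W_pos by (intro mult_mono) auto
  then have 1: "\<bar>4 / W * pbump' s * qbump t\<bar> \<le> 20 / \<delta> k"
    using W_pos D by (simp add: abs_mult mult.assoc field_simps)
  have "\<bar>slope (Suc k)\<bar> * \<bar>pbump s * qbump' t\<bar> \<le> (2 * K) * 60"
    using slope_bound(3)[OF k] pq K by (intro mult_mono) auto
  then have 2: "\<bar>slope (Suc k) / \<delta> k * pbump s * qbump' t\<bar> \<le> 120 * K / \<delta> k"
    using D by (simp add: abs_mult mult.assoc field_simps)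
  have 3: "\<bar>1 / \<delta> k * pbump s * qbump' t\<bar> \<le> 60 / \<delta> k"
    using pq D by (simp add: abs_mult mult.assoc field_simps)
  have "norm (grad (bub k) p) \<le> \<bar>4 / W * pbump' s * qbump t - slope (Suc k) / \<delta> k * pbump s * qbump' t\<bar> + \<bar>1 / \<delta> k * pbump s * qbump' t\<bar>"
    unfolding b using norm_Pair_le[of "4 / W * pbump' s * qbump t - slope (Suc k) / \<delta> k * pbump s * qbump' t" "1 / \<delta> k * pbump s * qbump' t"]
    by (simp only: real_norm_def)
  also have "\<dots> \<le> 20 / \<delta> k + 120 * K / \<delta> k + 60 / \<delta> k" using 1 2 3 by linarith
  also have "\<dots> \<le> K1 / \<delta> k" using K D by (simp add: K1_def field_simps)
  finally show "norm (grad (bub k) p) \<le> K1 / \<delta> k" .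
qed

text \<open>The coefficients change at the edge. The terms with \<open>qbump\<close> have the
  primitive \<open>qint\<close>, zero at 0 and \<plusminus>1, and drop out on each side; those with
  \<open>qbump'\<close> contribute the value \<open>qbump 0 = 1\<close> from either side with
  opposite signs.\<close>

lemma slice_integral:
  assumes k: "Suc k < m" and x: "\<bar>x - (x0 + d/2)\<bar> < W/4"
    and i: "set_integrable lborel {0<..<1} f"
    and below: "\<And>y. ell (Suc k) x - \<delta> k < y \<Longrightarrow> y < ell (Suc k) x \<Longrightarrow> f y = C1 * qbump ((y - ell (Suc k) x) / \<delta> k) + E1 * qbump' ((y - ell (Suc k) x) / \<delta> k)"
    and above: "\<And>y. ell (Suc k) x < y \<Longrightarrow> y < ell (Suc k) x + \<delta> k \<Longrightarrow> f y = C2 * qbump ((y - ell (Suc k) x) / \<delta> k) + E2 * qbump' ((y - ell (Suc k) x) / \<delta> k)"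
    and off: "\<And>y. \<bar>y - ell (Suc k) x\<bar> \<ge> \<delta> k \<Longrightarrow> f y = 0"
  shows "(LINT y:{0<..<1}|lborel. f y) = (E1 - E2) * \<delta> k"
proof -
  define L where "L = ell (Suc k) x"
  define e where "e = \<delta> k"
  have e: "e > 0" "L - e > 0" "L + e < 1" using \<delta>[OF k] mid_gaps[OF k, of x] x by (auto simp: L_def e_def)
  define \<Phi> where "\<Phi> C E y = e * C * qint ((y - L) / e) + e * E * qbump ((y - L) / e)" for C E y
  have d\<Phi>: "(\<Phi> C E has_real_derivative C * qbump ((y - L) / e) + E * qbump' ((y - L) / e)) (at y)" for C E y
    unfolding \<Phi>_def using e
    by (auto intro!: derivative_eq_intros DERIV_chain2[OF has_real_derivative_qint] DERIV_chain2[OF has_real_derivative_qbump] simp: field_simps)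
  \<comment> \<open>A primitive across the edge: the added constant makes the two branches agree
    there, so the jump of the coefficients appears as the value at the upper end.\<close>
  define \<Psi> where "\<Psi> y = (if y \<le> L then \<Phi> C1 E1 y else \<Phi> C2 E2 y + (\<Phi> C1 E1 L - \<Phi> C2 E2 L))" for y
  have "(LINT y:{0<..<1}|lborel. f y) = \<Psi> 1 - \<Psi> 0"
  proof (rule LINT_derivative[OF i, of "{L, L - e, L + e}"])
    show "(\<Psi> has_real_derivative f y) (at y)" if "y \<in> {0<..<1} - {L, L - e, L + e}" for y
    proof (cases "y < L")
      case True
      have "(\<Phi> C1 E1 has_real_derivative f y) (at y)"
      proof (cases "L - e < y")
        case True
        then show ?thesis using d\<Phi>[of C1 E1 y] below[of y] \<open>y < L\<close> by (simp add: L_def e_def)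
      next
        case False
        then have "\<bar>(y - L) / e\<bar> \<ge> 1" "\<bar>y - L\<bar> \<ge> e" using e by (auto simp: field_simps)
        then show ?thesis using d\<Phi>[of C1 E1 y] off[of y] by (simp add: bump_outside L_def e_def)
      qed
      then show ?thesis
        by (rule has_field_derivative_transform_within_open[where S="{..<L}"]) (use True in \<open>auto simp: \<Psi>_def\<close>)
    next
      case False
      then have yL: "y > L" using that by auto
      have "(\<Phi> C2 E2 has_real_derivative f y) (at y)"
      proof (cases "y < L + e")
        case True
        then show ?thesis using d\<Phi>[of C2 E2 y] above[of y] yL by (simp add: L_def e_def)
      next
        case False
        then have "\<bar>(y - L) / e\<bar> \<ge> 1" "\<bar>y - L\<bar> \<ge> e" using e by (auto simp: field_simps)
        then show ?thesis using d\<Phi>[of C2 E2 y] off[of y] by (simp add: bump_outside L_def e_def)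
      qed
      then have "((\<lambda>y. \<Phi> C2 E2 y + (\<Phi> C1 E1 L - \<Phi> C2 E2 L)) has_real_derivative f y) (at y)"
        by (auto intro!: derivative_eq_intros)
      then show ?thesis
        by (rule has_field_derivative_transform_within_open[where S="{L<..}"]) (use yL in \<open>auto simp: \<Psi>_def\<close>)
    qed
    have c\<Phi>: "continuous_on S (\<Phi> C E)" for C E S
      using d\<Phi> by (meson DERIV_isCont continuous_at_imp_continuous_on)
    have "continuous_on ({..L} \<union> {L..}) \<Psi>"
      unfolding \<Psi>_def
      by (rule continuous_on_cases) (auto intro!: continuous_intros c\<Phi>)
    then show "continuous_on {0..1} \<Psi>" by (rule continuous_on_subset) auto
  qed auto
  also have "\<Psi> 1 = \<Phi> C1 E1 L - \<Phi> C2 E2 L"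
  proof -
    have "\<bar>(1 - L) / e\<bar> \<ge> 1" using e by (auto simp: field_simps)
    then show ?thesis using e by (simp add: \<Psi>_def \<Phi>_def[of C2 E2 1] bump_outside)
  qed
  also have "\<Psi> 0 = 0"
  proof -
    have "\<bar>(0 - L) / e\<bar> \<ge> 1" using e by (auto simp: field_simps)
    then show ?thesis using e unfolding \<Psi>_def \<Phi>_def by (simp add: bump_outside(1,2))
  qed
  also have "\<Phi> C1 E1 L - \<Phi> C2 E2 L - 0 = (E1 - E2) * e"
    by (simp add: \<Phi>_def bump_values algebra_simps)
  finally show ?thesis by (simp add: e_def)
qed

end

lemma abs_div_ge: "e > 0 \<Longrightarrow> \<bar>z\<bar> \<ge> e \<Longrightarrow> \<bar>z / e\<bar> \<ge> 1" for z e :: real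
  by (simp add: abs_divide)

lemma abs_div_le: "e > 0 \<Longrightarrow> \<bar>z\<bar> \<le> C * e \<Longrightarrow> \<bar>z / e\<bar> \<le> C" for z e C :: real
  by (simp add: abs_divide pos_divide_le_eq)

lemma norm_set_LINT_le:
  fixes F :: "point \<Rightarrow> real"
  assumes Z: "Z \<in> sets borel" "bounded Z" and b: "\<And>p. p \<in> Z \<Longrightarrow> \<bar>F p\<bar> \<le> B" and B: "B \<ge> 0"
    and i: "set_integrable lborel Z F"
  shows "\<bar>LINT p:Z|lborel. F p\<bar> \<le> B * measure lborel Z"
proof -
  have "\<bar>LINT p:Z|lborel. F p\<bar> \<le> (LINT p:Z|lborel. \<bar>F p\<bar>)"
    using set_integral_norm_bound[OF i] by simp
  also have "\<dots> \<le> (LINT p:Z|lborel. B)"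
    by (rule set_integral_mono[OF set_integrable_abs[OF i] set_integrable_bounded[where B=B]])
      (use b B Z in \<open>auto simp: set_borel_measurable_def\<close>)
  also have "\<dots> = B * measure lborel Z" by (simp add: set_lebesgue_integral_def)
  finally show ?thesis .
qed

context mesh_side
begin

lemma bub_off:
  assumes "Suc k < m" "\<bar>x - (x0 + d/2)\<bar> \<ge> W/4 \<or> \<bar>y - ell (Suc k) x\<bar> \<ge> \<delta> k"
  shows "\<bar>(x - (x0 + d/2)) / (W/4)\<bar> \<ge> 1 \<or> \<bar>(y - ell (Suc k) x) / \<delta> k\<bar> \<ge> 1"
proof -
  have "W / 4 > 0" using W_pos by simp
  then show ?thesis using assms(2) \<delta>(1)[OF assms(1)] abs_div_ge by blast
qed

lemma l_r: "0 < \<tau> x \<Longrightarrow> \<tau> x < 1 \<Longrightarrow> x \<in> {l<..<r}"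
  using inside[of x "1/2"] by (auto simp: D_def)

definition Ip :: real where "Ip = (LINT x:{l<..<r}|lborel. pbump ((x - (x0 + d/2)) / (W/4)))"

lemma pbump_integrable: "set_integrable lborel {l<..<r} (\<lambda>x. pbump ((x - (x0 + d/2)) / (W/4)))"
  by (rule set_integrable_bounded[where B=1])
    (use bump_bounds W_pos in \<open>auto intro!: set_borel_measurable_continuous continuous_intros\<close>)

text \<open>On the inner half of its support the cut-off is at least (3/4)^2 = 9/16, over a length
  W/4; this gives 9 W / 64, more than W/8.\<close>

lemma Ip_ge: "Ip \<ge> W / 8"
proof -
  let ?I = "{x0 + d/2 - W/8 .. x0 + d/2 + W/8}"
  have mid: "\<bar>x - (x0 + d/2)\<bar> \<le> W/8" if "x \<in> ?I" for x
    using that unfolding atLeastAtMost_iff abs_le_iff by linarith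
  have sub: "?I \<subseteq> {l<..<r}"
  proof
    fix x assume "x \<in> ?I"
    then have "\<bar>x - (x0 + d/2)\<bar> \<le> W/4" using mid[of x] W_pos by linarith
    from mid_range[OF this] show "x \<in> {l<..<r}" by (intro l_r) auto
  qed
  have "W / 8 \<le> 9/16 * (W / 4)" using W_pos by simp
  also have "\<dots> = (LINT x:?I|lborel. 9/16)"
    using W_pos by (simp add: set_lebesgue_integral_def)
  also have "\<dots> \<le> (LINT x:?I|lborel. pbump ((x - (x0 + d/2)) / (W/4)))"
  proof (rule set_integral_mono)
    show "set_integrable lborel ?I (\<lambda>x. 9/16 :: real)"
      by (rule set_integrable_bounded[where B=1]) (auto simp: set_borel_measurable_def)
    show "set_integrable lborel ?I (\<lambda>x. pbump ((x - (x0 + d/2)) / (W/4)))"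
      by (rule set_integrable_subset[OF pbump_integrable _ sub]) auto
    fix x assume "x \<in> ?I"
    define s where "s = (x - (x0 + d/2)) / (W/4)"
    have "\<bar>s\<bar> \<le> 1/2" unfolding s_def using mid[OF \<open>x \<in> ?I\<close>] W_pos by (intro abs_div_le) auto
    then have "s\<^sup>2 \<le> (1/2)\<^sup>2" by (rule sq_le_of_abs_le)
    then have "3/4 \<le> 1 - s\<^sup>2" by (simp add: power2_eq_square)
    then have "(3/4)\<^sup>2 \<le> (max 0 (1 - s\<^sup>2))\<^sup>2" by (intro power_mono) auto
    then show "9/16 \<le> pbump ((x - (x0 + d/2)) / (W/4))"
      unfolding s_def[symmetric] pbump_def sqpos_def by (simp add: power2_eq_square)
  qed
  also have "\<dots> \<le> Ip" unfolding Ip_def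
    by (rule set_LINT_mono_subset[OF pbump_integrable sub]) (use bump_bounds in auto)
  finally show ?thesis .
qed

text \<open>The coefficients of \<open>qbump\<close> may depend on x, since they disappear slice by
  slice. The same formula thus serves the flux, where the derivative of the horizontal cut-off
  enters there, and the reaction term.\<close>

lemma bubble_Fubini:
  assumes k: "Suc k < m" and i: "set_integrable lborel D f"
    and below: "\<And>x y. \<bar>x - (x0 + d/2)\<bar> < W/4 \<Longrightarrow> ell (Suc k) x - \<delta> k < y \<Longrightarrow> y < ell (Suc k) x \<Longrightarrow>
      f (x, y) = Cb x * qbump ((y - ell (Suc k) x) / \<delta> k) + Eb * pbump ((x - (x0 + d/2)) / (W/4)) * qbump' ((y - ell (Suc k) x) / \<delta> k)"
    and above: "\<And>x y. \<bar>x - (x0 + d/2)\<bar> < W/4 \<Longrightarrow> ell (Suc k) x < y \<Longrightarrow> y < ell (Suc k) x + \<delta> k \<Longrightarrow>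
      f (x, y) = Ca x * qbump ((y - ell (Suc k) x) / \<delta> k) + Ea * pbump ((x - (x0 + d/2)) / (W/4)) * qbump' ((y - ell (Suc k) x) / \<delta> k)"
    and off: "\<And>x y. \<bar>x - (x0 + d/2)\<bar> \<ge> W/4 \<or> \<bar>y - ell (Suc k) x\<bar> \<ge> \<delta> k \<Longrightarrow> f (x, y) = 0"
  shows "(LINT p:D|lborel. f p) = (Eb - Ea) * \<delta> k * Ip"
proof -
  have i': "set_integrable lborel ({l<..<r} \<times> {0<..<1}) f" using i by (simp add: D_def)
  have "(LINT p:D|lborel. f p) = (LINT x:{l<..<r}|lborel. LINT y:{0<..<1}|lborel. f (x, y))"
    unfolding D_def by (rule set_integral_rectangle_fst(1)[OF i'])
  also have "\<dots> = (LINT x:{l<..<r}|lborel. (Eb - Ea) * \<delta> k * pbump ((x - (x0 + d/2)) / (W/4)))"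
  proof (rule set_LINT_cong_AE)
    show "AE x in lborel. x \<in> {l<..<r} \<longrightarrow>
      (LINT y:{0<..<1}|lborel. f (x, y)) = (Eb - Ea) * \<delta> k * pbump ((x - (x0 + d/2)) / (W/4))"
      using set_integral_rectangle_fst(3)[OF i']
    proof eventually_elim
      case (elim x)
      show ?case
      proof
        assume x: "x \<in> {l<..<r}"
        show "(LINT y:{0<..<1}|lborel. f (x, y)) = (Eb - Ea) * \<delta> k * pbump ((x - (x0 + d/2)) / (W/4))"
        proof (cases "\<bar>x - (x0 + d/2)\<bar> < W/4")
          case True
          show ?thesis
            using slice_integral[OF k True, of "\<lambda>y. f (x, y)" "Cb x" "Eb * pbump ((x - (x0 + d/2)) / (W/4))"
                "Ca x" "Ea * pbump ((x - (x0 + d/2)) / (W/4))"] elim x below[OF True] above[OF True] off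
            by (simp add: algebra_simps)
        next
          case False
          then have "f (x, y) = 0" for y using off by simp
          moreover have "\<bar>(x - (x0 + d/2)) / (W/4)\<bar> \<ge> 1"
            using False W_pos by (intro abs_div_ge) auto
          then have "pbump ((x - (x0 + d/2)) / (W/4)) = 0" by (rule bump_outside)
          ultimately show ?thesis by (simp add: set_lebesgue_integral_def)
        qed
      qed
    qed
    show "set_borel_measurable lborel {l<..<r} (\<lambda>x. LINT y:{0<..<1}|lborel. f (x, y))"
      using set_integral_rectangle_fst(2)[OF i'] by (auto simp: set_integrable_def set_borel_measurable_def)
    show "set_borel_measurable lborel {l<..<r} (\<lambda>x. (Eb - Ea) * \<delta> k * pbump ((x - (x0 + d/2)) / (W/4)))"
      using W_pos by (intro set_borel_measurable_continuous continuous_intros) auto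
  qed
  also have "\<dots> = (Eb - Ea) * \<delta> k * Ip" unfolding Ip_def by simp
  finally show ?thesis .
qed

text \<open>What survives is the jump of the flux across the edge. Continuity along the edge makes
  the jump of the horizontal component equal to minus slope times \<beta>, so that both components
  add up with the same sign to the factor 1 + slope^2.\<close>

lemma bubble_flux:
  assumes k: "Suc k < m"
  shows "(LINT p:D|lborel. G p \<bullet> grad (bub k) p) = - (1 + (slope (Suc k))\<^sup>2) * \<beta> k * Ip"
proof -
  let ?s = "slope (Suc k)"
  define p' where "p' x = 4 / W * pbump' ((x - (x0 + d/2)) / (W/4))" for x
  have "(LINT p:D|lborel. G p \<bullet> grad (bub k) p) = ((b k - a k * ?s) / \<delta> k - (b (Suc k) - a (Suc k) * ?s) / \<delta> k) * \<delta> k * Ip"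
  proof (rule bubble_Fubini[OF k, where Cb="\<lambda>x. a k * p' x" and Ca="\<lambda>x. a (Suc k) * p' x"])
    show "set_integrable lborel D (\<lambda>p. G p \<bullet> grad (bub k) p)"
      using h_test_integrable(2) bub_grad(3)[OF k] by blast
  next
    fix x y assume x: "\<bar>x - (x0 + d/2)\<bar> < W/4" and y: "ell (Suc k) x - \<delta> k < y" "y < ell (Suc k) x"
    have "G (x, y) = (a k, b k)"
      by (rule G_tri) (use mid_range[of x] mid_gaps[OF k, of x] k x y in auto)
    then show "G (x, y) \<bullet> grad (bub k) (x, y) = a k * p' x * qbump ((y - ell (Suc k) x) / \<delta> k) +
      (b k - a k * ?s) / \<delta> k * pbump ((x - (x0 + d/2)) / (W/4)) * qbump' ((y - ell (Suc k) x) / \<delta> k)"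
      using \<delta>(1)[OF k] unfolding bub_grad(1)[OF k] p'_def
      by (simp only: inner_Pair inner_real_def) (simp add: field_simps)
  next
    fix x y assume x: "\<bar>x - (x0 + d/2)\<bar> < W/4" and y: "ell (Suc k) x < y" "y < ell (Suc k) x + \<delta> k"
    have "G (x, y) = (a (Suc k), b (Suc k))"
      by (rule G_tri) (use mid_range[of x] mid_gaps[OF k, of x] k x y in auto)
    then show "G (x, y) \<bullet> grad (bub k) (x, y) = a (Suc k) * p' x * qbump ((y - ell (Suc k) x) / \<delta> k) +
      (b (Suc k) - a (Suc k) * ?s) / \<delta> k * pbump ((x - (x0 + d/2)) / (W/4)) * qbump' ((y - ell (Suc k) x) / \<delta> k)"
      using \<delta>(1)[OF k] unfolding bub_grad(1)[OF k] p'_def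
      by (simp only: inner_Pair inner_real_def) (simp add: field_simps)
  next
    fix x y assume "\<bar>x - (x0 + d/2)\<bar> \<ge> W/4 \<or> \<bar>y - ell (Suc k) x\<bar> \<ge> \<delta> k"
    then have "\<bar>(x - (x0 + d/2)) / (W/4)\<bar> \<ge> 1 \<or> \<bar>(y - ell (Suc k) x) / \<delta> k\<bar> \<ge> 1"
      by (rule bub_off[OF k])
    then show "G (x, y) \<bullet> grad (bub k) (x, y) = 0"
      unfolding bub_grad(1)[OF k] by (auto simp: bump_outside inner_prod_def)
  qed
  also have "((b k - a k * ?s) / \<delta> k - (b (Suc k) - a (Suc k) * ?s) / \<delta> k) * \<delta> k = - \<beta> k + (a (Suc k) - a k) * ?s"
    using \<delta>(1)[OF k] by (simp add: \<beta>_def field_simps)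
  also have "\<dots> = - (1 + ?s\<^sup>2) * \<beta> k"
    unfolding jump[OF k] \<beta>_def by (simp add: power2_eq_square algebra_simps)
  finally show ?thesis .
qed

text \<open>Subtracting an elementwise constant from the reaction costs nothing, as the bubble has
  mean zero on each side of the edge. Only oscillations remain, on a support of area
  \<open>W * \<delta> k\<close>.\<close>

lemma bubble_source:
  assumes k: "Suc k < m"
  shows "\<bar>LINT p:D|lborel. h p * bub k p\<bar> \<le> 6 * (oc k + oc (Suc k)) * (W * \<delta> k)"
proof -
  define H where "H p = (if snd p \<le> ell (Suc k) (fst p) then c k else c (Suc k))" for p
  have Hm [measurable]: "H \<in> borel_measurable borel"
  proof -
    have cl: "{p :: point. snd p \<le> ell (Suc k) (fst p)} \<in> sets borel"
      unfolding ell_slope by (intro borel_closed closed_Collect_le continuous_intros)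
    have "(\<lambda>p. if p \<in> {p :: point. snd p \<le> ell (Suc k) (fst p)} then c k else c (Suc k)) \<in> borel_measurable borel"
      by (intro borel_measurable_continuous_on_if[OF cl] continuous_on_const)
    then show ?thesis by (simp add: H_def[abs_def])
  qed
  note test = bub_grad(3)[OF k]
  have bc: "bub k \<in> borel_measurable borel"
    using test_functionE[OF test] borel_measurable_continuous_onI by metis
  define Hb where "Hb = max \<bar>c k\<bar> \<bar>c (Suc k)\<bar>"
  have iH: "set_integrable lborel D (\<lambda>p. H p * bub k p)"
  proof (rule set_integrable_bounded[where B="Hb * 6"])
    show "set_borel_measurable lborel D (\<lambda>p. H p * bub k p)"
      using bc by (intro set_borel_measurable_borel) auto
    show "norm (H p * bub k p) \<le> Hb * 6" for p
      unfolding real_norm_def abs_mult using bub_bounds(2)[OF k, of p]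
      by (intro mult_mono) (auto simp: Hb_def H_def)
  qed auto
  have zero: "(LINT p:D|lborel. H p * bub k p) = (0 - 0) * \<delta> k * Ip"
  proof (rule bubble_Fubini[OF k iH, where Cb="\<lambda>x. c k * pbump ((x - (x0 + d/2)) / (W/4))" and Ca="\<lambda>x. c (Suc k) * pbump ((x - (x0 + d/2)) / (W/4))"])
    fix x y assume "\<bar>x - (x0 + d/2)\<bar> \<ge> W/4 \<or> \<bar>y - ell (Suc k) x\<bar> \<ge> \<delta> k"
    then have "\<bar>(x - (x0 + d/2)) / (W/4)\<bar> \<ge> 1 \<or> \<bar>(y - ell (Suc k) x) / \<delta> k\<bar> \<ge> 1"
      by (rule bub_off[OF k])
    then show "H (x, y) * bub k (x, y) = 0"
      unfolding bub_grad(2)[OF k] by (auto simp: bump_outside)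
  qed (auto simp: H_def bub_grad(2)[OF k])
  have ih1: "set_integrable lborel D (\<lambda>p. h p * bub k p)" by (rule h_test_integrable(1)[OF test])
  have Zb: "Zs k \<in> sets borel" "bounded (Zs k)"
    using Zs_props(1)[OF k] compact_imp_bounded by (auto intro: borel_closed compact_imp_closed)
  have id: "set_integrable lborel D (\<lambda>p. h p * bub k p - H p * bub k p)"
    by (rule set_integral_diff(1)[OF ih1 iH])
  have "(LINT p:D|lborel. h p * bub k p) = (LINT p:D|lborel. h p * bub k p - H p * bub k p)"
    using zero by (simp add: set_integral_diff(2)[OF ih1 iH])
  also have "\<dots> = (LINT p:Zs k|lborel. h p * bub k p - H p * bub k p)"
    by (rule set_LINT_mono_set[OF Zs_props(2)[OF k]]) (use bub_grad(4)[OF k] in auto)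
  finally have "(LINT p:D|lborel. h p * bub k p) = (LINT p:Zs k|lborel. h p * bub k p - H p * bub k p)" .
  moreover have "\<bar>LINT p:Zs k|lborel. h p * bub k p - H p * bub k p\<bar> \<le> (6 * (oc k + oc (Suc k))) * measure lborel (Zs k)"
  proof (rule norm_set_LINT_le[OF Zb])
    show "set_integrable lborel (Zs k) (\<lambda>p. h p * bub k p - H p * bub k p)"
      by (rule set_integrable_subset[OF id _ Zs_props(2)[OF k]]) (use Zb in auto)
    show "0 \<le> 6 * (oc k + oc (Suc k))" using osc0 k by (simp add: add_nonneg_nonneg)
    fix p assume p: "p \<in> Zs k"
    then have pD: "p \<in> D" using Zs_props(2)[OF k] by auto
    have x: "\<bar>fst p - (x0 + d/2)\<bar> \<le> W/4" "\<bar>snd p - ell (Suc k) (fst p)\<bar> \<le> \<delta> k" using p by (auto simp only: Zs_iff)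
    note t = mid_range[OF x(1)] and g = mid_gaps(1,2)[OF k x(1)]
    have o: "0 \<le> oc k" "0 \<le> oc (Suc k)" using osc0 k by auto
    have hH: "\<bar>h p - H p\<bar> \<le> oc k + oc (Suc k)"
    proof (cases "snd p \<le> ell (Suc k) (fst p)")
      case True
      then have "p \<in> tri k" using t g x by (auto simp: tri_def)
      then show ?thesis using h_tri[of k p] k pD True o by (simp add: H_def)
    next
      case False
      then have "p \<in> tri (Suc k)" using t g x by (auto simp: tri_def)
      then show ?thesis using h_tri[of "Suc k" p] k pD False o by (simp add: H_def)
    qed
    have "\<bar>h p * bub k p - H p * bub k p\<bar> = \<bar>bub k p\<bar> * \<bar>h p - H p\<bar>"
      by (simp add: abs_mult[symmetric] algebra_simps)
    also have "\<dots> \<le> 6 * (oc k + oc (Suc k))" using hH bub_bounds(2)[OF k, of p] by (intro mult_mono) auto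
    finally show "\<bar>h p * bub k p - H p * bub k p\<bar> \<le> 6 * (oc k + oc (Suc k))" .
  qed
  ultimately show ?thesis unfolding Zs_props(3)[OF k] by simp
qed

text \<open>256 = 16 * 16 and 9216 = 16 * 576 are the coefficients of the error after absorption;
  9216 = 2 * 4608 also covers the oscillations.\<close>

definition C1 :: real where "C1 = 256 * K1\<^sup>2 + 9216"

lemma bubble_estimate:
  assumes k: "Suc k < m"
  shows "\<epsilon>\<^sup>2 * W * \<delta> k * (\<beta> k)\<^sup>2 \<le> C1 * ((LINT p:Zs k|lborel. R2 p) + W * sz k * (os k)\<^sup>2 + W * sz (Suc k) * (os (Suc k))\<^sup>2)"
proof -
  note D = \<delta>[OF k]
  define A where "A = \<bar>\<beta> k\<bar>"
  define X where "X = \<epsilon>\<^sup>2 * A\<^sup>2 * W"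
  define I where "I = (LINT p:Zs k|lborel. R2 p)"
  define O' where "O' = oc k + oc (Suc k)"
  define s where "s = slope (Suc k)"
  have A0: "A \<ge> 0" by (simp add: A_def)
  have I0: "I \<ge> 0" unfolding I_def by (rule set_LINT_nonneg) (simp add: R2_def)
  have O0: "O' \<ge> 0" using osc0 k by (simp add: O'_def add_nonneg_nonneg)
  have K1: "K1 > 0" using K by (simp add: K1_def)
  have Zb: "Zs k \<in> sets borel" using Zs_props(1)[OF k] by (auto intro: borel_closed compact_imp_closed)
  \<comment> \<open>The weight 1/(32 \<delta>) turns the absorbable term into X/32, because the
    support has area W \<delta>. The reaction contributes another X/32, and the flux is worth at
    least X/8 by \<open>Ip_ge\<close>, so that X/16 is left.\<close>
  have Y: "A * (LINT p:D|lborel. \<epsilon> * P p * norm (grad (bub k) p) + Q p * \<bar>bub k p\<bar>)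
    \<le> 1 / (32 * \<delta> k) * \<epsilon>\<^sup>2 * A\<^sup>2 * measure lborel (Zs k)
      + ((K1 / \<delta> k)\<^sup>2 / (2 * (1 / (32 * \<delta> k))) + 6\<^sup>2 / (2 * (1 / (32 * \<delta> k)) * \<epsilon>\<^sup>2)) * (LINT p:Zs k|lborel. R2 p)"
    by (rule residual_Young[OF bub_grad(3)[OF k] Zb Zs_props(2)[OF k] bub_grad(4)[OF k] A0])
      (use K1 D bub_bounds[OF k] in auto)
  also have "\<dots> = X / 32 + (16 * K1\<^sup>2 / \<delta> k + 576 * \<delta> k / \<epsilon>\<^sup>2) * I"
    unfolding Zs_props(3)[OF k] I_def[symmetric] X_def
    using D eps by (simp add: field_simps power2_eq_square)
  finally have Y: "A * (LINT p:D|lborel. \<epsilon> * P p * norm (grad (bub k) p) + Q p * \<bar>bub k p\<bar>)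
    \<le> X / 32 + (16 * K1\<^sup>2 / \<delta> k + 576 * \<delta> k / \<epsilon>\<^sup>2) * I" .
  have S: "A * (6 * O' * (W * \<delta> k)) \<le> X / 32 + 288 * W * (\<delta> k * O' / \<epsilon>)\<^sup>2"
  proof -
    have "A * (6 * O' * (W * \<delta> k)) = W * ((\<epsilon> * A) * (6 * (\<delta> k * O' / \<epsilon>)))" using eps by simp
    also have "\<dots> \<le> W * (1/16 * (\<epsilon> * A)\<^sup>2 / 2 + (6 * (\<delta> k * O' / \<epsilon>))\<^sup>2 / (2 * (1/16)))"
      using W_pos by (intro mult_left_mono Young_weighted) auto
    also have "\<dots> = X / 32 + 288 * W * (\<delta> k * O' / \<epsilon>)\<^sup>2"
      unfolding X_def power_mult_distrib by (simp add: algebra_simps)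
    finally show ?thesis .
  qed
  have "X / 8 = A * (\<epsilon>\<^sup>2 * (A * (W / 8)))" by (simp add: X_def power2_eq_square)
  also have "\<dots> \<le> A * (\<epsilon>\<^sup>2 * (A * ((1 + s\<^sup>2) * Ip)))"
  proof -
    have "W / 8 \<le> 1 * Ip" using Ip_ge by simp
    also have "\<dots> \<le> (1 + s\<^sup>2) * Ip" using Ip_ge W_pos by (intro mult_right_mono) auto
    finally show ?thesis using A0 by (intro mult_left_mono) auto
  qed
  also have "\<epsilon>\<^sup>2 * (A * ((1 + s\<^sup>2) * Ip)) = \<bar>\<epsilon>\<^sup>2 * (LINT p:D|lborel. G p \<bullet> grad (bub k) p)\<bar>"
  proof -
    have "Ip \<ge> 0" using Ip_ge W_pos by simp
    moreover have "1 + s\<^sup>2 \<ge> 0" by (simp add: add_nonneg_nonneg)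
    ultimately show ?thesis
      unfolding bubble_flux[OF k] s_def[symmetric] A_def
      by (simp only: abs_mult abs_minus_cancel abs_of_nonneg abs_power2 mult_ac)
  qed
  also have "\<dots> \<le> (LINT p:D|lborel. \<epsilon> * P p * norm (grad (bub k) p) + Q p * \<bar>bub k p\<bar>) + 6 * O' * (W * \<delta> k)"
    using residual[OF bub_grad(3)[OF k]] bubble_source[OF k] unfolding O'_def by linarith
  finally have "X / 8 \<le> A * ((LINT p:D|lborel. \<epsilon> * P p * norm (grad (bub k) p) + Q p * \<bar>bub k p\<bar>) + 6 * O' * (W * \<delta> k))"
    using A0 by (simp add: mult_left_mono)
  also have "\<dots> \<le> (X / 32 + (16 * K1\<^sup>2 / \<delta> k + 576 * \<delta> k / \<epsilon>\<^sup>2) * I) + (X / 32 + 288 * W * (\<delta> k * O' / \<epsilon>)\<^sup>2)"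
    unfolding distrib_left using Y S by (rule add_mono)
  finally have "X \<le> 16 * ((16 * K1\<^sup>2 / \<delta> k + 576 * \<delta> k / \<epsilon>\<^sup>2) * I) + 16 * (288 * W * (\<delta> k * O' / \<epsilon>)\<^sup>2)" by linarith
  then have "X \<le> 16 * (16 * K1\<^sup>2 / \<delta> k + 576 * \<delta> k / \<epsilon>\<^sup>2) * I + 4608 * W * (\<delta> k * O' / \<epsilon>)\<^sup>2"
    by (simp only: mult.assoc)
  from mult_left_mono[OF this, of "\<delta> k"]
  have "\<delta> k * X \<le> \<delta> k * (16 * (16 * K1\<^sup>2 / \<delta> k + 576 * \<delta> k / \<epsilon>\<^sup>2) * I + 4608 * W * (\<delta> k * O' / \<epsilon>)\<^sup>2)" using D by simp
  also have "\<dots> = (256 * K1\<^sup>2 + 9216 * (\<delta> k / \<epsilon>)\<^sup>2) * I + 4608 * W * (\<delta> k * (\<delta> k * O' / \<epsilon>)\<^sup>2)"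
    using D eps by (simp add: power_divide power2_eq_square field_simps)
  also have "\<dots> \<le> C1 * I + C1 * (W * sz k * (os k)\<^sup>2 + W * sz (Suc k) * (os (Suc k))\<^sup>2)"
  proof (rule add_mono)
    have "(\<delta> k / \<epsilon>)\<^sup>2 \<le> 1" using D eps by (simp add: power_le_one)
    then show "(256 * K1\<^sup>2 + 9216 * (\<delta> k / \<epsilon>)\<^sup>2) * I \<le> C1 * I"
      unfolding C1_def using I0 by (intro mult_right_mono) auto
    \<comment> \<open>The half-height is bounded by both \<epsilon> and W, so
      \<open>osc_scaled\<close> converts (\<delta>/\<epsilon>) times an oscillation into a weighted
      one.\<close>
    have W: "\<delta> k \<le> W" using D W_pos by linarith
    have o: "0 \<le> \<delta> k / \<epsilon> * oc k" "\<delta> k / \<epsilon> * oc k \<le> os k" "0 \<le> \<delta> k / \<epsilon> * oc (Suc k)" "\<delta> k / \<epsilon> * oc (Suc k) \<le> os (Suc k)"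
      using osc_scaled[of k "\<delta> k"] osc_scaled[of "Suc k" "\<delta> k"] D W k eps osc0[of k] osc0[of "Suc k"] by auto
    have "\<delta> k * O' / \<epsilon> \<le> os k + os (Suc k)" "0 \<le> \<delta> k * O' / \<epsilon>"
      using o by (auto simp: O'_def distrib_left add_divide_distrib)
    then have "(\<delta> k * O' / \<epsilon>)\<^sup>2 \<le> (os k + os (Suc k))\<^sup>2" by (intro power_mono)
    also have "\<dots> \<le> 2 * (os k)\<^sup>2 + 2 * (os (Suc k))\<^sup>2"
      using zero_le_power2[of "os k - os (Suc k)"] by (simp add: power2_eq_square algebra_simps)
    finally have "\<delta> k * (\<delta> k * O' / \<epsilon>)\<^sup>2 \<le> \<delta> k * (2 * (os k)\<^sup>2 + 2 * (os (Suc k))\<^sup>2)"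
      using D by (intro mult_left_mono) auto
    also have "\<dots> \<le> 2 * (sz k * (os k)\<^sup>2 + sz (Suc k) * (os (Suc k))\<^sup>2)"
    proof -
      have "\<delta> k \<le> sz k" "\<delta> k \<le> sz (Suc k)" using D by linarith+
      then have "\<delta> k * (os k)\<^sup>2 \<le> sz k * (os k)\<^sup>2" "\<delta> k * (os (Suc k))\<^sup>2 \<le> sz (Suc k) * (os (Suc k))\<^sup>2"
        by (auto intro: mult_right_mono)
      then show ?thesis by (simp add: algebra_simps)
    qed
    finally have "4608 * W * (\<delta> k * (\<delta> k * O' / \<epsilon>)\<^sup>2) \<le> 4608 * W * (2 * (sz k * (os k)\<^sup>2 + sz (Suc k) * (os (Suc k))\<^sup>2))"
      using W_pos by (intro mult_left_mono) auto
    also have "\<dots> = 9216 * (W * sz k * (os k)\<^sup>2 + W * sz (Suc k) * (os (Suc k))\<^sup>2)" by (simp add: algebra_simps)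
    also have "\<dots> \<le> C1 * (W * sz k * (os k)\<^sup>2 + W * sz (Suc k) * (os (Suc k))\<^sup>2)"
      unfolding C1_def using W_pos sz_pos[of k] sz_pos[of "Suc k"] k
      by (intro mult_right_mono) (auto intro!: add_nonneg_nonneg mult_nonneg_nonneg)
    finally show "4608 * W * (\<delta> k * (\<delta> k * O' / \<epsilon>)\<^sup>2) \<le> C1 * (W * sz k * (os k)\<^sup>2 + W * sz (Suc k) * (os (Suc k))\<^sup>2)" .
  qed
  finally show ?thesis unfolding X_def I_def A_def by (simp add: algebra_simps)
qed

text \<open>Disjoint supports add up to one error integral over \<open>D\<close>. Each element lies
  below one long edge and above another, whence the factor 2 of the oscillations.\<close>

lemma bubble_sum:
  "(\<Sum>k | Suc k < m. \<epsilon>\<^sup>2 * W * \<delta> k * (\<beta> k)\<^sup>2) \<le> C1 * ((LINT p:D|lborel. R2 p) + 2 * (\<Sum>k<m. W * sz k * (os k)\<^sup>2))"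
proof -
  let ?J = "{k. Suc k < m}"
  have J: "finite ?J" "?J \<subseteq> {..<m}" "Suc ` ?J \<subseteq> {..<m}" by (auto intro: finite_subset[of _ "{..<m}"])
  have C10: "C1 \<ge> 0" by (simp add: C1_def)
  have nn: "0 \<le> W * sz k * (os k)\<^sup>2" if "k < m" for k using W_pos sz_pos[OF that] by auto
  have Zb: "Zs k \<in> sets borel" if "Suc k < m" for k
    using Zs_props(1)[OF that] by (auto intro: borel_closed compact_imp_closed)
  have iZ: "set_integrable lborel (Zs k) R2" if "Suc k < m" for k
    by (rule set_integrable_subset[OF iR2]) (use Zb Zs_props that in auto)
  have "(\<Sum>k\<in>?J. LINT p:Zs k|lborel. R2 p) = (LINT p:(\<Union>k\<in>?J. Zs k)|lborel. R2 p)"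
  proof (rule set_integral_finite_Union[symmetric])
    show "disjoint_family_on Zs ?J"
      unfolding disjoint_family_on_def using Zs_disjoint by (metis Int_commute linorder_neqE_nat mem_Collect_eq)
  qed (use J iZ Zb in auto)
  also have "\<dots> \<le> (LINT p:D|lborel. R2 p)"
  proof (rule set_LINT_mono_subset[OF iR2])
    show "(\<Union>k\<in>?J. Zs k) \<in> sets borel" using J Zb by (intro sets.finite_UN) auto
    show "(\<Union>k\<in>?J. Zs k) \<subseteq> D" using Zs_props by blast
  qed (simp add: R2_def)
  finally have 1: "(\<Sum>k\<in>?J. LINT p:Zs k|lborel. R2 p) \<le> (LINT p:D|lborel. R2 p)" .
  have 2: "(\<Sum>k\<in>?J. W * sz k * (os k)\<^sup>2) \<le> (\<Sum>k<m. W * sz k * (os k)\<^sup>2)"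
    by (rule sum_mono2) (use J nn in auto)
  have "(\<Sum>k\<in>?J. W * sz (Suc k) * (os (Suc k))\<^sup>2) = (\<Sum>k\<in>Suc ` ?J. W * sz k * (os k)\<^sup>2)"
    by (subst sum.reindex) auto
  also have "\<dots> \<le> (\<Sum>k<m. W * sz k * (os k)\<^sup>2)"
    by (rule sum_mono2) (use J nn in auto)
  finally have 3: "(\<Sum>k\<in>?J. W * sz (Suc k) * (os (Suc k))\<^sup>2) \<le> (\<Sum>k<m. W * sz k * (os k)\<^sup>2)" .
  have "(\<Sum>k\<in>?J. \<epsilon>\<^sup>2 * W * \<delta> k * (\<beta> k)\<^sup>2) \<le> (\<Sum>k\<in>?J. C1 * ((LINT p:Zs k|lborel. R2 p) + W * sz k * (os k)\<^sup>2 + W * sz (Suc k) * (os (Suc k))\<^sup>2))"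
    by (intro sum_mono bubble_estimate) auto
  also have "\<dots> = C1 * ((\<Sum>k\<in>?J. LINT p:Zs k|lborel. R2 p) + (\<Sum>k\<in>?J. W * sz k * (os k)\<^sup>2) + (\<Sum>k\<in>?J. W * sz (Suc k) * (os (Suc k))\<^sup>2))"
    by (simp add: sum_distrib_left[symmetric] sum.distrib)
  also have "\<dots> \<le> C1 * ((LINT p:D|lborel. R2 p) + 2 * (\<Sum>k<m. W * sz k * (os k)\<^sup>2))"
    using 1 2 3 C10 by (intro mult_left_mono) auto
  finally show ?thesis .
qed

end

section \<open>Jumps near the line\<close>

lemma sum_square_le_card:
  fixes f :: "'a \<Rightarrow> real"
  assumes "finite A"
  shows "(\<Sum>i\<in>A. f i)\<^sup>2 \<le> real (card A) * (\<Sum>i\<in>A. (f i)\<^sup>2)"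
proof -
  have "(\<Sum>i\<in>A. 1 * f i)\<^sup>2 \<le> (\<Sum>i\<in>A. 1\<^sup>2) * (\<Sum>i\<in>A. (f i)\<^sup>2)"
    by (rule Cauchy_Schwarz_ineq_sum)
  then show ?thesis by simp
qed

section \<open>Variation of the gradient around the nodes of the near line\<close>

context mesh_side
begin

text \<open>Elements with their short edge on the near line; they index the mesh edges of that
  line.\<close>

definition Eg :: "nat set" where "Eg = {k. k < m \<and> N k < N (Suc k)}"

text \<open>Long edges ending at the node of height \<open>y\<close>, each indexed by the element
  below it. The edges on the bottom and top of the square, 0 and \<open>m\<close>, are left
  out.\<close>

definition fan :: "real \<Rightarrow> nat set" where "fan y = {i. Suc i < m \<and> N (Suc i) = y}"
text \<open>Total variation of the vertical gradient component around a node, on one side of the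
  line; \<open>\<Gamma>n\<close> is its counterpart for the horizontal component, whose jumps carry
  the slope.\<close>

definition Bn :: "real \<Rightarrow> real" where "Bn y = (\<Sum>i\<in>fan y. \<bar>\<beta> i\<bar>)"
definition \<Gamma>n :: "real \<Rightarrow> real" where "\<Gamma>n y = (\<Sum>i\<in>fan y. \<bar>slope (Suc i) * \<beta> i\<bar>)"
definition Bs :: "nat \<Rightarrow> real" where "Bs k = Bn (N k) + Bn (N (Suc k))"
definition \<Gamma>s :: "nat \<Rightarrow> real" where "\<Gamma>s k = \<Gamma>n (N k) + \<Gamma>n (N (Suc k))"
definition touch :: "nat \<Rightarrow> nat set"
  where "touch k = {j. j < m \<and> {N j, N (Suc j)} \<inter> {N k, N (Suc k)} \<noteq> {}}"
definition On :: "nat \<Rightarrow> real" where "On k = (\<Sum>j\<in>touch k. oc j)"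

lemma finite_sets [simp]: "finite (fan y)" "finite (touch k)" "finite Eg"
  by (auto simp: fan_def touch_def Eg_def intro: finite_subset[of _ "{..<m}"])

lemma Bn_nonneg: "Bn y \<ge> 0" "\<Gamma>n y \<ge> 0" "Bs k \<ge> 0" "\<Gamma>s k \<ge> 0"
  by (auto simp: Bn_def \<Gamma>n_def Bs_def \<Gamma>s_def intro!: sum_nonneg add_nonneg_nonneg)

lemma On_nonneg: "On k \<ge> 0"
  unfolding On_def by (rule sum_nonneg) (auto simp: touch_def osc0)

text \<open>Passing from element \<open>i\<close> to element \<open>j\<close> around one node
  crosses only edges of the fan of that node, and the jumps telescope.\<close>

lemma fan_path:
  assumes "i \<le> j" "j < m" "\<And>k. i \<le> k \<Longrightarrow> k < j \<Longrightarrow> N (Suc k) = y"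
  shows "\<bar>b j - b i\<bar> \<le> Bn y" "\<bar>a j - a i\<bar> \<le> \<Gamma>n y"
proof -
  have sub: "{i..<j} \<subseteq> fan y" using assms by (auto simp: fan_def)
  have "b j - b i = (\<Sum>k=i..<j. \<beta> k)"
    using assms(1) by (simp add: \<beta>_def sum_Suc_diff')
  then have "\<bar>b j - b i\<bar> \<le> (\<Sum>k=i..<j. \<bar>\<beta> k\<bar>)" by (simp add: sum_abs)
  also have "\<dots> \<le> Bn y" unfolding Bn_def by (rule sum_mono2[OF _ sub]) auto
  finally show "\<bar>b j - b i\<bar> \<le> Bn y" .
  have "a j - a i = (\<Sum>k=i..<j. a (Suc k) - a k)"
    using assms(1) by (simp add: sum_Suc_diff')
  also have "\<dots> = (\<Sum>k=i..<j. - (slope (Suc k) * \<beta> k))"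
    by (rule sum.cong) (use jump assms(2) in \<open>auto simp: \<beta>_def\<close>)
  finally have "\<bar>a j - a i\<bar> \<le> (\<Sum>k=i..<j. \<bar>slope (Suc k) * \<beta> k\<bar>)"
    using sum_abs[of "\<lambda>k. - (slope (Suc k) * \<beta> k)" "{i..<j}"] by simp
  also have "\<dots> \<le> \<Gamma>n y" unfolding \<Gamma>n_def by (rule sum_mono2[OF _ sub]) auto
  finally show "\<bar>a j - a i\<bar> \<le> \<Gamma>n y" .
qed

lemma sz_near: "k \<in> Eg \<Longrightarrow> sz k = N (Suc k) - N k" "k \<in> Eg \<Longrightarrow> F k = F (Suc k)"
  using step[of k] by (auto simp: Eg_def sz_def)

text \<open>Within horizontal distance \<open>W / K\<close> of the near line, only triangles with a vertex at an end of
  the near edge \<open>k\<close> are met at the heights of that edge.\<close>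

lemma window:
  assumes k: "k \<in> Eg" and x: "0 < \<tau> x" "K * \<tau> x \<le> 1" and y: "N k < y" "y < N (Suc k)"
    and j: "j < m" "(x, y) \<in> tri j"
  shows "(j \<le> k \<and> (\<forall>i. j \<le> i \<longrightarrow> i < k \<longrightarrow> N (Suc i) = N k)) \<or>
    (k \<le> j \<and> (\<forall>i. k \<le> i \<longrightarrow> i < j \<longrightarrow> N (Suc i) = N (Suc k)))"
proof -
  have km: "k < m" using k by (simp add: Eg_def)
  have t: "0 \<le> \<tau> x" "\<tau> x \<le> 1" using x j by (auto simp: tri_def)
  have yj: "ell j x \<le> y" "y \<le> ell (Suc j) x" using j by (auto simp: tri_def)
  consider "j = k" | "k < j" | "j < k" by linarith
  then show ?thesis
  proof cases
    case 1
    then show ?thesis by auto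
  next
    case 2
    have Nj: "N j = N (Suc k)"
    proof (rule ccontr)
      assume "N j \<noteq> N (Suc k)"
      then have gt: "N j > N (Suc k)" using NF_mono(1)[of "Suc k" j] 2 j by auto
      \<comment> \<open>With \<open>k' = Suc l\<close>, element \<open>l\<close> has its near edge
        just above the node \<open>N (Suc k)\<close>. Inside the window its upper long edge descends
        by at most the length of that near edge, so it stays above the node, and so does every
        higher element.\<close>
      define k' where "k' = (LEAST i. N i > N (Suc k))"
      have k': "N k' > N (Suc k)" "k' \<le> j" unfolding k'_def by (rule LeastI, rule gt) (rule Least_le, rule gt)
      have "k' > Suc k"
      proof (rule ccontr)
        assume "\<not> k' > Suc k"
        then have "N k' \<le> N (Suc k)" using NF_mono(1)[of k' "Suc k"] km by auto
        then show False using k' by simp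
      qed
      then obtain l where l: "k' = Suc l" "l \<ge> Suc k" by (cases k') auto
      have "\<not> N l > N (Suc k)" using not_less_Least[of l "\<lambda>i. N i > N (Suc k)"] l by (simp add: k'_def)
      then have Nl: "N l = N (Suc k)" using NF_mono(1)[of "Suc k" l] l k' j by auto
      have lm: "Suc l < m" using l k' j by simp
      have "N l < N (Suc l)" using Nl k' l by simp
      then have s: "sz l = N (Suc l) - N (Suc k)" using sz_near(1)[of l] lm Nl by (auto simp: Eg_def)
      have "\<bar>F (Suc l) - N (Suc l)\<bar> * \<tau> x \<le> K * sz l * \<tau> x"
        using slope_le[OF lm] t by (intro mult_right_mono) auto
      also have "\<dots> = (K * \<tau> x) * sz l" by simp
      also have "\<dots> \<le> 1 * sz l" using x sz_pos[of l] lm by (intro mult_right_mono) auto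
      finally have "\<bar>(F (Suc l) - N (Suc l)) * \<tau> x\<bar> \<le> sz l"
        using t by (simp add: abs_mult)
      then have "(F (Suc l) - N (Suc l)) * \<tau> x \<ge> - sz l" by linarith
      then have "ell (Suc l) x \<ge> N (Suc k)" unfolding ell_def s by linarith
      moreover have "ell (Suc l) x \<le> ell j x" using ell_mono[OF t, of "Suc l" j] l k' j by auto
      ultimately show False using yj y by linarith
    qed
    have "N (Suc i) = N (Suc k)" if "k \<le> i" "i < j" for i
      using NF_mono(1)[of "Suc k" "Suc i"] NF_mono(1)[of "Suc i" j] that j Nj by auto
    then show ?thesis using 2 less_imp_le by blast
  next
    case 3
    have Nj: "N (Suc j) = N k"
    proof (rule ccontr)
      assume "N (Suc j) \<noteq> N k"
      then have lt: "N (Suc j) < N k" using NF_mono(1)[of "Suc j" k] 3 km by auto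
      \<comment> \<open>Downward counterpart: \<open>Suc l\<close> is the last long edge starting
        below \<open>N k\<close>, and inside the window it cannot climb above that height.\<close>
      define k' where "k' = (LEAST i. N i \<ge> N k)"
      have k': "N k' \<ge> N k" "k' \<le> k" unfolding k'_def by (rule LeastI[of _ k], simp) (rule Least_le, simp)
      have "k' > Suc j"
      proof (rule ccontr)
        assume "\<not> k' > Suc j"
        then have "N k' \<le> N (Suc j)" using NF_mono(1)[of k' "Suc j"] j by auto
        then show False using k' lt by simp
      qed
      then obtain l' where l': "k' = Suc l'" "l' \<ge> Suc j" by (cases k') auto
      then obtain l where l: "k' = Suc (Suc l)" "l \<ge> j" by (cases l') auto
      have less: "N (Suc l) < N k" using not_less_Least[of "Suc l" "\<lambda>i. N i \<ge> N k"] l by (simp add: k'_def)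
      have Nl: "N (Suc (Suc l)) = N k" using NF_mono(1)[of k' k] l k' km by auto
      have lm: "Suc l < m" using l k' km by simp
      have s: "sz (Suc l) = N k - N (Suc l)" using sz_near(1)[of "Suc l"] lm Nl less by (auto simp: Eg_def)
      have "\<bar>F (Suc l) - N (Suc l)\<bar> * \<tau> x \<le> K * sz (Suc l) * \<tau> x"
        using slope_le[OF lm] t by (intro mult_right_mono) auto
      also have "\<dots> = (K * \<tau> x) * sz (Suc l)" by simp
      also have "\<dots> \<le> 1 * sz (Suc l)" using x sz_pos[of "Suc l"] lm by (intro mult_right_mono) auto
      finally have "\<bar>(F (Suc l) - N (Suc l)) * \<tau> x\<bar> \<le> sz (Suc l)"
        using t by (simp add: abs_mult)
      then have "(F (Suc l) - N (Suc l)) * \<tau> x \<le> sz (Suc l)" by linarith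
      then have "ell (Suc l) x \<le> N k" unfolding ell_def s by linarith
      moreover have "ell (Suc j) x \<le> ell (Suc l) x" using ell_mono[OF t, of "Suc j" "Suc l"] l lm by auto
      ultimately show False using yj y by linarith
    qed
    have "N (Suc i) = N k" if "j \<le> i" "i < k" for i
      using NF_mono(1)[of "Suc j" "Suc i"] NF_mono(1)[of "Suc i" k] that km Nj by auto
    then show ?thesis using 3 less_imp_le by blast
  qed
qed

text \<open>An element met in the window is joined to \<open>k\<close> by a path around a single end
  of the near edge, to which \<open>fan_path\<close> applies; that end is also the common node
  \<open>z\<close>.\<close>

lemma window_values:
  assumes k: "k \<in> Eg" and x: "0 < \<tau> x" "K * \<tau> x \<le> 1" and y: "N k < y" "y < N (Suc k)"
    and j: "j < m" "(x, y) \<in> tri j"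
  shows "\<bar>b j - b k\<bar> \<le> Bs k" "\<bar>a j - a k\<bar> \<le> \<Gamma>s k" "j \<in> touch k"
    "\<exists>z. (z = N j \<or> z = N (Suc j)) \<and> (z = N k \<or> z = N (Suc k))"
proof -
  have km: "k < m" using k by (simp add: Eg_def)
  note nn = Bn_nonneg(1,2)[of "N k"] Bn_nonneg(1,2)[of "N (Suc k)"]
  have "\<bar>b j - b k\<bar> \<le> Bs k \<and> \<bar>a j - a k\<bar> \<le> \<Gamma>s k \<and>
    (\<exists>z. (z = N j \<or> z = N (Suc j)) \<and> (z = N k \<or> z = N (Suc k)))"
    using window[OF assms]
  proof
    assume A: "j \<le> k \<and> (\<forall>i. j \<le> i \<longrightarrow> i < k \<longrightarrow> N (Suc i) = N k)"
    then have "\<bar>b k - b j\<bar> \<le> Bn (N k)" "\<bar>a k - a j\<bar> \<le> \<Gamma>n (N k)"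
      using fan_path[of j k "N k"] km by blast+
    moreover have "N (Suc j) = N k \<or> N j = N k"
      using A le_neq_implies_less by blast
    ultimately show ?thesis using nn unfolding Bs_def \<Gamma>s_def by (auto simp: abs_minus_commute)
  next
    assume A: "k \<le> j \<and> (\<forall>i. k \<le> i \<longrightarrow> i < j \<longrightarrow> N (Suc i) = N (Suc k))"
    then have "\<bar>b j - b k\<bar> \<le> Bn (N (Suc k))" "\<bar>a j - a k\<bar> \<le> \<Gamma>n (N (Suc k))"
      using fan_path[of k j "N (Suc k)"] j by blast+
    moreover from A have A1: "k \<le> j" and A2: "\<forall>i. k \<le> i \<longrightarrow> i < j \<longrightarrow> N (Suc i) = N (Suc k)" by blast+
    have "N j = N (Suc k) \<or> N j = N k"
    proof (cases "j = k")
      case False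
      then obtain i where i: "j = Suc i" "k \<le> i" using A1 by (cases j) auto
      then show ?thesis using A2 lessI by blast
    qed simp
    ultimately show ?thesis using nn unfolding Bs_def \<Gamma>s_def by auto
  qed
  then show "\<bar>b j - b k\<bar> \<le> Bs k" "\<bar>a j - a k\<bar> \<le> \<Gamma>s k" "j \<in> touch k"
    "\<exists>z. (z = N j \<or> z = N (Suc j)) \<and> (z = N k \<or> z = N (Suc k))"
    using j by (auto simp: touch_def)
qed

lemma edge_to_edge:
  assumes "j \<in> Eg" "k \<in> Eg" "N (Suc j) = N k"
  shows "\<bar>a k - a j\<bar> \<le> \<Gamma>n (N k)"
proof -
  have jk: "j \<le> k"
  proof (rule ccontr)
    assume "\<not> j \<le> k"
    then have "N (Suc k) \<le> N j" using NF_mono(1)[of "Suc k" j] assms by (auto simp: Eg_def)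
    then show False using assms by (auto simp: Eg_def)
  qed
  show ?thesis
  proof (rule fan_path(2)[OF jk])
    show "k < m" using assms by (simp add: Eg_def)
    show "N (Suc i) = N k" if "j \<le> i" "i < k" for i
      using NF_mono(1)[of "Suc j" "Suc i"] NF_mono(1)[of "Suc i" k] that assms by (auto simp: Eg_def)
  qed
qed

text \<open>At the end of the line there is no neighbouring near edge; the comparison is with the
  bottom element, whose horizontal component is zero by the boundary values. The top is treated
  alike.\<close>

lemma bottom_edge:
  assumes "k \<in> Eg" "N k = 0"
  shows "\<bar>a k\<bar> \<le> \<Gamma>n 0"
proof -
  have "\<bar>a k - a 0\<bar> \<le> \<Gamma>n 0"
  proof (rule fan_path(2))
    show "k < m" using assms by (simp add: Eg_def)
    show "N (Suc i) = 0" if "0 \<le> i" "i < k" for i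
      using NF_mono(1)[of 0 "Suc i"] NF_mono(1)[of "Suc i" k] that assms ends by (auto simp: Eg_def)
  qed simp
  then show ?thesis by (simp add: a_ends)
qed

lemma top_edge:
  assumes "k \<in> Eg" "N (Suc k) = 1"
  shows "\<bar>a k\<bar> \<le> \<Gamma>n 1"
proof -
  have km: "k < m" using assms by (simp add: Eg_def)
  have "\<bar>a (m - 1) - a k\<bar> \<le> \<Gamma>n 1"
  proof (rule fan_path(2))
    show "k \<le> m - 1" "m - 1 < m" using km by auto
    show "N (Suc i) = 1" if "k \<le> i" "i < m - 1" for i
    proof -
      have "Suc i \<le> m" "Suc k \<le> Suc i" using that by auto
      then show ?thesis using NF_mono(1)[of "Suc k" "Suc i"] NF_mono(1)[of "Suc i" m] assms ends by simp
    qed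
  qed
  then show ?thesis using a_ends by simp
qed

lemma Eg_inj: "inj_on N Eg" "inj_on (\<lambda>k. N (Suc k)) Eg"
proof -
  have *: "N i < N j \<and> N (Suc i) < N (Suc j)" if "i \<in> Eg" "j \<in> Eg" "i < j" for i j
    using NF_mono(1)[of "Suc i" j] that by (auto simp: Eg_def)
  show "inj_on N Eg" "inj_on (\<lambda>k. N (Suc k)) Eg"
    unfolding inj_on_def using * by (metis less_irrefl linorder_neqE_nat)+
qed

text \<open>The slopes in a fan are at most K times a short edge divided by W, and all short edges
  around the node are comparable. The variation of the horizontal component is therefore smaller
  than that of the vertical one by the aspect ratio, which later compensates the division by the
  short edge.\<close>

lemma \<Gamma>s_le:
  assumes k: "k \<in> Eg"
  shows "\<Gamma>s k \<le> K\<^sup>2 * (sz k / W) * Bs k"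
proof -
  have km: "k < m" using k by (simp add: Eg_def)
  have "\<Gamma>n y \<le> K\<^sup>2 * (sz k / W) * Bn y" if y: "y = N k \<or> y = N (Suc k)" for y
    unfolding \<Gamma>n_def Bn_def sum_distrib_left
  proof (rule sum_mono)
    fix i assume i: "i \<in> fan y"
    then have im: "Suc i < m" "y = N (Suc i)" by (auto simp: fan_def)
    have "sz i \<le> K * sz k" using sz_comp[of i k y] im km y by auto
    then have "K * sz i / W \<le> K * (K * sz k) / W"
      using K W_pos by (intro divide_right_mono mult_left_mono) auto
    then have "\<bar>slope (Suc i)\<bar> \<le> K\<^sup>2 * (sz k / W)"
      using slope_bound(1)[OF im(1)] by (simp add: power2_eq_square)
    then show "\<bar>slope (Suc i) * \<beta> i\<bar> \<le> K\<^sup>2 * (sz k / W) * \<bar>\<beta> i\<bar>"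
      unfolding abs_mult by (rule mult_right_mono) simp
  qed
  then show ?thesis unfolding \<Gamma>s_def Bs_def distrib_left by (intro add_mono) auto
qed

definition \<delta>e :: "nat \<Rightarrow> real" where "\<delta>e k = min \<epsilon> (sz k)"

text \<open>A long edge belongs to the fan of one node only, and injectivity of \<open>g\<close>
  prevents a node from being used twice.\<close>

lemma sum_over_edges:
  fixes f :: "nat \<Rightarrow> real"
  assumes "\<And>i. Suc i < m \<Longrightarrow> f i \<ge> 0" and inj: "inj_on g Eg"
  shows "(\<Sum>k\<in>Eg. \<Sum>i\<in>fan (g k). f i) \<le> (\<Sum>i | Suc i < m. f i)"
proof -
  have fin: "finite {i. Suc i < m}" by (rule finite_subset[of _ "{..<m}"]) auto
  have "(\<Sum>k\<in>Eg. \<Sum>i\<in>fan (g k). f i) = (\<Sum>i\<in>(\<Union>k\<in>Eg. fan (g k)). f i)"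
  proof (rule sum.UNION_disjoint[symmetric])
    show "\<forall>i\<in>Eg. \<forall>j\<in>Eg. i \<noteq> j \<longrightarrow> fan (g i) \<inter> fan (g j) = {}"
      using inj unfolding inj_on_def fan_def by auto
  qed auto
  also have "\<dots> \<le> (\<Sum>i | Suc i < m. f i)"
    by (rule sum_mono2[OF fin]) (use assms in \<open>auto simp: fan_def\<close>)
  finally show ?thesis .
qed

text \<open>Cauchy-Schwarz on a fan costs \<open>Mx\<close>, and comparability of the short edges
  gives \<open>\<delta>e k \<le> 10 * K * \<delta> i\<close>, with 10 undoing the tenth in \<delta>.
  The two ends of the near edge contribute 2 + 2 to 4 * 10 = 40.\<close>

lemma Bs_sum: "(\<Sum>k\<in>Eg. \<epsilon>\<^sup>2 * W * \<delta>e k * (Bs k)\<^sup>2) \<le> 40 * K * Mx * (\<Sum>i | Suc i < m. \<epsilon>\<^sup>2 * W * \<delta> i * (\<beta> i)\<^sup>2)"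
proof -
  define f where "f i = \<epsilon>\<^sup>2 * W * \<delta> i * (\<beta> i)\<^sup>2" for i
  have f0: "f i \<ge> 0" if "Suc i < m" for i
    using that W_pos \<delta>(1)[OF that] by (simp add: f_def)
  have one: "\<epsilon>\<^sup>2 * W * \<delta>e k * (Bn y)\<^sup>2 \<le> 10 * K * Mx * (\<Sum>i\<in>fan y. f i)"
    if k: "k \<in> Eg" and y: "y = N k \<or> y = N (Suc k)" for k y
  proof -
    have km: "k < m" using k by (simp add: Eg_def)
    have \<delta>e0: "\<delta>e k > 0" using eps sz_pos[OF km] by (simp add: \<delta>e_def)
    have "(Bn y)\<^sup>2 \<le> real (card (fan y)) * (\<Sum>i\<in>fan y. \<bar>\<beta> i\<bar>\<^sup>2)"
      unfolding Bn_def by (rule sum_square_le_card) simp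
    also have "\<dots> \<le> Mx * (\<Sum>i\<in>fan y. (\<beta> i)\<^sup>2)"
      using count[of y] by (auto simp: fan_def intro!: mult_right_mono sum_nonneg)
    finally have "\<epsilon>\<^sup>2 * W * \<delta>e k * (Bn y)\<^sup>2 \<le> \<epsilon>\<^sup>2 * W * \<delta>e k * (Mx * (\<Sum>i\<in>fan y. (\<beta> i)\<^sup>2))"
      using W_pos \<delta>e0 by (intro mult_left_mono) auto
    also have "\<dots> = Mx * (\<Sum>i\<in>fan y. \<epsilon>\<^sup>2 * W * \<delta>e k * (\<beta> i)\<^sup>2)"
      by (simp add: sum_distrib_left mult_ac)
    also have "\<dots> \<le> Mx * (\<Sum>i\<in>fan y. 10 * K * f i)"
    proof (intro mult_left_mono sum_mono)
      fix i assume i: "i \<in> fan y"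
      then have im: "Suc i < m" "y = N (Suc i)" by (auto simp: fan_def)
      have s: "sz k \<le> K * sz i" "sz k \<le> K * sz (Suc i)"
        using sz_comp[of k i y] sz_comp[of k "Suc i" y] im km y by auto
      have "\<epsilon> * 1 \<le> \<epsilon> * (10 * K)" using eps K by (intro mult_left_mono) auto
      moreover have "\<delta>e k \<le> \<epsilon>" "\<delta>e k \<le> sz k" by (auto simp: \<delta>e_def)
      ultimately have "\<delta>e k \<le> 10 * K * \<epsilon>" "\<delta>e k \<le> K * sz i" "\<delta>e k \<le> K * sz (Suc i)"
        using s by (auto simp: mult_ac)
      then have "\<delta>e k \<le> 10 * K * \<delta> i"
        unfolding \<delta>_def min_def by auto
      then have "\<epsilon>\<^sup>2 * W * \<delta>e k * (\<beta> i)\<^sup>2 \<le> \<epsilon>\<^sup>2 * W * (10 * K * \<delta> i) * (\<beta> i)\<^sup>2"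
        using W_pos by (intro mult_right_mono mult_left_mono) auto
      then show "\<epsilon>\<^sup>2 * W * \<delta>e k * (\<beta> i)\<^sup>2 \<le> 10 * K * f i" by (simp add: f_def mult_ac)
    qed simp
    also have "\<dots> = 10 * K * Mx * (\<Sum>i\<in>fan y. f i)" by (simp add: sum_distrib_left mult_ac)
    finally show ?thesis .
  qed
  have "(\<Sum>k\<in>Eg. \<epsilon>\<^sup>2 * W * \<delta>e k * (Bs k)\<^sup>2)
    \<le> (\<Sum>k\<in>Eg. 2 * (10 * K * Mx * (\<Sum>i\<in>fan (N k). f i)) + 2 * (10 * K * Mx * (\<Sum>i\<in>fan (N (Suc k)). f i)))"
  proof (rule sum_mono)
    fix k assume k: "k \<in> Eg"
    then have \<delta>e0: "\<delta>e k > 0" using eps sz_pos by (simp add: \<delta>e_def Eg_def)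
    have "(Bs k)\<^sup>2 \<le> 2 * (Bn (N k))\<^sup>2 + 2 * (Bn (N (Suc k)))\<^sup>2"
      unfolding Bs_def using zero_le_power2[of "Bn (N k) - Bn (N (Suc k))"] by (simp add: power2_eq_square algebra_simps)
    then have "\<epsilon>\<^sup>2 * W * \<delta>e k * (Bs k)\<^sup>2 \<le> \<epsilon>\<^sup>2 * W * \<delta>e k * (2 * (Bn (N k))\<^sup>2 + 2 * (Bn (N (Suc k)))\<^sup>2)"
      using W_pos \<delta>e0 by (intro mult_left_mono) auto
    also have "\<dots> = 2 * (\<epsilon>\<^sup>2 * W * \<delta>e k * (Bn (N k))\<^sup>2) + 2 * (\<epsilon>\<^sup>2 * W * \<delta>e k * (Bn (N (Suc k)))\<^sup>2)"
      by (simp add: algebra_simps)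
    also have "\<dots> \<le> 2 * (10 * K * Mx * (\<Sum>i\<in>fan (N k). f i)) + 2 * (10 * K * Mx * (\<Sum>i\<in>fan (N (Suc k)). f i))"
      using one[OF k] by (intro add_mono mult_left_mono) auto
    finally show "\<epsilon>\<^sup>2 * W * \<delta>e k * (Bs k)\<^sup>2 \<le> 2 * (10 * K * Mx * (\<Sum>i\<in>fan (N k). f i)) + 2 * (10 * K * Mx * (\<Sum>i\<in>fan (N (Suc k)). f i))" .
  qed
  also have "\<dots> = 20 * K * Mx * ((\<Sum>k\<in>Eg. \<Sum>i\<in>fan (N k). f i) + (\<Sum>k\<in>Eg. \<Sum>i\<in>fan (N (Suc k)). f i))"
    by (simp add: sum.distrib sum_distrib_left algebra_simps)
  also have "\<dots> \<le> 20 * K * Mx * ((\<Sum>i | Suc i < m. f i) + (\<Sum>i | Suc i < m. f i))"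
    using K sum_over_edges[OF f0 Eg_inj(1)] sum_over_edges[OF f0 Eg_inj(2)] by (intro mult_left_mono add_mono) auto
  finally show ?thesis by (simp add: f_def)
qed

text \<open>Apart from the bottom element, an element starting at \<open>y\<close> lies directly
  above an edge of the fan; apart from the top one, an element ending at \<open>y\<close> lies
  directly below such an edge. This accounts for the successor.\<close>

lemma card_touch: "card {j. j < m \<and> N j = y} \<le> Suc Mx" "card {j. j < m \<and> N (Suc j) = y} \<le> Suc Mx"
proof -
  have fin: "finite (fan y)" by simp
  have "{j. j < m \<and> N j = y} \<subseteq> insert 0 (Suc ` fan y)"
  proof
    fix j assume "j \<in> {j. j < m \<and> N j = y}"
    then show "j \<in> insert 0 (Suc ` fan y)" by (cases j) (auto simp: fan_def)
  qed
  then have "card {j. j < m \<and> N j = y} \<le> card (insert 0 (Suc ` fan y))" by (intro card_mono) auto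
  also have "\<dots> \<le> Suc (card (Suc ` fan y))" by (simp add: card_insert_if)
  also have "card (Suc ` fan y) = card (fan y)" by (rule card_image) simp
  finally show "card {j. j < m \<and> N j = y} \<le> Suc Mx" using count[of y] by (simp add: fan_def)
  have "{j. j < m \<and> N (Suc j) = y} \<subseteq> insert (m - 1) (fan y)" by (auto simp: fan_def)
  then have "card {j. j < m \<and> N (Suc j) = y} \<le> card (insert (m - 1) (fan y))" by (intro card_mono) auto
  also have "\<dots> \<le> Suc (card (fan y))" by (simp add: card_insert_if)
  finally show "card {j. j < m \<and> N (Suc j) = y} \<le> Suc Mx" using count[of y] by (simp add: fan_def)
qed

text \<open>The elements touching \<open>k\<close> number at most 4 (Mx + 1), which is the cost of
  Cauchy-Schwarz. Conversely each element is counted at most four times, by matching either of its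
  near heights with either end of an edge; 4 * 4 = 16.\<close>

lemma On_sum:
  assumes t: "0 \<le> t" "t \<le> \<epsilon>" "t \<le> W"
  shows "(\<Sum>k\<in>Eg. W * sz k * (t / \<epsilon> * On k)\<^sup>2) \<le> 16 * (real Mx + 1) * K * (\<Sum>j<m. W * sz j * (os j)\<^sup>2)"
proof -
  define g where "g j = W * sz j * (os j)\<^sup>2" for j
  have g0: "g j \<ge> 0" if "j < m" for j using W_pos sz_pos[OF that] by (simp add: g_def)
  have card: "card (touch k) \<le> 4 * (Mx+1)" for k
  proof -
    have "touch k \<subseteq> ({j. j < m \<and> N j = N k} \<union> {j. j < m \<and> N j = N (Suc k)}) \<union>
      ({j. j < m \<and> N (Suc j) = N k} \<union> {j. j < m \<and> N (Suc j) = N (Suc k)})" by (auto simp: touch_def)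
    then have "card (touch k) \<le> card (({j. j < m \<and> N j = N k} \<union> {j. j < m \<and> N j = N (Suc k)}) \<union>
      ({j. j < m \<and> N (Suc j) = N k} \<union> {j. j < m \<and> N (Suc j) = N (Suc k)}))" by (intro card_mono) auto
    also have "\<dots> \<le> (Suc Mx + Suc Mx) + (Suc Mx + Suc Mx)"
      by (intro order_trans[OF card_Un_le] add_mono card_touch)
    finally show ?thesis by simp
  qed
  have 1: "W * sz k * (t / \<epsilon> * On k)\<^sup>2 \<le> 4 * (real Mx + 1) * K * (\<Sum>j\<in>touch k. g j)" if k: "k \<in> Eg" for k
  proof -
    have km: "k < m" using k by (simp add: Eg_def)
    have "0 \<le> t / \<epsilon> * On k" using t eps On_nonneg by (intro mult_nonneg_nonneg divide_nonneg_pos) auto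
    moreover have "t / \<epsilon> * On k \<le> (\<Sum>j\<in>touch k. os j)"
      unfolding On_def sum_distrib_left by (intro sum_mono osc_scaled t) (auto simp: touch_def)
    ultimately have "(t / \<epsilon> * On k)\<^sup>2 \<le> (\<Sum>j\<in>touch k. os j)\<^sup>2" by (intro power_mono)
    also have "\<dots> \<le> real (card (touch k)) * (\<Sum>j\<in>touch k. (os j)\<^sup>2)" by (rule sum_square_le_card) simp
    also have "\<dots> \<le> (4 * (real Mx + 1)) * (\<Sum>j\<in>touch k. (os j)\<^sup>2)"
    proof (rule mult_right_mono)
      have "real (card (touch k)) \<le> real (4 * (Mx+1))" using card[of k] by (simp only: of_nat_le_iff)
      then show "real (card (touch k)) \<le> 4 * (real Mx + 1)" by simp
    qed (simp add: sum_nonneg)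
    finally have "W * sz k * (t / \<epsilon> * On k)\<^sup>2 \<le> W * sz k * ((4 * (real Mx + 1)) * (\<Sum>j\<in>touch k. (os j)\<^sup>2))"
      using W_pos sz_pos[OF km] by (intro mult_left_mono) auto
    also have "\<dots> = 4 * (real Mx + 1) * (\<Sum>j\<in>touch k. W * sz k * (os j)\<^sup>2)"
      by (simp add: sum_distrib_left mult_ac)
    also have "\<dots> \<le> 4 * (real Mx + 1) * (\<Sum>j\<in>touch k. K * g j)"
    proof (intro mult_left_mono sum_mono)
      fix j assume j: "j \<in> touch k"
      then obtain y where y: "j < m" "y = N j \<or> y = N (Suc j)" "y = N k \<or> y = N (Suc k)"
        by (auto simp: touch_def)
      have "sz k \<le> K * sz j" using sz_comp[of k j y] km y by auto
      then have "W * sz k * (os j)\<^sup>2 \<le> W * (K * sz j) * (os j)\<^sup>2"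
        using W_pos by (intro mult_right_mono mult_left_mono) auto
      then show "W * sz k * (os j)\<^sup>2 \<le> K * g j" by (simp add: g_def mult_ac)
    qed simp
    finally show ?thesis by (simp add: sum_distrib_left[symmetric] mult_ac)
  qed
  have 2: "(\<Sum>k\<in>Eg. \<Sum>j\<in>{j. j < m \<and> u j = w k}. g j) \<le> (\<Sum>j<m. g j)" if "inj_on w Eg" for u w :: "nat \<Rightarrow> real"
  proof -
    have "(\<Sum>k\<in>Eg. \<Sum>j\<in>{j. j < m \<and> u j = w k}. g j) = (\<Sum>j\<in>(\<Union>k\<in>Eg. {j. j < m \<and> u j = w k}). g j)"
      by (rule sum.UNION_disjoint[symmetric]) (use that in \<open>auto simp: inj_on_def\<close>)
    also have "\<dots> \<le> (\<Sum>j<m. g j)" by (rule sum_mono2) (use g0 in auto)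
    finally show ?thesis .
  qed
  have 3: "(\<Sum>j\<in>touch k. g j) \<le> (\<Sum>j\<in>{j. j < m \<and> N j = N k}. g j) + (\<Sum>j\<in>{j. j < m \<and> N j = N (Suc k)}. g j)
    + (\<Sum>j\<in>{j. j < m \<and> N (Suc j) = N k}. g j) + (\<Sum>j\<in>{j. j < m \<and> N (Suc j) = N (Suc k)}. g j)" for k
  proof -
    have U: "(\<Sum>j\<in>A \<union> B. g j) \<le> (\<Sum>j\<in>A. g j) + (\<Sum>j\<in>B. g j)" if "A \<subseteq> {..<m}" "B \<subseteq> {..<m}" for A B
    proof -
      have "finite A" "finite B" using that finite_subset by blast+
      then have "(\<Sum>j\<in>A \<union> B. g j) + (\<Sum>j\<in>A \<inter> B. g j) = (\<Sum>j\<in>A. g j) + (\<Sum>j\<in>B. g j)" by (rule sum.union_inter)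
      moreover have "(\<Sum>j\<in>A \<inter> B. g j) \<ge> 0" by (rule sum_nonneg) (use that g0 in auto)
      ultimately show ?thesis by linarith
    qed
    have "touch k = (({j. j < m \<and> N j = N k} \<union> {j. j < m \<and> N j = N (Suc k)}) \<union>
      {j. j < m \<and> N (Suc j) = N k}) \<union> {j. j < m \<and> N (Suc j) = N (Suc k)}" by (auto simp: touch_def)
    then show ?thesis
      by (simp only:) (intro order_trans[OF U] add_mono order_refl; auto)
  qed
  have "(\<Sum>k\<in>Eg. W * sz k * (t / \<epsilon> * On k)\<^sup>2) \<le> (\<Sum>k\<in>Eg. 4 * (real Mx + 1) * K * (\<Sum>j\<in>touch k. g j))"
    using 1 by (rule sum_mono)
  also have "\<dots> = 4 * (real Mx + 1) * K * (\<Sum>k\<in>Eg. \<Sum>j\<in>touch k. g j)" by (simp add: sum_distrib_left)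
  also have "\<dots> \<le> 4 * (real Mx + 1) * K * (4 * (\<Sum>j<m. g j))"
  proof (rule mult_left_mono)
    have "(\<Sum>k\<in>Eg. \<Sum>j\<in>touch k. g j) \<le> (\<Sum>k\<in>Eg. (\<Sum>j\<in>{j. j < m \<and> N j = N k}. g j) + (\<Sum>j\<in>{j. j < m \<and> N j = N (Suc k)}. g j)
    + (\<Sum>j\<in>{j. j < m \<and> N (Suc j) = N k}. g j) + (\<Sum>j\<in>{j. j < m \<and> N (Suc j) = N (Suc k)}. g j))"
      by (rule sum_mono) (rule 3)
    also have "\<dots> \<le> 4 * (\<Sum>j<m. g j)"
      using 2[OF Eg_inj(1), of N] 2[OF Eg_inj(2), of N] 2[OF Eg_inj(1), of "\<lambda>j. N (Suc j)"] 2[OF Eg_inj(2), of "\<lambda>j. N (Suc j)"]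
      by (simp add: sum.distrib)
    finally show "(\<Sum>k\<in>Eg. \<Sum>j\<in>touch k. g j) \<le> 4 * (\<Sum>j<m. g j)" .
    show "0 \<le> 4 * (real Mx + 1) * K" using K by simp
  qed
  finally show ?thesis by (simp add: g_def algebra_simps)
qed

end

section \<open>Integrals over the boxes beside the line\<close>

lemma norm_set_LINT_le_AE:
  fixes F :: "point \<Rightarrow> real"
  assumes Z: "Z \<in> sets borel" "bounded Z" and b: "AE p in lborel. p \<in> Z \<longrightarrow> \<bar>F p\<bar> \<le> B" and B: "B \<ge> 0"
    and i: "set_integrable lborel Z F"
  shows "\<bar>LINT p:Z|lborel. F p\<bar> \<le> B * measure lborel Z"
proof -
  have "\<bar>LINT p:Z|lborel. F p\<bar> \<le> (LINT p:Z|lborel. \<bar>F p\<bar>)"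
    using set_integral_norm_bound[OF i] by simp
  also have "\<dots> \<le> (LINT p:Z|lborel. B)"
    by (rule set_integral_mono_AE[OF set_integrable_abs[OF i] set_integrable_bounded[where B=B]])
      (use b B Z in \<open>auto simp: set_borel_measurable_def\<close>)
  also have "\<dots> = B * measure lborel Z" by (simp add: set_lebesgue_integral_def)
  finally show ?thesis .
qed

lemma set_integrable_continuous_rect:
  fixes F :: "point \<Rightarrow> 'b::{banach, second_countable_topology}"
  assumes "continuous_on UNIV F"
  shows "set_integrable lborel ({a<..<b} \<times> {c<..<d}) F"
proof -
  have "compact ({a..b} \<times> {c..d})" by (intro compact_Times compact_Icc)
  then have "bounded (F ` ({a..b} \<times> {c..d}))"
    by (intro compact_imp_bounded compact_continuous_image continuous_on_subset[OF assms]) auto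
  then obtain B where "\<And>p. p \<in> {a..b} \<times> {c..d} \<Longrightarrow> norm (F p) \<le> B" unfolding bounded_iff by auto
  then show ?thesis
    by (intro set_integrable_bounded[where B=B] set_borel_measurable_borel borel_measurable_continuous_onI assms) auto
qed

lemma LINT_rect_product:
  fixes f g :: "real \<Rightarrow> real"
  assumes "continuous_on UNIV f" "continuous_on UNIV g"
  shows "(LINT p:{a<..<b} \<times> {c<..<d}|lborel. f (fst p) * g (snd p))
    = (LINT x:{a<..<b}|lborel. f x) * (LINT y:{c<..<d}|lborel. g y)"
proof -
  have c: "continuous_on UNIV (\<lambda>p::point. f (fst p) * g (snd p))"
    by (intro continuous_intros continuous_on_compose2[OF assms(1)] continuous_on_compose2[OF assms(2)]) auto
  show ?thesis
    by (subst set_integral_rectangle_fst(1)[OF set_integrable_continuous_rect[OF c]]) (simp add: mult.commute)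
qed

lemma measure_rect:
  fixes a b c d :: real
  assumes "a \<le> b" "c \<le> d"
  shows "measure lborel ({a<..<b} \<times> {c<..<d}) = (b - a) * (d - c)"
proof -
  have "measure lborel ({a<..<b} \<times> {c<..<d}) = (LINT p:{a<..<b} \<times> {c<..<d}|lborel. 1 * 1)"
    by (simp add: set_lebesgue_integral_def)
  also have "\<dots> = (LINT x:{a<..<b}|lborel. 1) * (LINT y:{c<..<d}|lborel. 1)"
    by (rule LINT_rect_product) (auto intro: continuous_on_const)
  also have "\<dots> = (b - a) * (d - c)" using assms by (simp add: set_lebesgue_integral_def)
  finally show ?thesis .
qed

text \<open>A graph over an interval is the region between two equal functions, of area zero by
  \<open>measure_between\<close>.\<close>

lemma AE_not_graph:
  assumes "continuous_on UNIV g"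
  shows "AE p::point in lborel. fst p \<in> {\<alpha>..\<beta>} \<longrightarrow> snd p \<noteq> g (fst p)"
proof -
  let ?Z = "{p. fst p \<in> {\<alpha>..\<beta>} \<and> g (fst p) \<le> snd p \<and> snd p \<le> g (fst p)}"
  have c: "continuous_on {\<alpha>..\<beta>} g" using assms continuous_on_subset by blast
  have Z: "compact ?Z" "measure lborel ?Z = 0"
    using measure_between[OF c c] by auto
  have "emeasure lborel ?Z < \<infinity>" using emeasure_bounded_finite[OF compact_imp_bounded[OF Z(1)]] by simp
  then have "emeasure lborel ?Z = 0" using Z(2) by (simp add: emeasure_eq_ennreal_measure)
  then have "?Z \<in> null_sets lborel" using Z(1) by (auto intro: borel_closed compact_imp_closed simp: null_sets_def)
  from AE_not_in[OF this] show ?thesis by eventually_elim auto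
qed

context mesh_side
begin

text \<open>The interval of width \<omega> next to the near line on the side of the column; being
  open, it leaves out the line.\<close>

definition NI :: "real \<Rightarrow> real set"
  where "NI \<omega> = (if d > 0 then {x0<..<x0 + \<omega>} else {x0 - \<omega><..<x0})"

definition nbox :: "real \<Rightarrow> nat \<Rightarrow> point set"
  where "nbox \<omega> k = NI \<omega> \<times> {N k<..<N (Suc k)}"

lemma NI_\<tau>:
  assumes "x \<in> NI \<omega>" "2 * K * \<omega> \<le> W"
  shows "0 < \<tau> x" "K * \<tau> x \<le> 1" "\<tau> x < 1"
proof -
  have t: "\<tau> x = \<bar>x - x0\<bar> / W \<and> 0 < \<bar>x - x0\<bar> \<and> \<bar>x - x0\<bar> < \<omega>"
    using assms(1) d unfolding NI_def \<tau>_def W_def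
    by (cases "d > 0") (auto simp: field_simps)
  then show "0 < \<tau> x" using W_pos by simp
  have "K * \<bar>x - x0\<bar> \<le> K * \<omega>" using t K by (intro mult_left_mono) auto
  then have "K * \<bar>x - x0\<bar> \<le> W / 2" using assms(2) by linarith
  then have "K * \<tau> x \<le> 1/2" using t W_pos by (simp add: pos_divide_le_eq)
  moreover have "\<tau> x \<le> K * \<tau> x" using K \<open>0 < \<tau> x\<close> by simp
  ultimately show "K * \<tau> x \<le> 1" "\<tau> x < 1" by linarith+
qed

lemma nbox_D:
  assumes "2 * K * \<omega> \<le> W" "k \<in> Eg"
  shows "nbox \<omega> k \<subseteq> D"
proof -
  have "0 \<le> N k" "N (Suc k) \<le> 1" using NF_range[of k] NF_range[of "Suc k"] assms by (auto simp: Eg_def)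
  then show ?thesis unfolding nbox_def using NI_\<tau>[OF _ assms(1)] by (auto intro!: inside)
qed

lemma nbox_rect: obtains a' b' where "\<And>k. nbox \<omega> k = {a'<..<b'} \<times> {N k<..<N (Suc k)}" "NI \<omega> = {a'<..<b'}" "b' - a' = \<omega>"
proof (cases "d > 0")
  case True then show ?thesis by (intro that[of x0 "x0 + \<omega>"]) (auto simp: nbox_def NI_def)
next
  case False then show ?thesis by (intro that[of "x0 - \<omega>" x0]) (auto simp: nbox_def NI_def)
qed

lemma nbox_measure:
  assumes "\<omega> > 0" "k \<in> Eg"
  shows "measure lborel (nbox \<omega> k) = \<omega> * sz k" "nbox \<omega> k \<in> sets borel" "bounded (nbox \<omega> k)"
proof -
  obtain a' b' where n: "nbox \<omega> k = {a'<..<b'} \<times> {N k<..<N (Suc k)}" "b' - a' = \<omega>"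
    using nbox_rect by metis
  show "measure lborel (nbox \<omega> k) = \<omega> * sz k"
    unfolding n(1) sz_near(1)[OF assms(2)] using assms n(2) by (subst measure_rect) (auto simp: Eg_def)
  show "nbox \<omega> k \<in> sets borel" "bounded (nbox \<omega> k)" unfolding n(1) by auto
qed

text \<open>The derivative of the profile sees its value 1 on the line, with a sign telling the side
  of the column, and the profile itself has mean zero there. The opposite signs later combine the
  two sides to a jump.\<close>

lemma NI_integrals:
  assumes "\<omega> > 0"
  shows "(LINT x:NI \<omega>|lborel. qbump' ((x - x0) / \<omega>) / \<omega>) = - sgn d"
    "(LINT x:NI \<omega>|lborel. qbump ((x - x0) / \<omega>)) = 0"
proof -
  have dq: "((\<lambda>x. qbump ((x - x0) / \<omega>)) has_real_derivative qbump' ((x - x0) / \<omega>) / \<omega>) (at x)" for x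
  proof -
    have "((\<lambda>x. qbump ((x - x0) / \<omega>)) has_real_derivative qbump' ((x - x0) / \<omega>) * (1 / \<omega>)) (at x)"
      by (rule DERIV_chain2[OF has_real_derivative_qbump]) (use assms in \<open>auto intro!: derivative_eq_intros\<close>)
    then show ?thesis by simp
  qed
  have di: "((\<lambda>x. \<omega> * qint ((x - x0) / \<omega>)) has_real_derivative qbump ((x - x0) / \<omega>)) (at x)" for x
  proof -
    have "((\<lambda>x. qint ((x - x0) / \<omega>)) has_real_derivative qbump ((x - x0) / \<omega>) * (1 / \<omega>)) (at x)"
      by (rule DERIV_chain2[OF has_real_derivative_qint]) (use assms in \<open>auto intro!: derivative_eq_intros\<close>)
    from DERIV_cmult[OF this, of \<omega>] show ?thesis using assms by simp
  qed
  have i: "set_integrable lborel {a'<..<b'} f" if "continuous_on UNIV f" for f :: "real \<Rightarrow> real" and a' b'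
  proof -
    have "bounded (f ` {a'..b'})"
      by (intro compact_imp_bounded compact_continuous_image continuous_on_subset[OF that]) auto
    then obtain B where "\<forall>x\<in>{a'..b'}. norm (f x) \<le> B" unfolding bounded_iff by auto
    then show ?thesis
      by (intro set_integrable_bounded[where B=B] set_borel_measurable_borel borel_measurable_continuous_onI that) auto
  qed
  have c: "continuous_on UNIV (\<lambda>x. qbump' ((x - x0) / \<omega>) / \<omega>)" "continuous_on UNIV (\<lambda>x. qbump ((x - x0) / \<omega>))"
    using assms by (auto intro!: continuous_intros)
  have F: "(LINT x:{a'<..<b'}|lborel. f' x) = f b' - f a'"
    if "\<And>x. (f has_real_derivative f' x) (at x)" "continuous_on UNIV f'" "a' \<le> b'" for f f' a' b'
    by (rule LINT_derivative[OF i[OF that(2)] that(3), of "{}"])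
      (use that in \<open>auto intro: DERIV_continuous_on DERIV_subset\<close>)
  have qq: "qbump (-1) = 0" "qbump 1 = 0" "qbump 0 = 1" "qint (-1) = 0" "qint 1 = 0" "qint 0 = 0"
    using bump_values by auto
  show "(LINT x:NI \<omega>|lborel. qbump' ((x - x0) / \<omega>) / \<omega>) = - sgn d"
    unfolding NI_def using F[OF dq c(1), of x0 "x0 + \<omega>"] F[OF dq c(1), of "x0 - \<omega>" x0] assms d
    by (auto simp: qq sgn_if)
  show "(LINT x:NI \<omega>|lborel. qbump ((x - x0) / \<omega>)) = 0"
    unfolding NI_def using F[OF di c(2), of x0 "x0 + \<omega>"] F[OF di c(2), of "x0 - \<omega>" x0] assms d
    by (auto simp: qq)
qed

lemma window_AE:
  assumes k: "k \<in> Eg" and \<omega>: "2 * K * \<omega> \<le> W"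
  shows "AE p in lborel. p \<in> nbox \<omega> k \<longrightarrow>
    \<bar>fst (G p) - a k\<bar> \<le> \<Gamma>s k \<and> \<bar>snd (G p) - b k\<bar> \<le> Bs k \<and> \<bar>h p - c k\<bar> \<le> 2 * On k"
proof -
  have "AE p::point in lborel. \<forall>i\<in>{..m}. fst p \<in> {x0 - W..x0 + W} \<longrightarrow> snd p \<noteq> ell i (fst p)"
    by (intro AE_finite_allI AE_not_graph continuous_ell finite_atMost)
  then show ?thesis
  proof eventually_elim
    case (elim p)
    show ?case
    proof
      assume p: "p \<in> nbox \<omega> k"
      obtain x y where xy: "p = (x, y)" by (cases p)
      have x: "x \<in> NI \<omega>" and y: "N k < y" "y < N (Suc k)" using p by (auto simp: nbox_def xy)
      note t = NI_\<tau>[OF x \<omega>]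
      have km: "k < m" using k by (simp add: Eg_def)
      have y01: "0 \<le> y" "y \<le> 1" using NF_range[of k] NF_range[of "Suc k"] km y by auto
      obtain j where j: "j < m" "(x, y) \<in> tri j" using tri_cover[of x y] t y01 by auto
      have "\<bar>x - x0\<bar> < W"
      proof -
        have "\<bar>x - x0\<bar> = \<bar>\<tau> x\<bar> * W" using d by (simp add: \<tau>_def W_def abs_divide)
        also have "\<dots> < 1 * W" using t W_pos by (intro mult_strict_right_mono) auto
        finally show ?thesis by simp
      qed
      then have "x \<in> {x0 - W..x0 + W}" by auto
      then have ne: "y \<noteq> ell j x" "y \<noteq> ell (Suc j) x" using elim j by (auto simp: xy)
      have G: "G (x, y) = (a j, b j)"
        by (rule G_tri) (use j t ne in \<open>auto simp: tri_def\<close>)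
      note wv = window_values[OF k t(1,2) y j]
      have pD: "(x, y) \<in> D" using nbox_D[OF \<omega> k] p by (auto simp: xy)
      have o: "\<bar>h (x, y) - c j\<bar> \<le> oc j" by (rule h_tri[OF j pD])
      obtain z where "z = N j \<or> z = N (Suc j)" "z = N k \<or> z = N (Suc k)" using wv(4) by blast
      then have "\<bar>c j - c k\<bar> \<le> oc j + oc k" using c_comp[OF j(1) km] by blast
      moreover have "oc j \<le> On k" unfolding On_def
        by (rule member_le_sum) (use wv(3) osc0 in \<open>auto simp: touch_def\<close>)
      \<comment> \<open>Both h - c j and c j - c k cost at most \<open>On k\<close>. For j = k the
        second is zero, and the sum here would count the same oscillation twice, so that case is
        kept apart.\<close>
      moreover have "oc j + oc k \<le> On k" if "j \<noteq> k"
      proof -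
        have "(\<Sum>i\<in>{j, k}. oc i) \<le> On k" unfolding On_def
          by (rule sum_mono2) (use wv(3) km osc0 in \<open>auto simp: touch_def\<close>)
        then show ?thesis using that by simp
      qed
      ultimately have "\<bar>h (x, y) - c k\<bar> \<le> 2 * On k"
        using o On_nonneg[of k] by (cases "j = k") auto
      then show "\<bar>fst (G p) - a k\<bar> \<le> \<Gamma>s k \<and> \<bar>snd (G p) - b k\<bar> \<le> Bs k \<and> \<bar>h p - c k\<bar> \<le> 2 * On k"
        using wv(1,2) by (simp add: xy G)
    qed
  qed
qed

text \<open>Freezing gradient and reaction at their values on element \<open>k\<close> makes the
  integrals explicit: the profile has mean zero, so only the flux of \<open>a k\<close> through the
  line survives. The right-hand side is the cost of freezing, given by the fan variations and the
  oscillations.\<close>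

lemma side_box:
  assumes k: "k \<in> Eg" and \<omega>: "\<omega> > 0" "2 * K * \<omega> \<le> W"
    and c\<alpha>: "continuous_on UNIV \<alpha>" "continuous_on UNIV \<alpha>'"
    and A: "\<And>y. N k < y \<Longrightarrow> y < N (Suc k) \<Longrightarrow> \<bar>\<alpha> y\<bar> \<le> A" "\<And>y. N k < y \<Longrightarrow> y < N (Suc k) \<Longrightarrow> \<bar>\<alpha>' y\<bar> \<le> A'"
    and A0: "A \<ge> 0" "A' \<ge> 0"
  defines "v \<equiv> \<lambda>p. qbump ((fst p - x0) / \<omega>) * \<alpha> (snd p)"
    and "v' \<equiv> \<lambda>p. (qbump' ((fst p - x0) / \<omega>) / \<omega> * \<alpha> (snd p), qbump ((fst p - x0) / \<omega>) * \<alpha>' (snd p))"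
  shows "\<bar>\<epsilon>\<^sup>2 * (LINT p:nbox \<omega> k|lborel. G p \<bullet> v' p) + (LINT p:nbox \<omega> k|lborel. h p * v p)
      + sgn d * \<epsilon>\<^sup>2 * a k * (LINT y:{N k<..<N (Suc k)}|lborel. \<alpha> y)\<bar>
    \<le> \<omega> * sz k * (\<epsilon>\<^sup>2 * (\<Gamma>s k * (60 / \<omega> * A) + Bs k * (6 * A')) + 2 * On k * (6 * A))"
proof -
  let ?B = "nbox \<omega> k"
  obtain a' b' where n: "?B = {a'<..<b'} \<times> {N k<..<N (Suc k)}" "NI \<omega> = {a'<..<b'}"
    using nbox_rect by metis
  have BD: "?B \<subseteq> D" by (rule nbox_D[OF \<omega>(2) k])
  note Bm = nbox_measure[OF \<omega>(1) k]
  have cx: "continuous_on UNIV (\<lambda>x. qbump' ((x - x0) / \<omega>) / \<omega>)" "continuous_on UNIV (\<lambda>x. qbump ((x - x0) / \<omega>))"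
    using \<omega> by (auto intro!: continuous_intros)
  have cv: "continuous_on UNIV v" "continuous_on UNIV v'"
    unfolding v_def v'_def using \<omega>
    by (auto intro!: continuous_intros continuous_on_compose2[OF c\<alpha>(1)] continuous_on_compose2[OF c\<alpha>(2)])
  have iv: "set_integrable lborel ?B v" "set_integrable lborel ?B v'"
    unfolding n(1) by (rule set_integrable_continuous_rect[OF cv(1)]) (rule set_integrable_continuous_rect[OF cv(2)])
  have "bounded (v ` closure ?B)" "bounded (v' ` closure ?B)"
    using Bm(3) by (intro compact_imp_bounded compact_continuous_image continuous_on_subset[OF cv(1)]
        continuous_on_subset[OF cv(2)], auto)+
  then obtain V1 V2 where V: "\<And>p. p \<in> closure ?B \<Longrightarrow> \<bar>v p\<bar> \<le> V1" "\<And>p. p \<in> closure ?B \<Longrightarrow> norm (v' p) \<le> V2"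
    unfolding bounded_iff by auto
  \<comment> \<open>Cutting off outside the box makes the factors globally bounded, as the
    integrability lemmas for products require.\<close>
  define u where "u = (\<lambda>p. indicator ?B p * v p)"
  define u' where "u' = (\<lambda>p. indicator ?B p *\<^sub>R v' p)"
  have um: "u \<in> borel_measurable borel" "u' \<in> borel_measurable borel"
    unfolding u_def u'_def using Bm(2) borel_measurable_continuous_onI[OF cv(1)] borel_measurable_continuous_onI[OF cv(2)]
    by (auto intro!: borel_measurable_times borel_measurable_scaleR borel_measurable_indicator)
  have ub: "\<bar>u p\<bar> \<le> max V1 0" "norm (u' p) \<le> max V2 0" for p
    using V[of p] closure_subset[of ?B] unfolding u_def u'_def by (auto simp: indicator_def)
  have iG': "set_integrable lborel ?B G" and ih': "set_integrable lborel ?B h"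
    using set_integrable_subset[OF iG _ BD] set_integrable_subset[OF ih _ BD] Bm(2) by auto
  have ic: "set_integrable lborel ?B (\<lambda>p. (a k, b k))" "set_integrable lborel ?B (\<lambda>p. c k)"
    by (rule set_integrable_bounded[where B="norm (a k, b k)"], use Bm in \<open>auto intro!: set_borel_measurable_borel\<close>)
      (rule set_integrable_bounded[where B="\<bar>c k\<bar>"], use Bm in \<open>auto intro!: set_borel_measurable_borel\<close>)
  have onB: "set_integrable lborel ?B f" if "set_integrable lborel ?B g" "\<And>p. p \<in> ?B \<Longrightarrow> f p = g p" for f g :: "point \<Rightarrow> real"
    using that by (subst set_integrable_cong[of lborel lborel ?B ?B f g]) auto
  have i1: "set_integrable lborel ?B (\<lambda>p. G p \<bullet> v' p)"
    by (rule onB[OF set_integrable_inner_bounded[OF iG' um(2) ub(2)]]) (simp add: u'_def)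
  have i2: "set_integrable lborel ?B (\<lambda>p. (a k, b k) \<bullet> v' p)"
    by (rule onB[OF set_integrable_inner_bounded[OF ic(1) um(2) ub(2)]]) (simp add: u'_def)
  have i3: "set_integrable lborel ?B (\<lambda>p. h p * v p)"
    by (rule onB[OF set_integrable_times_bounded[OF ih' um(1) ub(1)]]) (simp add: u_def)
  have i4: "set_integrable lborel ?B (\<lambda>p. c k * v p)"
    using iv(1) by (rule set_integrable_mult_right)
  have z1: "(LINT p:?B|lborel. (a k, b k) \<bullet> v' p) = - sgn d * a k * (LINT y:{N k<..<N (Suc k)}|lborel. \<alpha> y)"
  proof -
    have j1: "set_integrable lborel ?B (\<lambda>p. a k * (qbump' ((fst p - x0) / \<omega>) / \<omega> * \<alpha> (snd p)))"
      unfolding n(1) using \<omega>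
      by (intro set_integrable_continuous_rect continuous_intros continuous_on_compose2[OF c\<alpha>(1)]) auto
    have j2: "set_integrable lborel ?B (\<lambda>p. b k * (qbump ((fst p - x0) / \<omega>) * \<alpha>' (snd p)))"
      unfolding n(1) using \<omega>
      by (intro set_integrable_continuous_rect continuous_intros continuous_on_compose2[OF c\<alpha>(2)]) auto
    have "(LINT p:?B|lborel. (a k, b k) \<bullet> v' p) = (LINT p:?B|lborel. a k * (qbump' ((fst p - x0) / \<omega>) / \<omega> * \<alpha> (snd p)))
        + (LINT p:?B|lborel. b k * (qbump ((fst p - x0) / \<omega>) * \<alpha>' (snd p)))"
      unfolding set_integral_add(2)[OF j1 j2, symmetric] by (simp add: v'_def)
    also have "\<dots> = a k * ((LINT x:NI \<omega>|lborel. qbump' ((x - x0) / \<omega>) / \<omega>) * (LINT y:{N k<..<N (Suc k)}|lborel. \<alpha> y))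
       + b k * ((LINT x:NI \<omega>|lborel. qbump ((x - x0) / \<omega>)) * (LINT y:{N k<..<N (Suc k)}|lborel. \<alpha>' y))"
      unfolding set_integral_mult_right n LINT_rect_product[OF cx(1) c\<alpha>(1)] LINT_rect_product[OF cx(2) c\<alpha>(2)] ..
    finally show ?thesis unfolding NI_integrals[OF \<omega>(1)] by simp
  qed
  have z2: "(LINT p:?B|lborel. c k * v p) = 0"
  proof -
    have "(LINT p:?B|lborel. c k * v p) = c k * ((LINT x:NI \<omega>|lborel. qbump ((x - x0) / \<omega>)) * (LINT y:{N k<..<N (Suc k)}|lborel. \<alpha> y))"
      unfolding set_integral_mult_right n v_def LINT_rect_product[OF cx(2) c\<alpha>(1)] ..
    then show ?thesis unfolding NI_integrals[OF \<omega>(1)] by simp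
  qed
  have d1: "set_integrable lborel ?B (\<lambda>p. G p \<bullet> v' p - (a k, b k) \<bullet> v' p)"
    and d2: "set_integrable lborel ?B (\<lambda>p. h p * v p - c k * v p)"
    using i1 i2 i3 i4 by (auto intro: set_integral_diff)
  have i5: "set_integrable lborel ?B (\<lambda>p. \<epsilon>\<^sup>2 * (G p \<bullet> v' p - (a k, b k) \<bullet> v' p) + (h p * v p - c k * v p))"
    using d1 d2 by (intro set_integral_add set_integrable_mult_right)
  have "\<epsilon>\<^sup>2 * (LINT p:?B|lborel. G p \<bullet> v' p) + (LINT p:?B|lborel. h p * v p)
      + sgn d * \<epsilon>\<^sup>2 * a k * (LINT y:{N k<..<N (Suc k)}|lborel. \<alpha> y)
    = \<epsilon>\<^sup>2 * ((LINT p:?B|lborel. G p \<bullet> v' p) - (LINT p:?B|lborel. (a k, b k) \<bullet> v' p))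
      + ((LINT p:?B|lborel. h p * v p) - (LINT p:?B|lborel. c k * v p))"
    unfolding z1 z2 by (simp add: algebra_simps)
  also have "\<dots> = (LINT p:?B|lborel. \<epsilon>\<^sup>2 * (G p \<bullet> v' p - (a k, b k) \<bullet> v' p) + (h p * v p - c k * v p))"
    using d1 d2 i1 i2 i3 i4 by (simp add: set_integral_add set_integral_diff)
  finally have eq: "\<epsilon>\<^sup>2 * (LINT p:?B|lborel. G p \<bullet> v' p) + (LINT p:?B|lborel. h p * v p)
      + sgn d * \<epsilon>\<^sup>2 * a k * (LINT y:{N k<..<N (Suc k)}|lborel. \<alpha> y)
    = (LINT p:?B|lborel. \<epsilon>\<^sup>2 * (G p \<bullet> v' p - (a k, b k) \<bullet> v' p) + (h p * v p - c k * v p))" .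
  have "\<bar>LINT p:?B|lborel. \<epsilon>\<^sup>2 * (G p \<bullet> v' p - (a k, b k) \<bullet> v' p) + (h p * v p - c k * v p)\<bar>
    \<le> (\<epsilon>\<^sup>2 * (\<Gamma>s k * (60 / \<omega> * A) + Bs k * (6 * A')) + 2 * On k * (6 * A)) * measure lborel ?B"
  proof (rule norm_set_LINT_le_AE[OF Bm(2,3) _ _ i5])
    show "0 \<le> \<epsilon>\<^sup>2 * (\<Gamma>s k * (60 / \<omega> * A) + Bs k * (6 * A')) + 2 * On k * (6 * A)"
      using Bn_nonneg On_nonneg A0 \<omega> by (intro add_nonneg_nonneg mult_nonneg_nonneg) auto
    show "AE p in lborel. p \<in> ?B \<longrightarrow> \<bar>\<epsilon>\<^sup>2 * (G p \<bullet> v' p - (a k, b k) \<bullet> v' p) + (h p * v p - c k * v p)\<bar>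
      \<le> \<epsilon>\<^sup>2 * (\<Gamma>s k * (60 / \<omega> * A) + Bs k * (6 * A')) + 2 * On k * (6 * A)"
      using window_AE[OF k \<omega>(2)]
    proof eventually_elim
      case (elim p)
      show ?case
      proof
        assume p: "p \<in> ?B"
        define s where "s = (fst p - x0) / \<omega>"
        have y: "N k < snd p" "snd p < N (Suc k)" using p by (auto simp: nbox_def)
        have e: "\<bar>fst (G p) - a k\<bar> \<le> \<Gamma>s k" "\<bar>snd (G p) - b k\<bar> \<le> Bs k" "\<bar>h p - c k\<bar> \<le> 2 * On k"
          using elim p by auto
        have q1: "\<bar>qbump' s / \<omega> * \<alpha> (snd p)\<bar> \<le> 60 / \<omega> * A"
          unfolding abs_mult abs_divide using bump_bounds(2)[of s] A(1)[OF y] A0 \<omega>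
          by (intro mult_mono divide_mono) auto
        have q2: "\<bar>qbump s * \<alpha>' (snd p)\<bar> \<le> 6 * A'"
          unfolding abs_mult using bump_bounds(1)[of s] A(2)[OF y] by (intro mult_mono) auto
        have q3: "\<bar>qbump s * \<alpha> (snd p)\<bar> \<le> 6 * A"
          unfolding abs_mult using bump_bounds(1)[of s] A(1)[OF y] by (intro mult_mono) auto
        have m1: "\<bar>(fst (G p) - a k) * (qbump' s / \<omega> * \<alpha> (snd p))\<bar> \<le> \<Gamma>s k * (60 / \<omega> * A)"
          unfolding abs_mult[of "fst (G p) - a k"] by (rule mult_mono[OF e(1) q1]) (use Bn_nonneg in auto)
        have m2: "\<bar>(snd (G p) - b k) * (qbump s * \<alpha>' (snd p))\<bar> \<le> Bs k * (6 * A')"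
          unfolding abs_mult[of "snd (G p) - b k"] by (rule mult_mono[OF e(2) q2]) (use Bn_nonneg in auto)
        have m3: "\<bar>(h p - c k) * (qbump s * \<alpha> (snd p))\<bar> \<le> 2 * On k * (6 * A)"
          unfolding abs_mult[of "h p - c k"] by (rule mult_mono[OF e(3) q3]) (use On_nonneg in auto)
        have g: "G p \<bullet> v' p - (a k, b k) \<bullet> v' p = (fst (G p) - a k) * (qbump' s / \<omega> * \<alpha> (snd p)) + (snd (G p) - b k) * (qbump s * \<alpha>' (snd p))"
          unfolding v'_def s_def by (cases "G p") (simp add: algebra_simps add_divide_distrib diff_divide_distrib)
        have hh: "h p * v p - c k * v p = (h p - c k) * (qbump s * \<alpha> (snd p))"
          unfolding v_def s_def by (simp add: algebra_simps)
        have "\<bar>G p \<bullet> v' p - (a k, b k) \<bullet> v' p\<bar> \<le> \<Gamma>s k * (60 / \<omega> * A) + Bs k * (6 * A')"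
          unfolding g using m1 m2 by linarith
        then have "\<bar>\<epsilon>\<^sup>2 * (G p \<bullet> v' p - (a k, b k) \<bullet> v' p)\<bar> \<le> \<epsilon>\<^sup>2 * (\<Gamma>s k * (60 / \<omega> * A) + Bs k * (6 * A'))"
          unfolding abs_mult by (simp add: mult_left_mono)
        then show "\<bar>\<epsilon>\<^sup>2 * (G p \<bullet> v' p - (a k, b k) \<bullet> v' p) + (h p * v p - c k * v p)\<bar>
          \<le> \<epsilon>\<^sup>2 * (\<Gamma>s k * (60 / \<omega> * A) + Bs k * (6 * A')) + 2 * On k * (6 * A)"
          using m3 unfolding hh by linarith
      qed
    qed
  qed
  then show ?thesis unfolding eq Bm(1) by (simp add: mult_ac)
qed

lemma Eg_cover:
  assumes "0 < y" "y < 1" "\<And>i. i \<le> m \<Longrightarrow> y \<noteq> N i"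
  obtains k where "k \<in> Eg" "N k < y" "y < N (Suc k)"
proof -
  define i where "i = (LEAST i. N i > y)"
  have i: "N i > y" "i \<le> m" unfolding i_def using ends assms by (auto intro: LeastI[of _ m] Least_le)
  then obtain k where k: "i = Suc k" using ends assms by (cases i) auto
  have "\<not> N k > y" using not_less_Least[of k "\<lambda>i. N i > y"] k by (simp add: i_def)
  then have "N k < y" using assms(3)[of k] i k by auto
  then show ?thesis using that[of k] i k by (auto simp: Eg_def)
qed

lemma Eg_below:
  assumes "k \<in> Eg" "N k > 0"
  obtains j where "j \<in> Eg" "N (Suc j) = N k"
proof -
  define i where "i = (LEAST i. N i = N k)"
  have i: "N i = N k" "i \<le> k" unfolding i_def by (rule LeastI[of _ k], simp) (rule Least_le, simp)
  then obtain j where j: "i = Suc j" using ends assms by (cases i) auto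
  have km: "k < m" using assms by (simp add: Eg_def)
  have "N j \<noteq> N k" using not_less_Least[of j "\<lambda>i. N i = N k"] j by (simp add: i_def)
  then have "N j < N (Suc j)" using NF_step(1)[of j] i j km by auto
  then show ?thesis using that[of j] i j km by (auto simp: Eg_def)
qed

lemma Eg_ordered:
  assumes "i \<in> Eg" "j \<in> Eg" "i \<noteq> j"
  shows "N (Suc i) \<le> N j \<or> N (Suc j) \<le> N i"
  using NF_mono(1)[of "Suc i" j] NF_mono(1)[of "Suc j" i] assms by (auto simp: Eg_def) (meson Suc_leI less_imp_le linorder_neqE_nat)

end

section \<open>Jumps on the line\<close>

text \<open>Arithmetic for one edge of length \<open>h\<close> with jump \<open>j\<close>. The left
  side collects the deviation of the interpolant from the jump, the cost of freezing on both sides,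
  and the absorbable part of the residual. The shares 1/16, 1/16, 1/16 and 1/8 of the squared jump
  stay below 1/2; the constant 58000 covers all coefficients of the rest.\<close>

lemma edge_Young:
  fixes \<epsilon> \<omega> h j \<Gamma> B o' :: real
  assumes pos: "\<epsilon> > 0" "\<omega> > 0" "h > 0" "j \<ge> 0" "\<Gamma> \<ge> 0" "B \<ge> 0" "o' \<ge> 0"
  defines "\<eta> \<equiv> 1 / 115776"
  shows "\<omega> * (\<epsilon>\<^sup>2 * h * j * \<Gamma>)
    + \<omega> * (2 * (\<omega> * h * (\<epsilon>\<^sup>2 * (\<Gamma> * (60 / \<omega> * (j + \<Gamma>)) + B * (6 * (8 * \<Gamma> / h))) + 2 * o' * (6 * (j + \<Gamma>)))))
    + \<eta> / 2 * \<epsilon>\<^sup>2 * ((\<omega> * (60 / \<omega> * (j + \<Gamma>) + 6 * (8 * \<Gamma> / h)))\<^sup>2 + (6 * (j + \<Gamma>))\<^sup>2) * (2 * \<omega> * h)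
    \<le> \<epsilon>\<^sup>2 * \<omega> * h * j\<^sup>2 / 2 + 58000 * (\<epsilon>\<^sup>2 * \<omega> * h * \<Gamma>\<^sup>2 + \<epsilon>\<^sup>2 * \<omega>\<^sup>2 * B * \<Gamma> + \<epsilon>\<^sup>2 * \<omega> * h * (\<omega> * \<Gamma> / h)\<^sup>2 + \<omega> * h * (\<omega> * o' / \<epsilon>)\<^sup>2)"
proof -
  define y where "y = \<epsilon>\<^sup>2 * \<omega> * h"
  define U where "U = \<omega> * \<Gamma> / h"
  define z where "z = \<omega> * o' / \<epsilon>"
  define S where "S = j + \<Gamma>"
  have y0: "y > 0" using pos by (simp add: y_def)
  have e1: "\<omega> * (\<epsilon>\<^sup>2 * h * j * \<Gamma>) = y * (j * \<Gamma>)" by (simp add: y_def)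
  have e2: "\<omega> * (2 * (\<omega> * h * (\<epsilon>\<^sup>2 * (\<Gamma> * (60 / \<omega> * (j + \<Gamma>)) + B * (6 * (8 * \<Gamma> / h))) + 2 * o' * (6 * (j + \<Gamma>)))))
    = y * (120 * \<Gamma> * S) + 96 * (\<epsilon>\<^sup>2 * \<omega>\<^sup>2 * B * \<Gamma>) + \<omega> * h * (24 * z * (\<epsilon> * S))"
    using pos by (simp add: y_def z_def S_def field_simps power2_eq_square)
  have e3: "\<omega> * (60 / \<omega> * (j + \<Gamma>) + 6 * (8 * \<Gamma> / h)) = 60 * S + 48 * U"
    using pos by (simp add: U_def S_def field_simps)
  have e4: "\<eta> / 2 * \<epsilon>\<^sup>2 * ((60 * S + 48 * U)\<^sup>2 + (6 * (j + \<Gamma>))\<^sup>2) * (2 * \<omega> * h) = y * (\<eta> * ((60 * S + 48 * U)\<^sup>2 + (6 * S)\<^sup>2))"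
    by (simp add: y_def S_def)
  have S2: "S\<^sup>2 \<le> 2 * j\<^sup>2 + 2 * \<Gamma>\<^sup>2" unfolding S_def using zero_le_power2[of "j - \<Gamma>"] by (simp add: power2_eq_square algebra_simps)
  have i1: "j * \<Gamma> \<le> j\<^sup>2 / 16 + 4 * \<Gamma>\<^sup>2"
    using zero_le_power2[of "j / 4 - 2 * \<Gamma>"] by (simp add: power2_eq_square algebra_simps)
  have i2: "120 * \<Gamma> * S \<le> j\<^sup>2 / 16 + 57720 * \<Gamma>\<^sup>2"
    unfolding S_def using zero_le_power2[of "j / 4 - 240 * \<Gamma>"] by (simp add: power2_eq_square algebra_simps)
  have i3: "24 * z * (\<epsilon> * S) \<le> \<epsilon>\<^sup>2 * j\<^sup>2 / 16 + \<epsilon>\<^sup>2 * \<Gamma>\<^sup>2 + 2448 * z\<^sup>2"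
    unfolding S_def using zero_le_power2[of "\<epsilon> * j / 4 - 48 * z"] zero_le_power2[of "\<epsilon> * \<Gamma> - 12 * z"]
    by (simp add: power2_eq_square algebra_simps)
  \<comment> \<open>The square of the gradient bound and that of the function value give 7200 + 36 =
    7236 times \<open>S\<^sup>2\<close>. Since 115776 = 16 * 7236, the squared jump receives exactly
    1/8.\<close>
  have i4: "\<eta> * ((60 * S + 48 * U)\<^sup>2 + (6 * S)\<^sup>2) \<le> j\<^sup>2 / 8 + \<Gamma>\<^sup>2 / 8 + U\<^sup>2"
  proof -
    have "(60 * S + 48 * U)\<^sup>2 \<le> 7200 * S\<^sup>2 + 4608 * U\<^sup>2"
      using zero_le_power2[of "60 * S - 48 * U"] by (simp add: power2_eq_square algebra_simps)
    then have "(60 * S + 48 * U)\<^sup>2 + (6 * S)\<^sup>2 \<le> 7236 * (2 * j\<^sup>2 + 2 * \<Gamma>\<^sup>2) + 4608 * U\<^sup>2"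
      using S2 by (simp add: power2_eq_square algebra_simps)
    then have "\<eta> * ((60 * S + 48 * U)\<^sup>2 + (6 * S)\<^sup>2) \<le> \<eta> * (7236 * (2 * j\<^sup>2 + 2 * \<Gamma>\<^sup>2) + 4608 * U\<^sup>2)"
      by (intro mult_left_mono) (auto simp: \<eta>_def)
    also have "\<dots> \<le> j\<^sup>2 / 8 + \<Gamma>\<^sup>2 / 8 + U\<^sup>2" by (simp add: \<eta>_def)
    finally show ?thesis .
  qed
  have "\<omega> * h * (24 * z * (\<epsilon> * S)) \<le> \<omega> * h * (\<epsilon>\<^sup>2 * j\<^sup>2 / 16 + \<epsilon>\<^sup>2 * \<Gamma>\<^sup>2 + 2448 * z\<^sup>2)"
    using pos i3 by (intro mult_left_mono) auto
  also have "\<dots> = y * (j\<^sup>2 / 16 + \<Gamma>\<^sup>2) + 2448 * (\<omega> * h * z\<^sup>2)" by (simp add: y_def algebra_simps)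
  finally have i3': "\<omega> * h * (24 * z * (\<epsilon> * S)) \<le> y * (j\<^sup>2 / 16 + \<Gamma>\<^sup>2) + 2448 * (\<omega> * h * z\<^sup>2)" .
  have nn: "0 \<le> \<epsilon>\<^sup>2 * \<omega>\<^sup>2 * B * \<Gamma>" "0 \<le> \<omega> * h * z\<^sup>2" "0 \<le> y * U\<^sup>2" "0 \<le> y * \<Gamma>\<^sup>2" "0 \<le> y * j\<^sup>2"
    using pos y0 by auto
  have "y * (j * \<Gamma>) + y * (120 * \<Gamma> * S) + y * (\<eta> * ((60 * S + 48 * U)\<^sup>2 + (6 * S)\<^sup>2))
    = y * (j * \<Gamma> + 120 * \<Gamma> * S + \<eta> * ((60 * S + 48 * U)\<^sup>2 + (6 * S)\<^sup>2))" by (simp add: algebra_simps)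
  also have "\<dots> \<le> y * (j\<^sup>2 / 16 + 4 * \<Gamma>\<^sup>2 + (j\<^sup>2 / 16 + 57720 * \<Gamma>\<^sup>2) + (j\<^sup>2 / 8 + \<Gamma>\<^sup>2 / 8 + U\<^sup>2))"
    using y0 i1 i2 i4 by (intro mult_left_mono) auto
  also have "\<dots> = y * j\<^sup>2 / 4 + (57724 + 1/8) * (y * \<Gamma>\<^sup>2) + y * U\<^sup>2" by (simp add: algebra_simps)
  finally have tot: "y * (j * \<Gamma>) + y * (120 * \<Gamma> * S) + y * (\<eta> * ((60 * S + 48 * U)\<^sup>2 + (6 * S)\<^sup>2))
    \<le> y * j\<^sup>2 / 4 + (57724 + 1/8) * (y * \<Gamma>\<^sup>2) + y * U\<^sup>2" .
  have d: "y * (j\<^sup>2 / 16 + \<Gamma>\<^sup>2) = y * j\<^sup>2 / 16 + y * \<Gamma>\<^sup>2" by (simp add: algebra_simps)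
  have fin: "T1 + (T2 + 96 * b + T3) + T4 \<le> q / 2 + 58000 * (g + b + u + w)"
    if "T1 + T2 + T4 \<le> q / 4 + (57724 + 1/8) * g + u" "T3 \<le> q / 16 + g + 2448 * w"
      "0 \<le> b" "0 \<le> w" "0 \<le> u" "0 \<le> g" "0 \<le> q" for T1 T2 T3 T4 q g u w b :: real
    using that by argo
  show ?thesis
    unfolding e1 e2 e3 e4 y_def[symmetric] U_def[symmetric] z_def[symmetric]
    by (rule fin[OF tot i3'[unfolded d] nn])
qed

text \<open>Here the aspect ratio disappears: each power of \<Gamma> brings a factor h / W, which
  compensates the division by \<open>h\<close>. What remains is measured in the weight
  min(\<epsilon>, h) W of the long-edge bubbles, according to whether \<open>h\<close> or \<epsilon>
  is smaller.\<close>

lemma edge_scales: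
  fixes \<epsilon> \<omega> h \<Gamma> B K W :: real
  assumes \<omega>: "0 < \<omega>" "\<omega> \<le> \<epsilon>" "\<omega> \<le> W" and h: "0 < h" "h \<le> 2 * W" and K: "K \<ge> 1"
    and \<Gamma>: "0 \<le> \<Gamma>" "\<Gamma> \<le> K\<^sup>2 * (h / W) * B" and B: "B \<ge> 0"
  shows "\<epsilon>\<^sup>2 * \<omega> * h * \<Gamma>\<^sup>2 + \<epsilon>\<^sup>2 * \<omega>\<^sup>2 * B * \<Gamma> + \<epsilon>\<^sup>2 * \<omega> * h * (\<omega> * \<Gamma> / h)\<^sup>2 \<le> 12 * K^4 * (\<epsilon>\<^sup>2 * W * min \<epsilon> h * B\<^sup>2)"
proof -
  define \<delta> where "\<delta> = min \<epsilon> h"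
  have pos: "\<epsilon> > 0" "W > 0" "\<delta> > 0" using assms by (auto simp: \<delta>_def)
  have h2: "h\<^sup>2 \<le> (2 * W)\<^sup>2" using h by (intro power_mono) auto
  have c1: "\<omega> * h^3 \<le> 8 * W^3 * \<delta>"
  proof (cases "h \<le> \<epsilon>")
    case True
    have "\<omega> * h^3 = h * (\<omega> * h\<^sup>2)" by (simp add: power2_eq_square power3_eq_cube)
    also have "\<dots> \<le> h * (W * (2 * W)\<^sup>2)" using h2 \<omega> h by (intro mult_left_mono mult_mono) auto
    also have "\<dots> \<le> 8 * W^3 * \<delta>" using True h pos by (simp add: \<delta>_def power2_eq_square power3_eq_cube)
    finally show ?thesis .
  next
    case False
    have "h^3 \<le> (2 * W)^3" using h by (intro power_mono) auto
    then have "\<omega> * h^3 \<le> \<epsilon> * (2 * W)^3" using \<omega> h pos by (intro mult_mono) auto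
    then show ?thesis using False by (simp add: \<delta>_def power3_eq_cube mult_ac)
  qed
  have c2: "\<omega>\<^sup>2 * h \<le> 2 * W\<^sup>2 * \<delta>"
  proof (cases "h \<le> \<epsilon>")
    case True
    have "\<omega>\<^sup>2 \<le> W\<^sup>2" using \<omega> by (intro power_mono) auto
    then have "\<omega>\<^sup>2 * h \<le> W\<^sup>2 * h" using h by (intro mult_right_mono) auto
    also have "\<dots> \<le> 2 * W\<^sup>2 * h" using h by simp
    finally show ?thesis using True by (simp add: \<delta>_def min_def)
  next
    case False
    have "\<omega>\<^sup>2 * h = \<omega> * (\<omega> * h)" by (simp add: power2_eq_square)
    also have "\<dots> \<le> \<epsilon> * (W * (2 * W))" using \<omega> h pos by (intro mult_mono) auto
    finally show ?thesis using False by (simp add: \<delta>_def power2_eq_square mult_ac)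
  qed
  have c3: "\<omega>^3 * h \<le> 2 * W^3 * \<delta>"
  proof -
    have "\<omega>^3 * h = \<omega> * (\<omega>\<^sup>2 * h)" by (simp add: power2_eq_square power3_eq_cube)
    also have "\<dots> \<le> W * (2 * W\<^sup>2 * \<delta>)" by (rule mult_mono[OF \<omega>(3) c2]) (use \<omega> pos h in auto)
    finally show ?thesis by (simp add: power2_eq_square power3_eq_cube mult_ac)
  qed
  define g where "g = K\<^sup>2 * (h / W) * B"
  have g0: "0 \<le> g" using \<Gamma> by (simp add: g_def)
  have G2: "\<Gamma>\<^sup>2 \<le> g\<^sup>2" using \<Gamma> by (intro power_mono) (auto simp: g_def)
  have W3: "W^3 > 0" using pos by simp
  have t1: "\<omega> * h * \<Gamma>\<^sup>2 \<le> 8 * K^4 * (W * \<delta> * B\<^sup>2)"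
  proof -
    have "\<omega> * h * \<Gamma>\<^sup>2 \<le> \<omega> * h * g\<^sup>2" using G2 \<omega> h by (intro mult_left_mono) auto
    also have "\<dots> = K^4 * B\<^sup>2 * (\<omega> * h^3) / W\<^sup>2"
      by (simp add: g_def power_mult_distrib power_divide power2_eq_square power3_eq_cube power4_eq_xxxx)
    also have "\<dots> \<le> K^4 * B\<^sup>2 * (8 * W^3 * \<delta>) / W\<^sup>2"
      using c1 by (intro divide_right_mono mult_left_mono) auto
    also have "\<dots> = 8 * K^4 * (W * \<delta> * B\<^sup>2)" using pos by (simp add: power2_eq_square power3_eq_cube)
    finally show ?thesis .
  qed
  have t2: "\<omega>\<^sup>2 * B * \<Gamma> \<le> 2 * K^4 * (W * \<delta> * B\<^sup>2)"
  proof -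
    have "\<omega>\<^sup>2 * B * \<Gamma> \<le> \<omega>\<^sup>2 * B * g" using \<Gamma> B by (intro mult_left_mono) (auto simp: g_def)
    also have "\<dots> = K\<^sup>2 * B\<^sup>2 * (\<omega>\<^sup>2 * h) / W" by (simp add: g_def power2_eq_square)
    also have "\<dots> \<le> K\<^sup>2 * B\<^sup>2 * (2 * W\<^sup>2 * \<delta>) / W"
      using c2 pos by (intro divide_right_mono mult_left_mono) auto
    also have "\<dots> = 2 * K\<^sup>2 * (W * \<delta> * B\<^sup>2)" using pos by (simp add: power2_eq_square)
    also have "\<dots> \<le> 2 * K^4 * (W * \<delta> * B\<^sup>2)"
      using K pos by (intro mult_right_mono mult_left_mono power_increasing) auto
    finally show ?thesis .
  qed
  have t3: "\<omega> * h * (\<omega> * \<Gamma> / h)\<^sup>2 \<le> 2 * K^4 * (W * \<delta> * B\<^sup>2)"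
  proof -
    have "\<omega> * h * (\<omega> * \<Gamma> / h)\<^sup>2 = \<omega>^3 / h * \<Gamma>\<^sup>2"
      using h by (simp add: power_mult_distrib power_divide power2_eq_square power3_eq_cube)
    also have "\<dots> \<le> \<omega>^3 / h * g\<^sup>2" using G2 \<omega> h by (intro mult_left_mono) auto
    also have "\<dots> = K^4 * B\<^sup>2 * (\<omega>^3 * h) / W\<^sup>2"
      using h by (simp add: g_def power_mult_distrib power_divide power2_eq_square power3_eq_cube power4_eq_xxxx)
    also have "\<dots> \<le> K^4 * B\<^sup>2 * (2 * W^3 * \<delta>) / W\<^sup>2"
      using c3 by (intro divide_right_mono mult_left_mono) auto
    also have "\<dots> = 2 * K^4 * (W * \<delta> * B\<^sup>2)" using pos by (simp add: power2_eq_square power3_eq_cube)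
    finally show ?thesis .
  qed
  have "\<epsilon>\<^sup>2 * \<omega> * h * \<Gamma>\<^sup>2 + \<epsilon>\<^sup>2 * \<omega>\<^sup>2 * B * \<Gamma> + \<epsilon>\<^sup>2 * \<omega> * h * (\<omega> * \<Gamma> / h)\<^sup>2
    = \<epsilon>\<^sup>2 * (\<omega> * h * \<Gamma>\<^sup>2 + \<omega>\<^sup>2 * B * \<Gamma> + \<omega> * h * (\<omega> * \<Gamma> / h)\<^sup>2)" by (simp add: algebra_simps)
  also have "\<dots> \<le> \<epsilon>\<^sup>2 * (12 * K^4 * (W * \<delta> * B\<^sup>2))"
    using t1 t2 t3 by (intro mult_left_mono) auto
  finally show ?thesis by (simp add: \<delta>_def mult_ac)
qed

text \<open>The columns to the right and to the left of one mesh line. They are numbered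
  independently; conformity of the mesh enters only as agreement of the short edges on the common
  line.\<close>

locale two_sides =
  R: mesh_side x0 dR mR NR FR l r D P Q G h \<epsilon> BG aR bR cR oR osR K Mx +
  L: mesh_side x0 dL mL NL FL l r D P Q G h \<epsilon> BG aL bL cL oL osL K Mx
  for x0 dR mR NR FR l r D P Q G h \<epsilon> BG aR bR cR oR osR K Mx dL mL NL FL aL bL cL oL osL +
  assumes dR: "dR > 0" and dL: "dL < 0"
    and same_edges: "(\<lambda>k. (NR k, NR (Suc k))) ` R.Eg = (\<lambda>k. (NL k, NL (Suc k))) ` L.Eg"
begin

text \<open>Pairs the right element at an edge of the line with the left element at the same
  edge.\<close>

definition lam :: "nat \<Rightarrow> nat"
  where "lam k = (SOME j. j \<in> L.Eg \<and> NL j = NR k \<and> NL (Suc j) = NR (Suc k))"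

lemma lam:
  assumes "k \<in> R.Eg"
  shows "lam k \<in> L.Eg" "NL (lam k) = NR k" "NL (Suc (lam k)) = NR (Suc k)"
proof -
  have "(NR k, NR (Suc k)) \<in> (\<lambda>k. (NL k, NL (Suc k))) ` L.Eg"
    unfolding same_edges[symmetric] using assms by auto
  then have "\<exists>j. j \<in> L.Eg \<and> NL j = NR k \<and> NL (Suc j) = NR (Suc k)" by auto
  from someI_ex[OF this] show "lam k \<in> L.Eg" "NL (lam k) = NR k" "NL (Suc (lam k)) = NR (Suc k)"
    unfolding lam_def by auto
qed

lemma lam_bij: "inj_on lam R.Eg" "lam ` R.Eg = L.Eg"
proof -
  show "inj_on lam R.Eg"
    using lam R.Eg_inj(1) unfolding inj_on_def by metis
  show "lam ` R.Eg = L.Eg"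
  proof (intro set_eqI iffI)
    fix j assume "j \<in> lam ` R.Eg" then show "j \<in> L.Eg" using lam by auto
  next
    fix j assume j: "j \<in> L.Eg"
    then have "(NL j, NL (Suc j)) \<in> (\<lambda>k. (NR k, NR (Suc k))) ` R.Eg" unfolding same_edges by auto
    then obtain k where k: "k \<in> R.Eg" "NL j = NR k" "NL (Suc j) = NR (Suc k)" by auto
    then have "lam k = j" using lam[OF k(1)] j L.Eg_inj(1) by (auto simp: inj_on_def)
    then show "j \<in> lam ` R.Eg" using k by auto
  qed
qed

lemma lam_sum: "(\<Sum>k\<in>R.Eg. f (lam k)) = (\<Sum>j\<in>L.Eg. f j)"
  using sum.reindex[OF lam_bij(1), of f] lam_bij(2) by simp

lemma lam_sz: "k \<in> R.Eg \<Longrightarrow> L.sz (lam k) = R.sz k"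
  using lam R.sz_near L.sz_near by simp

text \<open>The outward normals on the line are (1, 0) on the left and (-1, 0) on the right, so this
  is the normal jump.\<close>

definition J :: "nat \<Rightarrow> real" where "J k = aL (lam k) - aR k"
definition \<Gamma>2 :: "nat \<Rightarrow> real" where "\<Gamma>2 k = R.\<Gamma>s k + L.\<Gamma>s (lam k)"
definition B2 :: "nat \<Rightarrow> real" where "B2 k = R.Bs k + L.Bs (lam k)"
definition O2 :: "nat \<Rightarrow> real" where "O2 k = R.On k + L.On (lam k)"

lemma nonneg2: "\<Gamma>2 k \<ge> 0" "B2 k \<ge> 0" "O2 k \<ge> 0"
  using R.Bn_nonneg L.Bn_nonneg R.On_nonneg L.On_nonneg
  by (auto simp: \<Gamma>2_def B2_def O2_def intro!: add_nonneg_nonneg)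

text \<open>At an interior node, the value of the jump on the edge below it.\<close>

definition A :: "real \<Rightarrow> real"
  where "A y = (if y < 1 then (\<Sum>k | k \<in> R.Eg \<and> NR (Suc k) = y. J k) else 0)"

lemma A_eq: "k \<in> R.Eg \<Longrightarrow> NR (Suc k) < 1 \<Longrightarrow> A (NR (Suc k)) = J k"
proof -
  assume k: "k \<in> R.Eg" "NR (Suc k) < 1"
  have "{j. j \<in> R.Eg \<and> NR (Suc j) = NR (Suc k)} = {k}"
    using k R.Eg_inj(2) by (auto simp: inj_on_def)
  then show ?thesis using k by (simp add: A_def)
qed

lemma A_0: "A 0 = 0" "A 1 = 0"
proof -
  have "{k. k \<in> R.Eg \<and> NR (Suc k) = 0} = {}"
    using R.NF_range by (auto simp: R.Eg_def) (metis less_imp_le not_le)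
  then have "(\<Sum>k | k \<in> R.Eg \<and> NR (Suc k) = 0. J k) = 0" by (simp only: sum.empty)
  then show "A 0 = 0" by (simp add: A_def)
  show "A 1 = 0" by (simp add: A_def)
qed

text \<open>Adjacent edges of the line differ in their jumps only by the fan variations of both
  columns at the common node. At heights 0 and 1 the value zero is comparable with the jump because
  of the boundary conditions, through \<open>bottom_edge\<close> and
  \<open>top_edge\<close>.\<close>

lemma A_near:
  assumes k: "k \<in> R.Eg"
  shows "\<bar>A (NR (Suc k)) - J k\<bar> \<le> \<Gamma>2 k" "\<bar>A (NR k) - J k\<bar> \<le> \<Gamma>2 k"
proof -
  note lk = lam[OF k]
  have rng: "0 \<le> NR k" "NR k < NR (Suc k)" "NR (Suc k) \<le> 1"
    using k R.NF_range[of k] R.NF_range[of "Suc k"] by (auto simp: R.Eg_def)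
  have g: "R.\<Gamma>n (NR k) + L.\<Gamma>n (NR k) \<le> \<Gamma>2 k" "R.\<Gamma>n (NR (Suc k)) + L.\<Gamma>n (NR (Suc k)) \<le> \<Gamma>2 k"
    using R.Bn_nonneg(2) L.Bn_nonneg(2) by (auto simp: \<Gamma>2_def R.\<Gamma>s_def L.\<Gamma>s_def lk intro: add_mono)
  show "\<bar>A (NR (Suc k)) - J k\<bar> \<le> \<Gamma>2 k"
  proof (cases "NR (Suc k) < 1")
    case True
    then show ?thesis using A_eq[OF k] nonneg2 by simp
  next
    case False
    then have 1: "NR (Suc k) = 1" using rng by simp
    have "\<bar>aR k\<bar> \<le> R.\<Gamma>n 1" "\<bar>aL (lam k)\<bar> \<le> L.\<Gamma>n 1"
      using R.top_edge[OF k 1] L.top_edge[OF lk(1)] lk 1 by auto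
    then show ?thesis using g(2) unfolding 1 A_0 J_def by simp
  qed
  show "\<bar>A (NR k) - J k\<bar> \<le> \<Gamma>2 k"
  proof (cases "NR k = 0")
    case True
    have "\<bar>aR k\<bar> \<le> R.\<Gamma>n 0" "\<bar>aL (lam k)\<bar> \<le> L.\<Gamma>n 0"
      using R.bottom_edge[OF k True] L.bottom_edge[OF lk(1)] lk True by auto
    then show ?thesis using g(1) unfolding True A_0 J_def by simp
  next
    case False
    then obtain j where j: "j \<in> R.Eg" "NR (Suc j) = NR k"
      using R.Eg_below[OF k] rng by auto
    note lj = lam[OF j(1)]
    have "A (NR k) = J j" using A_eq[OF j(1)] j rng by simp
    moreover have "\<bar>aR k - aR j\<bar> \<le> R.\<Gamma>n (NR k)" by (rule R.edge_to_edge[OF j(1) k j(2)])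
    moreover have "\<bar>aL (lam k) - aL (lam j)\<bar> \<le> L.\<Gamma>n (NR k)"
      using L.edge_to_edge[OF lj(1) lk(1)] lj lk j by simp
    ultimately show ?thesis using g(1) unfolding J_def by linarith
  qed
qed

definition dA :: "nat \<Rightarrow> real" where "dA k = A (NR (Suc k)) - A (NR k)"
text \<open>A sum of smooth steps, one per edge of the line, interpolating the nodal values
  \<open>A\<close>; this gives a C^1 function with an explicit derivative. For an element without an
  edge on the line \<open>dA\<close> is zero, so the division by zero in its argument has no
  effect.\<close>

definition \<alpha> :: "real \<Rightarrow> real" where "\<alpha> y = (\<Sum>k<mR. dA k * sstep ((y - NR k) / (NR (Suc k) - NR k)))"
definition \<alpha>' :: "real \<Rightarrow> real"
  where "\<alpha>' y = (\<Sum>k<mR. dA k * (sstep' ((y - NR k) / (NR (Suc k) - NR k)) * (1 / (NR (Suc k) - NR k))))"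

lemma \<alpha>_deriv: "(\<alpha> has_real_derivative \<alpha>' y) (at y)"
  unfolding \<alpha>_def[abs_def] \<alpha>'_def
proof (rule DERIV_sum)
  fix k assume k: "k \<in> {..<mR}"
  show "((\<lambda>y. dA k * sstep ((y - NR k) / (NR (Suc k) - NR k))) has_real_derivative
    dA k * (sstep' ((y - NR k) / (NR (Suc k) - NR k)) * (1 / (NR (Suc k) - NR k)))) (at y)"
  proof (cases "NR (Suc k) = NR k")
    case True
    then show ?thesis by (simp add: dA_def)
  next
    case False
    then show ?thesis
      by (intro DERIV_cmult DERIV_chain2[OF has_real_derivative_sstep]) (auto intro!: derivative_eq_intros)
  qed
qed

lemma \<alpha>_cont: "continuous_on UNIV \<alpha>" "continuous_on UNIV \<alpha>'"
proof -
  show "continuous_on UNIV \<alpha>" using \<alpha>_deriv by (meson DERIV_isCont continuous_at_imp_continuous_on)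
  have c: "continuous_on UNIV (\<lambda>y. (y - NR k) / (NR (Suc k) - NR k))" for k
    unfolding divide_inverse by (intro continuous_intros)
  show "continuous_on UNIV \<alpha>'" unfolding \<alpha>'_def[abs_def] by (intro continuous_intros c)
qed

lemma NR_args:
  assumes "j < mR" "NR j < NR (Suc j)" "k \<in> R.Eg" "j \<noteq> k" "NR k \<le> y" "y \<le> NR (Suc k)"
  shows "(j < k \<and> (y - NR j) / (NR (Suc j) - NR j) \<ge> 1) \<or> (j > k \<and> (y - NR j) / (NR (Suc j) - NR j) \<le> 0)"
proof (cases "j < k")
  case True
  then have "NR (Suc j) \<le> NR k" using R.NF_mono(1)[of "Suc j" k] assms by (auto simp: R.Eg_def)
  then show ?thesis using True assms by (auto simp: field_simps)
next
  case False
  then have "NR (Suc k) \<le> NR j" using R.NF_mono(1)[of "Suc k" j] assms by auto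
  then show ?thesis using False assms by (auto simp: divide_nonpos_pos)
qed

text \<open>On the edge \<open>k\<close> the steps of lower edges are complete and those of higher
  edges have not begun; the completed ones telescope to the nodal value, since
  \<open>A 0 = 0\<close>.\<close>

lemma \<alpha>_on_edge:
  assumes k: "k \<in> R.Eg" and y: "NR k \<le> y" "y \<le> NR (Suc k)"
  shows "\<alpha> y = A (NR k) + dA k * sstep ((y - NR k) / (NR (Suc k) - NR k))"
    "\<alpha>' y = dA k * (sstep' ((y - NR k) / (NR (Suc k) - NR k)) * (1 / (NR (Suc k) - NR k)))"
proof -
  have km: "k < mR" using k by (simp add: R.Eg_def)
  have t: "dA j * sstep ((y - NR j) / (NR (Suc j) - NR j)) = (if j < k then dA j else if j = k then dA k * sstep ((y - NR k) / (NR (Suc k) - NR k)) else 0)"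
    "dA j * (sstep' ((y - NR j) / (NR (Suc j) - NR j)) * (1 / (NR (Suc j) - NR j))) = (if j = k then dA k * (sstep' ((y - NR k) / (NR (Suc k) - NR k)) * (1 / (NR (Suc k) - NR k))) else 0)"
    if j: "j < mR" for j
  proof -
    define u where "u = (y - NR j) / (NR (Suc j) - NR j)"
    consider "j = k" | "j \<noteq> k" "dA j = 0" | "j \<noteq> k" "NR j < NR (Suc j)"
      using R.NF_step(1)[OF j] by (cases "NR j = NR (Suc j)") (auto simp: dA_def)
    then have "dA j * sstep u = (if j < k then dA j else if j = k then dA k * sstep ((y - NR k) / (NR (Suc k) - NR k)) else 0) \<and>
      dA j * (sstep' u * (1 / (NR (Suc j) - NR j))) = (if j = k then dA k * (sstep' ((y - NR k) / (NR (Suc k) - NR k)) * (1 / (NR (Suc k) - NR k))) else 0)"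
    proof cases
      case 1
      then show ?thesis by (simp add: u_def)
    next
      case 2
      then show ?thesis by simp
    next
      case 3
      from NR_args[OF j 3(2) k 3(1) y] have "(j < k \<and> u \<ge> 1) \<or> (j > k \<and> u \<le> 0)" by (simp only: u_def)
      then show ?thesis
      proof
        assume "j < k \<and> u \<ge> 1"
        moreover from this have "sstep u = 1" "sstep' u = 0" by (auto intro: sstep_1 sstep'_0)
        ultimately show ?thesis by simp
      next
        assume "j > k \<and> u \<le> 0"
        moreover from this have "sstep u = 0" "sstep' u = 0" by (auto intro: sstep_0 sstep'_0)
        ultimately show ?thesis by simp
      qed
    qed
    then show "dA j * sstep ((y - NR j) / (NR (Suc j) - NR j)) = (if j < k then dA j else if j = k then dA k * sstep ((y - NR k) / (NR (Suc k) - NR k)) else 0)"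
      "dA j * (sstep' ((y - NR j) / (NR (Suc j) - NR j)) * (1 / (NR (Suc j) - NR j))) = (if j = k then dA k * (sstep' ((y - NR k) / (NR (Suc k) - NR k)) * (1 / (NR (Suc k) - NR k))) else 0)"
      by (simp_all only: u_def)
  qed
  have "\<alpha> y = (\<Sum>j<mR. if j < k then dA j else if j = k then dA k * sstep ((y - NR k) / (NR (Suc k) - NR k)) else 0)"
    unfolding \<alpha>_def by (rule sum.cong) (use t in auto)
  also have "\<dots> = (\<Sum>j<mR. (if j < k then dA j else 0) + (if j = k then dA k * sstep ((y - NR k) / (NR (Suc k) - NR k)) else 0))"
    by (rule sum.cong) auto
  also have "\<dots> = (\<Sum>j<mR. if j < k then dA j else 0) + dA k * sstep ((y - NR k) / (NR (Suc k) - NR k))"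
    using km by (simp add: sum.distrib)
  also have "(\<Sum>j<mR. if j < k then dA j else 0) = (\<Sum>j<k. dA j)"
    by (rule sum.mono_neutral_cong_right) (use km in auto)
  also have "\<dots> = A (NR k)"
    unfolding dA_def using sum_lessThan_telescope[of "\<lambda>j. A (NR j)" k] A_0 R.ends by simp
  finally show "\<alpha> y = A (NR k) + dA k * sstep ((y - NR k) / (NR (Suc k) - NR k))" .
  have "\<alpha>' y = (\<Sum>j<mR. if j = k then dA k * (sstep' ((y - NR k) / (NR (Suc k) - NR k)) * (1 / (NR (Suc k) - NR k))) else 0)"
    unfolding \<alpha>'_def by (rule sum.cong) (use t in auto)
  then show "\<alpha>' y = dA k * (sstep' ((y - NR k) / (NR (Suc k) - NR k)) * (1 / (NR (Suc k) - NR k)))"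
    using km by simp
qed

text \<open>On an edge the interpolant is a convex combination of two nodal values close to
  \<open>J k\<close>. Its derivative depends only on their difference, at most twice
  \<open>\<Gamma>2 k\<close>, times the slope 4 of the step: this is the 8, and the size of the jump
  itself does not enter.\<close>

lemma \<alpha>_bounds:
  assumes k: "k \<in> R.Eg" and y: "NR k \<le> y" "y \<le> NR (Suc k)"
  shows "\<bar>\<alpha> y - J k\<bar> \<le> \<Gamma>2 k" "\<bar>\<alpha> y\<bar> \<le> \<bar>J k\<bar> + \<Gamma>2 k" "\<bar>\<alpha>' y\<bar> \<le> 8 * \<Gamma>2 k / R.sz k"
proof -
  define s where "s = sstep ((y - NR k) / (NR (Suc k) - NR k))"
  have s: "0 \<le> s" "s \<le> 1" unfolding s_def using sstep_bounds by auto
  have eq: "\<alpha> y - J k = (1 - s) * (A (NR k) - J k) + s * (A (NR (Suc k)) - J k)"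
    unfolding \<alpha>_on_edge(1)[OF assms] s_def[symmetric] dA_def by (simp add: algebra_simps)
  have "\<bar>(1 - s) * (A (NR k) - J k) + s * (A (NR (Suc k)) - J k)\<bar> \<le> (1 - s) * \<Gamma>2 k + s * \<Gamma>2 k"
  proof -
    have "\<bar>(1 - s) * (A (NR k) - J k)\<bar> \<le> (1 - s) * \<Gamma>2 k" "\<bar>s * (A (NR (Suc k)) - J k)\<bar> \<le> s * \<Gamma>2 k"
      using A_near[OF k] s by (auto simp: abs_mult intro: mult_left_mono)
    then show ?thesis by linarith
  qed
  then show 1: "\<bar>\<alpha> y - J k\<bar> \<le> \<Gamma>2 k" unfolding eq by (simp add: algebra_simps)
  then show "\<bar>\<alpha> y\<bar> \<le> \<bar>J k\<bar> + \<Gamma>2 k" by linarith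
  have h: "NR (Suc k) - NR k = R.sz k" "R.sz k > 0" using R.sz_near[OF k] k by (auto simp: R.Eg_def)
  have "\<bar>dA k\<bar> \<le> 2 * \<Gamma>2 k" unfolding dA_def using A_near[OF k] by linarith
  moreover have "\<bar>sstep' ((y - NR k) / R.sz k)\<bar> \<le> 4" using sstep'_bounds[of "(y - NR k) / R.sz k"] by auto
  ultimately have "\<bar>dA k\<bar> * \<bar>sstep' ((y - NR k) / R.sz k)\<bar> \<le> (2 * \<Gamma>2 k) * 4" by (intro mult_mono) auto
  then show "\<bar>\<alpha>' y\<bar> \<le> 8 * \<Gamma>2 k / R.sz k"
    unfolding \<alpha>_on_edge(2)[OF assms] h(1) using h(2) by (simp add: abs_mult divide_right_mono)
qed

text \<open>The constant margins of \<open>sstep\<close> leave room at both ends of the line. The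
  test function thus has compact support in the open strip although the outermost edges begin on the
  boundary.\<close>

lemma \<alpha>_support: obtains \<zeta> where "\<zeta> > 0" "\<zeta> < 1/2" "\<And>y. y \<le> \<zeta> \<or> y \<ge> 1 - \<zeta> \<Longrightarrow> \<alpha> y = 0"
proof -
  \<comment> \<open>A quarter of the shortest edge is the margin of its step; including 1 in the
    minimum keeps the bound below 1/2.\<close>
  define \<zeta> where "\<zeta> = Min (insert 1 (R.sz ` R.Eg)) / 4"
  have fin: "finite (insert 1 (R.sz ` R.Eg))" by simp
  have \<zeta>0: "\<zeta> > 0" unfolding \<zeta>_def using R.sz_pos by (subst divide_pos_pos) (auto simp: R.Eg_def)
  have \<zeta>1: "\<zeta> \<le> 1/4" and \<zeta>k: "\<And>k. k \<in> R.Eg \<Longrightarrow> 4 * \<zeta> \<le> R.sz k"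
    unfolding \<zeta>_def using Min_le[OF fin] by auto
  have tm: "dA k * sstep ((y - NR k) / (NR (Suc k) - NR k)) = (if y \<le> \<zeta> then 0 else dA k)"
    if y: "y \<le> \<zeta> \<or> y \<ge> 1 - \<zeta>" and k: "k < mR" for k y
  proof (cases "k \<in> R.Eg")
    case False
    then have "NR (Suc k) = NR k" using R.NF_step(1)[OF k] k by (auto simp: R.Eg_def)
    then show ?thesis by (simp add: dA_def)
  next
    case True
    have h: "NR (Suc k) - NR k = R.sz k" "R.sz k > 0" using R.sz_near[OF True] R.sz_pos[OF k] by auto
    have rng: "0 \<le> NR k" "NR (Suc k) \<le> 1" using R.NF_range[of k] R.NF_range[of "Suc k"] k by auto
    show ?thesis
    proof (cases "y \<le> \<zeta>")
      case True1: True
      have "(y - NR k) / R.sz k \<le> 1/4" using \<zeta>k[OF True] True1 rng h by (simp add: pos_divide_le_eq)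
      then show ?thesis using True1 by (simp add: h sstep_0)
    next
      case False
      then have "y \<ge> 1 - \<zeta>" using y by simp
      then have "(y - NR k) / R.sz k \<ge> 3/4" using \<zeta>k[OF True] rng h by (simp add: pos_le_divide_eq)
      then show ?thesis using False by (simp add: h sstep_1)
    qed
  qed
  have zero: "\<alpha> y = 0" if y: "y \<le> \<zeta> \<or> y \<ge> 1 - \<zeta>" for y
  proof -
    have "\<alpha> y = (\<Sum>k<mR. if y \<le> \<zeta> then 0 else dA k)"
      unfolding \<alpha>_def by (rule sum.cong) (use tm[OF y] in auto)
    also have "\<dots> = 0"
    proof -
      have "(\<Sum>k<mR. dA k) = 0"
        unfolding dA_def using sum_lessThan_telescope[of "\<lambda>j. A (NR j)" mR] A_0 R.ends by simp
      then show ?thesis by (cases "y \<le> \<zeta>") auto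
    qed
    finally show ?thesis .
  qed
  show ?thesis by (rule that[of \<zeta>]) (use \<zeta>0 \<zeta>1 zero in auto)
qed

end

section \<open>The test function on the line and its contributions edge by edge\<close>

lemma AE_not_coordinate:
  "AE p::point in lborel. fst p \<noteq> c" "AE p::point in lborel. snd p \<noteq> c"
proof -
  have "emeasure (lborel \<Otimes>\<^sub>M lborel) ({c} \<times> (UNIV :: real set)) = 0"
    "emeasure (lborel \<Otimes>\<^sub>M lborel) ((UNIV :: real set) \<times> {c}) = 0"
    by (simp_all add: lborel.emeasure_pair_measure_Times)
  then have n: "{c} \<times> (UNIV :: real set) \<in> null_sets lborel" "(UNIV :: real set) \<times> {c} \<in> null_sets lborel"
    by (auto simp: null_sets_def lborel_prod intro!: borel_closed closed_Times)
  show "AE p::point in lborel. fst p \<noteq> c"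
    using AE_not_in[OF n(1)] by eventually_elim auto
  show "AE p::point in lborel. snd p \<noteq> c"
    using AE_not_in[OF n(2)] by eventually_elim auto
qed

context two_sides
begin

text \<open>At most \<epsilon>, to balance the reaction against the diffusion; at most W / (2 K) on
  either side, to stay within the reach of \<open>window\<close>.\<close>

definition wd :: real where "wd = min \<epsilon> (min R.W L.W) / (2 * K)"

lemma wd: "wd > 0" "2 * K * wd \<le> R.W" "2 * K * wd \<le> L.W" "wd \<le> \<epsilon>" "wd \<le> R.W" "wd \<le> L.W"
  "wd < R.W" "wd < L.W"
proof -
  have K: "K \<ge> 1" by (rule R.K)
  have p: "min \<epsilon> (min R.W L.W) > 0" using R.eps R.W_pos L.W_pos by simp
  then show w0: "wd > 0" using K by (simp add: wd_def)
  have e: "2 * K * wd = min \<epsilon> (min R.W L.W)" using K by (simp add: wd_def)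
  show "2 * K * wd \<le> R.W" "2 * K * wd \<le> L.W" unfolding e by auto
  have "2 * wd \<le> 2 * K * wd" using K w0 by simp
  then show "wd \<le> \<epsilon>" "wd \<le> R.W" "wd \<le> L.W" "wd < R.W" "wd < L.W" using e w0 by linarith+
qed

definition v :: "point \<Rightarrow> real" where "v p = qbump ((fst p - x0) / wd) * \<alpha> (snd p)"
definition v' :: "point \<Rightarrow> point"
  where "v' p = (qbump' ((fst p - x0) / wd) / wd * \<alpha> (snd p), qbump ((fst p - x0) / wd) * \<alpha>' (snd p))"

lemma v_off: "\<bar>fst p - x0\<bar> \<ge> wd \<Longrightarrow> v p = 0 \<and> v' p = 0"
  unfolding v_def v'_def using abs_div_ge[OF wd(1), of "fst p - x0"] by (simp add: bump_outside zero_prod_def)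

lemma v_grad: "grad v = v'" and v_test: "test_function D v"
proof -
  have c: "qbump ((fst p - x0) / wd) = qbump (1 / wd * fst p + - x0 / wd)"
    "qbump' ((fst p - x0) / wd) = qbump' (1 / wd * fst p + - x0 / wd)" for p :: point
    by (simp_all add: diff_divide_distrib)
  have G: "GDERIV v p :> v' p" for p
    using GDERIV_product_affine[OF has_real_derivative_qbump \<alpha>_deriv, of "1/wd" "- x0/wd" 0 1 0 p]
    unfolding v_def[abs_def] v'_def c by simp
  then show "grad v = v'" using grad_eq by blast
  have cont: "continuous_on UNIV v'"
    unfolding v'_def[abs_def] using wd(1)
    by (intro continuous_intros continuous_on_compose2[OF \<alpha>_cont(1)] continuous_on_compose2[OF \<alpha>_cont(2)]) auto
  obtain \<zeta> where z: "\<zeta> > 0" "\<zeta> < 1/2" "\<And>y. y \<le> \<zeta> \<or> y \<ge> 1 - \<zeta> \<Longrightarrow> \<alpha> y = 0" using \<alpha>_support by blast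
  let ?K = "{x0 - wd..x0 + wd} \<times> {\<zeta>..1 - \<zeta>}"
  have "?K \<subseteq> D"
  proof
    fix p assume p: "p \<in> ?K"
    obtain x y where xy: "p = (x, y)" by (cases p)
    have y: "0 < y" "y < 1" and x: "\<bar>x - x0\<bar> \<le> wd" using p z xy by auto
    have "R.\<tau> (x0 + R.W/2) = 1/2" "L.\<tau> (x0 - L.W/2) = 1/2"
      using dR dL by (simp_all add: R.\<tau>_def R.W_def L.\<tau>_def L.W_def)
    then have r: "x0 + R.W/2 \<in> {l<..<r}" "x0 - L.W/2 \<in> {l<..<r}"
      using R.l_r L.l_r by simp_all
    have "wd \<le> R.W / 2" "wd \<le> L.W / 2"
    proof -
      have "1 * wd \<le> K * wd" using R.K wd(1) by (intro mult_right_mono) auto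
      then show "wd \<le> R.W / 2" "wd \<le> L.W / 2" using wd(2,3) by linarith+
    qed
    then have "x \<in> {l<..<r}" using x r by auto
    then show "p \<in> D" using y by (simp add: R.D_def xy)
  qed
  moreover have "v p = 0" if "p \<notin> ?K" for p
  proof -
    have "\<bar>fst p - x0\<bar> \<ge> wd \<or> (snd p \<le> \<zeta> \<or> snd p \<ge> 1 - \<zeta>)" using that by (cases p) auto
    then show ?thesis using v_off[of p] z(3)[of "snd p"] by (auto simp: v_def)
  qed
  moreover have "compact ?K" by (intro compact_Times compact_Icc)
  ultimately show "test_function D v" using test_functionI[OF G cont] by blast
qed

definition wbox :: "nat \<Rightarrow> point set" where "wbox k = R.nbox wd k \<union> L.nbox wd (lam k)"

lemma wbox_props:
  assumes k: "k \<in> R.Eg"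
  shows "wbox k \<in> sets borel" "bounded (wbox k)" "wbox k \<subseteq> D" "measure lborel (wbox k) = 2 * wd * R.sz k"
    "R.nbox wd k \<inter> L.nbox wd (lam k) = {}"
    "p \<in> wbox k \<Longrightarrow> NR k < snd p \<and> snd p < NR (Suc k) \<and> fst p \<noteq> x0"
proof -
  note Rm = R.nbox_measure[OF wd(1) k] and Lm = L.nbox_measure[OF wd(1) lam(1)[OF k]]
  show "wbox k \<in> sets borel" "bounded (wbox k)" unfolding wbox_def using Rm Lm by auto
  show "wbox k \<subseteq> D" unfolding wbox_def using R.nbox_D[OF wd(2) k] L.nbox_D[OF wd(3) lam(1)[OF k]] by auto
  show dis: "R.nbox wd k \<inter> L.nbox wd (lam k) = {}"
    using dR dL by (auto simp: R.nbox_def L.nbox_def R.NI_def L.NI_def)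
  show "measure lborel (wbox k) = 2 * wd * R.sz k"
    unfolding wbox_def
    using measure_Un3[of "R.nbox wd k" lborel "L.nbox wd (lam k)"] Rm Lm dis lam_sz[OF k]
      emeasure_bounded_finite[OF Rm(3)] emeasure_bounded_finite[OF Lm(3)]
    by (simp add: fmeasurable_def)
  show "p \<in> wbox k \<Longrightarrow> NR k < snd p \<and> snd p < NR (Suc k) \<and> fst p \<noteq> x0"
    using dR dL lam[OF k] by (auto simp: wbox_def R.nbox_def L.nbox_def R.NI_def L.NI_def)
qed

lemma wbox_disjoint: "disjoint_family_on wbox R.Eg"
  unfolding disjoint_family_on_def
proof (intro ballI impI)
  fix i j assume ij: "i \<in> R.Eg" "j \<in> R.Eg" "i \<noteq> j"
  show "wbox i \<inter> wbox j = {}"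
    using R.Eg_ordered[OF ij] wbox_props(6)[OF ij(1)] wbox_props(6)[OF ij(2)] by fastforce
qed

text \<open>Off a vertical strip the integrand is zero. The strip is covered by the boxes up to the
  line itself and the horizontal lines through its nodes, all null sets.\<close>

lemma split_integral:
  fixes F :: "point \<Rightarrow> real"
  assumes i: "set_integrable lborel D F" and off: "\<And>p. \<bar>fst p - x0\<bar> \<ge> wd \<Longrightarrow> F p = 0"
  shows "(LINT p:D|lborel. F p) = (\<Sum>k\<in>R.Eg. LINT p:wbox k|lborel. F p)"
    "k \<in> R.Eg \<Longrightarrow> (LINT p:wbox k|lborel. F p) = (LINT p:R.nbox wd k|lborel. F p) + (LINT p:L.nbox wd (lam k)|lborel. F p)"
proof -
  have ib: "set_integrable lborel (wbox k) F" if "k \<in> R.Eg" for k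
    by (rule set_integrable_subset[OF i]) (use wbox_props[OF that] in auto)
  have U: "(\<Union>k\<in>R.Eg. wbox k) \<in> sets borel" "(\<Union>k\<in>R.Eg. wbox k) \<subseteq> D"
    using wbox_props by (auto intro!: sets.finite_UN)
  have "AE p::point in lborel. \<forall>i\<in>{..mR}. snd p \<noteq> NR i"
    by (intro AE_finite_allI AE_not_coordinate finite_atMost)
  then have "AE p in lborel. p \<in> D \<longrightarrow> F p = 0 \<or> p \<in> (\<Union>k\<in>R.Eg. wbox k)"
    using AE_not_coordinate(1)[of x0]
  proof eventually_elim
    case (elim p)
    show ?case
    proof (intro impI)
      assume p: "p \<in> D"
      show "F p = 0 \<or> p \<in> (\<Union>k\<in>R.Eg. wbox k)"
      proof (cases "\<bar>fst p - x0\<bar> < wd")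
        case True
        have y: "0 < snd p" "snd p < 1" using p by (auto simp: R.D_def)
        obtain k where k: "k \<in> R.Eg" "NR k < snd p" "snd p < NR (Suc k)"
          using R.Eg_cover[OF y] elim by auto
        have "p \<in> wbox k"
        proof (cases "fst p > x0")
          case True1: True
          then have "p \<in> R.nbox wd k" using True k dR by (cases p) (auto simp: R.nbox_def R.NI_def)
          then show ?thesis by (simp add: wbox_def)
        next
          case False
          then have "p \<in> L.nbox wd (lam k)" using True k dL elim lam[OF k(1)] by (cases p) (auto simp: L.nbox_def L.NI_def)
          then show ?thesis by (simp add: wbox_def)
        qed
        then show ?thesis using k by auto
      qed (use off in auto)
    qed
  qed
  then have "(LINT p:D|lborel. F p) = (LINT p:(\<Union>k\<in>R.Eg. wbox k)|lborel. F p)"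
    unfolding set_lebesgue_integral_def
  proof (intro integral_cong_AE)
    assume A: "AE p in lborel. p \<in> D \<longrightarrow> F p = 0 \<or> p \<in> (\<Union>k\<in>R.Eg. wbox k)"
    show "(\<lambda>p. indicator D p *\<^sub>R F p) \<in> borel_measurable lborel"
      using i unfolding set_integrable_def by auto
    show "(\<lambda>p. indicator (\<Union>k\<in>R.Eg. wbox k) p *\<^sub>R F p) \<in> borel_measurable lborel"
      using set_integrable_subset[OF i _ U(2)] U(1) unfolding set_integrable_def by auto
    show "AE p in lborel. indicator D p *\<^sub>R F p = indicator (\<Union>k\<in>R.Eg. wbox k) p *\<^sub>R F p"
      using A by eventually_elim (use U(2) in \<open>auto simp: indicator_def\<close>)
  qed
  also have "\<dots> = (\<Sum>k\<in>R.Eg. LINT p:wbox k|lborel. F p)"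
    by (rule set_integral_finite_Union[OF _ wbox_disjoint]) (use ib wbox_props in auto)
  finally show "(LINT p:D|lborel. F p) = (\<Sum>k\<in>R.Eg. LINT p:wbox k|lborel. F p)" .
  show "(LINT p:wbox k|lborel. F p) = (LINT p:R.nbox wd k|lborel. F p) + (LINT p:L.nbox wd (lam k)|lborel. F p)" if k: "k \<in> R.Eg"
    unfolding wbox_def
    by (rule set_integral_Un[OF wbox_props(5)[OF k]])
      (use ib[OF k] R.nbox_measure[OF wd(1) k] L.nbox_measure[OF wd(1) lam(1)[OF k]] in
        \<open>auto intro: set_integrable_subset simp: wbox_def\<close>)
qed

definition gb :: "nat \<Rightarrow> real" where "gb k = 60 / wd * (\<bar>J k\<bar> + \<Gamma>2 k) + 6 * (8 * \<Gamma>2 k / R.sz k)"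

lemma v_bounds:
  assumes k: "k \<in> R.Eg" and p: "p \<in> wbox k"
  shows "\<bar>v p\<bar> \<le> 6 * (\<bar>J k\<bar> + \<Gamma>2 k)" "norm (v' p) \<le> gb k"
proof -
  define s where "s = (fst p - x0) / wd"
  have y: "NR k \<le> snd p" "snd p \<le> NR (Suc k)" using wbox_props(6)[OF k p] by auto
  note ab = \<alpha>_bounds[OF k y]
  show "\<bar>v p\<bar> \<le> 6 * (\<bar>J k\<bar> + \<Gamma>2 k)"
    unfolding v_def s_def[symmetric] abs_mult using bump_bounds(1)[of s] ab by (intro mult_mono) auto
  have 1: "\<bar>qbump' s / wd * \<alpha> (snd p)\<bar> \<le> 60 / wd * (\<bar>J k\<bar> + \<Gamma>2 k)"
    unfolding abs_mult abs_divide using bump_bounds(2)[of s] ab wd(1) nonneg2(1)[of k]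
    by (intro mult_mono divide_mono) auto
  have 2: "\<bar>qbump s * \<alpha>' (snd p)\<bar> \<le> 6 * (8 * \<Gamma>2 k / R.sz k)"
    unfolding abs_mult using bump_bounds(1)[of s] ab by (intro mult_mono) auto
  have "norm (v' p) \<le> \<bar>qbump' s / wd * \<alpha> (snd p)\<bar> + \<bar>qbump s * \<alpha>' (snd p)\<bar>"
    unfolding v'_def s_def[symmetric]
    using norm_Pair_le[of "qbump' s / wd * \<alpha> (snd p)" "qbump s * \<alpha>' (snd p)"] by (simp only: real_norm_def)
  then show "norm (v' p) \<le> gb k" using 1 2 unfolding gb_def by linarith
qed

definition \<eta> :: real where "\<eta> = 1 / 115776"

lemma res_integrable:
  "set_integrable lborel D (\<lambda>p. \<epsilon> * P p * norm (v' p) + Q p * \<bar>v p\<bar>)"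
proof -
  obtain \<phi>' K B where g: "grad v = \<phi>'" and c: "continuous_on UNIV v" "continuous_on UNIV \<phi>'"
    and B: "\<And>p. \<bar>v p\<bar> \<le> B" "\<And>p. norm (\<phi>' p) \<le> B"
    using test_functionE[OF v_test] by metis
  have g': "\<phi>' = v'" using g v_grad by simp
  have "set_integrable lborel D (\<lambda>p. norm (v' p) *\<^sub>R P p)"
    by (rule set_integrable_times_bounded[OF R.iP, of _ B])
      (use B borel_measurable_continuous_onI[OF c(2)] in \<open>auto simp: g'\<close>)
  then have 1: "set_integrable lborel D (\<lambda>p. \<epsilon> * P p * norm (v' p))"
    using set_integrable_mult_right[of \<epsilon>] by (simp add: mult_ac)
  have "set_integrable lborel D (\<lambda>p. \<bar>v p\<bar> *\<^sub>R Q p)"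
    by (rule set_integrable_times_bounded[OF R.iQ, of _ B])
      (use B borel_measurable_continuous_onI[OF c(1)] in auto)
  then have 2: "set_integrable lborel D (\<lambda>p. Q p * \<bar>v p\<bar>)" by (simp add: mult_ac)
  show ?thesis using 1 2 by (rule set_integral_add)
qed

lemma box_Young:
  assumes k: "k \<in> R.Eg"
  shows "wd * (LINT p:wbox k|lborel. \<epsilon> * P p * norm (v' p) + Q p * \<bar>v p\<bar>)
    \<le> \<eta> / 2 * \<epsilon>\<^sup>2 * ((wd * gb k)\<^sup>2 + (6 * (\<bar>J k\<bar> + \<Gamma>2 k))\<^sup>2) * (2 * wd * R.sz k) + 1 / (2 * \<eta>) * (LINT p:wbox k|lborel. R.R2 p)"
proof -
  note W = wbox_props[OF k]
  define c0 where "c0 = \<eta> / 2 * \<epsilon>\<^sup>2 * ((wd * gb k)\<^sup>2 + (6 * (\<bar>J k\<bar> + \<Gamma>2 k))\<^sup>2)"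
  have \<eta>: "\<eta> > 0" by (simp add: \<eta>_def)
  have e: "\<epsilon> > 0" by (rule R.eps)
  have i0: "set_integrable lborel (wbox k) (\<lambda>p. c0)"
    by (rule set_integrable_bounded[where B="\<bar>c0\<bar>"]) (use W in \<open>auto simp: set_borel_measurable_def\<close>)
  have iR: "set_integrable lborel (wbox k) R.R2" by (rule set_integrable_subset[OF R.iR2]) (use W in auto)
  have iL: "set_integrable lborel (wbox k) (\<lambda>p. \<epsilon> * P p * norm (v' p) + Q p * \<bar>v p\<bar>)"
    by (rule set_integrable_subset[OF res_integrable]) (use W in auto)
  have "wd * (LINT p:wbox k|lborel. \<epsilon> * P p * norm (v' p) + Q p * \<bar>v p\<bar>)
    = (LINT p:wbox k|lborel. wd * (\<epsilon> * P p * norm (v' p) + Q p * \<bar>v p\<bar>))" by simp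
  also have "\<dots> \<le> (LINT p:wbox k|lborel. c0 + 1 / (2 * \<eta>) * R.R2 p)"
  proof (rule set_integral_mono)
    show "set_integrable lborel (wbox k) (\<lambda>p. wd * (\<epsilon> * P p * norm (v' p) + Q p * \<bar>v p\<bar>))"
      using iL by (rule set_integrable_mult_right)
    show "set_integrable lborel (wbox k) (\<lambda>p. c0 + 1 / (2 * \<eta>) * R.R2 p)"
      using i0 iR by (intro set_integral_add set_integrable_mult_right)
    fix p assume p: "p \<in> wbox k"
    note vb = v_bounds[OF k p]
    have P0: "P p \<ge> 0" "Q p \<ge> 0" by (rule R.P0, rule R.Q0)
    have "wd * (\<epsilon> * P p * norm (v' p)) \<le> wd * (\<epsilon> * P p * gb k)"
      using wd(1) e P0 vb by (intro mult_left_mono mult_nonneg_nonneg) auto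
    also have "\<dots> = (\<epsilon> * (wd * gb k)) * P p" by simp
    also have "\<dots> \<le> \<eta> * (\<epsilon> * (wd * gb k))\<^sup>2 / 2 + (P p)\<^sup>2 / (2 * \<eta>)" by (rule Young_weighted[OF \<eta>])
    finally have 1: "wd * (\<epsilon> * P p * norm (v' p)) \<le> \<eta> / 2 * \<epsilon>\<^sup>2 * (wd * gb k)\<^sup>2 + 1 / (2 * \<eta>) * (P p)\<^sup>2"
      by (simp add: power_mult_distrib mult_ac)
    \<comment> \<open>The bound wd \<le> \<epsilon> brings the zero-order term to the same scale as
      the gradient term.\<close>
    have "wd * (Q p * \<bar>v p\<bar>) \<le> \<epsilon> * (Q p * (6 * (\<bar>J k\<bar> + \<Gamma>2 k)))"
      using wd(1,4) e P0 vb by (intro mult_mono mult_nonneg_nonneg) auto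
    also have "\<dots> = (\<epsilon> * (6 * (\<bar>J k\<bar> + \<Gamma>2 k))) * Q p" by simp
    also have "\<dots> \<le> \<eta> * (\<epsilon> * (6 * (\<bar>J k\<bar> + \<Gamma>2 k)))\<^sup>2 / 2 + (Q p)\<^sup>2 / (2 * \<eta>)" by (rule Young_weighted[OF \<eta>])
    finally have 2: "wd * (Q p * \<bar>v p\<bar>) \<le> \<eta> / 2 * \<epsilon>\<^sup>2 * (6 * (\<bar>J k\<bar> + \<Gamma>2 k))\<^sup>2 + 1 / (2 * \<eta>) * (Q p)\<^sup>2"
      by (simp add: power_mult_distrib mult_ac)
    show "wd * (\<epsilon> * P p * norm (v' p) + Q p * \<bar>v p\<bar>) \<le> c0 + 1 / (2 * \<eta>) * R.R2 p"
      using add_mono[OF 1 2] unfolding c0_def R.R2_def distrib_left by linarith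
  qed
  also have "\<dots> = c0 * (2 * wd * R.sz k) + 1 / (2 * \<eta>) * (LINT p:wbox k|lborel. R.R2 p)"
    using i0 iR W(4) by (subst set_integral_add) (auto simp: set_lebesgue_integral_def)
  finally show ?thesis unfolding c0_def .
qed

definition Eb :: "nat \<Rightarrow> real"
  where "Eb k = wd * R.sz k * (\<epsilon>\<^sup>2 * (\<Gamma>2 k * (60 / wd * (\<bar>J k\<bar> + \<Gamma>2 k)) + B2 k * (6 * (8 * \<Gamma>2 k / R.sz k))) + 2 * O2 k * (6 * (\<bar>J k\<bar> + \<Gamma>2 k)))"

text \<open>The signs of \<open>side_box\<close> are opposite on the two sides, so the one-sided
  fluxes assemble to the jump. The common bound \<open>Eb\<close> dominates the freezing cost of
  each side, hence the factor 2.\<close>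

lemma edge_flux:
  assumes k: "k \<in> R.Eg"
  shows "\<epsilon>\<^sup>2 * J k * (LINT y:{NR k<..<NR (Suc k)}|lborel. \<alpha> y)
    \<le> \<epsilon>\<^sup>2 * (LINT p:wbox k|lborel. G p \<bullet> v' p) + (LINT p:wbox k|lborel. h p * v p) + 2 * Eb k"
proof -
  note lk = lam[OF k]
  have h0: "R.sz k > 0" using k R.sz_pos by (simp add: R.Eg_def)
  have ab: "\<bar>\<alpha> y\<bar> \<le> \<bar>J k\<bar> + \<Gamma>2 k" "\<bar>\<alpha>' y\<bar> \<le> 8 * \<Gamma>2 k / R.sz k" if "NR k < y" "y < NR (Suc k)" for y
    using \<alpha>_bounds[OF k, of y] that by auto
  have A0: "0 \<le> \<bar>J k\<bar> + \<Gamma>2 k" "0 \<le> 8 * \<Gamma>2 k / R.sz k" using nonneg2 h0 by (auto intro!: add_nonneg_nonneg)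
  have sR: "sgn dR = 1" and sL: "sgn dL = -1" using dR dL by auto
  have R1: "\<bar>\<epsilon>\<^sup>2 * (LINT p:R.nbox wd k|lborel. G p \<bullet> v' p) + (LINT p:R.nbox wd k|lborel. h p * v p)
      + sgn dR * \<epsilon>\<^sup>2 * aR k * (LINT y:{NR k<..<NR (Suc k)}|lborel. \<alpha> y)\<bar>
    \<le> wd * R.sz k * (\<epsilon>\<^sup>2 * (R.\<Gamma>s k * (60 / wd * (\<bar>J k\<bar> + \<Gamma>2 k)) + R.Bs k * (6 * (8 * \<Gamma>2 k / R.sz k))) + 2 * R.On k * (6 * (\<bar>J k\<bar> + \<Gamma>2 k)))"
    unfolding v_def v'_def
    by (rule R.side_box[OF k wd(1,2) \<alpha>_cont ab A0])
  have L1: "\<bar>\<epsilon>\<^sup>2 * (LINT p:L.nbox wd (lam k)|lborel. G p \<bullet> v' p) + (LINT p:L.nbox wd (lam k)|lborel. h p * v p)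
      + sgn dL * \<epsilon>\<^sup>2 * aL (lam k) * (LINT y:{NL (lam k)<..<NL (Suc (lam k))}|lborel. \<alpha> y)\<bar>
    \<le> wd * L.sz (lam k) * (\<epsilon>\<^sup>2 * (L.\<Gamma>s (lam k) * (60 / wd * (\<bar>J k\<bar> + \<Gamma>2 k)) + L.Bs (lam k) * (6 * (8 * \<Gamma>2 k / R.sz k))) + 2 * L.On (lam k) * (6 * (\<bar>J k\<bar> + \<Gamma>2 k)))"
    unfolding v_def v'_def
    by (rule L.side_box[OF lk(1) wd(1,3) \<alpha>_cont _ _ A0]) (use ab lk in auto)
  have mono: "wd * R.sz k * (\<epsilon>\<^sup>2 * (g * (60 / wd * (\<bar>J k\<bar> + \<Gamma>2 k)) + b * (6 * (8 * \<Gamma>2 k / R.sz k))) + 2 * q * (6 * (\<bar>J k\<bar> + \<Gamma>2 k))) \<le> Eb k"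
    if "g \<le> \<Gamma>2 k" "b \<le> B2 k" "q \<le> O2 k" for g b q
    unfolding Eb_def using that wd(1) h0 A0
    by (intro mult_left_mono add_mono mult_right_mono) auto
  have "R.\<Gamma>s k \<le> \<Gamma>2 k" "R.Bs k \<le> B2 k" "R.On k \<le> O2 k" "L.\<Gamma>s (lam k) \<le> \<Gamma>2 k" "L.Bs (lam k) \<le> B2 k" "L.On (lam k) \<le> O2 k"
    using R.Bn_nonneg L.Bn_nonneg R.On_nonneg L.On_nonneg by (auto simp: \<Gamma>2_def B2_def O2_def)
  note R2 = order_trans[OF R1[unfolded sR] mono[OF this(1,2,3)]]
    and L2 = order_trans[OF L1[unfolded sL lk lam_sz[OF k]] mono[OF this(4,5,6)]]
  have i1: "set_integrable lborel D (\<lambda>p. G p \<bullet> v' p)" "set_integrable lborel D (\<lambda>p. h p * v p)"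
    using R.h_test_integrable[OF v_test] v_grad by auto
  have s1: "(LINT p:wbox k|lborel. G p \<bullet> v' p) = (LINT p:R.nbox wd k|lborel. G p \<bullet> v' p) + (LINT p:L.nbox wd (lam k)|lborel. G p \<bullet> v' p)"
    by (rule split_integral(2)[OF i1(1) _ k]) (simp add: v_off)
  have s2: "(LINT p:wbox k|lborel. h p * v p) = (LINT p:R.nbox wd k|lborel. h p * v p) + (LINT p:L.nbox wd (lam k)|lborel. h p * v p)"
    by (rule split_integral(2)[OF i1(2) _ k]) (simp add: v_off)
  define I where "I = (LINT y:{NR k<..<NR (Suc k)}|lborel. \<alpha> y)"
  have "\<epsilon>\<^sup>2 * J k * I = \<epsilon>\<^sup>2 * aL (lam k) * I - \<epsilon>\<^sup>2 * aR k * I" by (simp add: J_def algebra_simps)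
  then show ?thesis using R2 L2 unfolding s1 s2 I_def[symmetric] distrib_left by (simp add: algebra_simps abs_le_iff)
qed

text \<open>On the edge \<alpha> deviates from \<open>J k\<close> by at most
  \<open>\<Gamma>2 k\<close>; the loss is a mixed term suited to Young's inequality.\<close>

lemma edge_mean:
  assumes k: "k \<in> R.Eg"
  shows "\<epsilon>\<^sup>2 * R.sz k * (J k)\<^sup>2 - \<epsilon>\<^sup>2 * R.sz k * \<bar>J k\<bar> * \<Gamma>2 k \<le> \<epsilon>\<^sup>2 * J k * (LINT y:{NR k<..<NR (Suc k)}|lborel. \<alpha> y)"
proof -
  let ?I = "{NR k<..<NR (Suc k)}"
  have h: "NR (Suc k) - NR k = R.sz k" "R.sz k > 0" using R.sz_near[OF k] k by (auto simp: R.Eg_def)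
  have len: "(LINT y:?I|lborel. c) = c * R.sz k" for c :: real
    using h by (simp add: set_lebesgue_integral_def)
  have ic: "set_integrable lborel ?I (\<lambda>y. c)" for c :: real
    by (rule set_integrable_bounded[where B="\<bar>c\<bar>"]) (auto simp: set_borel_measurable_def)
  have i\<alpha>: "set_integrable lborel ?I \<alpha>"
    by (rule set_integrable_bounded[where B="\<bar>J k\<bar> + \<Gamma>2 k"])
      (use \<alpha>_bounds[OF k] in \<open>auto intro!: set_borel_measurable_borel borel_measurable_continuous_onI \<alpha>_cont\<close>)
  have "((J k)\<^sup>2 - \<bar>J k\<bar> * \<Gamma>2 k) * R.sz k = (LINT y:?I|lborel. (J k)\<^sup>2 - \<bar>J k\<bar> * \<Gamma>2 k)" by (simp add: len)
  also have "\<dots> \<le> (LINT y:?I|lborel. J k * \<alpha> y)"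
  proof (rule set_integral_mono[OF ic set_integrable_mult_right[OF i\<alpha>]])
    fix y assume "y \<in> ?I"
    then have "\<bar>\<alpha> y - J k\<bar> \<le> \<Gamma>2 k" using \<alpha>_bounds(1)[OF k, of y] by auto
    then have "\<bar>J k\<bar> * \<bar>\<alpha> y - J k\<bar> \<le> \<bar>J k\<bar> * \<Gamma>2 k" by (intro mult_left_mono) auto
    then have "\<bar>J k * (\<alpha> y - J k)\<bar> \<le> \<bar>J k\<bar> * \<Gamma>2 k" by (simp add: abs_mult)
    then show "(J k)\<^sup>2 - \<bar>J k\<bar> * \<Gamma>2 k \<le> J k * \<alpha> y"
      by (simp add: power2_eq_square algebra_simps abs_le_iff)
  qed
  also have "\<dots> = J k * (LINT y:?I|lborel. \<alpha> y)" by simp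
  finally have "\<epsilon>\<^sup>2 * (((J k)\<^sup>2 - \<bar>J k\<bar> * \<Gamma>2 k) * R.sz k) \<le> \<epsilon>\<^sup>2 * (J k * (LINT y:?I|lborel. \<alpha> y))"
    by (rule mult_left_mono) simp
  then show ?thesis by (simp add: algebra_simps)
qed

text \<open>The factor 116000 = 2 * 58000 arises when half of the jumps is absorbed. The summands
  stand for the long-edge jumps, the oscillations near the line, and the error tested
  directly.\<close>

definition C2 :: real
  where "C2 = 116000 * (24 * K^4 * (40 * K * real Mx) * R.C1 * 2 + 32 * (real Mx + 1) * K + 1)"

text \<open>Multiplication by the width \<open>wd\<close> gives the jumps their weight. The per-edge
  errors are reduced to variations of the long-edge fans, oscillations and error integrals, whose
  sums over the line are bounded by \<open>Bs_sum\<close> with \<open>bubble_sum\<close>, by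
  \<open>On_sum\<close>, and by disjointness of the boxes.\<close>

theorem main_estimate:
  "(\<Sum>k\<in>R.Eg. \<epsilon>\<^sup>2 * wd * R.sz k * (J k)\<^sup>2)
    \<le> C2 * ((LINT p:D|lborel. R.R2 p) + (\<Sum>j<mR. R.W * R.sz j * (osR j)\<^sup>2) + (\<Sum>j<mL. L.W * L.sz j * (osL j)\<^sup>2))"
proof -
  define I where "I = (LINT p:D|lborel. R.R2 p)"
  define oR where "oR = (\<Sum>j<mR. R.W * R.sz j * (osR j)\<^sup>2)"
  define oL' where "oL' = (\<Sum>j<mL. L.W * L.sz j * (osL j)\<^sup>2)"
  define X where "X k = \<epsilon>\<^sup>2 * wd * R.sz k * (J k)\<^sup>2" for k
  define Ik where "Ik k = (LINT p:wbox k|lborel. R.R2 p)" for k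
  define bR where "bR k = \<epsilon>\<^sup>2 * R.W * R.\<delta>e k * (R.Bs k)\<^sup>2" for k
  define bL where "bL k = \<epsilon>\<^sup>2 * L.W * L.\<delta>e k * (L.Bs k)\<^sup>2" for k
  define uR where "uR k = R.W * R.sz k * (wd / \<epsilon> * R.On k)\<^sup>2" for k
  define uL where "uL k = L.W * L.sz k * (wd / \<epsilon> * L.On k)\<^sup>2" for k
  have e: "\<epsilon> > 0" by (rule R.eps)
  have K: "K \<ge> 1" by (rule R.K)
  have C10: "R.C1 \<ge> 0" by (simp add: R.C1_def)
  have nn: "I \<ge> 0" "oR \<ge> 0" "oL' \<ge> 0"
  proof -
    show "I \<ge> 0" unfolding I_def by (rule set_LINT_nonneg) (simp add: R.R2_def)
    show "oR \<ge> 0" unfolding oR_def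
      by (intro sum_nonneg mult_nonneg_nonneg zero_le_power2 less_imp_le[OF R.W_pos] less_imp_le[OF R.sz_pos]) auto
    show "oL' \<ge> 0" unfolding oL'_def
      by (intro sum_nonneg mult_nonneg_nonneg zero_le_power2 less_imp_le[OF L.W_pos] less_imp_le[OF L.sz_pos]) auto
  qed
  \<comment> \<open>All losses of one edge, with half of its jump term on the right for absorption.
    The smaller of the two column widths is used, so that \<open>edge_scales\<close> fits both
    sides.\<close>
  have edge: "wd * (\<epsilon>\<^sup>2 * R.sz k * \<bar>J k\<bar> * \<Gamma>2 k) + wd * (2 * Eb k) + wd * (LINT p:wbox k|lborel. \<epsilon> * P p * norm (v' p) + Q p * \<bar>v p\<bar>)
    \<le> X k / 2 + 58000 * (24 * K^4 * (bR k + bL (lam k)) + 2 * (uR k + uL (lam k))) + 58000 * Ik k" if k: "k \<in> R.Eg" for k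
  proof -
    note lk = lam(1)[OF k]
    define h where "h = R.sz k"
    define Wm where "Wm = min R.W L.W"
    have h0: "h > 0" "h \<le> 2 * R.W" "h \<le> 2 * L.W"
      using R.sz_pos[of k] R.sz_le[of k] L.sz_le[of "lam k"] k lk lam_sz[OF k] by (auto simp: R.Eg_def L.Eg_def h_def)
    have Wm: "Wm > 0" "h \<le> 2 * Wm" "wd \<le> Wm" "Wm \<le> R.W" "Wm \<le> L.W"
      unfolding Wm_def using h0 wd R.W_pos L.W_pos by (auto simp: min_def)
    have J2: "\<bar>J k\<bar>\<^sup>2 = (J k)\<^sup>2" by simp
    have Y: "wd * (\<epsilon>\<^sup>2 * R.sz k * \<bar>J k\<bar> * \<Gamma>2 k) + wd * (2 * Eb k) + \<eta> / 2 * \<epsilon>\<^sup>2 * ((wd * gb k)\<^sup>2 + (6 * (\<bar>J k\<bar> + \<Gamma>2 k))\<^sup>2) * (2 * wd * R.sz k)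
      \<le> X k / 2 + 58000 * (\<epsilon>\<^sup>2 * wd * h * (\<Gamma>2 k)\<^sup>2 + \<epsilon>\<^sup>2 * wd\<^sup>2 * B2 k * \<Gamma>2 k + \<epsilon>\<^sup>2 * wd * h * (wd * \<Gamma>2 k / h)\<^sup>2 + wd * h * (wd * O2 k / \<epsilon>)\<^sup>2)"
      using edge_Young[OF e wd(1) h0(1) abs_ge_zero[of "J k"] nonneg2(1)[of k] nonneg2(2)[of k] nonneg2(3)[of k]]
      unfolding X_def Eb_def gb_def \<eta>_def h_def J2 .
    have G: "\<Gamma>2 k \<le> K\<^sup>2 * (h / Wm) * B2 k"
    proof -
      have "R.\<Gamma>s k \<le> K\<^sup>2 * (h / R.W) * R.Bs k" using R.\<Gamma>s_le[OF k] by (simp add: h_def)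
      also have "\<dots> \<le> K\<^sup>2 * (h / Wm) * R.Bs k"
        using Wm h0 R.Bn_nonneg by (intro mult_right_mono mult_left_mono divide_left_mono) auto
      finally have 1: "R.\<Gamma>s k \<le> K\<^sup>2 * (h / Wm) * R.Bs k" .
      have "L.\<Gamma>s (lam k) \<le> K\<^sup>2 * (h / L.W) * L.Bs (lam k)" using L.\<Gamma>s_le[OF lk] lam_sz[OF k] by (simp add: h_def)
      also have "\<dots> \<le> K\<^sup>2 * (h / Wm) * L.Bs (lam k)"
        using Wm h0 L.Bn_nonneg by (intro mult_right_mono mult_left_mono divide_left_mono) auto
      finally show ?thesis using 1 unfolding \<Gamma>2_def B2_def distrib_left by linarith
    qed
    have S: "\<epsilon>\<^sup>2 * wd * h * (\<Gamma>2 k)\<^sup>2 + \<epsilon>\<^sup>2 * wd\<^sup>2 * B2 k * \<Gamma>2 k + \<epsilon>\<^sup>2 * wd * h * (wd * \<Gamma>2 k / h)\<^sup>2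
      \<le> 12 * K^4 * (\<epsilon>\<^sup>2 * Wm * min \<epsilon> h * (B2 k)\<^sup>2)"
      by (rule edge_scales[OF wd(1,4) Wm(3) h0(1) Wm(2) K nonneg2(1) G nonneg2(2)])
    have sq: "(x + y)\<^sup>2 \<le> 2 * x\<^sup>2 + 2 * y\<^sup>2" for x y :: real
      using zero_le_power2[of "x - y"] by (simp add: power2_eq_square algebra_simps)
    have "\<epsilon>\<^sup>2 * Wm * min \<epsilon> h * (B2 k)\<^sup>2 \<le> \<epsilon>\<^sup>2 * Wm * min \<epsilon> h * (2 * (R.Bs k)\<^sup>2 + 2 * (L.Bs (lam k))\<^sup>2)"
      unfolding B2_def using Wm e h0 sq by (intro mult_left_mono mult_nonneg_nonneg) auto
    also have "\<dots> = 2 * (\<epsilon>\<^sup>2 * Wm * min \<epsilon> h * (R.Bs k)\<^sup>2) + 2 * (\<epsilon>\<^sup>2 * Wm * min \<epsilon> h * (L.Bs (lam k))\<^sup>2)" by (simp add: algebra_simps)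
    also have "\<dots> \<le> 2 * bR k + 2 * bL (lam k)"
      unfolding bR_def bL_def R.\<delta>e_def L.\<delta>e_def lam_sz[OF k] h_def[symmetric] using Wm e h0
      by (intro add_mono mult_left_mono mult_right_mono) auto
    finally have "12 * K^4 * (\<epsilon>\<^sup>2 * Wm * min \<epsilon> h * (B2 k)\<^sup>2) \<le> 12 * K^4 * (2 * bR k + 2 * bL (lam k))"
      using K by (intro mult_left_mono) auto
    then have V: "\<epsilon>\<^sup>2 * wd * h * (\<Gamma>2 k)\<^sup>2 + \<epsilon>\<^sup>2 * wd\<^sup>2 * B2 k * \<Gamma>2 k + \<epsilon>\<^sup>2 * wd * h * (wd * \<Gamma>2 k / h)\<^sup>2 \<le> 24 * K^4 * (bR k + bL (lam k))"
      using S by (simp add: algebra_simps)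
    have "wd * h * (wd * O2 k / \<epsilon>)\<^sup>2 = wd * h * (wd / \<epsilon> * R.On k + wd / \<epsilon> * L.On (lam k))\<^sup>2"
      by (simp add: O2_def distrib_left add_divide_distrib)
    also have "\<dots> \<le> wd * h * (2 * (wd / \<epsilon> * R.On k)\<^sup>2 + 2 * (wd / \<epsilon> * L.On (lam k))\<^sup>2)"
      using wd(1) h0 sq by (intro mult_left_mono) auto
    also have "\<dots> = 2 * (wd * h * (wd / \<epsilon> * R.On k)\<^sup>2) + 2 * (wd * h * (wd / \<epsilon> * L.On (lam k))\<^sup>2)" by (simp add: algebra_simps)
    also have "\<dots> \<le> 2 * uR k + 2 * uL (lam k)"
      unfolding uR_def uL_def lam_sz[OF k] h_def[symmetric] using wd h0
      by (intro add_mono mult_left_mono mult_right_mono) auto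
    finally have U: "wd * h * (wd * O2 k / \<epsilon>)\<^sup>2 \<le> 2 * (uR k + uL (lam k))" by simp
    have Ik0: "Ik k \<ge> 0" unfolding Ik_def by (rule set_LINT_nonneg) (simp add: R.R2_def)
    have "1 / (2 * \<eta>) * Ik k \<le> 58000 * Ik k" using Ik0 by (simp add: \<eta>_def)
    then show ?thesis using Y V U box_Young[OF k] unfolding Ik_def[symmetric] by argo
  qed
  have i1: "set_integrable lborel D (\<lambda>p. G p \<bullet> v' p)" "set_integrable lborel D (\<lambda>p. h p * v p)"
    using R.h_test_integrable[OF v_test] v_grad by auto
  \<comment> \<open>Only after summation over the line do the box integrals form integrals over
    \<open>D\<close>, where the residual bound for the single function \<open>v\<close> applies; its
    right-hand side is then split into boxes again.\<close>
  have "(\<Sum>k\<in>R.Eg. \<epsilon>\<^sup>2 * R.sz k * (J k)\<^sup>2 - \<epsilon>\<^sup>2 * R.sz k * \<bar>J k\<bar> * \<Gamma>2 k)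
    \<le> (\<Sum>k\<in>R.Eg. \<epsilon>\<^sup>2 * (LINT p:wbox k|lborel. G p \<bullet> v' p) + (LINT p:wbox k|lborel. h p * v p) + 2 * Eb k)"
    by (rule sum_mono) (rule order_trans[OF edge_mean edge_flux])
  also have "\<dots> = \<epsilon>\<^sup>2 * (\<Sum>k\<in>R.Eg. LINT p:wbox k|lborel. G p \<bullet> v' p) + (\<Sum>k\<in>R.Eg. LINT p:wbox k|lborel. h p * v p) + (\<Sum>k\<in>R.Eg. 2 * Eb k)"
    by (simp add: sum.distrib sum_distrib_left)
  also have "(\<Sum>k\<in>R.Eg. LINT p:wbox k|lborel. G p \<bullet> v' p) = (LINT p:D|lborel. G p \<bullet> v' p)"
    by (rule split_integral(1)[symmetric, OF i1(1)]) (simp add: v_off)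
  also have "(\<Sum>k\<in>R.Eg. LINT p:wbox k|lborel. h p * v p) = (LINT p:D|lborel. h p * v p)"
    by (rule split_integral(1)[symmetric, OF i1(2)]) (simp add: v_off)
  also have "\<epsilon>\<^sup>2 * (LINT p:D|lborel. G p \<bullet> v' p) + (LINT p:D|lborel. h p * v p) \<le> (LINT p:D|lborel. \<epsilon> * P p * norm (v' p) + Q p * \<bar>v p\<bar>)"
    using R.residual[OF v_test] unfolding v_grad by linarith
  also have "(LINT p:D|lborel. \<epsilon> * P p * norm (v' p) + Q p * \<bar>v p\<bar>) = (\<Sum>k\<in>R.Eg. LINT p:wbox k|lborel. \<epsilon> * P p * norm (v' p) + Q p * \<bar>v p\<bar>)"
    by (rule split_integral(1)[OF res_integrable]) (simp add: v_off)
  finally have tot: "(\<Sum>k\<in>R.Eg. \<epsilon>\<^sup>2 * R.sz k * (J k)\<^sup>2 - \<epsilon>\<^sup>2 * R.sz k * \<bar>J k\<bar> * \<Gamma>2 k)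
    \<le> (\<Sum>k\<in>R.Eg. LINT p:wbox k|lborel. \<epsilon> * P p * norm (v' p) + Q p * \<bar>v p\<bar>) + (\<Sum>k\<in>R.Eg. 2 * Eb k)" by simp
  have "(\<Sum>k\<in>R.Eg. X k) = wd * (\<Sum>k\<in>R.Eg. \<epsilon>\<^sup>2 * R.sz k * (J k)\<^sup>2 - \<epsilon>\<^sup>2 * R.sz k * \<bar>J k\<bar> * \<Gamma>2 k) + (\<Sum>k\<in>R.Eg. wd * (\<epsilon>\<^sup>2 * R.sz k * \<bar>J k\<bar> * \<Gamma>2 k))"
    unfolding X_def sum_distrib_left sum.distrib[symmetric] by (rule sum.cong) (auto simp: algebra_simps)
  also have "\<dots> \<le> wd * ((\<Sum>k\<in>R.Eg. LINT p:wbox k|lborel. \<epsilon> * P p * norm (v' p) + Q p * \<bar>v p\<bar>) + (\<Sum>k\<in>R.Eg. 2 * Eb k)) + (\<Sum>k\<in>R.Eg. wd * (\<epsilon>\<^sup>2 * R.sz k * \<bar>J k\<bar> * \<Gamma>2 k))"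
    using tot wd(1) by (intro add_right_mono mult_left_mono) auto
  also have "\<dots> = (\<Sum>k\<in>R.Eg. wd * (\<epsilon>\<^sup>2 * R.sz k * \<bar>J k\<bar> * \<Gamma>2 k) + wd * (2 * Eb k) + wd * (LINT p:wbox k|lborel. \<epsilon> * P p * norm (v' p) + Q p * \<bar>v p\<bar>))"
    unfolding distrib_left sum_distrib_left sum.distrib by linarith
  also have "\<dots> \<le> (\<Sum>k\<in>R.Eg. X k / 2 + 58000 * (24 * K^4 * (bR k + bL (lam k)) + 2 * (uR k + uL (lam k))) + 58000 * Ik k)"
    by (rule sum_mono) (rule edge)
  also have "\<dots> = (\<Sum>k\<in>R.Eg. X k) / 2 + 58000 * (24 * K^4 * ((\<Sum>k\<in>R.Eg. bR k) + (\<Sum>k\<in>R.Eg. bL (lam k))) + 2 * ((\<Sum>k\<in>R.Eg. uR k) + (\<Sum>k\<in>R.Eg. uL (lam k)))) + 58000 * (\<Sum>k\<in>R.Eg. Ik k)"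
    by (simp add: sum.distrib sum_distrib_left sum_divide_distrib distrib_left)
  finally have main: "(\<Sum>k\<in>R.Eg. X k) \<le> 116000 * (24 * K^4 * ((\<Sum>k\<in>R.Eg. bR k) + (\<Sum>k\<in>R.Eg. bL (lam k))) + 2 * ((\<Sum>k\<in>R.Eg. uR k) + (\<Sum>k\<in>R.Eg. uL (lam k))) + (\<Sum>k\<in>R.Eg. Ik k))"
    by argo
  have Isum: "(\<Sum>k\<in>R.Eg. Ik k) \<le> I"
  proof -
    have iR: "set_integrable lborel (wbox k) R.R2" if "k \<in> R.Eg" for k
      by (rule set_integrable_subset[OF R.iR2]) (use wbox_props[OF that] in auto)
    have "(\<Sum>k\<in>R.Eg. Ik k) = (LINT p:(\<Union>k\<in>R.Eg. wbox k)|lborel. R.R2 p)"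
      unfolding Ik_def by (rule set_integral_finite_Union[symmetric, OF _ wbox_disjoint]) (use iR wbox_props in auto)
    also have "\<dots> \<le> I" unfolding I_def
      by (rule set_LINT_mono_subset[OF R.iR2]) (use wbox_props in \<open>auto intro!: sets.finite_UN simp: R.R2_def\<close>)
    finally show ?thesis .
  qed
  define k1 where "k1 = 40 * K * real Mx"
  have k10: "k1 \<ge> 0" using K by (simp add: k1_def)
  have bRs: "(\<Sum>k\<in>R.Eg. bR k) \<le> k1 * (R.C1 * (I + 2 * oR))"
    unfolding bR_def k1_def I_def oR_def using K
    by (intro order_trans[OF R.Bs_sum] mult_left_mono R.bubble_sum) auto
  have bLs: "(\<Sum>k\<in>R.Eg. bL (lam k)) \<le> k1 * (R.C1 * (I + 2 * oL'))"
    unfolding lam_sum[of bL] unfolding bL_def k1_def I_def oL'_def using K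
    by (intro order_trans[OF L.Bs_sum] mult_left_mono L.bubble_sum) auto
  have uRs: "(\<Sum>k\<in>R.Eg. uR k) \<le> 16 * (real Mx + 1) * K * oR"
    unfolding uR_def oR_def by (rule R.On_sum) (use wd in auto)
  have uLs: "(\<Sum>k\<in>R.Eg. uL (lam k)) \<le> 16 * (real Mx + 1) * K * oL'"
    unfolding lam_sum[of uL] unfolding uL_def oL'_def by (rule L.On_sum) (use wd in auto)
  define q where "q = 16 * (real Mx + 1) * K"
  have q0: "q \<ge> 0" using K by (simp add: q_def)
  have b: "(\<Sum>k\<in>R.Eg. bR k) + (\<Sum>k\<in>R.Eg. bL (lam k)) \<le> k1 * R.C1 * 2 * (I + oR + oL')"
  proof -
    have "(\<Sum>k\<in>R.Eg. bR k) + (\<Sum>k\<in>R.Eg. bL (lam k)) \<le> k1 * (R.C1 * (I + 2 * oR)) + k1 * (R.C1 * (I + 2 * oL'))"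
      using bRs bLs by (rule add_mono)
    also have "\<dots> = k1 * R.C1 * 2 * (I + oR + oL')" by (simp add: algebra_simps)
    finally show ?thesis .
  qed
  have "(\<Sum>k\<in>R.Eg. uR k) + (\<Sum>k\<in>R.Eg. uL (lam k)) \<le> q * (oR + oL')"
    using add_mono[OF uRs uLs] unfolding q_def by (simp add: algebra_simps)
  also have "\<dots> \<le> q * (I + oR + oL')" using nn q0 by (intro mult_left_mono) auto
  finally have u: "(\<Sum>k\<in>R.Eg. uR k) + (\<Sum>k\<in>R.Eg. uL (lam k)) \<le> q * (I + oR + oL')" .
  have "(\<Sum>k\<in>R.Eg. X k) \<le> 116000 * (24 * K^4 * (k1 * R.C1 * 2 * (I + oR + oL')) + 2 * (q * (I + oR + oL')) + (I + oR + oL'))"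
  proof (rule order_trans[OF main], intro mult_left_mono add_mono)
    show "(\<Sum>k\<in>R.Eg. Ik k) \<le> I + oR + oL'" using Isum nn by linarith
  qed (use b u K in auto)
  also have "\<dots> = C2 * (I + oR + oL')"
    by (simp add: C2_def k1_def q_def algebra_simps)
  finally show ?thesis unfolding X_def I_def oR_def oL'_def .
qed

end

section \<open>Triangles\<close>

lemma diameter_segment: "diameter (closed_segment a b) = dist a b" for a b :: "'a::euclidean_space"
proof (rule antisym)
  show "diameter (closed_segment a b) \<le> dist a b"
  proof (rule diameter_le)
    show "norm (x - y) \<le> dist a b" if "x \<in> closed_segment a b" "y \<in> closed_segment a b" for x y
      using that by (metis dist_norm dist_in_closed_segment dist_commute order_trans segment_bound1 segment_furthest_le
          dist_decreases_closed_segment)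
  qed auto
  show "dist a b \<le> diameter (closed_segment a b)"
    by (rule diameter_bounded_bound) (auto intro: compact_imp_bounded)
qed

text \<open>Faces of a simplex are the hulls of subsets of its vertices, and by affine independence
  dimension 1 means two vertices.\<close>

lemma triangle_edges:
  fixes a b c :: point
  assumes ind: "\<not> affine_dependent {a, b, c}" and abc: "a \<noteq> b" "a \<noteq> c" "b \<noteq> c"
  shows "S edge_of (convex hull {a, b, c}) \<longleftrightarrow> S \<in> {closed_segment a b, closed_segment a c, closed_segment b c}"
    "vertices (convex hull {a, b, c}) = {a, b, c}"
proof -
  show "vertices (convex hull {a, b, c}) = {a, b, c}"
    unfolding vertices_def using extreme_point_of_convex_hull_affine_independent[OF ind] by auto
  have "S edge_of (convex hull {a, b, c}) \<longleftrightarrow> (\<exists>c'. c' \<subseteq> {a, b, c} \<and> S = convex hull c' \<and> aff_dim c' = 1)"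
    unfolding edge_of_def face_of_convex_hull_affine_independent[OF ind] by (auto simp: aff_dim_convex_hull)
  also have "\<dots> \<longleftrightarrow> (\<exists>c'. c' \<subseteq> {a, b, c} \<and> S = convex hull c' \<and> card c' = 2)"
  proof -
    have "aff_dim c' = 1 \<longleftrightarrow> card c' = 2" if "c' \<subseteq> {a, b, c}" for c'
      using aff_dim_affine_independent[of c'] affine_independent_subset[OF ind that] by linarith
    then show ?thesis by metis
  qed
  also have "\<dots> \<longleftrightarrow> S \<in> {closed_segment a b, closed_segment a c, closed_segment b c}"
  proof
    assume "\<exists>c'. c' \<subseteq> {a, b, c} \<and> S = convex hull c' \<and> card c' = 2"
    then obtain c' where c': "c' \<subseteq> {a, b, c}" "S = convex hull c'" "card c' = 2" by blast
    then obtain u v where "c' = {u, v}" "u \<noteq> v" by (auto simp: card_2_iff)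
    with c' show "S \<in> {closed_segment a b, closed_segment a c, closed_segment b c}"
      by (auto simp: segment_convex_hull insert_commute)
  next
    assume "S \<in> {closed_segment a b, closed_segment a c, closed_segment b c}"
    then consider "S = convex hull {a, b}" | "S = convex hull {a, c}" | "S = convex hull {b, c}"
      by (auto simp: segment_convex_hull)
    then show "\<exists>c'. c' \<subseteq> {a, b, c} \<and> S = convex hull c' \<and> card c' = 2"
    proof cases
      case 1 then show ?thesis using abc by (intro exI[of _ "{a, b}"]) auto
    next
      case 2 then show ?thesis using abc by (intro exI[of _ "{a, c}"]) auto
    next
      case 3 then show ?thesis using abc by (intro exI[of _ "{b, c}"]) auto
    qed
  qed
  finally show "S edge_of (convex hull {a, b, c}) \<longleftrightarrow> S \<in> {closed_segment a b, closed_segment a c, closed_segment b c}" .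
qed

lemma triangle_H:
  fixes a b c :: point
  assumes "\<not> affine_dependent {a, b, c}" "a \<noteq> b" "a \<noteq> c" "b \<noteq> c"
  shows "H_tri (convex hull {a, b, c}) = max (dist a b) (max (dist a c) (dist b c))"
proof -
  have "{S. S edge_of (convex hull {a, b, c})} = {closed_segment a b, closed_segment a c, closed_segment b c}"
    using triangle_edges(1)[OF assms] by blast
  then show ?thesis by (simp add: H_tri_def diameter_segment)
qed

lemma two_simplex:
  assumes "2 simplex T"
  obtains a b c where "T = convex hull {a, b, c}" "\<not> affine_dependent {a, b, c}" "a \<noteq> b" "a \<noteq> c" "b \<noteq> c"
proof -
  obtain C where C: "\<not> affine_dependent C" "int (card C) = 2 + 1" "T = convex hull C"
    using assms unfolding simplex_def by blast
  then have "card C = 3" by simp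
  then obtain a b c where "C = {a, b, c}" "a \<noteq> b" "a \<noteq> c" "b \<noteq> c" by (auto simp: card_3_iff)
  with C show ?thesis using that by blast
qed

text \<open>The region between two segments that lead from the heights \<open>p\<close>,
  \<open>q\<close> at \<open>x0\<close> to \<open>P\<close>, \<open>Q\<close> at \<open>x0\<close> +
  \<open>d\<close>, with either sign of \<open>d\<close>. It is a triangle when one of the two pairs
  coincides.\<close>

definition wedge :: "real \<Rightarrow> real \<Rightarrow> real \<Rightarrow> real \<Rightarrow> real \<Rightarrow> real \<Rightarrow> point set"
  where "wedge x0 d p P q Q = {z. 0 \<le> (fst z - x0) / d \<and> (fst z - x0) / d \<le> 1 \<and>
    p + (P - p) * ((fst z - x0) / d) \<le> snd z \<and> snd z \<le> q + (Q - q) * ((fst z - x0) / d)}"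

text \<open>The barycentric weight of the apex is the normalised horizontal distance from the line
  through the other two vertices; the remaining weights follow from the height.\<close>

lemma hull_wedge:
  assumes d: "d \<noteq> 0" and pq: "p < q"
  shows "convex hull {(x0, p), (x0, q), (x0 + d, Y)} = wedge x0 d p Y q Y"
proof (intro set_eqI iffI)
  fix z assume "z \<in> convex hull {(x0, p), (x0, q), (x0 + d, Y)}"
  then obtain u v w where uvw: "0 \<le> u" "0 \<le> v" "0 \<le> w" "u + v + w = 1"
    and z: "z = u *\<^sub>R (x0, p) + v *\<^sub>R (x0, q) + w *\<^sub>R (x0 + d, Y)"
    unfolding convex_hull_3 by blast
  have "fst z - x0 = (u + v + w) * x0 + w * d - x0" unfolding z by (simp add: algebra_simps)
  then have t: "(fst z - x0) / d = w" using uvw d by simp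
  have u: "u = 1 - v - w" using uvw by simp
  have s: "snd z = u * p + v * q + w * Y" unfolding z by simp
  have "0 \<le> v * (q - p)" "0 \<le> u * (q - p)" using uvw pq by auto
  then show "z \<in> wedge x0 d p Y q Y"
    unfolding wedge_def mem_Collect_eq t s using uvw by (simp add: u algebra_simps)
next
  fix z assume "z \<in> wedge x0 d p Y q Y"
  then have t: "0 \<le> (fst z - x0) / d" "(fst z - x0) / d \<le> 1"
    "p + (Y - p) * ((fst z - x0) / d) \<le> snd z" "snd z \<le> q + (Y - q) * ((fst z - x0) / d)"
    by (auto simp: wedge_def)
  define w where "w = (fst z - x0) / d"
  define v where "v = (snd z - p - (Y - p) * w) / (q - p)"
  define u where "u = 1 - v - w"
  have v0: "v \<ge> 0" unfolding v_def using t pq by (simp add: w_def)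
  have "v * (q - p) = snd z - p - (Y - p) * w" using pq by (simp add: v_def)
  moreover have "snd z - p - (Y - p) * w \<le> (1 - w) * (q - p)"
    using t(4) unfolding w_def[symmetric] by (simp add: algebra_simps)
  ultimately have "v \<le> 1 - w" using pq by (metis diff_gt_0_iff_gt mult_le_cancel_right_pos)
  then have u0: "u \<ge> 0" by (simp add: u_def)
  have f: "fst z = x0 + w * d" using d by (simp add: w_def)
  have s: "snd z = p + v * (q - p) + (Y - p) * w" using pq by (simp add: v_def)
  have "z = u *\<^sub>R (x0, p) + v *\<^sub>R (x0, q) + w *\<^sub>R (x0 + d, Y)"
    unfolding prod_eq_iff by (simp add: f s u_def algebra_simps)
  moreover have "u + v + w = 1" by (simp add: u_def)
  ultimately show "z \<in> convex hull {(x0, p), (x0, q), (x0 + d, Y)}"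
    unfolding convex_hull_3 using u0 v0 t(1)[folded w_def] by blast
qed

lemma wedge_flip:
  assumes "d \<noteq> 0"
  shows "wedge (x0 + d) (- d) P p Q q = wedge x0 d p P q Q"
proof -
  have t: "(fst z - (x0 + d)) / - d = 1 - (fst z - x0) / d" for z :: point
    using assms by (simp add: field_simps)
  have e: "P + (p - P) * (1 - s) = p + (P - p) * s" for p P s :: real by (simp add: algebra_simps)
  show ?thesis unfolding wedge_def t e by auto
qed

definition owedge :: "real \<Rightarrow> real \<Rightarrow> real \<Rightarrow> real \<Rightarrow> real \<Rightarrow> real \<Rightarrow> point set"
  where "owedge x0 d p P q Q = {z. 0 < (fst z - x0) / d \<and> (fst z - x0) / d < 1 \<and>
    p + (P - p) * ((fst z - x0) / d) < snd z \<and> snd z < q + (Q - q) * ((fst z - x0) / d)}"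

lemma owedge_interior: "owedge x0 d p P q Q \<subseteq> interior (wedge x0 d p P q Q)"
proof (rule interior_maximal)
  show "owedge x0 d p P q Q \<subseteq> wedge x0 d p P q Q" by (auto simp: owedge_def wedge_def)
  have "owedge x0 d p P q Q = {z. 0 < (fst z - x0) / d} \<inter> {z. (fst z - x0) / d < 1} \<inter>
    {z. p + (P - p) * ((fst z - x0) / d) < snd z} \<inter> {z. snd z < q + (Q - q) * ((fst z - x0) / d)}"
    by (auto simp: owedge_def)
  then show "open (owedge x0 d p P q Q)"
    unfolding divide_inverse by (simp only:) (intro open_Int open_Collect_less continuous_intros)
qed

text \<open>Induction on the number of tiles, splitting off the one that contains the left end.
  Covering by half-open tiles guarantees that this tile reaches strictly beyond the end, and so
  makes the remaining interval shorter.\<close>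

lemma interval_tiling:
  fixes lo hi :: "'t \<Rightarrow> real"
  assumes "finite F" "a < b"
    and "\<And>T. T \<in> F \<Longrightarrow> lo T < hi T" "\<And>T. T \<in> F \<Longrightarrow> a \<le> lo T \<and> hi T \<le> b"
    and "\<And>y. a \<le> y \<Longrightarrow> y < b \<Longrightarrow> \<exists>T\<in>F. lo T \<le> y \<and> y < hi T"
    and "\<And>S T. S \<in> F \<Longrightarrow> T \<in> F \<Longrightarrow> S \<noteq> T \<Longrightarrow> hi S \<le> lo T \<or> hi T \<le> lo S"
  shows "\<exists>m t. 0 < m \<and> bij_betw t {..<m::nat} F \<and> lo (t 0) = a \<and> hi (t (m - 1)) = b \<and>
    (\<forall>k. Suc k < m \<longrightarrow> hi (t k) = lo (t (Suc k)))"
  using assms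
proof (induction "card F" arbitrary: F a)
  case 0
  then have "F = {}" by simp
  then show ?case using 0(6)[of a] \<open>a < b\<close> by auto
next
  case (Suc n)
  obtain T where T: "T \<in> F" "lo T \<le> a" "a < hi T" using Suc(7)[of a] Suc(4) by auto
  then have loT: "lo T = a" using Suc(6)[OF T(1)] by simp
  have hiT: "hi T \<le> b" using Suc(6)[OF T(1)] by simp
  show ?case
  proof (cases "hi T = b")
    case True
    have "F = {T}"
    proof (rule ccontr)
      assume "F \<noteq> {T}"
      then obtain S where S: "S \<in> F" "S \<noteq> T" using T by auto
      from Suc(8)[OF S(1) T(1) S(2)] show False
        using Suc(5)[OF S(1)] Suc(6)[OF S(1)] loT True by auto
    qed
    then show ?thesis using loT True
      by (intro exI[of _ 1] exI[of _ "\<lambda>_. T"]) (auto simp: bij_betw_def lessThan_Suc)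
  next
    case False
    then have lt: "hi T < b" using hiT by simp
    have other: "hi T \<le> lo S" if "S \<in> F - {T}" for S
      using Suc(8)[of S T] Suc(5)[of S] Suc(6)[of S] that T loT by force
    have "\<exists>m t. 0 < m \<and> bij_betw t {..<m::nat} (F - {T}) \<and> lo (t 0) = hi T \<and> hi (t (m - 1)) = b \<and>
      (\<forall>k. Suc k < m \<longrightarrow> hi (t k) = lo (t (Suc k)))"
    proof (rule Suc(1))
      show "n = card (F - {T})" using Suc(2) T Suc(3) by simp
      show "finite (F - {T})" using Suc(3) by simp
      show "hi T < b" by (rule lt)
      show "lo S < hi S" if "S \<in> F - {T}" for S using Suc(5) that by auto
      show "hi T \<le> lo S \<and> hi S \<le> b" if "S \<in> F - {T}" for S using other[OF that] Suc(6) that by auto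
      show "\<exists>S\<in>F - {T}. lo S \<le> y \<and> y < hi S" if "hi T \<le> y" "y < b" for y
        using Suc(7)[of y] that T Suc(4) by force
      show "hi S \<le> lo S' \<or> hi S' \<le> lo S" if "S \<in> F - {T}" "S' \<in> F - {T}" "S \<noteq> S'" for S S'
        using Suc(8) that by auto
    qed
    then obtain m t where m: "0 < m" "bij_betw t {..<m::nat} (F - {T})" "lo (t 0) = hi T" "hi (t (m - 1)) = b"
      "\<And>k. Suc k < m \<Longrightarrow> hi (t k) = lo (t (Suc k))" by blast
    define t' where "t' k = (case k of 0 \<Rightarrow> T | Suc j \<Rightarrow> t j)" for k
    have im: "t ` {..<m} = F - {T}" "inj_on t {..<m}" using m(2) by (auto simp: bij_betw_def)
    have tin: "j < m \<Longrightarrow> t j \<noteq> T \<and> t j \<in> F" for j using im(1) by blast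
    have "inj_on t' {..<Suc m}"
    proof -
      have "inj_on t' (Suc ` {..<m})" using im(2) by (auto simp: inj_on_def t'_def)
      moreover have "t' ` Suc ` {..<m} = F - {T}" using im(1) by (simp add: t'_def image_image)
      then have "t' 0 \<notin> t' ` Suc ` {..<m}" by (simp add: t'_def)
      ultimately show ?thesis unfolding lessThan_Suc_eq_insert_0 by (auto simp: inj_on_insert)
    qed
    moreover have "t' ` {..<Suc m} = F"
    proof -
      have "t' ` {..<Suc m} = insert T (t ` {..<m})"
        unfolding lessThan_Suc_eq_insert_0 by (simp add: t'_def image_image)
      then show ?thesis using im(1) T(1) by auto
    qed
    ultimately have "bij_betw t' {..<Suc m} F" by (simp add: bij_betw_def)
    moreover have "hi (t' (Suc m - 1)) = b" using m by (cases m) (auto simp: t'_def)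
    moreover have "hi (t' k) = lo (t' (Suc k))" if "Suc k < Suc m" for k
      using m(3,5) that by (cases k) (auto simp: t'_def)
    ultimately show ?thesis using loT
      by (intro exI[of _ "Suc m"] exI[of _ t']) (auto simp: t'_def)
  qed
qed

section \<open>Geometry of the mesh\<close>

lemma between_iff:
  fixes x x0 d :: real
  assumes "d \<noteq> 0"
  shows "0 \<le> (x - x0) / d \<and> (x - x0) / d \<le> 1 \<longleftrightarrow> x \<in> {min x0 (x0 + d)..max x0 (x0 + d)}"
  using assms by (cases "d > 0") (auto simp: field_simps)

lemma area_wedge:
  assumes d: "d \<noteq> 0" and pq: "p \<le> q" "P \<le> Q"
  shows "measure lborel (wedge x0 d p P q Q) = \<bar>d\<bar> * ((q - p) + (Q - P)) / 2" "compact (wedge x0 d p P q Q)"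
proof -
  let ?a = "min x0 (x0 + d)" and ?b = "max x0 (x0 + d)"
  let ?g = "\<lambda>x. p + (P - p) * ((x - x0) / d)" and ?h = "\<lambda>x. q + (Q - q) * ((x - x0) / d)"
  have eq: "wedge x0 d p P q Q = {z. fst z \<in> {?a..?b} \<and> ?g (fst z) \<le> snd z \<and> snd z \<le> ?h (fst z)}"
    unfolding wedge_def between_iff[OF d, symmetric] by auto
  have c: "continuous_on {?a..?b} ?g" "continuous_on {?a..?b} ?h"
    using d by (auto intro!: continuous_intros)
  have le: "?g x \<le> ?h x" if "x \<in> {?a..?b}" for x
  proof -
    define t where "t = (x - x0) / d"
    have "0 \<le> t" "t \<le> 1" using between_iff[OF d, of x x0] that by (auto simp: t_def)
    then have "(1 - t) * p + t * P \<le> (1 - t) * q + t * Q" using pq by (intro add_mono mult_left_mono) auto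
    then show ?thesis unfolding t_def[symmetric] by (simp add: algebra_simps)
  qed
  show "compact (wedge x0 d p P q Q)" unfolding eq by (rule measure_between(1)[OF c le])
  define A where "A = q - p"
  define B where "B = ((Q - q) - (P - p)) / d"
  have "((\<lambda>x. A + B * (x - x0)) has_integral
    (A * (?b - x0) + B * (?b - x0)\<^sup>2 / 2) - (A * (?a - x0) + B * (?a - x0)\<^sup>2 / 2)) {?a..?b}"
  proof (rule fundamental_theorem_of_calculus)
    fix x assume "x \<in> {?a..?b}"
    have "((\<lambda>x. A * (x - x0) + B * (x - x0)\<^sup>2 / 2) has_real_derivative A * 1 + B * (2 * (x - x0) * 1) / 2) (at x within {?a..?b})"
      by (auto intro!: derivative_eq_intros)
    moreover have "A * 1 + B * (2 * (x - x0) * 1) / 2 = A + B * (x - x0)" by simp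
    ultimately show "((\<lambda>x. A * (x - x0) + B * (x - x0)\<^sup>2 / 2) has_vector_derivative A + B * (x - x0)) (at x within {?a..?b})"
      by (simp only: has_real_derivative_iff_has_vector_derivative)
  qed simp
  moreover have "?h x - ?g x = A + B * (x - x0)" for x
    using d by (simp add: A_def B_def field_simps)
  ultimately have "integral {?a..?b} (\<lambda>x. ?h x - ?g x) = (A * (?b - x0) + B * (?b - x0)\<^sup>2 / 2) - (A * (?a - x0) + B * (?a - x0)\<^sup>2 / 2)"
    by (simp add: integral_unique)
  also have "\<dots> = \<bar>d\<bar> * ((q - p) + (Q - P)) / 2"
    using d by (cases "d > 0") (auto simp: A_def B_def power2_eq_square min_def max_def field_simps)
  finally have I: "integral {?a..?b} (\<lambda>x. ?h x - ?g x) = \<bar>d\<bar> * ((q - p) + (Q - P)) / 2" .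
  show "measure lborel (wedge x0 d p P q Q) = \<bar>d\<bar> * ((q - p) + (Q - P)) / 2"
    unfolding eq by (rule trans[OF measure_between(2)[OF c le] I])
qed

text \<open>For an obtuse angle, minus the cosine is the sine of the excess over the right angle and
  hence at most the excess; otherwise the inner product is nonnegative and t \<ge> 0
  suffices.\<close>

lemma angle_obtuse:
  fixes a z b :: point
  assumes ne: "a \<noteq> z" "b \<noteq> z" and t: "t \<ge> 0" and ang: "angle a z b \<le> pi / 2 + t"
  shows "- ((a - z) \<bullet> (b - z)) \<le> t * (norm (a - z) * norm (b - z))"
proof -
  define n where "n = norm (a - z) * norm (b - z)"
  have n: "n > 0" using ne by (simp add: n_def)
  define c where "c = ((a - z) \<bullet> (b - z)) / n"
  have "\<bar>(a - z) \<bullet> (b - z)\<bar> \<le> n" unfolding n_def by (rule Cauchy_Schwarz_ineq2)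
  then have c1: "-1 \<le> c" "c \<le> 1" using n by (auto simp: c_def field_simps abs_le_iff)
  have "- c \<le> t"
  proof (cases "c \<ge> 0")
    case True then show ?thesis using t by simp
  next
    case False
    define \<theta> where "\<theta> = arccos c"
    have \<theta>: "cos \<theta> = c" "0 \<le> \<theta>" "\<theta> \<le> pi" using c1 by (auto simp: \<theta>_def arccos_lbound arccos_ubound)
    have "\<theta> \<ge> pi / 2"
    proof (rule ccontr)
      assume "\<not> \<theta> \<ge> pi / 2"
      then have "cos \<theta> > 0" using \<theta> by (intro cos_gt_zero_pi) auto
      then show False using \<theta> False by simp
    qed
    then have "sin (\<theta> - pi / 2) \<le> \<theta> - pi / 2" by (intro sin_x_le_x) simp
    moreover have "sin (\<theta> - pi / 2) = - c" using \<theta>(1) by (simp add: sin_diff)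
    ultimately show ?thesis using ang unfolding angle_def \<theta>_def c_def n_def by linarith
  qed
  then have "- c * n \<le> t * n" using n by (intro mult_right_mono) auto
  then show ?thesis using n unfolding n_def[symmetric] by (simp add: c_def)
qed

locale psm =
  fixes lam\<^sub>0 \<kappa> c\<^sub>0 lam\<^sub>1 :: real and M n :: nat and x :: "nat \<Rightarrow> real" and \<T> :: "point set set"
  assumes psm: "partially_structured_mesh lam\<^sub>0 M \<kappa> c\<^sub>0 lam\<^sub>1 n x \<T>"
    and \<kappa>: "\<kappa> \<ge> 1" and lam1: "lam\<^sub>1 > 0" and c0: "c\<^sub>0 > 0" "lam\<^sub>1 * c\<^sub>0 \<le> 1/2"
begin

lemma finT: "finite \<T>" and simplexT: "T \<in> \<T> \<Longrightarrow> 2 simplex T"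
  and faceT: "T \<in> \<T> \<Longrightarrow> T' \<in> \<T> \<Longrightarrow> (T \<inter> T') face_of T"
  and UnT: "\<Union>\<T> = {0..1} \<times> {0..1}"
  and x_ends: "x 0 = 0" "x n = 1" and x_mono: "i < j \<Longrightarrow> j \<le> n \<Longrightarrow> x i < x j"
  using psm by (auto simp: partially_structured_mesh_def standing_mesh_assumptions_def triangulates_Omega_def
      triangulation_def Omega_def closure_Times strict_mono_on_def)

lemma x_inj: "i \<le> n \<Longrightarrow> j \<le> n \<Longrightarrow> x i = x j \<longleftrightarrow> i = j"
  using x_mono by (metis less_irrefl linorder_neqE_nat)

text \<open>Conformity: the intersection of two elements is a face, and a face that contains an
  inner point of a segment of the element contains its ends.\<close>

lemma shared:
  assumes "T \<in> \<T>" "T' \<in> \<T>" "a \<in> T" "b \<in> T" "z \<in> open_segment a b" "z \<in> T'"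
  shows "a \<in> T'" "b \<in> T'"
proof -
  have "convex T" using simplexT[OF assms(1)] by (auto simp: simplex_def)
  then have "z \<in> T" using assms by (meson closed_segment_subset in_mono open_closed_segment)
  then have "a \<in> T \<inter> T' \<and> b \<in> T \<inter> T'"
    using faceT[OF assms(1,2)] assms unfolding face_of_def by blast
  then show "a \<in> T'" "b \<in> T'" by auto
qed

text \<open>A face that meets the relative interior of an element is the whole element.\<close>

lemma interior_disjoint:
  assumes "T \<in> \<T>" "T' \<in> \<T>" "z \<in> interior T" "z \<in> interior T'"
  shows "T = T'"
proof -
  have "T \<subseteq> T'" if "T \<in> \<T>" "T' \<in> \<T>" "z \<in> interior T" "z \<in> interior T'" for T T'
  proof -
    have "(T \<inter> T') \<inter> rel_interior T \<noteq> {}"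
      using that rel_interior_nonempty_interior[of T] interior_subset by fastforce
    from subset_of_face_of[OF faceT[OF that(1,2)] subset_refl this] show ?thesis by auto
  qed
  then show ?thesis using assms by blast
qed

lemma node_props:
  assumes "z \<in> nodes \<T>" "T \<in> \<T>" "z \<in> T"
  shows "h_node \<T> z < c\<^sub>0 * H_node \<T> z" "comparable \<kappa> (h_tri T) (h_node \<T> z)" "comparable \<kappa> (H_tri T) (H_node \<T> z)"
  using psm assms unfolding partially_structured_mesh_def aniso_nodes_def elements_at_def by blast+

lemma mesh_triangle:
  assumes T: "T \<in> \<T>"
  obtains i j p q Y where "i \<le> n" "j \<le> n" "j = i + 1 \<or> i = j + 1" "p < q"
    "T = convex hull {(x i, p), (x i, q), (x j, Y)}" "\<not> affine_dependent {(x i, p), (x i, q), (x j, Y)}"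
    "q - p \<le> dist (x i, p) (x j, Y)" "q - p \<le> dist (x i, q) (x j, Y)"
proof -
  note base = that
  obtain a b c where abc: "T = convex hull {a, b, c}" "\<not> affine_dependent {a, b, c}" "a \<noteq> b" "a \<noteq> c" "b \<noteq> c"
    using two_simplex[OF simplexT[OF T]] by blast
  note ed = triangle_edges[OF abc(2-5), folded abc(1)]
  obtain i j S where ij: "i \<le> n" "j \<le> n" "j = i + 1 \<or> i = j + 1" and S: "shortest_edge T S" "S \<subseteq> vline (x i)"
    and vj: "vertices T \<inter> vline (x j) \<noteq> {}"
    using psm T unfolding partially_structured_mesh_def by blast
  have "S \<in> {closed_segment a b, closed_segment a c, closed_segment b c}"
    using S(1) ed(1) by (auto simp: shortest_edge_def)
  then consider "S = closed_segment a b" | "S = closed_segment a c" | "S = closed_segment b c" by blast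
  then obtain u v w where uvw: "S = closed_segment u v" "{a, b, c} = {u, v, w}" "u \<noteq> v" "u \<noteq> w" "v \<noteq> w"
  proof cases
    case 1 then show ?thesis using abc(3-5) that[of a b c] by auto
  next
    case 2 then show ?thesis using abc(3-5) that[of a c b] by auto
  next
    case 3 then show ?thesis using abc(3-5) that[of b c a] by auto
  qed
  have e: "closed_segment u w edge_of T" "closed_segment v w edge_of T"
    using triangle_edges(1)[of u v w] abc(1,2) uvw by auto
  have short: "dist u v \<le> dist u w" "dist u v \<le> dist v w"
  proof -
    have *: "diameter S \<le> diameter S'" if "S' edge_of T" for S'
      using S(1) that by (simp add: shortest_edge_def)
    show "dist u v \<le> dist u w" "dist u v \<le> dist v w"
      using *[OF e(1)] *[OF e(2)] by (simp_all add: uvw(1) diameter_segment)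
  qed
  have uv: "fst u = x i" "fst v = x i" using S(2) uvw(1) by (auto simp: vline_def)
  have ij': "x i \<noteq> x j" using x_inj[OF ij(1,2)] ij(3) by auto
  have w: "fst w = x j"
  proof -
    have "vertices T = {u, v, w}" using ed(2) uvw by simp
    then show ?thesis using vj uv ij' by (auto simp: vline_def)
  qed
  have main: thesis if "snd u < snd v" "fst u = x i" "fst v = x i" "{a, b, c} = {u, v, w}"
    "dist u v \<le> dist u w" "dist u v \<le> dist v w" for u v
  proof -
    have uv: "u = (x i, snd u)" "v = (x i, snd v)" "w = (x j, snd w)" using that w by (auto simp: prod_eq_iff)
    have d: "dist u v = snd v - snd u" using that(1-3) by (simp add: dist_prod_def dist_real_def)
    have set: "{a, b, c} = {(x i, snd u), (x i, snd v), (x j, snd w)}"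
      unfolding uv[symmetric] by (rule that(4))
    show thesis
    proof (rule base[OF ij that(1)])
      show "T = convex hull {(x i, snd u), (x i, snd v), (x j, snd w)}" unfolding set[symmetric] by (rule abc(1))
      show "\<not> affine_dependent {(x i, snd u), (x i, snd v), (x j, snd w)}" unfolding set[symmetric] by (rule abc(2))
      show "snd v - snd u \<le> dist (x i, snd u) (x j, snd w)" "snd v - snd u \<le> dist (x i, snd v) (x j, snd w)"
        unfolding uv[symmetric] d[symmetric] by (rule that(5), rule that(6))
    qed
  qed
  consider "snd u < snd v" | "snd v < snd u" using uvw(3) uv by (metis linorder_neqE_linordered_idom prod_eq_iff)
  then show thesis
  proof cases
    case 1
    show ?thesis by (rule main[OF 1 uv uvw(2) short])
  next
    case 2
    show ?thesis by (rule main[OF 2 uv(2,1)]) (use uvw(2) short in \<open>auto simp: dist_commute insert_commute\<close>)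
  qed
qed

text \<open>One constant for two purposes: 4 \<kappa>^2 compares elements through a common node,
  with \<kappa> for each of them and 4 between a short edge and the height of its element; 1 +
  \<open>lam\<^sub>1\<close> \<kappa>^2 bounds the vertical extent of a long edge in units of the
  short one.\<close>

definition Kc :: real where "Kc = 1 + 4 * \<kappa>\<^sup>2 + lam\<^sub>1 * \<kappa>\<^sup>2"

lemma Kc: "Kc \<ge> 1" "4 * \<kappa>\<^sup>2 \<le> Kc" "1 + lam\<^sub>1 * \<kappa>\<^sup>2 \<le> Kc"
  using lam1 by (auto simp: Kc_def add_nonneg_nonneg)

text \<open>The angle condition at the two ends of the shortest edge limits how far the apex lies
  above or below that edge: by a multiple of the edge, and also by half of the adjacent long edge.
  The second bound excludes steep long edges, so that the horizontal width is comparable with the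
  longest edge.\<close>

lemma triangle_shape:
  assumes T: "T \<in> \<T>" and ij: "x i \<noteq> x j" and pq: "p < q"
    and hull: "T = convex hull {(x i, p), (x i, q), (x j, Y)}" and ind: "\<not> affine_dependent {(x i, p), (x i, q), (x j, Y)}"
    and short: "q - p \<le> dist (x i, p) (x j, Y)" "q - p \<le> dist (x i, q) (x j, Y)"
  defines "W \<equiv> \<bar>x j - x i\<bar>" and "s \<equiv> q - p"
  shows "T = wedge (x i) (x j - x i) p Y q Y" "vertices T = {(x i, p), (x i, q), (x j, Y)}"
    "s \<le> 2 * W" "\<bar>Y - p\<bar> \<le> Kc * s" "\<bar>Y - q\<bar> \<le> Kc * s" "area T = W * s / 2" "W \<le> H_tri T" "H_tri T \<le> 4 * W"
    "s / 4 \<le> h_tri T" "h_tri T \<le> s"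
proof -
  let ?a = "(x i, p)" and ?b = "(x i, q)" and ?c = "(x j, Y)"
  have ne: "?a \<noteq> ?b" "?a \<noteq> ?c" "?b \<noteq> ?c" using pq ij by auto
  have d: "x j - x i \<noteq> 0" using ij by simp
  have W: "W > 0" using ij by (simp add: W_def)
  have s: "s > 0" using pq by (simp add: s_def)
  show wedge: "T = wedge (x i) (x j - x i) p Y q Y"
    using hull_wedge[OF d pq, of "x i" Y] hull by simp
  show vert: "vertices T = {?a, ?b, ?c}" using triangle_edges(2)[OF ind ne] hull by simp
  show ar: "area T = W * s / 2" unfolding wedge using area_wedge(1)[OF d, of p q Y Y] pq by (simp add: W_def s_def)
  define A where "A = dist ?a ?c"
  define B where "B = dist ?b ?c"
  have AB: "A = sqrt (W\<^sup>2 + (Y - p)\<^sup>2)" "B = sqrt (W\<^sup>2 + (Y - q)\<^sup>2)"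
    unfolding A_def B_def W_def by (simp_all add: dist_Pair_Pair dist_real_def power2_commute)
  have AW: "W \<le> A" "W \<le> B" unfolding AB using W by (auto intro!: real_le_rsqrt)
  have ABle: "A \<le> W + \<bar>Y - p\<bar>" "B \<le> W + \<bar>Y - q\<bar>"
    unfolding AB using W sqrt_sum_squares_le_sum_abs[of W "Y - p"] sqrt_sum_squares_le_sum_abs[of W "Y - q"] by auto
  have H: "H_tri T = max s (max A B)"
    unfolding hull triangle_H[OF ind ne] A_def B_def s_def using pq by (simp add: dist_Pair_Pair dist_real_def)
  have short': "s \<le> A" "s \<le> B" using short by (auto simp: A_def B_def s_def)
  have H': "H_tri T = max A B" unfolding H using short' by auto
  show HW: "W \<le> H_tri T" unfolding H' using AW by auto
  have Hpos: "H_tri T > 0" using HW W by linarith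
  have h: "h_tri T = W * s / H_tri T" unfolding h_tri_def ar by simp
  have hs: "h_tri T \<le> s"
  proof -
    have "W * s \<le> H_tri T * s" using HW s by (intro mult_right_mono) auto
    then show ?thesis unfolding h using Hpos by (simp add: pos_divide_le_eq mult.commute)
  qed
  then show "h_tri T \<le> s" .
  have node: "?a \<in> nodes \<T>" "?b \<in> nodes \<T>" "?a \<in> T" "?b \<in> T"
    using T vert unfolding nodes_def hull by (auto intro: hull_inc)
  text \<open>The angle condition bounds by how much the apex overshoots the shortest edge.\<close>
  have over: "e \<le> lam\<^sub>1 * \<kappa>\<^sup>2 * s \<and> e \<le> L / 2"
    if z: "z \<in> nodes \<T>" "z \<in> T"
      and L: "L = norm (c - z)" "L \<le> H_tri T" and b: "norm (b - z) = s"
      and inner: "(c - z) \<bullet> (b - z) = - e * s" and v: "vertices T = {c, z, b}" "c \<noteq> z" "b \<noteq> z" for z c b e L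
  proof -
    define t where t: "t = lam\<^sub>1 * (h_node \<T> z / H_node \<T> z)"
    note np = node_props[OF z(1) T z(2)]
    have Hz: "H_node \<T> z > 0" using np(3) Hpos \<kappa> unfolding comparable_def
      by (smt (verit) mult_nonneg_nonpos)
    have h0: "h_tri T > 0" unfolding h using W s Hpos by simp
    have hz0: "h_node \<T> z > 0" using np(2) h0 \<kappa> unfolding comparable_def
      by (smt (verit) mult_nonneg_nonpos)
    have t0: "t \<ge> 0" unfolding t using Hz hz0 lam1 by simp
    have "h_node \<T> z / H_node \<T> z \<le> c\<^sub>0" using np(1) Hz by (simp add: pos_divide_le_eq)
    then have "t \<le> lam\<^sub>1 * c\<^sub>0" unfolding t using lam1 by (intro mult_left_mono) auto
    then have t2: "t \<le> 1/2" using c0 by linarith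
    have "angle c z b \<le> pi / 2 + t"
      using psm T v(1) unfolding partially_structured_mesh_def t by blast
    from angle_obtuse[OF v(2,3) t0 this] have "e * s \<le> t * (L * s)" unfolding inner L(1) b by simp
    then have 1: "e \<le> t * L" using s by (simp add: mult.assoc[symmetric])
    have L0: "L \<ge> 0" using L(1) by simp
    have "h_node \<T> z / H_node \<T> z * L \<le> (\<kappa> * h_tri T) / (H_tri T / \<kappa>) * H_tri T"
    proof (intro mult_mono frac_le)
      show "h_node \<T> z \<le> \<kappa> * h_tri T" using np(2) by (simp add: comparable_def)
      show "H_tri T / \<kappa> \<le> H_node \<T> z" using np(3) \<kappa> by (simp add: comparable_def pos_divide_le_eq mult.commute)
    qed (use L L0 \<kappa> h0 Hpos in auto)
    also have "\<dots> = \<kappa>\<^sup>2 * h_tri T" using Hpos \<kappa> by (simp add: power2_eq_square)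
    also have "\<dots> \<le> \<kappa>\<^sup>2 * s" using hs by (intro mult_left_mono) auto
    finally have "lam\<^sub>1 * (h_node \<T> z / H_node \<T> z * L) \<le> lam\<^sub>1 * (\<kappa>\<^sup>2 * s)" using lam1 by (intro mult_left_mono) auto
    then have 2: "t * L \<le> lam\<^sub>1 * \<kappa>\<^sup>2 * s" unfolding t by (simp add: mult.assoc)
    have "t * L \<le> 1/2 * L" using t2 L0 by (rule mult_right_mono)
    then show ?thesis using 1 2 by simp
  qed
  have nAB: "B = norm (?c - ?b)" "A = norm (?c - ?a)" 
    unfolding A_def B_def dist_norm by (rule norm_minus_commute)+
  have nab: "norm (?a - ?b) = s" "norm (?b - ?a) = s"
    using pq by (simp_all add: norm_prod_def s_def)
  have HAB: "A \<le> H_tri T" "B \<le> H_tri T" unfolding H' by auto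
  have ob: "Y - q \<le> lam\<^sub>1 * \<kappa>\<^sup>2 * s \<and> Y - q \<le> B / 2"
  proof -
    have i: "(?c - ?b) \<bullet> (?a - ?b) = - (Y - q) * s" by (simp add: s_def algebra_simps)
    have v: "vertices T = {?c, ?b, ?a}" using vert by auto
    from over[OF node(2,4) nAB(1) HAB(2) nab(1) i v ne(3)[symmetric] ne(1)] show ?thesis .
  qed
  have oa: "p - Y \<le> lam\<^sub>1 * \<kappa>\<^sup>2 * s \<and> p - Y \<le> A / 2"
  proof -
    have i: "(?c - ?a) \<bullet> (?b - ?a) = - (p - Y) * s" by (simp add: s_def algebra_simps)
    have v: "vertices T = {?c, ?a, ?b}" using vert by auto
    from over[OF node(1,3) nAB(2) HAB(1) nab(2) i v ne(2)[symmetric] ne(1)[symmetric]] show ?thesis .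
  qed
  have K: "lam\<^sub>1 * \<kappa>\<^sup>2 * s + s \<le> Kc * s" "s \<le> Kc * s"
    using mult_right_mono[OF Kc(3), of s] mult_right_mono[OF Kc(1), of s] s by (auto simp: algebra_simps)
  show "\<bar>Y - p\<bar> \<le> Kc * s" "\<bar>Y - q\<bar> \<le> Kc * s"
    using oa ob K s lam1 unfolding s_def abs_le_iff by auto
  \<comment> \<open>An overshoot of at most half a long edge cannot exceed its horizontal
    width.\<close>
  have half: "e \<le> W" if "e \<le> sqrt (W\<^sup>2 + e\<^sup>2) / 2" for e
  proof (rule ccontr)
    assume "\<not> e \<le> W"
    then have e: "e > W" by simp
    then have "W\<^sup>2 \<le> e\<^sup>2" using W by (intro power_mono) auto
    then have "W\<^sup>2 + e\<^sup>2 \<le> 2 * e\<^sup>2" by simp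
    also have "\<dots> < (2 * e)\<^sup>2" using e W by (simp add: power2_eq_square)
    finally have "sqrt (W\<^sup>2 + e\<^sup>2) < 2 * e" using e W by (intro real_less_lsqrt) auto
    then show False using that by simp
  qed
  have oW: "Y - q \<le> W" "p - Y \<le> W"
    using half[of "Y - q"] half[of "p - Y"] oa ob unfolding AB by (auto simp: power2_commute)
  \<comment> \<open>The shortest edge is compared with the long edge at the end nearer in height to
    the apex. Either the overshoot is at most W or the height difference is at most half of the
    shortest edge.\<close>
  show s2: "s \<le> 2 * W"
  proof -
    consider "Y > q" | "Y < p" | "p \<le> Y" "Y \<le> q" "Y - p \<le> s / 2" | "p \<le> Y" "Y \<le> q" "q - Y \<le> s / 2"
      unfolding s_def by argo
    then show ?thesis
    proof cases
      case 1 then show ?thesis using short'(2) ABle(2) oW by auto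
    next
      case 2 then show ?thesis using short'(1) ABle(1) oW by auto
    next
      case 3 then show ?thesis using short'(1) ABle(1) by auto
    next
      case 4 then show ?thesis using short'(2) ABle(2) by auto
    qed
  qed
  show H4: "H_tri T \<le> 4 * W"
    unfolding H' using ABle oW s2 W s unfolding s_def by (auto simp: abs_if split: if_splits)
  have "s * H_tri T \<le> s * (4 * W)" using H4 s by (intro mult_left_mono) auto
  then show "s / 4 \<le> h_tri T" unfolding h using Hpos by (simp add: pos_le_divide_eq mult_ac)
qed

text \<open>Normal form of an element as seen from the line \<open>x i\<close>, with its short edge
  on either of the two lines: one of q - p and Q - P is zero, and their sum is the length of the
  short edge. The form is symmetric in the two lines, as one element belongs to the right column of
  one line and to the left column of the next.\<close>

definition slab_triangle :: "nat \<Rightarrow> nat \<Rightarrow> point set \<Rightarrow> real \<Rightarrow> real \<Rightarrow> real \<Rightarrow> real \<Rightarrow> bool"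
  where "slab_triangle i j T p P q Q \<longleftrightarrow> T \<in> \<T> \<and> i \<le> n \<and> j \<le> n \<and> (j = i + 1 \<or> i = j + 1) \<and>
    T = wedge (x i) (x j - x i) p P q Q \<and> vertices T = {(x i, p), (x i, q), (x j, P), (x j, Q)} \<and>
    ((p < q \<and> P = Q) \<or> (p = q \<and> P < Q)) \<and>
    (q - p) + (Q - P) \<le> 2 * \<bar>x j - x i\<bar> \<and>
    \<bar>P - p\<bar> \<le> Kc * ((q - p) + (Q - P)) \<and> \<bar>Q - q\<bar> \<le> Kc * ((q - p) + (Q - P)) \<and>
    area T = \<bar>x j - x i\<bar> * ((q - p) + (Q - P)) / 2 \<and>
    \<bar>x j - x i\<bar> \<le> H_tri T \<and> H_tri T \<le> 4 * \<bar>x j - x i\<bar> \<and>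
    ((q - p) + (Q - P)) / 4 \<le> h_tri T \<and> h_tri T \<le> (q - p) + (Q - P)"

definition column :: "nat \<Rightarrow> nat \<Rightarrow> point set set"
  where "column i j = {T. \<exists>p P q Q. slab_triangle i j T p P q Q}"

lemma slab_triangleD:
  assumes "slab_triangle i j T p P q Q"
  shows "T \<in> \<T>" "i \<le> n" "j \<le> n" "j = i + 1 \<or> i = j + 1" "x i \<noteq> x j"
    "T = wedge (x i) (x j - x i) p P q Q" "vertices T = {(x i, p), (x i, q), (x j, P), (x j, Q)}"
    "(p < q \<and> P = Q) \<or> (p = q \<and> P < Q)"
    "(q - p) + (Q - P) \<le> 2 * \<bar>x j - x i\<bar>"
    "\<bar>P - p\<bar> \<le> Kc * ((q - p) + (Q - P))" "\<bar>Q - q\<bar> \<le> Kc * ((q - p) + (Q - P))"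
    "area T = \<bar>x j - x i\<bar> * ((q - p) + (Q - P)) / 2"
    "\<bar>x j - x i\<bar> \<le> H_tri T" "H_tri T \<le> 4 * \<bar>x j - x i\<bar>"
    "((q - p) + (Q - P)) / 4 \<le> h_tri T" "h_tri T \<le> (q - p) + (Q - P)"
    "(x i, p) \<in> T" "(x i, q) \<in> T" "(x j, P) \<in> T" "(x j, Q) \<in> T"
proof -
  note a = assms[unfolded slab_triangle_def]
  show b: "T \<in> \<T>" "i \<le> n" "j \<le> n" "j = i + 1 \<or> i = j + 1"
    "T = wedge (x i) (x j - x i) p P q Q" "vertices T = {(x i, p), (x i, q), (x j, P), (x j, Q)}"
    "(p < q \<and> P = Q) \<or> (p = q \<and> P < Q)"
    "(q - p) + (Q - P) \<le> 2 * \<bar>x j - x i\<bar>"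
    "\<bar>P - p\<bar> \<le> Kc * ((q - p) + (Q - P))" "\<bar>Q - q\<bar> \<le> Kc * ((q - p) + (Q - P))"
    "area T = \<bar>x j - x i\<bar> * ((q - p) + (Q - P)) / 2"
    "\<bar>x j - x i\<bar> \<le> H_tri T" "H_tri T \<le> 4 * \<bar>x j - x i\<bar>"
    "((q - p) + (Q - P)) / 4 \<le> h_tri T" "h_tri T \<le> (q - p) + (Q - P)"
    using a by blast+
  show "x i \<noteq> x j" using x_inj[OF b(2,3)] b(4) by auto
  have "v \<in> T" if "v \<in> vertices T" for v
    using that by (simp add: vertices_def extreme_point_of_def)
  then show "(x i, p) \<in> T" "(x i, q) \<in> T" "(x j, P) \<in> T" "(x j, Q) \<in> T" by (auto simp: b(6))
qed

lemma slab_triangle_flip: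
  assumes "slab_triangle i j T p P q Q"
  shows "slab_triangle j i T P p Q q"
proof -
  note D = slab_triangleD[OF assms]
  have "wedge (x j) (x i - x j) P p Q q = T"
    using wedge_flip[of "x j - x i" "x i" P p Q q] D(5,6) by simp
  moreover have "vertices T = {(x j, P), (x j, Q), (x i, p), (x i, q)}" using D(7) by auto
  ultimately show ?thesis
    using assms unfolding slab_triangle_def
    by (simp add: abs_minus_commute add.commute)
      auto
qed

lemma slab_ends:
  assumes "slab_triangle i j T p P q Q"
  shows "(x i, y) \<in> T \<longleftrightarrow> p \<le> y \<and> y \<le> q" "(x j, y) \<in> T \<longleftrightarrow> P \<le> y \<and> y \<le> Q"
proof -
  note D = slab_triangleD[OF assms]
  have "(x i - x i) / (x j - x i) = 0" "(x j - x i) / (x j - x i) = 1" using D(5) by auto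
  then have "(x i, y) \<in> wedge (x i) (x j - x i) p P q Q \<longleftrightarrow> p \<le> y \<and> y \<le> q"
    "(x j, y) \<in> wedge (x i) (x j - x i) p P q Q \<longleftrightarrow> P \<le> y \<and> y \<le> Q"
    unfolding wedge_def mem_Collect_eq fst_conv snd_conv by simp_all
  then show "(x i, y) \<in> T \<longleftrightarrow> p \<le> y \<and> y \<le> q" "(x j, y) \<in> T \<longleftrightarrow> P \<le> y \<and> y \<le> Q"
    unfolding D(6)[symmetric] .
qed

lemma column_flip: "column i j = column j i"
  unfolding column_def using slab_triangle_flip by blast

lemma mesh_slab_triangle:
  assumes T: "T \<in> \<T>"
  obtains i j p P q Q where "slab_triangle i j T p P q Q"
proof -
  obtain i j p q Y where 1: "i \<le> n" "j \<le> n" "j = i + 1 \<or> i = j + 1" "p < q"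
    "T = convex hull {(x i, p), (x i, q), (x j, Y)}" "\<not> affine_dependent {(x i, p), (x i, q), (x j, Y)}"
    "q - p \<le> dist (x i, p) (x j, Y)" "q - p \<le> dist (x i, q) (x j, Y)"
    by (rule mesh_triangle[OF T])
  have ij: "x i \<noteq> x j" using x_inj[OF 1(1,2)] 1(3) by auto
  note sh = triangle_shape[OF T ij 1(4-8)]
  have "slab_triangle i j T p Y q Y"
    unfolding slab_triangle_def using T 1(1-4) sh(2-) sh(1)[symmetric] by simp
  then show ?thesis by (rule that)
qed

lemma slab_range:
  assumes "slab_triangle i j T p P q Q" "z \<in> T"
  shows "min (x i) (x j) \<le> fst z \<and> fst z \<le> max (x i) (x j)"
  using assms(2) between_iff[of "x j - x i" "fst z" "x i"] slab_triangleD(5,6)[OF assms(1)]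
  by (auto simp: wedge_def)

text \<open>An element spans exactly one gap between neighbouring lines, so a point strictly inside
  a gap determines the column of every element containing it.\<close>

lemma slab_triangle_at:
  assumes T: "T \<in> \<T>" "z \<in> T" and i: "i < n" "x i < fst z" "fst z < x (i + 1)"
  shows "T \<in> column i (i + 1)"
proof -
  obtain i0 j p P q Q where s: "slab_triangle i0 j T p P q Q" by (rule mesh_slab_triangle[OF T(1)])
  have "\<exists>k p P q Q. k < n \<and> slab_triangle k (k + 1) T p P q Q"
    using slab_triangleD(2-4)[OF s] s slab_triangle_flip[OF s] by (metis Suc_eq_plus1 Suc_le_eq)
  then obtain k p P q Q where k: "k < n" and s: "slab_triangle k (k + 1) T p P q Q" by blast
  have kx: "x k < x (k + 1)" using k x_mono by simp
  have r: "x k \<le> fst z" "fst z \<le> x (k + 1)" using slab_range[OF s T(2)] kx by auto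
  have "k = i"
  proof (rule ccontr)
    assume "k \<noteq> i"
    then consider "k + 1 \<le> i" | "i + 1 \<le> k" by linarith
    then show False
    proof cases
      case 1 then have "x (k + 1) \<le> x i" using x_mono[of "k + 1" i] i by (cases "k + 1 = i") auto
      then show False using r i by linarith
    next
      case 2 then have "x (i + 1) \<le> x k" using x_mono[of "i + 1" k] k by (cases "i + 1 = k") auto
      then show False using r i by linarith
    qed
  qed
  then show ?thesis using s by (auto simp: column_def)
qed

lemma finite_column: "finite (column i j)"
  by (rule finite_subset[OF _ finT]) (auto simp: column_def dest: slab_triangleD)

lemma in_unit_square: "T \<in> \<T> \<Longrightarrow> z \<in> T \<Longrightarrow> 0 \<le> fst z \<and> fst z \<le> 1 \<and> 0 \<le> snd z \<and> snd z \<le> 1"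
  using UnT UnionI[of T \<T> z] by (cases z) simp

text \<open>The elements of a column are ordered by their traces on the vertical midline, which tile
  the unit interval: interiors are disjoint and the mesh covers the square. Conformity then makes
  consecutive elements share a whole long edge rather than just a point of the midline.\<close>

lemma column_ordered:
  assumes i: "i \<le> n" "j \<le> n" "j = i + 1 \<or> i = j + 1"
  obtains m t N F where "half_strip (x j - x i) m N F" "bij_betw t {..<m} (column i j)"
    "\<And>k. k < m \<Longrightarrow> slab_triangle i j (t k) (N k) (F k) (N (Suc k)) (F (Suc k))" "m > 0"
proof -
  have "\<forall>T\<in>column i j. \<exists>v. slab_triangle i j T (fst (fst v)) (snd (fst v)) (fst (snd v)) (snd (snd v))"
    by (auto simp: column_def)
  then obtain v where v: "\<And>T. T \<in> column i j \<Longrightarrow>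
      slab_triangle i j T (fst (fst (v T))) (snd (fst (v T))) (fst (snd (v T))) (snd (snd (v T)))"
    by metis
  define p where "p T = fst (fst (v T))" for T
  define P where "P T = snd (fst (v T))" for T
  define q where "q T = fst (snd (v T))" for T
  define Q where "Q T = snd (snd (v T))" for T
  have S: "slab_triangle i j T (p T) (P T) (q T) (Q T)" if "T \<in> column i j" for T
    unfolding p_def P_def q_def Q_def by (rule v[OF that])
  note D = slab_triangleD[OF S]
  have ij: "x i \<noteq> x j" using x_inj[OF i(1,2)] i(3) by auto
  define c where "c = (x i + x j) / 2"
  have \<tau>c: "(c - x i) / (x j - x i) = 1/2" using ij by (simp add: c_def field_simps)
  define lo where "lo T = (p T + P T) / 2" for T
  define hi where "hi T = (q T + Q T) / 2" for T
  have mem: "(c, y) \<in> T \<longleftrightarrow> lo T \<le> y \<and> y \<le> hi T" if "T \<in> column i j" for T y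
  proof -
    have "(c, y) \<in> wedge (x i) (x j - x i) (p T) (P T) (q T) (Q T) \<longleftrightarrow> lo T \<le> y \<and> y \<le> hi T"
      unfolding wedge_def mem_Collect_eq fst_conv snd_conv \<tau>c by (simp add: lo_def hi_def field_simps)
    then show ?thesis using D(6)[OF that] by simp
  qed
  have int: "(c, y) \<in> interior T" if "T \<in> column i j" "lo T < y" "y < hi T" for T y
  proof -
    have "(c, y) \<in> owedge (x i) (x j - x i) (p T) (P T) (q T) (Q T)"
      unfolding owedge_def mem_Collect_eq fst_conv snd_conv \<tau>c using that by (simp add: lo_def hi_def field_simps)
    then show ?thesis by (metis D(6)[OF that(1)] owedge_interior subsetD)
  qed
  have cover: "\<exists>T\<in>column i j. (c, y) \<in> T" if "0 \<le> y" "y \<le> 1" for y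
  proof -
    have x01: "0 \<le> x k" "x k \<le> 1" if "k \<le> n" for k
      using x_mono[of 0 k] x_mono[of k n] x_ends that by (cases "k = 0"; cases "k = n"; auto)+
    have "(c, y) \<in> \<Union>\<T>" unfolding UnT c_def using that x01[OF i(1)] x01[OF i(2)] by auto
    then obtain T where T: "T \<in> \<T>" "(c, y) \<in> T" by auto
    show ?thesis
    proof (cases "j = i + 1")
      case True
      then have "x i < x j" using i x_mono by simp
      then have "T \<in> column i (i + 1)" by (intro slab_triangle_at[OF T]) (use True i in \<open>auto simp: c_def\<close>)
      then show ?thesis using T True by auto
    next
      case False
      then have ji: "i = j + 1" using i by simp
      then have "x j < x i" using i x_mono by simp
      then have "T \<in> column j (j + 1)" by (intro slab_triangle_at[OF T]) (use ji i in \<open>auto simp: c_def\<close>)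
      then show ?thesis using T ji column_flip by auto
    qed
  qed
  have nn: "0 \<le> p T" "0 \<le> P T" "q T \<le> 1" "Q T \<le> 1" if T: "T \<in> column i j" for T
    using in_unit_square[OF D(1)[OF T] D(17)[OF T]] in_unit_square[OF D(1)[OF T] D(18)[OF T]]
      in_unit_square[OF D(1)[OF T] D(19)[OF T]] in_unit_square[OF D(1)[OF T] D(20)[OF T]] by auto
  have "\<exists>m t. 0 < m \<and> bij_betw t {..<m::nat} (column i j) \<and> lo (t 0) = 0 \<and> hi (t (m - 1)) = 1 \<and>
    (\<forall>k. Suc k < m \<longrightarrow> hi (t k) = lo (t (Suc k)))"
  proof (rule interval_tiling[OF finite_column])
    show "lo T < hi T" if "T \<in> column i j" for T
      using D(8)[OF that] unfolding lo_def hi_def by auto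
    show "0 \<le> lo T \<and> hi T \<le> 1" if "T \<in> column i j" for T
      using nn[OF that] unfolding lo_def hi_def by auto
    show "\<exists>T\<in>column i j. lo T \<le> y \<and> y < hi T" if y: "0 \<le> y" "y < 1" for y
    proof -
      \<comment> \<open>The element is chosen at a height slightly above \<open>y\<close>, below
        every trace that begins later. It must begin at or below \<open>y\<close> and end strictly
        above, which gives the half-open covering.\<close>
      define Z where "Z = insert 1 (lo ` {T\<in>column i j. y < lo T})"
      have Z: "finite Z" "Z \<noteq> {}" "\<And>z. z \<in> Z \<Longrightarrow> y < z" using y finite_column by (auto simp: Z_def)
      define y' where "y' = (y + Min Z) / 2"
      have yM: "y < Min Z" using Z by simp
      have "Min Z \<le> 1" using Z(1) by (simp add: Z_def)
      then have y': "y < y'" "y' < 1" "y' < Min Z" using yM y by (auto simp: y'_def)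
      then obtain T where T: "T \<in> column i j" "lo T \<le> y'" "y' \<le> hi T" using cover[of y'] mem y by auto
      have "lo T \<le> y"
      proof (rule ccontr)
        assume "\<not> lo T \<le> y"
        then have "Min Z \<le> lo T" using Z(1) T(1) by (intro Min_le) (auto simp: Z_def)
        then show False using T y' by linarith
      qed
      then show ?thesis using T y' by (intro bexI[of _ T]) auto
    qed
    show "hi S \<le> lo T \<or> hi T \<le> lo S" if "S \<in> column i j" "T \<in> column i j" "S \<noteq> T" for S T
    proof (rule ccontr)
      assume "\<not> ?thesis"
      moreover have "lo S < hi S" "lo T < hi T" using D(8)[OF that(1)] D(8)[OF that(2)] unfolding lo_def hi_def by auto
      ultimately have "max (lo S) (lo T) < min (hi S) (hi T)" by auto
      then obtain y where "max (lo S) (lo T) < y" "y < min (hi S) (hi T)" using dense by blast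
      then show False using int[OF that(1), of y] int[OF that(2), of y] interior_disjoint[OF D(1) D(1)] that by auto
    qed
  qed simp
  then obtain m t where mt: "0 < m" "bij_betw t {..<m} (column i j)" "lo (t 0) = 0" "hi (t (m - 1)) = 1"
    "\<And>k. Suc k < m \<Longrightarrow> hi (t k) = lo (t (Suc k))" by blast
  have t: "t k \<in> column i j" if "k < m" for k using mt(2) that by (auto simp: bij_betw_def)
  \<comment> \<open>The value 1 after the last element closes the stack at the top of the square; it
    agrees with the upper edge there, whose end heights are at most 1 with sum 2.\<close>
  define N where "N k = (if k < m then p (t k) else 1)" for k
  define F where "F k = (if k < m then P (t k) else 1)" for k
  have next': "q (t k) = N (Suc k) \<and> Q (t k) = F (Suc k)" if k: "k < m" for k
  proof (cases "Suc k < m")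
    case True
    define T where "T = t k" define T' where "T' = t (Suc k)"
    have T: "T \<in> column i j" "T' \<in> column i j" using t k True by (auto simp: T_def T'_def)
    have e: "hi T = lo T'" unfolding T_def T'_def by (rule mt(5)[OF True])
    \<comment> \<open>The midpoint of the upper long edge lies in the next element, so by conformity
      both ends do. The ends cannot lie below the lower edge of that element, and the equal
      midpoints force equality.\<close>
    have "(c, hi T) \<in> T'" unfolding mem[OF T(2)] e using D(8)[OF T(2)] by (auto simp: lo_def hi_def)
    moreover have "(c, hi T) = midpoint (x i, q T) (x j, Q T)"
      by (simp add: midpoint_def c_def hi_def field_simps)
    moreover have "midpoint (x i, q T) (x j, Q T) \<in> open_segment (x i, q T) (x j, Q T)"
      using ij by (simp only: midpoint_in_open_segment) simp
    ultimately have "(x i, q T) \<in> T'" "(x j, Q T) \<in> T'"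
      using shared[OF D(1)[OF T(1)] D(1)[OF T(2)] D(18)[OF T(1)] D(20)[OF T(1)]] by metis+
    then have "p T' \<le> q T" "P T' \<le> Q T"
      using slab_ends[OF S[OF T(2)]] by blast+
    then have "q T = p T'" "Q T = P T'" using e by (auto simp: lo_def hi_def)
    then show ?thesis using True by (auto simp: N_def F_def T_def T'_def)
  next
    case False
    then have "k = m - 1" using k by simp
    then have "q (t k) + Q (t k) = 2" using mt(4) by (simp add: hi_def)
    then show ?thesis using nn[OF t[OF k]] False by (auto simp: N_def F_def)
  qed
  have sl: "slab_triangle i j (t k) (N k) (F k) (N (Suc k)) (F (Suc k))" if k: "k < m" for k
    using S[OF t[OF k]] next'[OF k] k by (simp add: N_def F_def)
  show ?thesis
  proof (rule that[OF _ mt(2) sl mt(1)])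
    show "half_strip (x j - x i) m N F"
    proof
      show "x j - x i \<noteq> 0" using ij by simp
      show "N 0 = 0" "F 0 = 0" using mt(1,3) nn[OF t[OF mt(1)]] by (auto simp: N_def F_def lo_def)
      show "N m = 1" "F m = 1" by (auto simp: N_def F_def)
      show "N k < N (Suc k) \<and> F k = F (Suc k) \<or> N k = N (Suc k) \<and> F k < F (Suc k)" if "k < m" for k
        using slab_triangleD(8)[OF sl[OF that]] by auto
    qed
  qed
qed

end

section \<open>Finite element functions\<close>

context psm
begin

lemma slab_interior:
  assumes s: "slab_triangle i j T p P q Q"
    and a: "0 < (a - x i) / (x j - x i)" "(a - x i) / (x j - x i) < 1"
    and y: "p + (P - p) * ((a - x i) / (x j - x i)) < y" "y < q + (Q - q) * ((a - x i) / (x j - x i))"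
  shows "(a, y) \<in> interior T"
proof -
  have "(a, y) \<in> owedge (x i) (x j - x i) p P q Q" using a y by (simp add: owedge_def)
  then show ?thesis by (metis slab_triangleD(6)[OF s] owedge_interior subsetD)
qed

lemma interior_nonempty:
  assumes "T \<in> \<T>"
  obtains z where "z \<in> interior T"
proof -
  obtain i j p P q Q where s: "slab_triangle i j T p P q Q" by (rule mesh_slab_triangle[OF assms])
  note D = slab_triangleD[OF s]
  define a where "a = (x i + x j) / 2"
  have t: "(a - x i) / (x j - x i) = 1/2" using D(5) by (simp add: a_def field_simps)
  have "(a, (p + P + q + Q) / 4) \<in> interior T"
    by (rule slab_interior[OF s]) (use D(8) in \<open>auto simp: t field_simps\<close>)
  then show ?thesis by (rule that)
qed

lemma slab_boundary:
  assumes s: "slab_triangle i j T p P q Q" and z: "(a, y) \<in> T" "(a, y) \<notin> interior T"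
  shows "a = x i \<or> a = x j \<or> y = p + (P - p) * ((a - x i) / (x j - x i)) \<or> y = q + (Q - q) * ((a - x i) / (x j - x i))"
proof (rule ccontr)
  assume neg: "\<not> ?thesis"
  note D = slab_triangleD[OF s]
  define \<tau> where "\<tau> = (a - x i) / (x j - x i)"
  have w: "0 \<le> \<tau>" "\<tau> \<le> 1" "p + (P - p) * \<tau> \<le> y" "y \<le> q + (Q - q) * \<tau>"
    using z(1) D(6) by (auto simp: wedge_def \<tau>_def)
  moreover have "\<tau> \<noteq> 0" "\<tau> \<noteq> 1" using neg D(5) by (auto simp: \<tau>_def)
  ultimately have "(a, y) \<in> interior T"
    using neg slab_interior[OF s, of a y] unfolding \<tau>_def[symmetric] by auto
  then show False using z by simp
qed

text \<open>A vertical line between mesh lines meets the boundary of an element in its two long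
  edges. A horizontal line away from the heights of the vertices meets no horizontal edge, and each
  other long edge at most once.\<close>

lemma finite_slices:
  assumes T: "T \<in> \<T>"
  shows "a \<notin> x ` {..n} \<Longrightarrow> finite {y. (a, y) \<in> T - interior T}"
    "y \<notin> snd ` vertices T \<Longrightarrow> finite {a. (a, y) \<in> T - interior T}"
proof -
  obtain i j p P q Q where s: "slab_triangle i j T p P q Q" by (rule mesh_slab_triangle[OF T])
  note D = slab_triangleD[OF s]
  define \<tau> where "\<tau> a = (a - x i) / (x j - x i)" for a
  have b: "a = x i \<or> a = x j \<or> y = p + (P - p) * \<tau> a \<or> y = q + (Q - q) * \<tau> a" if "(a, y) \<in> T - interior T" for a y
    using slab_boundary[OF s, of a y] that by (auto simp: \<tau>_def)
  show "finite {y. (a, y) \<in> T - interior T}" if "a \<notin> x ` {..n}"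
  proof (rule finite_subset)
    show "{y. (a, y) \<in> T - interior T} \<subseteq> {p + (P - p) * \<tau> a, q + (Q - q) * \<tau> a}"
      using b that D(2,3) by blast
  qed simp
  have one: "finite {a. y = p + (P - p) * \<tau> a}" if "y \<noteq> p" for p P
  proof (rule finite_subset)
    show "{a. y = p + (P - p) * \<tau> a} \<subseteq> {x i + (y - p) / (P - p) * (x j - x i)}"
    proof
      fix a assume "a \<in> {a. y = p + (P - p) * \<tau> a}"
      then have e: "y - p = (P - p) * \<tau> a" by simp
      then have "P - p \<noteq> 0" using that by auto
      then have "\<tau> a = (y - p) / (P - p)" using e by simp
      then show "a \<in> {x i + (y - p) / (P - p) * (x j - x i)}" using D(5) by (simp add: \<tau>_def field_simps)
    qed
  qed simp
  show "finite {a. (a, y) \<in> T - interior T}" if y: "y \<notin> snd ` vertices T"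
  proof (rule finite_subset)
    show "{a. (a, y) \<in> T - interior T} \<subseteq> {x i, x j} \<union> {a. y = p + (P - p) * \<tau> a} \<union> {a. y = q + (Q - q) * \<tau> a}"
      using b by auto
    have "y \<noteq> p" "y \<noteq> q" using y D(7) by auto
    then show "finite ({x i, x j} \<union> {a. y = p + (P - p) * \<tau> a} \<union> {a. y = q + (Q - q) * \<tau> a})"
      using one by simp
  qed
qed

lemma T_closed: "T \<in> \<T> \<Longrightarrow> compact T" and T_convex: "T \<in> \<T> \<Longrightarrow> convex T"
  using simplexT by (auto dest: compact_simplex convex_simplex)

end

locale fe_mesh = psm +
  fixes u\<^sub>h :: "point \<Rightarrow> real"
  assumes FE: "u\<^sub>h \<in> FE_space \<T>"
begin

text \<open>The description of \<open>element_grad\<close> has a unique solution since every element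
  has an interior point, where the derivative is unique.\<close>

lemma element_affine:
  assumes T: "T \<in> \<T>"
  shows "p \<in> interior T \<Longrightarrow> GDERIV u\<^sub>h p :> element_grad T u\<^sub>h"
    "\<exists>c. \<forall>p\<in>T. u\<^sub>h p = element_grad T u\<^sub>h \<bullet> p + c"
proof -
  obtain g c where gc: "\<forall>p\<in>T. u\<^sub>h p = g \<bullet> p + c" using FE T unfolding FE_space_def by blast
  have G: "GDERIV u\<^sub>h p :> g" if p: "p \<in> interior T" for p
    unfolding gderiv_def
  proof (rule has_derivative_transform_within_open[OF _ open_interior p])
    show "((\<lambda>p. g \<bullet> p + c) has_derivative (\<lambda>h. h \<bullet> g)) (at p)"
      by (auto intro!: derivative_eq_intros simp: inner_commute)
    show "g \<bullet> z + c = u\<^sub>h z" if "z \<in> interior T" for z using gc that interior_subset by fastforce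
  qed
  obtain z where z: "z \<in> interior T" by (rule interior_nonempty[OF T])
  have e: "element_grad T u\<^sub>h = g"
    unfolding element_grad_def
  proof (rule the_equality)
    show "\<forall>p\<in>interior T. GDERIV u\<^sub>h p :> g" using G by blast
    show "g' = g" if "\<forall>p\<in>interior T. GDERIV u\<^sub>h p :> g'" for g'
      using GDERIV_unique G[OF z] that z by blast
  qed
  show "\<exists>c. \<forall>p\<in>T. u\<^sub>h p = element_grad T u\<^sub>h \<bullet> p + c" using gc e by blast
  show "p \<in> interior T \<Longrightarrow> GDERIV u\<^sub>h p :> element_grad T u\<^sub>h" using G e by simp
qed

lemma element_diff:
  assumes "T \<in> \<T>" "p \<in> T" "q \<in> T"
  shows "u\<^sub>h p - u\<^sub>h q = element_grad T u\<^sub>h \<bullet> (p - q)"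
  using element_affine(2)[OF assms(1)] assms(2,3) by (auto simp: inner_diff_right)

definition gradh :: "point \<Rightarrow> point"
  where "gradh p = (\<Sum>T\<in>\<T>. indicator (interior T) p *\<^sub>R element_grad T u\<^sub>h)"

lemma gradh_interior:
  assumes "T \<in> \<T>" "p \<in> interior T"
  shows "gradh p = element_grad T u\<^sub>h"
proof -
  have "gradh p = (\<Sum>T'\<in>\<T>. if T' = T then element_grad T' u\<^sub>h else 0)"
    unfolding gradh_def
  proof (rule sum.cong[OF refl])
    fix T' assume T': "T' \<in> \<T>"
    have "T' = T" if "p \<in> interior T'" using interior_disjoint[OF T' assms(1) that assms(2)] .
    then have "p \<in> interior T' \<longleftrightarrow> T' = T" using assms(2) by blast
    then have "indicator (interior T') p = (if T' = T then 1 else 0 :: real)" by (simp only: indicator_def of_bool_def)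
    then show "indicator (interior T') p *\<^sub>R element_grad T' u\<^sub>h = (if T' = T then element_grad T' u\<^sub>h else 0)" by simp
  qed
  then show ?thesis using finT assms by simp
qed

lemma gradh_broken:
  assumes D: "D = {l<..<r} \<times> {0<..<1}" "0 \<le> l" "l < r" "r \<le> 1"
  shows "broken_gradient l r 0 1 D u\<^sub>h gradh (\<Union>(interior ` \<T>)) (\<Sum>T\<in>\<T>. norm (element_grad T u\<^sub>h))"
proof
  show "D = {l<..<r} \<times> {0<..<1}" "l < r" "(0::real) < 1" using D by auto
  show "continuous_on ({l..r} \<times> {0..1}) u\<^sub>h"
    using FE D by (auto simp: FE_space_def Omega_def closure_Times intro: continuous_on_subset)
  show "GDERIV u\<^sub>h p :> gradh p" if p: "p \<in> \<Union>(interior ` \<T>)" for p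
  proof -
    obtain T where T: "T \<in> \<T>" "p \<in> interior T" using p by blast
    show ?thesis using element_affine(1)[OF T] by (simp add: gradh_interior[OF T])
  qed
  have [measurable]: "interior T \<in> sets borel" for T :: "point set" by simp
  show "gradh \<in> borel_measurable borel" unfolding gradh_def by measurable
  show "norm (gradh p) \<le> (\<Sum>T\<in>\<T>. norm (element_grad T u\<^sub>h))" for p
    unfolding gradh_def by (rule order_trans[OF norm_sum sum_mono]) (auto simp: indicator_def)
  have cov: "\<exists>T\<in>\<T>. p \<in> T" if "p \<in> {l<..<r} \<times> {0<..<1}" for p
  proof -
    have "p \<in> {0..1} \<times> {0..1}" using that D by auto
    then show ?thesis unfolding UnT[symmetric] by blast
  qed
  show "\<exists>X. finite X \<and> (\<forall>a\<in>{l<..<r} - X. finite {y \<in> {0<..<1}. (a, y) \<notin> \<Union>(interior ` \<T>)})"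
  \<comment> \<open>The exceptional vertical lines are the mesh lines; for horizontal lines the
    heights of the nodes are excluded.\<close>
  proof (intro exI[of _ "x ` {..n}"] conjI ballI)
    fix a assume a: "a \<in> {l<..<r} - x ` {..n}"
    show "finite {y \<in> {0<..<1}. (a, y) \<notin> \<Union>(interior ` \<T>)}"
    proof (rule finite_subset)
      show "{y \<in> {0<..<1}. (a, y) \<notin> \<Union>(interior ` \<T>)} \<subseteq> (\<Union>T\<in>\<T>. {y. (a, y) \<in> T - interior T})"
        using cov a by fastforce
      show "finite (\<Union>T\<in>\<T>. {y. (a, y) \<in> T - interior T})"
        using finT finite_slices(1) a by blast
    qed
  qed simp
  show "\<exists>Y. finite Y \<and> (\<forall>y\<in>{0<..<1} - Y. finite {a \<in> {l<..<r}. (a, y) \<notin> \<Union>(interior ` \<T>)})"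
  proof (intro exI[of _ "snd ` \<Union>(vertices ` \<T>)"] conjI ballI)
    have "finite (vertices T)" if T: "T \<in> \<T>" for T
    proof -
      obtain i j p P q Q where "slab_triangle i j T p P q Q" by (rule mesh_slab_triangle[OF T])
      from slab_triangleD(7)[OF this] show ?thesis by simp
    qed
    then show "finite (snd ` \<Union>(vertices ` \<T>))" using finT by simp
    fix y assume y: "y \<in> {0<..<1} - snd ` \<Union>(vertices ` \<T>)"
    show "finite {a \<in> {l<..<r}. (a, y) \<notin> \<Union>(interior ` \<T>)}"
    proof (rule finite_subset)
      show "{a \<in> {l<..<r}. (a, y) \<notin> \<Union>(interior ` \<T>)} \<subseteq> (\<Union>T\<in>\<T>. {a. (a, y) \<in> T - interior T})"
        using cov y by fastforce
      show "finite (\<Union>T\<in>\<T>. {a. (a, y) \<in> T - interior T})"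
        using finT finite_slices(2) y by blast
    qed
  qed
qed

lemma frontier_Omega: "p \<in> closure Omega \<Longrightarrow> p \<notin> Omega \<Longrightarrow> u\<^sub>h p = 0"
  using FE interior_open[of Omega] by (auto simp: FE_space_def frontier_def Omega_def open_Times)

lemma u_ends: "0 \<le> a \<Longrightarrow> a \<le> 1 \<Longrightarrow> u\<^sub>h (a, 0) = 0" "0 \<le> a \<Longrightarrow> a \<le> 1 \<Longrightarrow> u\<^sub>h (a, 1) = 0"
  by (rule frontier_Omega; simp add: Omega_def closure_Times)+

end

locale fe_problem = fe_mesh +
  fixes f :: "point \<Rightarrow> real \<Rightarrow> real" and C\<^sub>f L :: real
  assumes adm: "admissible_reaction f C\<^sub>f"
    and Lip: "\<And>p s t. p \<in> Omega \<Longrightarrow> \<bar>f p s - f p t\<bar> \<le> L * \<bar>s - t\<bar>" and L0: "L \<ge> 0"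
begin

definition fh :: "point \<Rightarrow> real" where "fh p = f p (u\<^sub>h p)"

text \<open>The growth bound of the reaction is available inside the square. On the boundary the
  discrete solution is zero, and boundedness of the reaction at zero suffices.\<close>

lemma fh_bounded: obtains B where "\<And>p. p \<in> closure Omega \<Longrightarrow> \<bar>fh p\<bar> \<le> B"
proof -
  obtain F where F: "\<And>p. p \<in> closure Omega \<Longrightarrow> \<bar>f p 0\<bar> \<le> F" "F \<ge> 0"
    "\<And>p s. p \<in> Omega \<Longrightarrow> \<bar>f p s\<bar> \<le> F + L * \<bar>s\<bar>"
    using reaction_bounded[OF adm Lip] by blast
  have "compact (closure Omega)" by (simp add: Omega_def closure_Times compact_Times)
  then have "bounded (u\<^sub>h ` closure Omega)"
    using FE by (intro compact_imp_bounded compact_continuous_image) (auto simp: FE_space_def)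
  then obtain C where C: "\<And>p. p \<in> closure Omega \<Longrightarrow> \<bar>u\<^sub>h p\<bar> \<le> C" unfolding bounded_iff by auto
  show ?thesis
  proof (rule that)
    fix p assume p: "p \<in> closure Omega"
    show "\<bar>fh p\<bar> \<le> F + L * C"
    proof (cases "p \<in> Omega")
      case True
      have "L * \<bar>u\<^sub>h p\<bar> \<le> L * C" using C[OF p] L0 by (rule mult_left_mono)
      then show ?thesis using F(3)[OF True, of "u\<^sub>h p"] by (simp add: fh_def)
    next
      case False
      have "C \<ge> 0" using C[OF p] by linarith
      then have "0 \<le> L * C" using L0 by simp
      then show ?thesis using F(1)[OF p] frontier_Omega[OF p False] by (simp add: fh_def)
    qed
  qed
qed

text \<open>Boundedness of \<open>fh\<close> on the closed element makes the supremum and infimum in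
  \<open>osc\<close> actual bounds.\<close>

lemma osc_bound:
  assumes T: "T \<in> \<T>" and pq: "p \<in> T" "q \<in> T"
  shows "\<bar>fh p - fh q\<bar> \<le> osc fh T"
proof -
  obtain B where B: "\<And>p. p \<in> closure Omega \<Longrightarrow> \<bar>fh p\<bar> \<le> B" using fh_bounded by blast
  have TO: "z \<in> closure Omega" if "z \<in> T" for z
    using UnT UnionI[OF T that] by (simp add: Omega_def closure_Times)
  have bd: "bdd_above (fh ` T)" "bdd_below (fh ` T)"
    using B[OF TO] by (auto simp: abs_le_iff intro!: bdd_aboveI2[where M=B] bdd_belowI2[where m="-B"]) (metis minus_le_iff)
  have "fh z \<le> Sup (fh ` T)" "Inf (fh ` T) \<le> fh z" if "z \<in> T" for z
    using that bd by (auto intro: cSup_upper cInf_lower)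
  from this[OF pq(1)] this[OF pq(2)] show ?thesis unfolding osc_def by linarith
qed

lemma osc_nonneg: "T \<in> \<T> \<Longrightarrow> osc fh T \<ge> 0"
  using osc_bound interior_nonempty interior_subset by (metis abs_ge_zero order_trans subsetD)

text \<open>Both elements are comparable with the patch of the common node, once for each of them;
  the factor 4 passes between height and short edge, or between longest edge and width.\<close>

lemma size_comparable:
  assumes S: "slab_triangle i j T p P q Q" "slab_triangle i' j' T' p' P' q' Q'"
    and z: "z \<in> vertices T" "z \<in> T'"
  shows "(q - p) + (Q - P) \<le> Kc * ((q' - p') + (Q' - P'))" "\<bar>x j - x i\<bar> \<le> Kc * \<bar>x j' - x i'\<bar>"
proof -
  note D = slab_triangleD[OF S(1)] and D' = slab_triangleD[OF S(2)]
  have zn: "z \<in> nodes \<T>" using z D(1) by (auto simp: nodes_def)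
  have zT: "z \<in> T" using z by (simp add: vertices_def extreme_point_of_def)
  note c = node_props[OF zn D(1) zT] and c' = node_props[OF zn D'(1) z(2)]
  have comb: "a \<le> Kc * b" if "a / 4 \<le> k" "k \<le> \<kappa> * w" "w \<le> \<kappa> * k'" "k' \<le> b" "b \<ge> 0" for a b k k' w
  proof -
    have "\<kappa> * w \<le> \<kappa> * (\<kappa> * k')" using that(3) \<kappa> by (intro mult_left_mono) auto
    also have "\<dots> \<le> \<kappa> * (\<kappa> * b)" using that(4) \<kappa> by (intro mult_left_mono) auto
    finally have "a \<le> 4 * \<kappa>\<^sup>2 * b" using that(1,2) by (simp add: power2_eq_square)
    also have "\<dots> \<le> Kc * b" using Kc(2) that(5) by (intro mult_right_mono)
    finally show ?thesis .
  qed
  show "(q - p) + (Q - P) \<le> Kc * ((q' - p') + (Q' - P'))"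
    by (rule comb[where k="h_tri T" and w="h_node \<T> z" and k'="h_tri T'"])
      (use D(15) c(2) c'(2) D'(8,16) in \<open>auto simp: comparable_def\<close>)
  have "\<bar>x j - x i\<bar> * 4 \<le> Kc * (4 * \<bar>x j' - x i'\<bar>)"
    by (rule comb[where k="H_tri T" and w="H_node \<T> z" and k'="H_tri T'"])
      (use D(13) c(3) c'(3) D'(14) in \<open>auto simp: comparable_def\<close>)
  then show "\<bar>x j - x i\<bar> \<le> Kc * \<bar>x j' - x i'\<bar>" by simp
qed

end

section \<open>Columns of the mesh as abstract stacks\<close>

context fe_problem
begin

text \<open>The reference value of the reaction on an element is its value at a vertex on the near
  line. Two elements sharing a node of that line can then be compared through this node, at the
  price of their two oscillations.\<close>

lemma column_side:
  assumes ij: "i \<le> n" "j \<le> n" "j = i + 1 \<or> i = j + 1"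
    and box: "l \<le> min (x i) (x j)" "max (x i) (x j) \<le> r" "0 \<le> l" "r \<le> 1"
    and hs: "half_strip (x j - x i) m N F"
    and rb: "residual_bound l r D P Q gradh fh \<epsilon> BG"
    and bij: "bij_betw t {..<m} (column i j)"
    and sl: "\<And>k. k < m \<Longrightarrow> slab_triangle i j (t k) (N k) (F k) (N (Suc k)) (F (Suc k))"
  shows "mesh_side (x i) (x j - x i) m N F l r D P Q gradh fh \<epsilon> BG
    (\<lambda>k. fst (element_grad (t k) u\<^sub>h)) (\<lambda>k. snd (element_grad (t k) u\<^sub>h)) (\<lambda>k. fh (x i, N k))
    (\<lambda>k. osc fh (t k)) (\<lambda>k. lambda_tri \<epsilon> (t k) * osc fh (t k)) Kc M"
proof -
  interpret half_strip "x i" "x j - x i" m N F by (rule hs)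
  interpret residual_bound l r D P Q gradh fh \<epsilon> BG by (rule rb)
  note S = slab_triangleD[OF sl]
  let ?g = "\<lambda>k. element_grad (t k) u\<^sub>h"
  have m0: "m > 0" using ends by (cases m) auto
  have ne: "x i \<noteq> x j" using x_inj[OF ij(1,2)] ij(3) by auto
  have "l \<le> x i" "l \<le> x j" "x i \<le> r" "x j \<le> r" using box(1,2) by linarith+
  then have x01: "0 \<le> x i" "x i \<le> 1" "0 \<le> x j" "x j \<le> 1" "x i \<noteq> x j"
    using box(3,4) ne by linarith+
  have tri: "tri k = t k" if "k < m" for k
  proof -
    have "tri k = wedge (x i) (x j - x i) (N k) (F k) (N (Suc k)) (F (Suc k))"
      unfolding tri_def wedge_def ell_def \<tau>_def by simp
    then show ?thesis using S(6)[OF that] by simp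
  qed
  have tri_int: "(a, y) \<in> interior (t k)" if "k < m" "0 < \<tau> a" "\<tau> a < 1" "ell k a < y" "y < ell (Suc k) a" for k a y
    using slab_interior[OF sl[OF that(1)], of a y] that unfolding ell_def \<tau>_def by simp
  have szW: "sz k = N (Suc k) - N k + (F (Suc k) - F k)" "W = \<bar>x j - x i\<bar>" for k
    by (simp_all add: sz_def W_def)
  have inn: "(u, v) \<bullet> (u', v') = u * u' + v * v'" for u v u' v' :: real by simp
  show ?thesis
  proof
    show "(a, y) \<in> D" if "0 < \<tau> a" "\<tau> a < 1" "0 < y" "y < 1" for a y
    proof -
      have "a \<in> {min (x i) (x j)<..<max (x i) (x j)}"
        using that(1,2) x01(5) unfolding \<tau>_def by (cases "x i < x j") (auto simp: field_simps)
      then show ?thesis using that(3,4) box unfolding D_def by auto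
    qed
    show "gradh (a, y) = (fst (?g k), snd (?g k))"
      if "k < m" "0 < \<tau> a" "\<tau> a < 1" "ell k a < y" "y < ell (Suc k) a" for k a y
      using gradh_interior[OF S(1)[OF that(1)] tri_int[OF that]] by simp
    show "\<bar>fh p - fh (x i, N k)\<bar> \<le> osc fh (t k)" if "k < m" "p \<in> tri k" "p \<in> D" for k p
      using osc_bound[OF S(1)[OF that(1)] _ S(17)[OF that(1)]] that(2) tri[OF that(1)] by simp
    show "fst (?g (Suc k)) - fst (?g k) = - slope (Suc k) * (snd (?g (Suc k)) - snd (?g k))" if k: "Suc k < m" for k
    proof -
      have k': "k < m" using k by simp
      let ?d = "(x j, F (Suc k)) - (x i, N (Suc k))"
      \<comment> \<open>Both element gradients reproduce the same difference of the discrete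
        solution along the common long edge.\<close>
      have "?g k \<bullet> ?d = ?g (Suc k) \<bullet> ?d"
        using element_diff[OF S(1)[OF k'] S(20)[OF k'] S(18)[OF k']] element_diff[OF S(1)[OF k] S(19)[OF k] S(17)[OF k]] by simp
      then have eq: "(fst (?g (Suc k)) - fst (?g k)) * (x j - x i) = - (F (Suc k) - N (Suc k)) * (snd (?g (Suc k)) - snd (?g k))"
        by (simp add: inner_prod_def algebra_simps)
      have gen: "A = - (e / dd) * B" if "A * dd = - e * B" "dd \<noteq> 0" for A B e dd :: real
        using that by (simp add: field_simps)
      show ?thesis unfolding slope_def by (rule gen[OF eq]) (use x01(5) in simp)
    qed
    show "fst (?g 0) = 0"
    proof -
      have "?g 0 \<bullet> ((x j, F 0) - (x i, N 0)) = 0"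
        using element_diff[OF S(1)[OF m0] S(19)[OF m0] S(17)[OF m0]] u_ends(1)[of "x i"] u_ends(1)[of "x j"] x01 ends by simp
      then show ?thesis using x01(5) ends by (simp add: inner_prod_def)
    qed
    show "fst (?g (m - 1)) = 0"
    proof -
      have k: "m - 1 < m" using m0 by simp
      have e: "N (Suc (m - 1)) = 1" "F (Suc (m - 1)) = 1" using ends m0 by simp_all
      have "?g (m - 1) \<bullet> ((x j, 1) - (x i, 1)) = 0"
        using element_diff[OF S(1)[OF k] S(20)[OF k] S(18)[OF k]] u_ends(2)[of "x i"] u_ends(2)[of "x j"] x01
        unfolding e by simp
      then show ?thesis using x01(5) by (simp add: inner_prod_def)
    qed
    show "Kc \<ge> 1" by (rule Kc(1))
    show "\<bar>F (Suc k) - N (Suc k)\<bar> \<le> Kc * sz k \<and> \<bar>F (Suc k) - N (Suc k)\<bar> \<le> Kc * sz (Suc k)" if k: "Suc k < m" for k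
      using S(11)[of k] S(10)[OF k] k unfolding szW by simp
    show "sz k \<le> 2 * W" if "k < m" for k using S(9)[OF that] unfolding szW .
    have vert: "(x i, y) \<in> vertices (t k) \<and> (x i, y) \<in> t k" if "k < m" "y = N k \<or> y = N (Suc k)" for k y
      using that(2) S(7)[OF that(1)] S(17,18)[OF that(1)] by auto
    show "sz k \<le> Kc * sz k'" if "k < m" "k' < m" "y = N k \<or> y = N (Suc k)" "y = N k' \<or> y = N (Suc k')" for k k' y
      using size_comparable(1)[OF sl[OF that(1)] sl[OF that(2)]] vert[OF that(1,3)] vert[OF that(2,4)] unfolding szW by blast
    show "\<bar>fh (x i, N k) - fh (x i, N k')\<bar> \<le> osc fh (t k) + osc fh (t k')"
      if "k < m" "k' < m" "y = N k \<or> y = N (Suc k)" "y = N k' \<or> y = N (Suc k')" for k k' y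
      using osc_bound[OF S(1)[OF that(1)] S(17)[OF that(1)], of "(x i, y)"] osc_bound[OF S(1)[OF that(2)] S(17)[OF that(2)], of "(x i, y)"]
        vert[OF that(1,3)] vert[OF that(2,4)] by linarith
    show "osc fh (t k) \<ge> 0" if "k < m" for k by (rule osc_nonneg[OF S(1)[OF that]])
    show "s / \<epsilon> * osc fh (t k) \<le> lambda_tri \<epsilon> (t k) * osc fh (t k)" if "k < m" "0 \<le> s" "s \<le> \<epsilon>" "s \<le> W" for k s
    proof (rule mult_right_mono[OF _ osc_nonneg[OF S(1)[OF that(1)]]])
      have "s \<le> H_tri (t k)" using that(4) S(13)[OF that(1)] unfolding szW by linarith
      then show "s / \<epsilon> \<le> lambda_tri \<epsilon> (t k)" using that eps by (simp add: lambda_tri_def divide_right_mono)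
    qed
    show "card {k. Suc k < m \<and> N (Suc k) = y} \<le> M" for y
    proof (cases "{k. Suc k < m \<and> N (Suc k) = y} = {}")
      case False
      then obtain k where "Suc k < m" "N (Suc k) = y" by auto
      then have z: "(x i, y) \<in> nodes \<T>" using S(1,7)[of k] unfolding nodes_def by auto
      \<comment> \<open>Different indices belong to different elements, and each of these elements
        contains the node.\<close>
      have "card {k. Suc k < m \<and> N (Suc k) = y} \<le> card (elements_at \<T> (x i, y))"
      proof (rule card_inj_on_le)
        show "inj_on t {k. Suc k < m \<and> N (Suc k) = y}"
          using bij by (auto simp: bij_betw_def inj_on_def)
        show "t ` {k. Suc k < m \<and> N (Suc k) = y} \<subseteq> elements_at \<T> (x i, y)"
          using S(1,18) unfolding elements_at_def by auto
        show "finite (elements_at \<T> (x i, y))" using finT by (simp add: elements_at_def)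
      qed
      also have "\<dots> \<le> M" using psm z unfolding partially_structured_mesh_def standing_mesh_assumptions_def by blast
      finally show ?thesis .
    qed (metis card.empty le0)
  qed
qed

text \<open>The midpoint of the short edge is an inner point of the edges of both elements on the
  line, so conformity carries the ends of each edge into the other element.\<close>

lemma column_edge_shared:
  assumes s: "slab_triangle i j T p P q Q" "slab_triangle i j' T' p' P' q' Q'" and pq: "p < q"
    and z: "(x i, (p + q) / 2) \<in> T'"
  shows "p' = p" "q' = q"
proof -
  note D = slab_triangleD[OF s(1)] and D' = slab_triangleD[OF s(2)]
  have mid: "(x i, (a + b) / 2) \<in> open_segment (x i, a) (x i, b)" if "a < b" for a b :: real
  proof -
    have "(x i, (a + b) / 2) = midpoint (x i, a) (x i, b)" by (simp add: midpoint_def field_simps)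
    then show ?thesis using that by (simp only: midpoint_in_open_segment) simp
  qed
  have "(x i, p) \<in> T'" "(x i, q) \<in> T'"
    using shared[OF D(1) D'(1) D(17,18) mid[OF pq] z] by blast+
  then have le: "p' \<le> p" "q \<le> q'" using slab_ends(1)[OF s(2)] by auto
  have "(x i, (p + q) / 2) \<in> open_segment (x i, p') (x i, q')"
  proof -
    define u where "u = ((p + q) / 2 - p') / (q' - p')"
    have u: "0 < u" "u < 1" using le pq by (auto simp: u_def field_simps)
    have "u * (q' - p') = (p + q) / 2 - p'" using le pq by (simp add: u_def)
    then have "(x i, (p + q) / 2) = (1 - u) *\<^sub>R (x i, p') + u *\<^sub>R (x i, q')" by (simp add: field_simps)
    then show ?thesis using u le pq unfolding in_segment by auto
  qed
  moreover have "(x i, (p + q) / 2) \<in> T" using slab_ends(1)[OF s(1)] pq by auto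
  ultimately have "(x i, p') \<in> T" "(x i, q') \<in> T"
    using shared[OF D'(1) D(1) D'(17,18)] by blast+
  then show "p' = p" "q' = q" using le slab_ends(1)[OF s(1)] by auto
qed

lemma columns_match:
  assumes hs: "half_strip (x j' - x i) m' N' F'" and i: "0 < i" "i < n"
    and sl: "\<And>k. k < m' \<Longrightarrow> slab_triangle i j' (t' k) (N' k) (F' k) (N' (Suc k)) (F' (Suc k))"
    and T: "slab_triangle i j T p P q Q" "p < q"
  obtains k where "k < m'" "N' k = p" "N' (Suc k) = q"
proof -
  interpret half_strip "x i" "x j' - x i" m' N' F' by (rule hs)
  have y: "0 \<le> (p + q) / 2" "(p + q) / 2 \<le> 1"
    using in_unit_square[OF slab_triangleD(1,17)[OF T(1)]] in_unit_square[OF slab_triangleD(1,18)[OF T(1)]] by auto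
  have "0 \<le> \<tau> (x i)" "\<tau> (x i) \<le> 1" by (auto simp: \<tau>_def)
  then obtain k where k: "k < m'" "(x i, (p + q) / 2) \<in> tri k" using tri_cover y by metis
  have "tri k = t' k"
    unfolding slab_triangleD(6)[OF sl[OF k(1)]] tri_def wedge_def ell_def \<tau>_def by simp
  then show ?thesis using column_edge_shared[OF T(1) sl[OF k(1)] T(2)] k by (intro that) auto
qed

end

section \<open>Edges on a mesh line, their normals and element areas\<close>

context psm
begin

lemma element_edges:
  assumes "T \<in> \<T>"
  shows "S edge_of T \<longleftrightarrow> (\<exists>a b. a \<in> vertices T \<and> b \<in> vertices T \<and> a \<noteq> b \<and> S = closed_segment a b)"
proof -
  obtain a b c where abc: "T = convex hull {a, b, c}" "\<not> affine_dependent {a, b, c}" "a \<noteq> b" "a \<noteq> c" "b \<noteq> c"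
    using two_simplex[OF simplexT[OF assms]] by blast
  note E = triangle_edges[OF abc(2-5), folded abc(1)]
  show ?thesis
    unfolding E insert_iff empty_iff
    using abc(3-5) closed_segment_commute[of a b] closed_segment_commute[of a c] closed_segment_commute[of b c]
    by blast
qed

lemma vertical_edge:
  assumes s: "slab_triangle i j T p P q Q"
  shows "S edge_of T \<and> S \<subseteq> vline (x i) \<longleftrightarrow> p < q \<and> S = closed_segment (x i, p) (x i, q)"
proof
  note D = slab_triangleD[OF s]
  assume S: "S edge_of T \<and> S \<subseteq> vline (x i)"
  then obtain a b where ab: "a \<in> vertices T" "b \<in> vertices T" "a \<noteq> b" "S = closed_segment a b"
    using element_edges[OF D(1)] by blast
  then have "a \<in> vline (x i)" "b \<in> vline (x i)" using S by auto
  then have "fst a = x i" "fst b = x i" by (auto simp: vline_def)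
  moreover have "v = (x i, p) \<or> v = (x i, q)" if "v \<in> vertices T" "fst v = x i" for v
  proof -
    have "v \<in> {(x i, p), (x i, q), (x j, P), (x j, Q)}" using that(1) unfolding D(7) .
    moreover have "v \<noteq> (x j, P)" "v \<noteq> (x j, Q)" using that(2) D(5) by force+
    ultimately show ?thesis by blast
  qed
  ultimately have "a = (x i, p) \<or> a = (x i, q)" "b = (x i, p) \<or> b = (x i, q)" using ab(1,2) by blast+
  then show "p < q \<and> S = closed_segment (x i, p) (x i, q)"
    using ab(3,4) D(8) closed_segment_commute[of "(x i, p)" "(x i, q)"] by (metis order_less_irrefl)
next
  note D = slab_triangleD[OF s]
  assume S: "p < q \<and> S = closed_segment (x i, p) (x i, q)"
  then have "S edge_of T" unfolding element_edges[OF D(1)] D(7)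
    by (intro exI[of _ "(x i, p)"] exI[of _ "(x i, q)"]) auto
  moreover have "closed_segment (x i, p) (x i, q) \<subseteq> vline (x i)"
    by (auto simp: closed_segment_def vline_def algebra_simps)
  ultimately show "S edge_of T \<and> S \<subseteq> vline (x i)" using S by blast
qed

text \<open>The normal form of the element may mention its two lines in either order; it is flipped
  when the given line is the second one.\<close>

lemma vertical_edge_element:
  assumes T: "T \<in> \<T>" and S: "S edge_of T" "S \<subseteq> vline (x i)" and i: "i \<le> n"
  obtains j p P q Q where "slab_triangle i j T p P q Q" "p < q" "S = closed_segment (x i, p) (x i, q)"
proof -
  obtain i0 j0 p P q Q where s: "slab_triangle i0 j0 T p P q Q" by (rule mesh_slab_triangle[OF T])
  obtain a b where ab: "a \<in> vertices T" "S = closed_segment a b"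
    using element_edges[OF T] S(1) by blast
  then have "fst a = x i" using S(2) by (auto simp: vline_def)
  moreover have "fst a = x i0 \<or> fst a = x j0" using ab(1) unfolding slab_triangleD(7)[OF s] by auto
  ultimately have "x i = x i0 \<or> x i = x j0" by simp
  then have "i = i0 \<or> i = j0" using x_inj[OF i] slab_triangleD(2,3)[OF s] by blast
  then obtain j p P q Q where s': "slab_triangle i j T p P q Q" using s slab_triangle_flip[OF s] by blast
  have "p < q \<and> S = closed_segment (x i, p) (x i, q)" using vertical_edge[OF s', of S] S by (simp only: simp_thms)
  then show ?thesis using that[OF s'] by (simp only: simp_thms)
qed

text \<open>Orthogonality to the edge leaves two horizontal unit vectors, and a vertex on the other
  line selects the sign.\<close>

lemma outward_normal_vertical:
  assumes s: "slab_triangle i j T p P q Q" and pq: "p < q"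
  shows "outward_normal T (closed_segment (x i, p) (x i, q)) = (- sgn (x j - x i), 0)"
  unfolding outward_normal_def
proof (rule the_equality)
  note D = slab_triangleD[OF s]
  let ?S = "closed_segment (x i, p) (x i, q)"
  have fS: "fst z = x i" if "z \<in> ?S" for z
  proof -
    have "?S \<subseteq> vline (x i)" using vertical_edge[OF s, of ?S] pq by (simp only: simp_thms)
    then show ?thesis using that by (auto simp: vline_def)
  qed
  have dir: "sgn (x j - x i) * (fst z - x i) \<ge> 0" if "z \<in> T" for z
  proof -
    have "0 \<le> (fst z - x i) / (x j - x i)" using that D(6) by (auto simp: wedge_def)
    then show ?thesis using D(5) by (auto simp: sgn_if zero_le_divide_iff)
  qed
  have inn: "v \<bullet> w = fst v * fst w + snd v * snd w" for v w :: point by (simp add: inner_prod_def)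
  show "norm (- sgn (x j - x i), 0::real) = 1 \<and>
    (\<forall>z\<in>?S. \<forall>w\<in>?S. (- sgn (x j - x i), 0) \<bullet> (z - w) = 0) \<and> (\<forall>z\<in>T. \<forall>w\<in>?S. (- sgn (x j - x i), 0) \<bullet> (z - w) \<le> 0)"
  proof (intro conjI ballI)
    show "norm (- sgn (x j - x i), 0::real) = 1" using D(5) by (simp add: norm_prod_def sgn_if)
    show "(- sgn (x j - x i), 0) \<bullet> (z - w) = 0" if "z \<in> ?S" "w \<in> ?S" for z w
      unfolding inn fst_diff using fS[OF that(1)] fS[OF that(2)] by simp
    show "(- sgn (x j - x i), 0) \<bullet> (z - w) \<le> 0" if "z \<in> T" "w \<in> ?S" for z w
      unfolding inn fst_diff using fS[OF that(2)] dir[OF that(1)] by simp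
  qed
  fix \<nu> :: point
  assume \<nu>: "norm \<nu> = 1 \<and> (\<forall>z\<in>?S. \<forall>w\<in>?S. \<nu> \<bullet> (z - w) = 0) \<and> (\<forall>z\<in>T. \<forall>w\<in>?S. \<nu> \<bullet> (z - w) \<le> 0)"
  have e: "(x i, p) \<in> ?S" "(x i, q) \<in> ?S" by auto
  have "\<nu> \<bullet> ((x i, q) - (x i, p)) = 0" using \<nu> e by blast
  then have b: "snd \<nu> = 0" using pq by (simp add: inn)
  have a: "\<bar>fst \<nu>\<bar> = 1" using \<nu> b by (simp add: norm_prod_def)
  have "\<nu> \<bullet> ((x j, P) - (x i, p)) \<le> 0" using \<nu> e D(19) by blast
  then have "fst \<nu> * (x j - x i) \<le> 0" using b by (simp add: inn)
  then have "fst \<nu> = - sgn (x j - x i)" using a D(5) by (cases "x j > x i") (auto simp: abs_if mult_le_0_iff split: if_splits)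
  then show "\<nu> = (- sgn (x j - x i), 0)" using b by (simp add: prod_eq_iff)
qed

lemma interior_slab:
  assumes s: "slab_triangle i j T p P q Q"
  shows "interior T \<subseteq> {min (x i) (x j)<..<max (x i) (x j)} \<times> {0<..<1}"
proof -
  have "T \<subseteq> {min (x i) (x j)..max (x i) (x j)} \<times> {0..1}"
    using slab_range[OF s] in_unit_square[OF slab_triangleD(1)[OF s]] by (auto simp: mem_Times_iff)
  then have "interior T \<subseteq> interior ({min (x i) (x j)..max (x i) (x j)} \<times> {0..1})" by (rule interior_mono)
  then show ?thesis by (simp add: interior_Times)
qed

text \<open>The trace of an element on the line determines its two heights there, so any description
  of the element agrees with its place in the stack.\<close>

lemma column_index:
  assumes bij: "bij_betw t {..<m::nat} (column i j)"
    and sl: "\<And>k. k < m \<Longrightarrow> slab_triangle i j (t k) (N k) (F k) (N (Suc k)) (F (Suc k))"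
    and s: "slab_triangle i j T p P q Q"
  obtains k where "k < m" "t k = T" "N k = p" "N (Suc k) = q"
proof -
  have "T \<in> column i j" using s by (auto simp: column_def)
  then have "T \<in> t ` {..<m}" using bij by (simp add: bij_betw_def)
  then obtain k where k: "k < m" "t k = T" by (metis imageE lessThan_iff)
  have e: "p \<le> y \<and> y \<le> q \<longleftrightarrow> N k \<le> y \<and> y \<le> N (Suc k)" for y
    using slab_ends(1)[OF s] slab_ends(1)[OF sl[OF k(1)]] k(2) by simp
  have "p \<le> q" "N k \<le> N (Suc k)" using slab_triangleD(8)[OF s] slab_triangleD(8)[OF sl[OF k(1)]] by auto
  then have "N k = p" "N (Suc k) = q" using e[of p] e[of q] e[of "N k"] e[of "N (Suc k)"] by auto
  then show ?thesis using k that by blast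
qed

lemma area_interior: "T \<in> \<T> \<Longrightarrow> measure lborel (interior T) = area T"
  using measure_interior[of T] negligible_convex_frontier[OF T_convex] T_closed[of T]
  by (simp add: compact_imp_bounded borel_closed compact_imp_closed)

end

section \<open>Summation of the oscillation terms\<close>

context fe_problem
begin

lemma osc_sum_le:
  assumes sub: "\<S> \<subseteq> \<T>" "\<And>T. T \<in> \<S> \<Longrightarrow> interior T \<subseteq> D" and D: "D \<in> sets borel" "bounded D"
  shows "(\<Sum>T\<in>\<S>. area T * (lambda_tri \<epsilon> T * osc fh T)\<^sup>2) \<le> (L2_norm D (osc_function \<epsilon> \<T> fh))\<^sup>2"
proof -
  let ?o = "osc_function \<epsilon> \<T> fh"
  have finS: "finite \<S>" using finite_subset[OF sub(1) finT] .
  have val: "?o p = lambda_tri \<epsilon> T * osc fh T" if T: "T \<in> \<T>" "p \<in> interior T" for p T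
  proof -
    have "?o p = (\<Sum>T'\<in>\<T>. if T' = T then lambda_tri \<epsilon> T' * osc fh T' else 0)"
      unfolding osc_function_def
    proof (rule sum.cong[OF refl])
      fix T' assume T': "T' \<in> \<T>"
      have "p \<in> interior T' \<longleftrightarrow> T' = T" using interior_disjoint[OF T' T(1) _ T(2)] T(2) by blast
      then show "lambda_tri \<epsilon> T' * osc fh T' * indicator (interior T') p = (if T' = T then lambda_tri \<epsilon> T' * osc fh T' else 0)"
        by (simp add: indicator_def)
    qed
    then show ?thesis using finT T by simp
  qed
  have [measurable]: "interior T \<in> sets borel" for T :: "point set" by simp
  have meas: "?o \<in> borel_measurable borel" unfolding osc_function_def by measurable
  have bound: "\<bar>?o p\<bar> \<le> (\<Sum>T\<in>\<T>. \<bar>lambda_tri \<epsilon> T * osc fh T\<bar>)" for p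
    unfolding osc_function_def by (rule order_trans[OF sum_abs sum_mono]) (auto simp: indicator_def abs_mult)
  have iD: "set_integrable lborel D (\<lambda>p. (norm (?o p))\<^sup>2)"
  proof (rule set_integrable_bounded[OF set_borel_measurable_borel])
    show "(\<lambda>p. (norm (?o p))\<^sup>2) \<in> borel_measurable borel" using meas by measurable
    show "norm ((norm (?o p))\<^sup>2) \<le> (\<Sum>T\<in>\<T>. \<bar>lambda_tri \<epsilon> T * osc fh T\<bar>)\<^sup>2" for p
      using power_mono[OF bound, of p 2] by simp
  qed (use D in auto)
  have "(\<Sum>T\<in>\<S>. area T * (lambda_tri \<epsilon> T * osc fh T)\<^sup>2) = (\<Sum>T\<in>\<S>. LINT p:interior T|lborel. (norm (?o p))\<^sup>2)"
  proof (rule sum.cong[OF refl])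
    fix T assume "T \<in> \<S>"
    then have T: "T \<in> \<T>" using sub by blast
    have "(LINT p:interior T|lborel. (norm (?o p))\<^sup>2) = (LINT p:interior T|lborel. (lambda_tri \<epsilon> T * osc fh T)\<^sup>2)"
      by (rule set_lebesgue_integral_cong) (auto simp: val[OF T])
    also have "\<dots> = area (interior T) * (lambda_tri \<epsilon> T * osc fh T)\<^sup>2"
      by (simp add: set_lebesgue_integral_def)
    finally show "area T * (lambda_tri \<epsilon> T * osc fh T)\<^sup>2 = (LINT p:interior T|lborel. (norm (?o p))\<^sup>2)"
      using area_interior[OF T] by simp
  qed
  also have "\<dots> = (LINT p:(\<Union>T\<in>\<S>. interior T)|lborel. (norm (?o p))\<^sup>2)"
  proof (rule set_integral_finite_Union[symmetric, OF finS])
    show "disjoint_family_on interior \<S>"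
      unfolding disjoint_family_on_def
    proof (intro ballI impI)
      fix S T assume "S \<in> \<S>" "T \<in> \<S>" "S \<noteq> T"
      then show "interior S \<inter> interior T = {}" using interior_disjoint[of S T] sub(1) by blast
    qed
    show "set_integrable lborel (interior T) (\<lambda>p. (norm (?o p))\<^sup>2)" if "T \<in> \<S>" for T
      by (rule set_integrable_subset[OF iD]) (use sub(2)[OF that] in auto)
  qed auto
  also have "\<dots> \<le> (LINT p:D|lborel. (norm (?o p))\<^sup>2)"
    by (rule set_LINT_mono_subset[OF iD]) (use sub(2) in \<open>auto intro!: borel_open\<close>)
  also have "\<dots> = (L2_norm D ?o)\<^sup>2" by (rule L2_norm_sq[symmetric])
  finally show ?thesis .
qed

text \<open>The area of an element is half of its width times its short edge, whence the factor
  2.\<close>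

lemma column_osc_sum:
  assumes bij: "bij_betw t {..<m::nat} (column i j)"
    and sl: "\<And>k. k < m \<Longrightarrow> slab_triangle i j (t k) (N k) (F k) (N (Suc k)) (F (Suc k))"
    and D: "{min (x i) (x j)<..<max (x i) (x j)} \<times> {0<..<1} \<subseteq> D" "D \<in> sets borel" "bounded D"
  shows "(\<Sum>k<m. \<bar>x j - x i\<bar> * ((N (Suc k) - N k) + (F (Suc k) - F k)) * (lambda_tri \<epsilon> (t k) * osc fh (t k))\<^sup>2)
    \<le> 2 * (L2_norm D (osc_function \<epsilon> \<T> fh))\<^sup>2"
proof -
  have "(\<Sum>k<m. \<bar>x j - x i\<bar> * ((N (Suc k) - N k) + (F (Suc k) - F k)) * (lambda_tri \<epsilon> (t k) * osc fh (t k))\<^sup>2)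
    = 2 * (\<Sum>k<m. area (t k) * (lambda_tri \<epsilon> (t k) * osc fh (t k))\<^sup>2)"
    unfolding sum_distrib_left
  proof (rule sum.cong[OF refl])
    fix k assume "k \<in> {..<m}"
    then have "k < m" by simp
    from slab_triangleD(12)[OF sl[OF this]]
    show "\<bar>x j - x i\<bar> * ((N (Suc k) - N k) + (F (Suc k) - F k)) * (lambda_tri \<epsilon> (t k) * osc fh (t k))\<^sup>2
      = 2 * (area (t k) * (lambda_tri \<epsilon> (t k) * osc fh (t k))\<^sup>2)" by simp
  qed
  also have "(\<Sum>k<m. area (t k) * (lambda_tri \<epsilon> (t k) * osc fh (t k))\<^sup>2)
    = (\<Sum>T\<in>column i j. area T * (lambda_tri \<epsilon> T * osc fh T)\<^sup>2)"
    using bij by (rule sum.reindex_bij_betw)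
  also have "\<dots> \<le> (L2_norm D (osc_function \<epsilon> \<T> fh))\<^sup>2"
  proof (rule osc_sum_le)
    show "column i j \<subseteq> \<T>" by (auto simp: column_def dest: slab_triangleD)
    show "interior T \<subseteq> D" if "T \<in> column i j" for T
      using that interior_slab D(1) unfolding column_def by blast
  qed (use D in auto)
  finally show ?thesis by simp
qed

end

text \<open>Comparable column widths bound the area of the edge patch by K times the smaller width
  times the edge; the remaining 2 K undoes the division in the width of the test function.\<close>

lemma min_weight_le:
  fixes \<epsilon> s A K WR WL :: real
  assumes "\<epsilon> > 0" "s > 0" "K \<ge> 1" "A \<le> (WR + WL) / 2 * s" "WR \<le> K * WL" "WL \<le> K * WR" "WR > 0" "WL > 0"
  shows "min (\<epsilon> * s) A \<le> 2 * K\<^sup>2 * (min \<epsilon> (min WR WL) / (2 * K) * s)"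
proof -
  define w where "w = min WR WL"
  have w: "w > 0" using assms by (simp add: w_def)
  have "w \<le> K * w" using w assms(3) by simp
  then have "(WR + WL) / 2 \<le> K * w" using assms(5,6) unfolding w_def min_def by (auto split: if_splits)
  then have A: "A \<le> K * w * s" using assms(2,4) by (meson mult_right_mono less_imp_le order_trans)
  have "min (\<epsilon> * s) A \<le> K * min \<epsilon> w * s"
  proof (cases "\<epsilon> \<le> w")
    case True
    have "1 * (\<epsilon> * s) \<le> K * (\<epsilon> * s)" using assms by (intro mult_right_mono) auto
    then show ?thesis using True by (auto simp: min_def mult.assoc)
  next
    case False
    then show ?thesis using A by (auto simp: min_def)
  qed
  also have "\<dots> = 2 * K\<^sup>2 * (min \<epsilon> w / (2 * K) * s)" using assms(3) by (simp add: power2_eq_square)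
  finally show ?thesis unfolding w_def .
qed

section \<open>The jump estimate\<close>

context fe_problem
begin

text \<open>Transfers \<open>two_sides.main_estimate\<close> from indices to mesh edges: the edges
  on the line correspond to the short edges of the right column, each lying on exactly two elements,
  and its weight is bounded by that of the test function.\<close>

theorem jump_estimate:
  fixes i :: nat and \<epsilon> :: real and u :: "point \<Rightarrow> real"
  assumes i: "1 \<le> i" "i \<le> n - 1" and wsol: "weak_solution \<epsilon> f u" and eps: "0 < \<epsilon>" "C\<^sub>f + \<epsilon>\<^sup>2 \<ge> 1"
  shows "(\<Sum>S\<in>{S \<in> edges \<T>. S \<subseteq> vline (x i)}.
      min (\<epsilon> * diameter S) (area (edge_patch \<T> S)) * (\<epsilon> * normal_jump \<T> u\<^sub>h S)\<^sup>2)
    \<le> 2 * Kc\<^sup>2 * (\<bar>two_sides.C2 Kc M\<bar> * (5 + 4 * L\<^sup>2)) *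
      ((energy_norm \<epsilon> C\<^sub>f (strip x i) (\<lambda>p. u\<^sub>h p - u p))\<^sup>2 + (L2_norm (strip x i) (osc_function \<epsilon> \<T> fh))\<^sup>2)"
proof -
  define l where "l = x (i - 1)"
  define r where "r = x (i + 1)"
  define D where "D = strip x i"
  define E where "E = energy_norm \<epsilon> C\<^sub>f D (\<lambda>p. u\<^sub>h p - u p)"
  define O' where "O' = L2_norm D (osc_function \<epsilon> \<T> fh)"
  have n: "i < n" "i \<le> n" "i + 1 \<le> n" "i - 1 \<le> n" "i = (i - 1) + 1" using i by auto
  have xs: "l < x i" "x i < r" unfolding l_def r_def using n by (auto intro!: x_mono)
  have "0 \<le> l" unfolding l_def using x_mono[of 0 "i - 1"] x_ends n by (cases "i - 1 = 0") auto
  moreover have "r \<le> 1" unfolding r_def using x_mono[of "i + 1" n] x_ends n by (cases "i + 1 = n") auto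
  ultimately have box: "0 \<le> l" "l < r" "r \<le> 1" using xs by auto
  have D: "D = {l<..<r} \<times> {0<..<1}" by (simp add: D_def strip_def l_def r_def)
  have DO: "D \<subseteq> Omega" "D \<in> sets borel" "bounded D"
    using box by (auto simp: D Omega_def intro!: borel_open open_Times bounded_Times)
  define BG where "BG = (\<Sum>T\<in>\<T>. norm (element_grad T u\<^sub>h))"
  interpret bg: broken_gradient l r 0 1 D u\<^sub>h gradh "\<Union>(interior ` \<T>)" BG
    unfolding BG_def by (rule gradh_broken[OF D box])
  obtain P Q :: "point \<Rightarrow> real" where PQ: "set_integrable lborel D P" "set_integrable lborel D Q"
    "set_integrable lborel D (\<lambda>p. (P p)\<^sup>2)" "set_integrable lborel D (\<lambda>p. (Q p)\<^sup>2)"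
    "\<And>p. P p \<ge> 0" "\<And>p. Q p \<ge> 0"
    and PE: "(LINT p:D|lborel. (P p)\<^sup>2) \<le> E\<^sup>2" "(LINT p:D|lborel. (Q p)\<^sup>2) \<le> 4 * L\<^sup>2 * E\<^sup>2"
    and res: "\<And>\<phi>. test_function D \<phi> \<Longrightarrow>
      \<bar>\<epsilon>\<^sup>2 * (LINT p:D|lborel. gradh p \<bullet> grad \<phi> p) + (LINT p:D|lborel. f p (u\<^sub>h p) * \<phi> p)\<bar>
        \<le> (LINT p:D|lborel. \<epsilon> * P p * norm (grad \<phi> p) + Q p * \<bar>\<phi> p\<bar>)"
  proof (rule bg.error_residual[OF wsol adm Lip L0 eps box(1,3) refl refl])
    show "u\<^sub>h (a, 0) = 0" if "a \<in> {l<..<r}" for a using that box by (intro u_ends(1)) auto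
  qed (auto simp: E_def)
  have rb: "residual_bound l r D P Q gradh fh \<epsilon> BG"
  proof
    show "set_integrable lborel D fh"
      unfolding fh_def by (rule reaction_integrable[OF adm Lip DO(1,2) bg.v_L2 L0])
    show "\<bar>\<epsilon>\<^sup>2 * (LINT p:D|lborel. gradh p \<bullet> grad \<phi> p) + (LINT p:D|lborel. fh p * \<phi> p)\<bar>
        \<le> (LINT p:D|lborel. \<epsilon> * P p * norm (grad \<phi> p) + Q p * \<bar>\<phi> p\<bar>)" if "test_function D \<phi>" for \<phi>
      using res[OF that] by (simp add: fh_def)
  qed (use D box eps PQ bg.meas bg.bound in auto)
  have adjR: "i + 1 = i + 1 \<or> i = (i + 1) + 1" and adjL: "i - 1 = i + 1 \<or> i = (i - 1) + 1" using n by auto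
  obtain mR tR NR FR where hsR: "half_strip (x (i + 1) - x i) mR NR FR" and bijR: "bij_betw tR {..<mR} (column i (i + 1))"
    and slR: "\<And>k. k < mR \<Longrightarrow> slab_triangle i (i + 1) (tR k) (NR k) (FR k) (NR (Suc k)) (FR (Suc k))" and "mR > 0"
    by (rule column_ordered[OF n(2,3) adjR]) (rule that)
  obtain mL tL NL FL where hsL: "half_strip (x (i - 1) - x i) mL NL FL" and bijL: "bij_betw tL {..<mL} (column i (i - 1))"
    and slL: "\<And>k. k < mL \<Longrightarrow> slab_triangle i (i - 1) (tL k) (NL k) (FL k) (NL (Suc k)) (FL (Suc k))" and "mL > 0"
    by (rule column_ordered[OF n(2,4) adjL]) (rule that)
  let ?aR = "\<lambda>k. fst (element_grad (tR k) u\<^sub>h)" and ?bR = "\<lambda>k. snd (element_grad (tR k) u\<^sub>h)"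
    and ?aL = "\<lambda>k. fst (element_grad (tL k) u\<^sub>h)" and ?bL = "\<lambda>k. snd (element_grad (tL k) u\<^sub>h)"
  have bx: "l \<le> min (x i) (x (i + 1))" "max (x i) (x (i + 1)) \<le> r" "l \<le> min (x i) (x (i - 1))" "max (x i) (x (i - 1)) \<le> r"
    using xs unfolding l_def[symmetric] r_def[symmetric] by auto
  interpret R: mesh_side "x i" "x (i + 1) - x i" mR NR FR l r D P Q gradh fh \<epsilon> BG ?aR ?bR "\<lambda>k. fh (x i, NR k)"
    "\<lambda>k. osc fh (tR k)" "\<lambda>k. lambda_tri \<epsilon> (tR k) * osc fh (tR k)" Kc M
    by (rule column_side[OF n(2,3) adjR bx(1,2) box(1,3) hsR rb bijR slR])
  interpret L: mesh_side "x i" "x (i - 1) - x i" mL NL FL l r D P Q gradh fh \<epsilon> BG ?aL ?bL "\<lambda>k. fh (x i, NL k)"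
    "\<lambda>k. osc fh (tL k)" "\<lambda>k. lambda_tri \<epsilon> (tL k) * osc fh (tL k)" Kc M
    by (rule column_side[OF n(2,4) adjL bx(3,4) box(1,3) hsL rb bijL slL])
  have i0: "0 < i" using i by simp
  interpret T: two_sides "x i" "x (i + 1) - x i" mR NR FR l r D P Q gradh fh \<epsilon> BG ?aR ?bR "\<lambda>k. fh (x i, NR k)"
    "\<lambda>k. osc fh (tR k)" "\<lambda>k. lambda_tri \<epsilon> (tR k) * osc fh (tR k)" Kc M
    "x (i - 1) - x i" mL NL FL ?aL ?bL "\<lambda>k. fh (x i, NL k)" "\<lambda>k. osc fh (tL k)" "\<lambda>k. lambda_tri \<epsilon> (tL k) * osc fh (tL k)"
  proof
    show "0 < x (i + 1) - x i" "x (i - 1) - x i < 0" using xs by (auto simp: l_def r_def)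
    show "(\<lambda>k. (NR k, NR (Suc k))) ` R.Eg = (\<lambda>k. (NL k, NL (Suc k))) ` L.Eg"
    proof (intro equalityI image_subsetI)
      fix k assume "k \<in> R.Eg"
      then have k: "k < mR" "NR k < NR (Suc k)" by (simp_all add: R.Eg_def)
      obtain k' where k': "k' < mL" "NL k' = NR k" "NL (Suc k') = NR (Suc k)"
        by (rule columns_match[OF hsL i0 n(1) slL slR[OF k(1)] k(2)])
      then have "k' \<in> L.Eg" using k by (simp add: L.Eg_def)
      then show "(NR k, NR (Suc k)) \<in> (\<lambda>k. (NL k, NL (Suc k))) ` L.Eg"
        by (rule rev_image_eqI) (simp add: k')
    next
      fix k assume "k \<in> L.Eg"
      then have k: "k < mL" "NL k < NL (Suc k)" by (simp_all add: L.Eg_def)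
      obtain k' where k': "k' < mR" "NR k' = NL k" "NR (Suc k') = NL (Suc k)"
        by (rule columns_match[OF hsR i0 n(1) slR slL[OF k(1)] k(2)])
      then have "k' \<in> R.Eg" using k by (simp add: R.Eg_def)
      then show "(NL k, NL (Suc k)) \<in> (\<lambda>k. (NR k, NR (Suc k))) ` R.Eg"
        by (rule rev_image_eqI) (simp add: k')
    qed
  qed
  define seg where "seg k = closed_segment (x i, NR k) (x i, NR (Suc k))" for k
  have seg_eq: "p = NR k \<and> q = NR (Suc k)" if "closed_segment (x i, p) (x i, q) = seg k" "p < q" "NR k < NR (Suc k)" for p q k
  proof -
    have "{(x i, p), (x i, q)} = {(x i, NR k), (x i, NR (Suc k))}" using that(1) unfolding seg_def closed_segment_eq .
    then have "(p = NR k \<and> q = NR (Suc k)) \<or> (p = NR (Suc k) \<and> q = NR k)" unfolding doubleton_eq_iff by simp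
    then show ?thesis using that(2,3) by linarith
  qed
  have injN: "k = k'" if "k \<in> R.Eg" "k' \<in> R.Eg" "NR k = NR k'" for k k'
    using R.Eg_ordered[OF that(1,2)] that by (force simp: R.Eg_def)
  have injL: "k = k'" if "k \<in> L.Eg" "k' \<in> L.Eg" "NL k = NL k'" for k k'
    using L.Eg_ordered[OF that(1,2)] that by (force simp: L.Eg_def)
  have RD: "k < mR" "NR k < NR (Suc k)" "T.lam k < mL" "NL (T.lam k) = NR k" "NL (Suc (T.lam k)) = NR (Suc k)"
    "NL (T.lam k) < NL (Suc (T.lam k))" if "k \<in> R.Eg" for k
    using that T.lam[OF that] by (auto simp: R.Eg_def L.Eg_def)
  have seg_edge: "seg k edge_of tR k" "seg k \<subseteq> vline (x i)" "seg k edge_of tL (T.lam k)" if k: "k \<in> R.Eg" for k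
    using vertical_edge[OF slR[OF RD(1)[OF k]], of "seg k"] vertical_edge[OF slL[OF RD(3)[OF k]], of "seg k"]
      RD(2,6)[OF k] RD(4,5)[OF k] by (simp_all add: seg_def)
  have edge_cases: "\<exists>k. k \<in> R.Eg \<and> S = seg k \<and> (T = tR k \<or> T = tL (T.lam k))"
    if TS: "T \<in> \<T>" "S edge_of T" "S \<subseteq> vline (x i)" for T S
  proof -
    obtain j p P' q Q' where s: "slab_triangle i j T p P' q Q'" "p < q" and S: "S = closed_segment (x i, p) (x i, q)"
      by (rule vertical_edge_element[OF TS n(2)])
    consider "j = i + 1" | "j = i - 1" using slab_triangleD(4)[OF s(1)] by auto
    then show ?thesis
    proof cases
      case 1
      obtain k where k: "k < mR" "tR k = T" "NR k = p" "NR (Suc k) = q"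
        by (rule column_index[OF bijR slR s(1)[unfolded 1]])
      then have "k \<in> R.Eg" using s(2) by (simp add: R.Eg_def)
      moreover have "S = seg k" by (simp only: S seg_def k(3,4))
      ultimately show ?thesis using k(2) by blast
    next
      case 2
      obtain k where k: "k < mL" "tL k = T" "NL k = p" "NL (Suc k) = q"
        by (rule column_index[OF bijL slL s(1)[unfolded 2]])
      then have kE: "k \<in> L.Eg" using s(2) by (simp add: L.Eg_def)
      have "(NL k, NL (Suc k)) \<in> (\<lambda>k. (NR k, NR (Suc k))) ` R.Eg" unfolding T.same_edges using kE by (rule imageI)
      then obtain k' where k': "k' \<in> R.Eg" "NR k' = p" "NR (Suc k') = q" using k(3,4) by auto
      have "T.lam k' = k" using injL[OF T.lam(1)[OF k'(1)] kE] RD(4)[OF k'(1)] k' k by simp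
      then have "T = tL (T.lam k')" by (simp only: k(2))
      moreover have "S = seg k'" by (simp only: S seg_def k'(2,3))
      ultimately show ?thesis using k'(1) by blast
    qed
  qed
  have E_eq: "{S \<in> edges \<T>. S \<subseteq> vline (x i)} = seg ` R.Eg"
  proof (intro equalityI subsetI)
    fix S assume "S \<in> {S \<in> edges \<T>. S \<subseteq> vline (x i)}"
    then obtain T where "T \<in> \<T>" "S edge_of T" "S \<subseteq> vline (x i)" by (auto simp: edges_def)
    from edge_cases[OF this] show "S \<in> seg ` R.Eg" by blast
  next
    fix S assume "S \<in> seg ` R.Eg"
    then obtain k where k: "k \<in> R.Eg" "S = seg k" by blast
    show "S \<in> {S \<in> edges \<T>. S \<subseteq> vline (x i)}"
      unfolding k(2) using seg_edge(1,2)[OF k(1)] slab_triangleD(1)[OF slR[OF RD(1)[OF k(1)]]] unfolding edges_def by blast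
  qed
  have inj: "inj_on seg R.Eg"
  proof (rule inj_onI)
    fix k k' assume k: "k \<in> R.Eg" "k' \<in> R.Eg" "seg k = seg k'"
    have "NR k = NR k' \<and> NR (Suc k) = NR (Suc k')"
      using k(3) RD(2)[OF k(1)] RD(2)[OF k(2)] by (intro seg_eq) (simp_all only: seg_def[of k, symmetric])
    then show "k = k'" using injN k by blast
  qed
  have on: "elements_on \<T> (seg k) = {tR k, tL (T.lam k)}" "tR k \<noteq> tL (T.lam k)" if k: "k \<in> R.Eg" for k
  proof -
    note sR = slR[OF RD(1)[OF k]] and sL = slL[OF RD(3)[OF k]]
    show "elements_on \<T> (seg k) = {tR k, tL (T.lam k)}"
    proof (intro equalityI subsetI)
      fix T assume "T \<in> elements_on \<T> (seg k)"
      then have T: "T \<in> \<T>" "seg k edge_of T" by (auto simp: elements_on_def)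
      obtain k' where k': "k' \<in> R.Eg" "seg k = seg k'" "T = tR k' \<or> T = tL (T.lam k')"
        using edge_cases[OF T seg_edge(2)[OF k]] by blast
      then have "k = k'" using inj k by (auto simp only: inj_on_def)
      then show "T \<in> {tR k, tL (T.lam k)}" using k' by blast
    next
      fix T assume "T \<in> {tR k, tL (T.lam k)}"
      then consider "T = tR k" | "T = tL (T.lam k)" by blast
      then show "T \<in> elements_on \<T> (seg k)"
        by cases (use seg_edge(1,3)[OF k] slab_triangleD(1)[OF sR] slab_triangleD(1)[OF sL] in \<open>simp_all add: elements_on_def\<close>)
    qed
    show "tR k \<noteq> tL (T.lam k)"
    proof
      assume e: "tR k = tL (T.lam k)"
      \<comment> \<open>The far vertex of the right element lies strictly beyond the line and so
        outside the left column.\<close>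
      have "(x (i + 1), FR k) \<in> tL (T.lam k)" using slab_triangleD(19)[OF sR] unfolding e .
      from slab_range[OF sL this] show False using xs unfolding l_def r_def by simp
    qed
  qed
  have term_le: "min (\<epsilon> * diameter (seg k)) (area (edge_patch \<T> (seg k))) * (\<epsilon> * normal_jump \<T> u\<^sub>h (seg k))\<^sup>2
      \<le> 2 * Kc\<^sup>2 * (\<epsilon>\<^sup>2 * T.wd * R.sz k * (T.J k)\<^sup>2)" if k: "k \<in> R.Eg" for k
  proof -
    note sR = slR[OF RD(1)[OF k]] and sL = slL[OF RD(3)[OF k]]
    note DR = slab_triangleD[OF sR] and DL = slab_triangleD[OF sL]
    have sz: "R.sz k = NR (Suc k) - NR k" "L.sz (T.lam k) = NR (Suc k) - NR k" "R.sz k > 0"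
      using R.sz_near(1)[OF k] L.sz_near(1)[OF T.lam(1)[OF k]] RD[OF k] by auto
    have diam: "diameter (seg k) = R.sz k"
      unfolding seg_def diameter_segment using sz by (simp add: dist_prod_def dist_real_def)
    have "outward_normal (tR k) (seg k) = (- 1, 0)"
      using outward_normal_vertical[OF sR RD(2)[OF k]] xs unfolding seg_def r_def by simp
    moreover have "outward_normal (tL (T.lam k)) (seg k) = (1, 0)"
      using outward_normal_vertical[OF sL RD(6)[OF k]] xs unfolding seg_def l_def RD(4,5)[OF k] by simp
    ultimately have jump: "normal_jump \<T> u\<^sub>h (seg k) = T.J k"
      unfolding normal_jump_def on(1)[OF k] T.J_def using on(2)[OF k] by (simp add: inner_prod_def)
    have WR: "R.W = \<bar>x (i + 1) - x i\<bar>" and WL: "L.W = \<bar>x (i - 1) - x i\<bar>" by (rule R.W_def, rule L.W_def)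
    have ar: "area (edge_patch \<T> (seg k)) \<le> (R.W + L.W) / 2 * R.sz k"
    proof -
      have "area (edge_patch \<T> (seg k)) \<le> area (tR k) + area (tL (T.lam k))"
        unfolding edge_patch_def on(1)[OF k] using T_closed[OF DR(1)] T_closed[OF DL(1)]
        by (simp add: measure_Un_le borel_closed compact_imp_closed)
      also have "\<dots> = R.W * R.sz k / 2 + L.W * L.sz (T.lam k) / 2"
        unfolding DR(12) DL(12) WR WL R.sz_def L.sz_def by simp
      also have "\<dots> = (R.W + L.W) / 2 * R.sz k" using sz by (simp add: field_simps)
      finally show ?thesis .
    qed
    \<comment> \<open>The lower end of the edge is a node of both elements, which makes the widths
      of the two columns comparable.\<close>
    have cR: "R.W \<le> Kc * L.W" unfolding WR WL
      by (rule size_comparable(2)[OF sR sL, of "(x i, NR k)"]) (use DR(7) DL(17) RD(4)[OF k] in auto)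
    have cL: "L.W \<le> Kc * R.W" unfolding WR WL
      by (rule size_comparable(2)[OF sL sR, of "(x i, NR k)"]) (use DL(7) DR(17) RD(4)[OF k] in auto)
    have "min (\<epsilon> * R.sz k) (area (edge_patch \<T> (seg k))) \<le> 2 * Kc\<^sup>2 * (T.wd * R.sz k)"
      unfolding T.wd_def by (rule min_weight_le[OF eps(1) sz(3) Kc(1) ar cR cL R.W_pos L.W_pos])
    then have "min (\<epsilon> * R.sz k) (area (edge_patch \<T> (seg k))) * (\<epsilon> * T.J k)\<^sup>2
      \<le> 2 * Kc\<^sup>2 * (T.wd * R.sz k) * (\<epsilon> * T.J k)\<^sup>2" by (rule mult_right_mono) simp
    then show ?thesis unfolding diam jump by (simp add: power_mult_distrib mult_ac)
  qed
  have "(\<Sum>S\<in>{S \<in> edges \<T>. S \<subseteq> vline (x i)}.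
      min (\<epsilon> * diameter S) (area (edge_patch \<T> S)) * (\<epsilon> * normal_jump \<T> u\<^sub>h S)\<^sup>2)
    = (\<Sum>k\<in>R.Eg. min (\<epsilon> * diameter (seg k)) (area (edge_patch \<T> (seg k))) * (\<epsilon> * normal_jump \<T> u\<^sub>h (seg k))\<^sup>2)"
    unfolding E_eq by (simp add: sum.reindex[OF inj])
  also have "\<dots> \<le> (\<Sum>k\<in>R.Eg. 2 * Kc\<^sup>2 * (\<epsilon>\<^sup>2 * T.wd * R.sz k * (T.J k)\<^sup>2))"
    by (rule sum_mono) (rule term_le)
  also have "\<dots> = 2 * Kc\<^sup>2 * (\<Sum>k\<in>R.Eg. \<epsilon>\<^sup>2 * T.wd * R.sz k * (T.J k)\<^sup>2)" by (rule sum_distrib_left[symmetric])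
  also have "\<dots> \<le> 2 * Kc\<^sup>2 * (\<bar>T.C2\<bar> * ((5 + 4 * L\<^sup>2) * (E\<^sup>2 + O'\<^sup>2)))"
  proof (rule mult_left_mono)
    define oR where "oR = (\<Sum>j<mR. R.W * R.sz j * (lambda_tri \<epsilon> (tR j) * osc fh (tR j))\<^sup>2)"
    define oL where "oL = (\<Sum>j<mL. L.W * L.sz j * (lambda_tri \<epsilon> (tL j) * osc fh (tL j))\<^sup>2)"
    define I where "I = (LINT p:D|lborel. R.R2 p)"
    have subR: "{min (x i) (x (i + 1))<..<max (x i) (x (i + 1))} \<times> {0<..<1} \<subseteq> D"
      using bx(1,2) unfolding D by auto
    have subL: "{min (x i) (x (i - 1))<..<max (x i) (x (i - 1))} \<times> {0<..<1} \<subseteq> D"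
      using bx(3,4) unfolding D by auto
    have o1: "oR \<le> 2 * O'\<^sup>2" unfolding oR_def O'_def R.W_def R.sz_def
      by (rule column_osc_sum[OF bijR slR subR DO(2,3)])
    have o2: "oL \<le> 2 * O'\<^sup>2" unfolding oL_def O'_def L.W_def L.sz_def
      by (rule column_osc_sum[OF bijL slL subL DO(2,3)])
    have "I = (LINT p:D|lborel. (P p)\<^sup>2) + (LINT p:D|lborel. (Q p)\<^sup>2)"
      unfolding I_def R.R2_def using PQ(3,4) by (rule set_integral_add)
    then have I: "I \<le> (1 + 4 * L\<^sup>2) * E\<^sup>2" using PE by (simp add: distrib_right)
    \<comment> \<open>The densities \<open>P\<close> and \<open>Q\<close> contribute 1 + 4 L^2, and
      each column twice the oscillation norm; 5 + 4 L^2 exceeds both coefficients.\<close>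
    have "I + oR + oL \<le> (1 + 4 * L\<^sup>2) * E\<^sup>2 + 4 * O'\<^sup>2" using I o1 o2 by simp
    also have "\<dots> \<le> (5 + 4 * L\<^sup>2) * E\<^sup>2 + (5 + 4 * L\<^sup>2) * O'\<^sup>2"
      by (intro add_mono mult_right_mono) auto
    finally have tot: "I + oR + oL \<le> (5 + 4 * L\<^sup>2) * (E\<^sup>2 + O'\<^sup>2)" by (simp add: distrib_left)
    have nn: "0 \<le> I + oR + oL"
    proof (intro add_nonneg_nonneg)
      show "0 \<le> I" unfolding I_def by (rule set_LINT_nonneg) (simp add: R.R2_def)
      show "0 \<le> oR" unfolding oR_def using R.W_pos R.sz_pos by (intro sum_nonneg mult_nonneg_nonneg) (auto intro: less_imp_le)
      show "0 \<le> oL" unfolding oL_def using L.W_pos L.sz_pos by (intro sum_nonneg mult_nonneg_nonneg) (auto intro: less_imp_le)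
    qed
    have "(\<Sum>k\<in>R.Eg. \<epsilon>\<^sup>2 * T.wd * R.sz k * (T.J k)\<^sup>2) \<le> T.C2 * (I + oR + oL)"
      unfolding I_def oR_def oL_def by (rule T.main_estimate)
    also have "\<dots> \<le> \<bar>T.C2\<bar> * (I + oR + oL)" using nn by (intro mult_right_mono) auto
    also have "\<dots> \<le> \<bar>T.C2\<bar> * ((5 + 4 * L\<^sup>2) * (E\<^sup>2 + O'\<^sup>2))" using tot by (intro mult_left_mono) auto
    finally show "(\<Sum>k\<in>R.Eg. \<epsilon>\<^sup>2 * T.wd * R.sz k * (T.J k)\<^sup>2) \<le> \<bar>T.C2\<bar> * ((5 + 4 * L\<^sup>2) * (E\<^sup>2 + O'\<^sup>2))" .
  qed simp
  finally show ?thesis unfolding E_def O'_def D_def by (simp only: mult.assoc)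
qed

end

theorem theorem9p4:
  fixes lam\<^sub>0 \<kappa> lam\<^sub>1 :: real and M :: nat
  assumes "lam\<^sub>0 < pi" and "\<kappa> \<ge> 1" and "lam\<^sub>1 > 0"
  shows "\<exists>c_max > 0. \<forall>c\<^sub>0. 0 < c\<^sub>0 \<and> c\<^sub>0 \<le> c_max \<longrightarrow>
    (\<forall>C\<^sub>1 > 0. \<forall>f C\<^sub>f. admissible_reaction f C\<^sub>f \<longrightarrow>
      (\<exists>C. \<forall>\<epsilon> n x \<T> ip_h u u\<^sub>h i.
         0 < \<epsilon> \<and> \<epsilon> \<le> 1 \<and> C\<^sub>f + \<epsilon>\<^sup>2 \<ge> 1 \<and>
         partially_structured_mesh lam\<^sub>0 M \<kappa> c\<^sub>0 lam\<^sub>1 n x \<T> \<and>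
         1 \<le> i \<and> i \<le> n - 1 \<and>
         weak_solution \<epsilon> f u \<and>
         discrete_solution \<epsilon> f \<T> ip_h u\<^sub>h \<and>
         (no_quadrature_in (strip x i) \<T> ip_h (\<lambda>p. f p (u\<^sub>h p)) \<or>
          quadrature_in_strip \<kappa> c\<^sub>0 C\<^sub>1 \<epsilon> \<T> x i ip_h (\<lambda>p. f p (u\<^sub>h p)))
         \<longrightarrow>
         (\<Sum>S \<in> {S \<in> edges \<T>. S \<subseteq> vline (x i)}.
            min (\<epsilon> * diameter S) (area (edge_patch \<T> S)) * (\<epsilon> * normal_jump \<T> u\<^sub>h S)\<^sup>2)
         \<le> C * ((energy_norm \<epsilon> C\<^sub>f (strip x i) (\<lambda>p. u\<^sub>h p - u p))\<^sup>2
              + (L2_norm (strip x i) (osc_function \<epsilon> \<T> (\<lambda>p. f p (u\<^sub>h p))))\<^sup>2)))"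
proof (rule exI[of _ "1 / (2 * lam\<^sub>1)"], intro conjI allI impI)
  show "1 / (2 * lam\<^sub>1) > 0" using assms(3) by simp
  fix c\<^sub>0 C\<^sub>1 :: real and f C\<^sub>f
  assume c0: "0 < c\<^sub>0 \<and> c\<^sub>0 \<le> 1 / (2 * lam\<^sub>1)" and adm: "admissible_reaction f C\<^sub>f"
  \<comment> \<open>The threshold for \<open>c\<^sub>0\<close> is chosen to keep the angle excess at
    every node at most 1/2.\<close>
  have c0': "lam\<^sub>1 * c\<^sub>0 \<le> 1/2" using c0 assms(3) by (simp add: field_simps)
  obtain L0 where "\<forall>p\<in>Omega. \<forall>s t. \<bar>f p s - f p t\<bar> \<le> L0 * \<bar>s - t\<bar>"
    using adm unfolding admissible_reaction_def by blast
  \<comment> \<open>The Lipschitz constant in \<open>admissible_reaction\<close> carries no sign, so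
    it is replaced by its maximum with 0.\<close>
  then have Lip: "\<bar>f p s - f p t\<bar> \<le> max L0 0 * \<bar>s - t\<bar>" if "p \<in> Omega" for p s t
    using that order_trans[OF _ mult_right_mono[of L0 "max L0 0" "\<bar>s - t\<bar>"]] by simp
  show "\<exists>C. \<forall>\<epsilon> n x \<T> ip_h u u\<^sub>h i.
         0 < \<epsilon> \<and> \<epsilon> \<le> 1 \<and> C\<^sub>f + \<epsilon>\<^sup>2 \<ge> 1 \<and>
         partially_structured_mesh lam\<^sub>0 M \<kappa> c\<^sub>0 lam\<^sub>1 n x \<T> \<and>
         1 \<le> i \<and> i \<le> n - 1 \<and>
         weak_solution \<epsilon> f u \<and>
         discrete_solution \<epsilon> f \<T> ip_h u\<^sub>h \<and>
         (no_quadrature_in (strip x i) \<T> ip_h (\<lambda>p. f p (u\<^sub>h p)) \<or>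
          quadrature_in_strip \<kappa> c\<^sub>0 C\<^sub>1 \<epsilon> \<T> x i ip_h (\<lambda>p. f p (u\<^sub>h p)))
         \<longrightarrow>
         (\<Sum>S \<in> {S \<in> edges \<T>. S \<subseteq> vline (x i)}.
            min (\<epsilon> * diameter S) (area (edge_patch \<T> S)) * (\<epsilon> * normal_jump \<T> u\<^sub>h S)\<^sup>2)
         \<le> C * ((energy_norm \<epsilon> C\<^sub>f (strip x i) (\<lambda>p. u\<^sub>h p - u p))\<^sup>2
              + (L2_norm (strip x i) (osc_function \<epsilon> \<T> (\<lambda>p. f p (u\<^sub>h p))))\<^sup>2)"
  proof (intro exI allI impI, elim conjE)
    fix \<epsilon> :: real and n x \<T> ip_h u u\<^sub>h and i :: nat
    assume eps: "0 < \<epsilon>" "C\<^sub>f + \<epsilon>\<^sup>2 \<ge> 1" and psm: "partially_structured_mesh lam\<^sub>0 M \<kappa> c\<^sub>0 lam\<^sub>1 n x \<T>"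
      and i: "1 \<le> i" "i \<le> n - 1" and u: "weak_solution \<epsilon> f u" and uh: "discrete_solution \<epsilon> f \<T> ip_h u\<^sub>h"
    interpret fe_problem lam\<^sub>0 \<kappa> c\<^sub>0 lam\<^sub>1 M n x \<T> u\<^sub>h f C\<^sub>f "max L0 0"
      by unfold_locales (use psm assms c0 c0' uh adm Lip in \<open>auto simp: discrete_solution_def\<close>)
    \<comment> \<open>The witness for the constant is determined by this goal; it involves only
      \<kappa>, \<open>lam\<^sub>1\<close>, \<open>M\<close> and the Lipschitz constant.\<close>
    show "(\<Sum>S \<in> {S \<in> edges \<T>. S \<subseteq> vline (x i)}.
            min (\<epsilon> * diameter S) (area (edge_patch \<T> S)) * (\<epsilon> * normal_jump \<T> u\<^sub>h S)\<^sup>2)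
         \<le> 2 * (psm.Kc \<kappa> lam\<^sub>1)\<^sup>2 * (\<bar>two_sides.C2 (psm.Kc \<kappa> lam\<^sub>1) M\<bar> * (5 + 4 * (max L0 0)\<^sup>2)) *
           ((energy_norm \<epsilon> C\<^sub>f (strip x i) (\<lambda>p. u\<^sub>h p - u p))\<^sup>2
              + (L2_norm (strip x i) (osc_function \<epsilon> \<T> (\<lambda>p. f p (u\<^sub>h p))))\<^sup>2)"
      using jump_estimate[OF i u eps] unfolding fh_def[abs_def] .
  qed
qed

end
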